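(* Let $\mathcal{G}$ be a second countable, locally compact Hausdorff, étale groupoid, and let $c$ be a continuous $\mathbb{T}$-valued 2-cocycle on $\mathcal{G}$. Suppose $\mathcal{S}$ is maximal (with respect to inclusion) among abelian subgroupoids of $\mathrm{Iso}(\mathcal{G})$ on which $c$ is symmetric. If $\mathcal{S}$ is clopen in $\mathcal{G}$, normal, and immediately centralizing, then $C^*_r(\mathcal{S}, c)$ is a Cartan subalgebra of $C^*_r(\mathcal{G}, c)$.
   Context: Groupoids. For a groupoid $\mathcal{G}$ with unit space $\mathcal{G}^{(0)}$, write $s(g)=g^{-1}g$, $r(g)=gg^{-1}$, $\mathcal{G}^{(2)}=\{(g,h): s(g)=r(h)\}$, $\mathcal{G}^u=r^{-1}(u)$, $\mathcal{G}_u=s^{-1}(u)$, $\mathcal{G}^u_u=\mathcal{G}^u\cap\mathcal{G}_u$, and $\mathrm{Iso}(\mathcal{G})=\{g: s(g)=r(g)\}$. A topological groupoid is étale if $r$ (hence $s$) is a local homeomorphism. A subset $\mathcal{S}$ is a subgroupoid if it is closed under inverses and under products of composable pairs. A subset $\mathcal{S}$ is abelian if whenever $g,h\in\mathcal{S}$ with $(g,h)\in\mathcal{G}^{(2)}$, also $(h,g)\in\mathcal{G}^{(2)}$ and $gh=hg$. $\mathcal{S}$ is normal if for all $g\in\mathcal{G}$ and all $t\in\mathcal{S}$ with $s(t)=r(t)=s(g)$ one has $gtg^{-1}\in\mathcal{S}$. Immediately centralizing. For a subgroupoid $\mathcal{S}\subseteq\mathcal{G}$ and $k\ge 1$, an element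 $\nu\in\mathcal{G}^u_u$ is $k$-centralizing for $\mathcal{S}$ if for all $t\in\mathcal{S}^u_u$ there exists $j\in\{1,\dots,k\}$ with $\nu t^j=t^j\nu$. Let $C_k(\mathcal{S})$ be the set of $k$-centralizing elements. $\mathcal{S}$ is immediately centralizing if $C_k(\mathcal{S})=C_1(\mathcal{S})$ for all $k\ge1$. 2-cocycles and $C^*$-algebras. A ($\mathbb{T}$-valued) 2-cocycle is a map $c:\mathcal{G}^{(2)}\to\mathbb{T}$ with $c(g,s(g))=c(r(g),g)=1$ and $c(g,hk)c(h,k)=c(gh,k)c(g,h)$ for composable $g,h,k$. It is symmetric on $\mathcal{S}\subseteq\mathrm{Iso}(\mathcal{G})$ if $c(s,t)=c(t,s)$ for all composable $s,t\in\mathcal{S}$. $C_c(\mathcal{G})$ is a $*$-algebra with $f*h(\gamma)=\sum_{\eta\in\mathcal{G}^{s(\gamma)}}f(\gamma\eta)h(\eta^{-1})c(\gamma\eta,\eta^{-1})$ and $f^*(\gamma)=\overline{f(\gamma^{-1})c(\gamma,\gamma^{-1})}$. For each unit $u$ it acts on $\ell^2(\mathcal{G}_u)$ by the same convolution formula, and $C^*_r(\mathcal{G},c)$ is the completion in the norm $\|f\|_r=\sup\{\|f*\xi\|: u\in\mathcal{G}^{(0)},\ \xi\in\ell^2(\mathcal{G}_u),\ \|\xi\|=1\}$. For $\mathcal{S}$ an open subgroupoid, $C^*_r(\mathcal{S},c)$ is defined using the restriction of $c$, and extension by zero $C_c(\mathcal{S})\to C_c(\mathcal{G})$ extends to an injective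 $*$-homomorphism $C^*_r(\mathcal{S},c)\to C^*_r(\mathcal{G},c)$, through which $C^*_r(\mathcal{S},c)$ is regarded as a subalgebra. Cartan subalgebra. A $C^*$-subalgebra $B$ of a $C^*$-algebra $A$ is Cartan if (1) $B$ is a maximal abelian subalgebra of $A$; (2) there is a faithful conditional expectation $\Phi:A\to B$; (3) the normalizer $N(B)=\{n\in A: nbn^*,\,n^*bn\in B\ \forall b\in B\}$ generates $A$ as a $C^*$-algebra; (4) $B$ contains an approximate identity for $A$. *)

theory Defs
  imports "HOL-Analysis.Analysis"
begin

section \<open>Groupoids\<close>

text \<open>
  The set of arrows is the topspace of \<open>gtop\<close>. The product is a total function of which only the
  values on composable pairs matter. As in the paper, \<open>s\<close> and \<open>r\<close> are derived from product and
  inverse, and units are those arrows that are of the form \<open>s(g)\<close>.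
\<close>

record 'g groupoid =
  gtop :: "'g topology"
  gmul :: "'g \<Rightarrow> 'g \<Rightarrow> 'g" (infixl "\<cdot>\<index>" 70)
  ginv :: "'g \<Rightarrow> 'g"

definition arrows :: "'g groupoid \<Rightarrow> 'g set" where
  "arrows G = topspace (gtop G)"

definition src :: "'g groupoid \<Rightarrow> 'g \<Rightarrow> 'g" where
  "src G g = ginv G g \<cdot>\<^bsub>G\<^esub> g"

definition rng :: "'g groupoid \<Rightarrow> 'g \<Rightarrow> 'g" where
  "rng G g = g \<cdot>\<^bsub>G\<^esub> ginv G g"

definition units :: "'g groupoid \<Rightarrow> 'g set" where
  "units G = src G ` arrows G"

definition composable :: "'g groupoid \<Rightarrow> ('g \<times> 'g) set" where
  "composable G = {(g, h). g \<in> arrows G \<and> h \<in> arrows G \<and> src G g = rng G h}"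

definition rng_fibre :: "'g groupoid \<Rightarrow> 'g \<Rightarrow> 'g set" where
  "rng_fibre G u = {g \<in> arrows G. rng G g = u}"

definition src_fibre :: "'g groupoid \<Rightarrow> 'g \<Rightarrow> 'g set" where
  "src_fibre G u = {g \<in> arrows G. src G g = u}"

definition isotropy_at :: "'g groupoid \<Rightarrow> 'g \<Rightarrow> 'g set" where
  "isotropy_at G u = rng_fibre G u \<inter> src_fibre G u"

definition Iso :: "'g groupoid \<Rightarrow> 'g set" where
  "Iso G = {g \<in> arrows G. src G g = rng G g}"

text \<open>The axioms of Hahn and Renault for a groupoid given by a partial product and an inverse.\<close>

locale groupoid =
  fixes G :: "'g groupoid" (structure)
  assumes inv_closed: "g \<in> arrows G \<Longrightarrow> ginv G g \<in> arrows G"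
    and inv_inv: "g \<in> arrows G \<Longrightarrow> ginv G (ginv G g) = g"
    and mul_closed: "(g, h) \<in> composable G \<Longrightarrow> g \<cdot> h \<in> arrows G"
    and assoc_composable:
      "(g, h) \<in> composable G \<Longrightarrow> (h, k) \<in> composable G \<Longrightarrow>
        (g \<cdot> h, k) \<in> composable G \<and> (g, h \<cdot> k) \<in> composable G"
    and assoc:
      "(g, h) \<in> composable G \<Longrightarrow> (h, k) \<in> composable G \<Longrightarrow> (g \<cdot> h) \<cdot> k = g \<cdot> (h \<cdot> k)"
    and cancel_left: "(g, h) \<in> composable G \<Longrightarrow> ginv G g \<cdot> (g \<cdot> h) = h"
    and cancel_right: "(g, h) \<in> composable G \<Longrightarrow> (g \<cdot> h) \<cdot> ginv G h = g"

locale topological_groupoid = groupoid +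
  assumes continuous_inv: "continuous_map (gtop G) (gtop G) (ginv G)"
    and continuous_mul:
      "continuous_map (subtopology (prod_topology (gtop G) (gtop G)) (composable G)) (gtop G)
        (\<lambda>(g, h). g \<cdot> h)"

definition local_homeomorphism :: "'a topology \<Rightarrow> 'b topology \<Rightarrow> ('a \<Rightarrow> 'b) \<Rightarrow> bool" where
  "local_homeomorphism X Y f \<longleftrightarrow>
    f \<in> topspace X \<rightarrow> topspace Y \<and>
    (\<forall>x \<in> topspace X. \<exists>U V. openin X U \<and> x \<in> U \<and> openin Y V \<and>
      homeomorphic_map (subtopology X U) (subtopology Y V) f)"

locale etale_groupoid = topological_groupoid +
  assumes local_homeomorphism_rng:
    "local_homeomorphism (gtop G) (subtopology (gtop G) (units G)) (rng G)"

definition subgroupoid :: "'g groupoid \<Rightarrow> 'g set \<Rightarrow> bool" where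
  "subgroupoid G S \<longleftrightarrow> S \<subseteq> arrows G \<and> (\<forall>g \<in> S. ginv G g \<in> S) \<and>
    (\<forall>g \<in> S. \<forall>h \<in> S. (g, h) \<in> composable G \<longrightarrow> g \<cdot>\<^bsub>G\<^esub> h \<in> S)"

definition restrict_groupoid :: "'g groupoid \<Rightarrow> 'g set \<Rightarrow> 'g groupoid" where
  "restrict_groupoid G S = G\<lparr>gtop := subtopology (gtop G) S\<rparr>"

definition abelian_subset :: "'g groupoid \<Rightarrow> 'g set \<Rightarrow> bool" where
  "abelian_subset G S \<longleftrightarrow> (\<forall>g \<in> S. \<forall>h \<in> S. (g, h) \<in> composable G \<longrightarrow>
    (h, g) \<in> composable G \<and> g \<cdot>\<^bsub>G\<^esub> h = h \<cdot>\<^bsub>G\<^esub> g)"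

definition normal_subset :: "'g groupoid \<Rightarrow> 'g set \<Rightarrow> bool" where
  "normal_subset G S \<longleftrightarrow> (\<forall>g \<in> arrows G. \<forall>t \<in> S. src G t = rng G t \<and> rng G t = src G g \<longrightarrow>
    (g \<cdot>\<^bsub>G\<^esub> t) \<cdot>\<^bsub>G\<^esub> ginv G g \<in> S)"

primrec gpow :: "'g groupoid \<Rightarrow> 'g \<Rightarrow> nat \<Rightarrow> 'g" where
  "gpow G t 0 = src G t"
| "gpow G t (Suc n) = gpow G t n \<cdot>\<^bsub>G\<^esub> t"

definition centralizing :: "'g groupoid \<Rightarrow> 'g set \<Rightarrow> nat \<Rightarrow> 'g set" where
  "centralizing G S k = {\<nu>. \<exists>u \<in> units G. \<nu> \<in> isotropy_at G u \<and>
    (\<forall>t \<in> S \<inter> isotropy_at G u. \<exists>j \<in> {1..k}. \<nu> \<cdot>\<^bsub>G\<^esub> gpow G t j = gpow G t j \<cdot>\<^bsub>G\<^esub> \<nu>)}"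

definition immediately_centralizing :: "'g groupoid \<Rightarrow> 'g set \<Rightarrow> bool" where
  "immediately_centralizing G S \<longleftrightarrow> (\<forall>k \<ge> 1. centralizing G S k = centralizing G S 1)"

section \<open>Cocycles\<close>

definition cocycle2 :: "'g groupoid \<Rightarrow> ('g \<times> 'g \<Rightarrow> complex) \<Rightarrow> bool" where
  "cocycle2 G c \<longleftrightarrow>
    (\<forall>p \<in> composable G. norm (c p) = 1) \<and>
    (\<forall>g \<in> arrows G. c (g, src G g) = 1 \<and> c (rng G g, g) = 1) \<and>
    (\<forall>g h k. (g, h) \<in> composable G \<longrightarrow> (h, k) \<in> composable G \<longrightarrow>
      c (g, h \<cdot>\<^bsub>G\<^esub> k) * c (h, k) = c (g \<cdot>\<^bsub>G\<^esub> h, k) * c (g, h))"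

definition continuous_cocycle2 :: "'g groupoid \<Rightarrow> ('g \<times> 'g \<Rightarrow> complex) \<Rightarrow> bool" where
  "continuous_cocycle2 G c \<longleftrightarrow> cocycle2 G c \<and>
    continuous_map (subtopology (prod_topology (gtop G) (gtop G)) (composable G))
      (top_of_set (sphere 0 1)) c"

definition symmetric_on :: "'g groupoid \<Rightarrow> ('g \<times> 'g \<Rightarrow> complex) \<Rightarrow> 'g set \<Rightarrow> bool" where
  "symmetric_on G c S \<longleftrightarrow> (\<forall>s \<in> S. \<forall>t \<in> S. (s, t) \<in> composable G \<longrightarrow> c (s, t) = c (t, s))"

definition abelian_symmetric_subgroupoids ::
  "'g groupoid \<Rightarrow> ('g \<times> 'g \<Rightarrow> complex) \<Rightarrow> 'g set set" where
  "abelian_symmetric_subgroupoids G c =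
    {S. subgroupoid G S \<and> S \<subseteq> Iso G \<and> abelian_subset G S \<and> symmetric_on G c S}"

section \<open>Normed *-algebras, C*-algebras and Cartan subalgebras\<close>

record 'a star_alg =
  carr :: "'a set"
  zer :: 'a
  add :: "'a \<Rightarrow> 'a \<Rightarrow> 'a" (infixl "\<oplus>\<index>" 65)
  scl :: "complex \<Rightarrow> 'a \<Rightarrow> 'a" (infixr "\<odot>\<index>" 75)
  mul :: "'a \<Rightarrow> 'a \<Rightarrow> 'a" (infixl "\<otimes>\<index>" 70)
  adj :: "'a \<Rightarrow> 'a"
  nrm :: "'a \<Rightarrow> real"

definition sub :: "'a star_alg \<Rightarrow> 'a \<Rightarrow> 'a \<Rightarrow> 'a" where
  "sub A x y = x \<oplus>\<^bsub>A\<^esub> (-1) \<odot>\<^bsub>A\<^esub> y"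

text \<open>The library locale \<open>Metric_space\<close> asks for nonnegativity and symmetry of the distance
  also outside the carrier, hence the case distinction.\<close>

definition adist :: "'a star_alg \<Rightarrow> 'a \<Rightarrow> 'a \<Rightarrow> real" where
  "adist A x y = (if x \<in> carr A \<and> y \<in> carr A then nrm A (sub A x y) else 0)"

locale cstar_algebra =
  fixes A :: "'a star_alg" (structure)
  assumes zer_closed: "zer A \<in> carr A"
    and add_closed: "x \<in> carr A \<Longrightarrow> y \<in> carr A \<Longrightarrow> x \<oplus> y \<in> carr A"
    and scl_closed: "x \<in> carr A \<Longrightarrow> a \<odot> x \<in> carr A"
    and mul_closed: "x \<in> carr A \<Longrightarrow> y \<in> carr A \<Longrightarrow> x \<otimes> y \<in> carr A"
    and adj_closed: "x \<in> carr A \<Longrightarrow> adj A x \<in> carr A"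
    and add_assoc: "x \<in> carr A \<Longrightarrow> y \<in> carr A \<Longrightarrow> z \<in> carr A \<Longrightarrow> (x \<oplus> y) \<oplus> z = x \<oplus> (y \<oplus> z)"
    and add_comm: "x \<in> carr A \<Longrightarrow> y \<in> carr A \<Longrightarrow> x \<oplus> y = y \<oplus> x"
    and add_zer: "x \<in> carr A \<Longrightarrow> x \<oplus> zer A = x"
    and add_neg: "x \<in> carr A \<Longrightarrow> x \<oplus> (-1) \<odot> x = zer A"
    and scl_add_right: "x \<in> carr A \<Longrightarrow> y \<in> carr A \<Longrightarrow> a \<odot> (x \<oplus> y) = a \<odot> x \<oplus> a \<odot> y"
    and scl_add_left: "x \<in> carr A \<Longrightarrow> (a + b) \<odot> x = a \<odot> x \<oplus> b \<odot> x"
    and scl_scl: "x \<in> carr A \<Longrightarrow> a \<odot> (b \<odot> x) = (a * b) \<odot> x"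
    and scl_one: "x \<in> carr A \<Longrightarrow> 1 \<odot> x = x"
    and mul_assoc: "x \<in> carr A \<Longrightarrow> y \<in> carr A \<Longrightarrow> z \<in> carr A \<Longrightarrow> (x \<otimes> y) \<otimes> z = x \<otimes> (y \<otimes> z)"
    and mul_add_right:
      "x \<in> carr A \<Longrightarrow> y \<in> carr A \<Longrightarrow> z \<in> carr A \<Longrightarrow> x \<otimes> (y \<oplus> z) = x \<otimes> y \<oplus> x \<otimes> z"
    and mul_add_left:
      "x \<in> carr A \<Longrightarrow> y \<in> carr A \<Longrightarrow> z \<in> carr A \<Longrightarrow> (x \<oplus> y) \<otimes> z = x \<otimes> z \<oplus> y \<otimes> z"
    and mul_scl_left: "x \<in> carr A \<Longrightarrow> y \<in> carr A \<Longrightarrow> (a \<odot> x) \<otimes> y = a \<odot> (x \<otimes> y)"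
    and mul_scl_right: "x \<in> carr A \<Longrightarrow> y \<in> carr A \<Longrightarrow> x \<otimes> (a \<odot> y) = a \<odot> (x \<otimes> y)"
    and adj_adj: "x \<in> carr A \<Longrightarrow> adj A (adj A x) = x"
    and adj_add: "x \<in> carr A \<Longrightarrow> y \<in> carr A \<Longrightarrow> adj A (x \<oplus> y) = adj A x \<oplus> adj A y"
    and adj_scl: "x \<in> carr A \<Longrightarrow> adj A (a \<odot> x) = cnj a \<odot> adj A x"
    and adj_mul: "x \<in> carr A \<Longrightarrow> y \<in> carr A \<Longrightarrow> adj A (x \<otimes> y) = adj A y \<otimes> adj A x"
    and nrm_nonneg: "x \<in> carr A \<Longrightarrow> 0 \<le> nrm A x"
    and nrm_eq_0: "x \<in> carr A \<Longrightarrow> nrm A x = 0 \<longleftrightarrow> x = zer A"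
    and nrm_triangle: "x \<in> carr A \<Longrightarrow> y \<in> carr A \<Longrightarrow> nrm A (x \<oplus> y) \<le> nrm A x + nrm A y"
    and nrm_scl: "x \<in> carr A \<Longrightarrow> nrm A (a \<odot> x) = cmod a * nrm A x"
    and nrm_mul: "x \<in> carr A \<Longrightarrow> y \<in> carr A \<Longrightarrow> nrm A (x \<otimes> y) \<le> nrm A x * nrm A y"
    and cstar_identity: "x \<in> carr A \<Longrightarrow> nrm A (adj A x \<otimes> x) = (nrm A x)\<^sup>2"
    and complete: "Metric_space.mcomplete (carr A) (adist A)"

definition subalgebra :: "'a star_alg \<Rightarrow> 'a set \<Rightarrow> bool" where
  "subalgebra A B \<longleftrightarrow> B \<subseteq> carr A \<and> zer A \<in> B \<and>
    (\<forall>x \<in> B. \<forall>y \<in> B. x \<oplus>\<^bsub>A\<^esub> y \<in> B) \<and>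
    (\<forall>a. \<forall>x \<in> B. a \<odot>\<^bsub>A\<^esub> x \<in> B) \<and>
    (\<forall>x \<in> B. \<forall>y \<in> B. x \<otimes>\<^bsub>A\<^esub> y \<in> B)"

definition cstar_subalgebra :: "'a star_alg \<Rightarrow> 'a set \<Rightarrow> bool" where
  "cstar_subalgebra A B \<longleftrightarrow> subalgebra A B \<and> (\<forall>x \<in> B. adj A x \<in> B) \<and>
    closedin (Metric_space.mtopology (carr A) (adist A)) B"

definition cstar_generated :: "'a star_alg \<Rightarrow> 'a set \<Rightarrow> 'a set" where
  "cstar_generated A N = \<Inter> {C. cstar_subalgebra A C \<and> N \<subseteq> C}"

definition abelian_subalgebra :: "'a star_alg \<Rightarrow> 'a set \<Rightarrow> bool" where
  "abelian_subalgebra A B \<longleftrightarrow> subalgebra A B \<and> (\<forall>x \<in> B. \<forall>y \<in> B. x \<otimes>\<^bsub>A\<^esub> y = y \<otimes>\<^bsub>A\<^esub> x)"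

definition maximal_abelian_subalgebra :: "'a star_alg \<Rightarrow> 'a set \<Rightarrow> bool" where
  "maximal_abelian_subalgebra A B \<longleftrightarrow> abelian_subalgebra A B \<and>
    (\<forall>C. abelian_subalgebra A C \<and> B \<subseteq> C \<longrightarrow> C = B)"

definition positive :: "'a star_alg \<Rightarrow> 'a \<Rightarrow> bool" where
  "positive A x \<longleftrightarrow> (\<exists>y \<in> carr A. x = adj A y \<otimes>\<^bsub>A\<^esub> y)"

text \<open>Complete positivity need not be listed: by the bimodule property,
  \<open>\<Sum>i j. b\<^sub>i* \<Phi>(a\<^sub>i* a\<^sub>j) b\<^sub>j = \<Phi>(x* x)\<close> for \<open>x = \<Sum>i. a\<^sub>i b\<^sub>i\<close>.\<close>

definition conditional_expectation :: "'a star_alg \<Rightarrow> 'a set \<Rightarrow> ('a \<Rightarrow> 'a) \<Rightarrow> bool" where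
  "conditional_expectation A B \<Phi> \<longleftrightarrow>
    \<Phi> \<in> carr A \<rightarrow> B \<and>
    (\<forall>x \<in> carr A. \<forall>y \<in> carr A. \<Phi> (x \<oplus>\<^bsub>A\<^esub> y) = \<Phi> x \<oplus>\<^bsub>A\<^esub> \<Phi> y) \<and>
    (\<forall>a. \<forall>x \<in> carr A. \<Phi> (a \<odot>\<^bsub>A\<^esub> x) = a \<odot>\<^bsub>A\<^esub> \<Phi> x) \<and>
    (\<forall>b \<in> B. \<Phi> b = b) \<and>
    (\<forall>x \<in> carr A. nrm A (\<Phi> x) \<le> nrm A x) \<and>
    (\<forall>x \<in> carr A. positive A x \<longrightarrow> positive A (\<Phi> x)) \<and>
    (\<forall>b \<in> B. \<forall>x \<in> carr A. \<Phi> (b \<otimes>\<^bsub>A\<^esub> x) = b \<otimes>\<^bsub>A\<^esub> \<Phi> x \<and> \<Phi> (x \<otimes>\<^bsub>A\<^esub> b) = \<Phi> x \<otimes>\<^bsub>A\<^esub> b)"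

definition faithful :: "'a star_alg \<Rightarrow> ('a \<Rightarrow> 'a) \<Rightarrow> bool" where
  "faithful A \<Phi> \<longleftrightarrow> (\<forall>x \<in> carr A. \<Phi> (adj A x \<otimes>\<^bsub>A\<^esub> x) = zer A \<longrightarrow> x = zer A)"

definition normalizer :: "'a star_alg \<Rightarrow> 'a set \<Rightarrow> 'a set" where
  "normalizer A B = {n \<in> carr A. \<forall>b \<in> B.
    n \<otimes>\<^bsub>A\<^esub> b \<otimes>\<^bsub>A\<^esub> adj A n \<in> B \<and> adj A n \<otimes>\<^bsub>A\<^esub> b \<otimes>\<^bsub>A\<^esub> n \<in> B}"

text \<open>The net of positive contractions forming the approximate identity is given by its
  filter of tails on the algebra.\<close>

definition contains_approximate_identity :: "'a star_alg \<Rightarrow> 'a set \<Rightarrow> bool" where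
  "contains_approximate_identity A B \<longleftrightarrow> (\<exists>F. F \<noteq> bot \<and>
    (\<forall>\<^sub>F e in F. e \<in> B \<and> positive A e \<and> nrm A e \<le> 1) \<and>
    (\<forall>x \<in> carr A. ((\<lambda>e. nrm A (sub A (e \<otimes>\<^bsub>A\<^esub> x) x)) \<longlongrightarrow> 0) F \<and>
      ((\<lambda>e. nrm A (sub A (x \<otimes>\<^bsub>A\<^esub> e) x)) \<longlongrightarrow> 0) F))"

definition cartan_subalgebra :: "'a star_alg \<Rightarrow> 'a set \<Rightarrow> bool" where
  "cartan_subalgebra A B \<longleftrightarrow> cstar_algebra A \<and> cstar_subalgebra A B \<and>
    maximal_abelian_subalgebra A B \<and>
    (\<exists>\<Phi>. conditional_expectation A B \<Phi> \<and> faithful A \<Phi>) \<and>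
    cstar_generated A (normalizer A B) = carr A \<and>
    contains_approximate_identity A B"

section \<open>Completion of a normed *-algebra\<close>

text \<open>Elements of the completion are equivalence classes of Cauchy sequences, with the
  operations induced by the termwise operations.\<close>

definition cauchy_rel :: "'a star_alg \<Rightarrow> ((nat \<Rightarrow> 'a) \<times> (nat \<Rightarrow> 'a)) set" where
  "cauchy_rel A = {(\<sigma>, \<tau>).
    Metric_space.MCauchy (carr A) (adist A) \<sigma> \<and> Metric_space.MCauchy (carr A) (adist A) \<tau> \<and>
    (\<lambda>n. adist A (\<sigma> n) (\<tau> n)) \<longlonglongrightarrow> 0}"

definition completion :: "'a star_alg \<Rightarrow> (nat \<Rightarrow> 'a) set star_alg" where
  "completion A = \<lparr>
    carr = {\<sigma>. Metric_space.MCauchy (carr A) (adist A) \<sigma>} // cauchy_rel A,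
    zer = cauchy_rel A `` {\<lambda>n. zer A},
    add = (\<lambda>X Y. \<Union>\<sigma>\<in>X. \<Union>\<tau>\<in>Y. cauchy_rel A `` {\<lambda>n. \<sigma> n \<oplus>\<^bsub>A\<^esub> \<tau> n}),
    scl = (\<lambda>a X. \<Union>\<sigma>\<in>X. cauchy_rel A `` {\<lambda>n. a \<odot>\<^bsub>A\<^esub> \<sigma> n}),
    mul = (\<lambda>X Y. \<Union>\<sigma>\<in>X. \<Union>\<tau>\<in>Y. cauchy_rel A `` {\<lambda>n. \<sigma> n \<otimes>\<^bsub>A\<^esub> \<tau> n}),
    adj = (\<lambda>X. \<Union>\<sigma>\<in>X. cauchy_rel A `` {\<lambda>n. adj A (\<sigma> n)}),
    nrm = (\<lambda>X. THE l. \<forall>\<sigma>\<in>X. (\<lambda>n. nrm A (\<sigma> n)) \<longlonglongrightarrow> l)\<rparr>"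

definition completion_map ::
  "'b star_alg \<Rightarrow> ('a \<Rightarrow> 'b) \<Rightarrow> (nat \<Rightarrow> 'a) set \<Rightarrow> (nat \<Rightarrow> 'b) set" where
  "completion_map B \<phi> X = (\<Union>\<sigma>\<in>X. cauchy_rel B `` {\<lambda>n. \<phi> (\<sigma> n)})"

section \<open>The reduced twisted groupoid C*-algebra\<close>

text \<open>Functions on the groupoid, or on one of its source fibres, are represented by functions
  on the whole type that vanish off their domain.\<close>

definition Cc :: "'g groupoid \<Rightarrow> ('g \<Rightarrow> complex) set" where
  "Cc G = {f. continuous_map (gtop G) euclidean f \<and>
    compactin (gtop G) (gtop G closure_of {g \<in> arrows G. f g \<noteq> 0}) \<and>
    (\<forall>g. g \<notin> arrows G \<longrightarrow> f g = 0)}"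

text \<open>On the functions to which it is applied below, the sum has finitely many nonzero terms.\<close>

definition conv ::
  "'g groupoid \<Rightarrow> ('g \<times> 'g \<Rightarrow> complex) \<Rightarrow> ('g \<Rightarrow> complex) \<Rightarrow> ('g \<Rightarrow> complex) \<Rightarrow> 'g \<Rightarrow> complex"
  where
  "conv G c f h \<gamma> = (if \<gamma> \<in> arrows G
    then \<Sum>\<^sub>\<infinity>\<eta>\<in>rng_fibre G (src G \<gamma>).
      f (\<gamma> \<cdot>\<^bsub>G\<^esub> \<eta>) * h (ginv G \<eta>) * c (\<gamma> \<cdot>\<^bsub>G\<^esub> \<eta>, ginv G \<eta>)
    else 0)"

definition conv_star ::
  "'g groupoid \<Rightarrow> ('g \<times> 'g \<Rightarrow> complex) \<Rightarrow> ('g \<Rightarrow> complex) \<Rightarrow> 'g \<Rightarrow> complex" where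
  "conv_star G c f \<gamma> = (if \<gamma> \<in> arrows G then cnj (f (ginv G \<gamma>) * c (\<gamma>, ginv G \<gamma>)) else 0)"

definition ell2 :: "'g set \<Rightarrow> ('g \<Rightarrow> complex) set" where
  "ell2 K = {\<xi>. (\<forall>g. g \<notin> K \<longrightarrow> \<xi> g = 0) \<and> (\<lambda>g. (cmod (\<xi> g))\<^sup>2) summable_on K}"

definition ell2_norm :: "'g set \<Rightarrow> ('g \<Rightarrow> complex) \<Rightarrow> real" where
  "ell2_norm K \<xi> = sqrt (\<Sum>\<^sub>\<infinity>g\<in>K. (cmod (\<xi> g))\<^sup>2)"

text \<open>Inserting \<open>0\<close> matters only for the empty groupoid, where the supremum is over the empty
  set.\<close>

definition reduced_norm ::
  "'g groupoid \<Rightarrow> ('g \<times> 'g \<Rightarrow> complex) \<Rightarrow> ('g \<Rightarrow> complex) \<Rightarrow> real" where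
  "reduced_norm G c f = Sup (insert 0 {ell2_norm (src_fibre G u) (conv G c f \<xi>) | u \<xi>.
    u \<in> units G \<and> \<xi> \<in> ell2 (src_fibre G u) \<and> ell2_norm (src_fibre G u) \<xi> = 1})"

definition Cc_alg ::
  "'g groupoid \<Rightarrow> ('g \<times> 'g \<Rightarrow> complex) \<Rightarrow> ('g \<Rightarrow> complex) star_alg" where
  "Cc_alg G c = \<lparr>
    carr = Cc G,
    zer = (\<lambda>g. 0),
    add = (\<lambda>f h g. f g + h g),
    scl = (\<lambda>a f g. a * f g),
    mul = conv G c,
    adj = conv_star G c,
    nrm = reduced_norm G c\<rparr>"

definition Cstar_r ::
  "'g groupoid \<Rightarrow> ('g \<times> 'g \<Rightarrow> complex) \<Rightarrow> (nat \<Rightarrow> 'g \<Rightarrow> complex) set star_alg" where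
  "Cstar_r G c = completion (Cc_alg G c)"

definition extend_by_zero :: "'g set \<Rightarrow> ('g \<Rightarrow> complex) \<Rightarrow> 'g \<Rightarrow> complex" where
  "extend_by_zero S f g = (if g \<in> S then f g else 0)"

text \<open>The copy of \<open>C*\<^sub>r(S,c)\<close> inside \<open>C*\<^sub>r(G,c)\<close>. The cocycle needs no explicit restriction, as
  only its values on composable pairs of the groupoid \<open>S\<close> enter \<open>Cstar_r\<close>.\<close>

definition Cstar_r_embedded ::
  "'g groupoid \<Rightarrow> ('g \<times> 'g \<Rightarrow> complex) \<Rightarrow> 'g set \<Rightarrow> (nat \<Rightarrow> 'g \<Rightarrow> complex) set set" where
  "Cstar_r_embedded G c S =
    completion_map (Cc_alg G c) (extend_by_zero S) ` carr (Cstar_r (restrict_groupoid G S) c)"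

end

theory Submission
  imports Defs
begin

text \<open>
  A function \<open>f\<close> on the groupoid acts on \<open>\<ell>\<^sup>2\<close> of the arrows by the matrix with entries
  \<open>f(\<alpha>\<beta>\<inverse>) c(\<alpha>\<beta>\<inverse>, \<beta>)\<close>. Convolution becomes the matrix product, the involution becomes the adjoint, and the
  reduced norm is the operator norm, so that everything about \<open>C\<^sub>c(G)\<close> reduces to finite sums.
  Restricting a function to \<open>S\<close> means keeping the diagonal blocks of the matrix with respect to the
  cosets \<open>S\<alpha>\<close>. This is contractive, hence extends to the conditional expectation; the norm computed
  in \<open>S\<close> agrees with the one computed in \<open>G\<close> since every block is unitarily equivalent to a block
  of \<open>S\<close>.

  If \<open>x\<close> commutes with the subalgebra, then \<open>\<bar>x(t\<inverse>\<nu>t)\<bar> = \<bar>x(\<nu>)\<bar>\<close> for \<open>t \<in> S\<close>. As \<open>x\<close> is square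
  summable on source fibres, \<open>x(\<nu>) \<noteq> 0\<close> bounds the number of conjugates of \<open>\<nu>\<close> by powers of \<open>t\<close>
  uniformly in \<open>t\<close>, so \<open>\<nu>\<close> is \<open>k\<close>-centralizing for some \<open>k\<close>, and thus commutes with \<open>S\<close>. The same
  equation gives \<open>c(\<nu>, t) = c(t, \<nu>)\<close>, and maximality of \<open>S\<close> puts \<open>\<nu>\<close> into \<open>S\<close>. Hence \<open>x\<close> is
  supported in \<open>S\<close> and fixed by the expectation.
\<close>

section \<open>Kernels bounded on finitely supported vectors\<close>

text \<open>The elements of the algebra are classes of Cauchy sequences rather than operators, and
  this shapes two steps. To speak of the support of such an element, a Cauchy sequence that tends to
  zero pointwise must be null in norm. Bounds tested on finite sets of rows and columns pass to
  entrywise limits, which is why boundedness is phrased in this way. Moreover, positivity means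
  being of the form \<open>y* y\<close>, so positivity of the expectation of \<open>x* x\<close>
  demands an actual square root in an algebra that may have no unit. It is extracted from one
  inequality: for a contraction \<open>z\<close>, both \<open>1 - z* z\<close> and its diagonal part
  are contractions, and an iteration dominated by a scalar recursion then produces the root.

  Continuity and boundedness are local questions. On an open set on which range and source are
  injective a convolution has at most one nonzero term at each arrow, and every function with
  compact support is a finite sum of functions living on such sets. Normality of \<open>S\<close> is
  what turns these local functions into normalizers.\<close>

definition kernel_bounded :: "('i \<Rightarrow> 'i \<Rightarrow> complex) \<Rightarrow> real \<Rightarrow> bool" where
  "kernel_bounded K M \<longleftrightarrow> (\<forall>F E \<xi>. finite F \<longrightarrow> finite E \<longrightarrow>
    L2_set (\<lambda>\<alpha>. cmod (\<Sum>\<beta>\<in>E. K \<alpha> \<beta> * \<xi> \<beta>)) F \<le> M * L2_set (\<lambda>\<beta>. cmod (\<xi> \<beta>)) E)"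

definition kernel_adj :: "('i \<Rightarrow> 'i \<Rightarrow> complex) \<Rightarrow> 'i \<Rightarrow> 'i \<Rightarrow> complex" where
  "kernel_adj K \<alpha> \<beta> = cnj (K \<beta> \<alpha>)"

definition column_finite :: "('i \<Rightarrow> 'i \<Rightarrow> complex) \<Rightarrow> bool" where
  "column_finite K \<longleftrightarrow> (\<forall>\<beta>. finite {\<gamma>. K \<gamma> \<beta> \<noteq> 0})"

text \<open>The matrix product. Restricting the sum to the support of column \<beta> of
  \<open>L\<close> makes it finite whenever \<open>L\<close> is \<open>column_finite\<close>,
  whatever \<open>K\<close> is.\<close>

definition kernel_mult :: "('i \<Rightarrow> 'i \<Rightarrow> complex) \<Rightarrow> ('i \<Rightarrow> 'i \<Rightarrow> complex) \<Rightarrow> 'i \<Rightarrow> 'i \<Rightarrow> complex" where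
  "kernel_mult K L \<alpha> \<beta> = (\<Sum>\<gamma> | L \<gamma> \<beta> \<noteq> 0. K \<alpha> \<gamma> * L \<gamma> \<beta>)"

lemma L2_set_power2: "(L2_set f A)\<^sup>2 = (\<Sum>i\<in>A. (f i)\<^sup>2)"
  by (simp add: L2_set_def sum_nonneg)

lemma kernel_boundedI:
  assumes "\<And>F E \<xi>. finite F \<Longrightarrow> finite E \<Longrightarrow>
    L2_set (\<lambda>\<alpha>. cmod (\<Sum>\<beta>\<in>E. K \<alpha> \<beta> * \<xi> \<beta>)) F \<le> M * L2_set (\<lambda>\<beta>. cmod (\<xi> \<beta>)) E"
  shows "kernel_bounded K M"
  using assms by (auto simp: kernel_bounded_def)

lemma kernel_boundedD:
  assumes "kernel_bounded K M" "finite F" "finite E"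
  shows "L2_set (\<lambda>\<alpha>. cmod (\<Sum>\<beta>\<in>E. K \<alpha> \<beta> * \<xi> \<beta>)) F \<le> M * L2_set (\<lambda>\<beta>. cmod (\<xi> \<beta>)) E"
  using assms by (auto simp: kernel_bounded_def)

lemma kernel_boundedI_sq:
  assumes "0 \<le> M"
    and "\<And>F E \<xi>. finite F \<Longrightarrow> finite E \<Longrightarrow>
      (\<Sum>\<alpha>\<in>F. (cmod (\<Sum>\<beta>\<in>E. K \<alpha> \<beta> * \<xi> \<beta>))\<^sup>2) \<le> M\<^sup>2 * (\<Sum>\<beta>\<in>E. (cmod (\<xi> \<beta>))\<^sup>2)"
  shows "kernel_bounded K M"
proof (rule kernel_boundedI)
  fix F E :: "'a set" and \<xi> :: "'a \<Rightarrow> complex"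
  assume "finite F" "finite E"
  from assms(2)[OF this, of \<xi>] have
    "(L2_set (\<lambda>\<alpha>. cmod (\<Sum>\<beta>\<in>E. K \<alpha> \<beta> * \<xi> \<beta>)) F)\<^sup>2 \<le> (M * L2_set (\<lambda>\<beta>. cmod (\<xi> \<beta>)) E)\<^sup>2"
    by (simp add: L2_set_power2 power_mult_distrib)
  then show "L2_set (\<lambda>\<alpha>. cmod (\<Sum>\<beta>\<in>E. K \<alpha> \<beta> * \<xi> \<beta>)) F \<le> M * L2_set (\<lambda>\<beta>. cmod (\<xi> \<beta>)) E"
    by (rule power2_le_imp_le) (simp add: assms)
qed

lemma kernel_boundedD_sq:
  assumes "kernel_bounded K M" "finite F" "finite E"
  shows "(\<Sum>\<alpha>\<in>F. (cmod (\<Sum>\<beta>\<in>E. K \<alpha> \<beta> * \<xi> \<beta>))\<^sup>2) \<le> M\<^sup>2 * (\<Sum>\<beta>\<in>E. (cmod (\<xi> \<beta>))\<^sup>2)"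
proof -
  have "(L2_set (\<lambda>\<alpha>. cmod (\<Sum>\<beta>\<in>E. K \<alpha> \<beta> * \<xi> \<beta>)) F)\<^sup>2 \<le> (M * L2_set (\<lambda>\<beta>. cmod (\<xi> \<beta>)) E)\<^sup>2"
    by (rule power_mono[OF kernel_boundedD[OF assms]]) simp
  then show ?thesis by (simp add: L2_set_power2 power_mult_distrib)
qed

lemma kernel_bounded_mono: "kernel_bounded K M \<Longrightarrow> M \<le> N \<Longrightarrow> kernel_bounded K N"
  unfolding kernel_bounded_def
  by (meson L2_set_nonneg mult_right_mono order_trans)

lemma kernel_bounded_add:
  assumes "kernel_bounded K M" "kernel_bounded L N"
  shows "kernel_bounded (\<lambda>\<alpha> \<beta>. K \<alpha> \<beta> + L \<alpha> \<beta>) (M + N)"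
proof (rule kernel_boundedI)
  fix F E :: "'a set" and \<xi> :: "'a \<Rightarrow> complex"
  assume fin: "finite F" "finite E"
  have "L2_set (\<lambda>\<alpha>. cmod (\<Sum>\<beta>\<in>E. (K \<alpha> \<beta> + L \<alpha> \<beta>) * \<xi> \<beta>)) F
    \<le> L2_set (\<lambda>\<alpha>. cmod (\<Sum>\<beta>\<in>E. K \<alpha> \<beta> * \<xi> \<beta>) + cmod (\<Sum>\<beta>\<in>E. L \<alpha> \<beta> * \<xi> \<beta>)) F"
    by (rule L2_set_mono) (auto simp: distrib_right sum.distrib norm_triangle_ineq)
  also have "\<dots> \<le> L2_set (\<lambda>\<alpha>. cmod (\<Sum>\<beta>\<in>E. K \<alpha> \<beta> * \<xi> \<beta>)) F
      + L2_set (\<lambda>\<alpha>. cmod (\<Sum>\<beta>\<in>E. L \<alpha> \<beta> * \<xi> \<beta>)) F"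
    by (rule L2_set_triangle_ineq)
  also have "\<dots> \<le> M * L2_set (\<lambda>\<beta>. cmod (\<xi> \<beta>)) E + N * L2_set (\<lambda>\<beta>. cmod (\<xi> \<beta>)) E"
    using fin by (intro add_mono kernel_boundedD assms)
  finally show "L2_set (\<lambda>\<alpha>. cmod (\<Sum>\<beta>\<in>E. (K \<alpha> \<beta> + L \<alpha> \<beta>) * \<xi> \<beta>)) F
    \<le> (M + N) * L2_set (\<lambda>\<beta>. cmod (\<xi> \<beta>)) E"
    by (simp add: distrib_right)
qed

lemma kernel_bounded_scale:
  assumes "kernel_bounded K M"
  shows "kernel_bounded (\<lambda>\<alpha> \<beta>. a * K \<alpha> \<beta>) (cmod a * M)"
proof (rule kernel_boundedI)
  fix F E :: "'a set" and \<xi> :: "'a \<Rightarrow> complex"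
  assume fin: "finite F" "finite E"
  have "(\<Sum>\<beta>\<in>E. a * K \<alpha> \<beta> * \<xi> \<beta>) = a * (\<Sum>\<beta>\<in>E. K \<alpha> \<beta> * \<xi> \<beta>)" for \<alpha>
    by (simp add: sum_distrib_left mult.assoc)
  then have "L2_set (\<lambda>\<alpha>. cmod (\<Sum>\<beta>\<in>E. a * K \<alpha> \<beta> * \<xi> \<beta>)) F
      = cmod a * L2_set (\<lambda>\<alpha>. cmod (\<Sum>\<beta>\<in>E. K \<alpha> \<beta> * \<xi> \<beta>)) F"
    by (simp add: norm_mult L2_set_right_distrib)
  then show "L2_set (\<lambda>\<alpha>. cmod (\<Sum>\<beta>\<in>E. a * K \<alpha> \<beta> * \<xi> \<beta>)) F
      \<le> cmod a * M * L2_set (\<lambda>\<beta>. cmod (\<xi> \<beta>)) E"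
    using mult_left_mono[OF kernel_boundedD[OF assms fin, of \<xi>], of "cmod a"]
    by (simp add: mult.assoc)
qed

section \<open>Adjoints, products and the C*-identity for kernels\<close>

lemma cmod_sum_mult_le_L2_set:
  "cmod (\<Sum>i\<in>A. f i * g i) \<le> L2_set (\<lambda>i. cmod (f i)) A * L2_set (\<lambda>i. cmod (g i)) A"
proof -
  have "cmod (\<Sum>i\<in>A. f i * g i) \<le> (\<Sum>i\<in>A. \<bar>cmod (f i)\<bar> * \<bar>cmod (g i)\<bar>)"
    by (rule order_trans[OF norm_sum]) (simp add: norm_mult)
  then show ?thesis by (rule order_trans[OF _ L2_set_mult_ineq])
qed

lemma power2_le_imp_le_mult:
  fixes x y :: real
  assumes "x\<^sup>2 \<le> y * x" "0 \<le> x" "0 \<le> y"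
  shows "x \<le> y"
proof (cases "x = 0")
  case False
  then show ?thesis using assms by (auto simp: power2_eq_square)
qed (use assms in auto)

text \<open>With \<eta> the image of \<xi> under the adjoint, |\<eta>|^2 is a pairing of \<xi> with
  \<open>K\<close> \<eta>, hence at most M |\<xi>| |\<eta>|, and one factor |\<eta>| cancels. The
  finite sets of rows and columns exchange their roles.\<close>

lemma kernel_bounded_adj:
  assumes K: "kernel_bounded K M" and M: "0 \<le> M"
  shows "kernel_bounded (kernel_adj K) M"
proof (rule kernel_boundedI)
  fix F E :: "'a set" and \<xi> :: "'a \<Rightarrow> complex"
  assume fin: "finite F" "finite E"
  define \<eta> where "\<eta> = (\<lambda>\<alpha>. \<Sum>\<beta>\<in>E. kernel_adj K \<alpha> \<beta> * \<xi> \<beta>)"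
  let ?n = "L2_set (\<lambda>\<alpha>. cmod (\<eta> \<alpha>)) F" and ?x = "L2_set (\<lambda>\<beta>. cmod (\<xi> \<beta>)) E"
  have "complex_of_real (?n\<^sup>2) = (\<Sum>\<alpha>\<in>F. cnj (\<eta> \<alpha>) * \<eta> \<alpha>)"
    by (simp add: L2_set_power2 complex_norm_square mult.commute del: of_real_power)
  also have "\<dots> = (\<Sum>\<alpha>\<in>F. \<Sum>\<beta>\<in>E. cnj (\<xi> \<beta>) * (K \<beta> \<alpha> * \<eta> \<alpha>))"
  proof (rule sum.cong[OF refl])
    fix \<alpha>
    have "cnj (\<eta> \<alpha>) = (\<Sum>\<beta>\<in>E. K \<beta> \<alpha> * cnj (\<xi> \<beta>))"
      by (simp add: \<eta>_def kernel_adj_def)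
    then show "cnj (\<eta> \<alpha>) * \<eta> \<alpha> = (\<Sum>\<beta>\<in>E. cnj (\<xi> \<beta>) * (K \<beta> \<alpha> * \<eta> \<alpha>))"
      by (simp only: sum_distrib_right) (simp add: mult_ac)
  qed
  also have "\<dots> = (\<Sum>\<beta>\<in>E. cnj (\<xi> \<beta>) * (\<Sum>\<alpha>\<in>F. K \<beta> \<alpha> * \<eta> \<alpha>))"
    by (subst sum.swap) (simp add: sum_distrib_left)
  finally have "?n\<^sup>2 = cmod (\<Sum>\<beta>\<in>E. cnj (\<xi> \<beta>) * (\<Sum>\<alpha>\<in>F. K \<beta> \<alpha> * \<eta> \<alpha>))"
    by (metis L2_set_nonneg norm_of_real abs_of_nonneg zero_le_power)
  also have "\<dots> \<le> ?x * L2_set (\<lambda>\<beta>. cmod (\<Sum>\<alpha>\<in>F. K \<beta> \<alpha> * \<eta> \<alpha>)) E"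
    using cmod_sum_mult_le_L2_set[of "\<lambda>\<beta>. cnj (\<xi> \<beta>)"] by simp
  also have "\<dots> \<le> ?x * (M * ?n)"
    using fin by (intro mult_left_mono kernel_boundedD K) auto
  finally have "?n\<^sup>2 \<le> (M * ?x) * ?n" by (simp add: mult_ac)
  then have "?n \<le> M * ?x" by (rule power2_le_imp_le_mult) (auto simp: M)
  then show "L2_set (\<lambda>\<alpha>. cmod (\<Sum>\<beta>\<in>E. kernel_adj K \<alpha> \<beta> * \<xi> \<beta>)) F \<le> M * ?x"
    by (simp add: \<eta>_def)
qed

lemma kernel_mult_eq:
  assumes "finite C" "\<And>\<gamma>. \<gamma> \<notin> C \<Longrightarrow> K \<alpha> \<gamma> * L \<gamma> \<beta> = 0" "finite {\<gamma>. L \<gamma> \<beta> \<noteq> 0}"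
  shows "kernel_mult K L \<alpha> \<beta> = (\<Sum>\<gamma>\<in>C. K \<alpha> \<gamma> * L \<gamma> \<beta>)"
  unfolding kernel_mult_def by (rule sum.mono_neutral_cong) (use assms in auto)

definition column_support :: "('i \<Rightarrow> 'i \<Rightarrow> complex) \<Rightarrow> 'i set \<Rightarrow> 'i set" where
  "column_support L E = (\<Union>\<beta>\<in>E. {\<gamma>. L \<gamma> \<beta> \<noteq> 0})"

lemma finite_column_support: "column_finite L \<Longrightarrow> finite E \<Longrightarrow> finite (column_support L E)"
  by (auto simp: column_support_def column_finite_def)

lemma column_support_outside: "\<beta> \<in> E \<Longrightarrow> \<gamma> \<notin> column_support L E \<Longrightarrow> L \<gamma> \<beta> = 0"
  by (auto simp: column_support_def)

text \<open>Two finite sums are interchanged. \<open>column_support L E\<close> is the finite set of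
  intermediate indices reached from \<open>E\<close>, so estimates for products stay within finite
  sections of the matrices.\<close>

lemma kernel_mult_apply:
  assumes "column_finite L" "finite E"
  shows "(\<Sum>\<beta>\<in>E. kernel_mult K L \<alpha> \<beta> * \<xi> \<beta>)
    = (\<Sum>\<gamma>\<in>column_support L E. K \<alpha> \<gamma> * (\<Sum>\<beta>\<in>E. L \<gamma> \<beta> * \<xi> \<beta>))"
proof -
  let ?C = "column_support L E"
  have "(\<Sum>\<beta>\<in>E. kernel_mult K L \<alpha> \<beta> * \<xi> \<beta>) = (\<Sum>\<beta>\<in>E. (\<Sum>\<gamma>\<in>?C. K \<alpha> \<gamma> * L \<gamma> \<beta>) * \<xi> \<beta>)"
  proof (rule sum.cong[OF refl])
    fix \<beta> assume "\<beta> \<in> E"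
    then have "kernel_mult K L \<alpha> \<beta> = (\<Sum>\<gamma>\<in>?C. K \<alpha> \<gamma> * L \<gamma> \<beta>)"
      using assms column_support_outside[OF \<open>\<beta> \<in> E\<close>]
      by (intro kernel_mult_eq finite_column_support) (simp_all add: column_finite_def)
    then show "kernel_mult K L \<alpha> \<beta> * \<xi> \<beta> = (\<Sum>\<gamma>\<in>?C. K \<alpha> \<gamma> * L \<gamma> \<beta>) * \<xi> \<beta>" by simp
  qed
  also have "\<dots> = (\<Sum>\<gamma>\<in>?C. K \<alpha> \<gamma> * (\<Sum>\<beta>\<in>E. L \<gamma> \<beta> * \<xi> \<beta>))"
    by (simp add: sum_distrib_left sum_distrib_right mult.assoc) (rule sum.swap)
  finally show ?thesis .
qed

lemma kernel_bounded_mult: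
  assumes K: "kernel_bounded K M" and L: "kernel_bounded L N" and "0 \<le> M" "column_finite L"
  shows "kernel_bounded (kernel_mult K L) (M * N)"
proof (rule kernel_boundedI)
  fix F E :: "'a set" and \<xi> :: "'a \<Rightarrow> complex"
  assume fin: "finite F" "finite E"
  define C where "C = column_support L E"
  have C: "finite C" "\<And>\<gamma> \<beta>. \<beta> \<in> E \<Longrightarrow> \<gamma> \<notin> C \<Longrightarrow> L \<gamma> \<beta> = 0"
    using finite_column_support[OF assms(4) fin(2)] by (auto simp: C_def column_support_outside)
  note app = kernel_mult_apply[OF assms(4) fin(2), folded C_def]
  have "L2_set (\<lambda>\<alpha>. cmod (\<Sum>\<beta>\<in>E. kernel_mult K L \<alpha> \<beta> * \<xi> \<beta>)) F
      \<le> M * L2_set (\<lambda>\<gamma>. cmod (\<Sum>\<beta>\<in>E. L \<gamma> \<beta> * \<xi> \<beta>)) C"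
    unfolding app by (rule kernel_boundedD[OF K fin(1) C(1)])
  also have "\<dots> \<le> M * (N * L2_set (\<lambda>\<beta>. cmod (\<xi> \<beta>)) E)"
    by (intro mult_left_mono kernel_boundedD L C fin assms)
  finally show "L2_set (\<lambda>\<alpha>. cmod (\<Sum>\<beta>\<in>E. kernel_mult K L \<alpha> \<beta> * \<xi> \<beta>)) F
      \<le> M * N * L2_set (\<lambda>\<beta>. cmod (\<xi> \<beta>)) E" by (simp add: mult.assoc)
qed

text \<open>The adjoint is moved to the other side of the pairing. The rows in
  \<open>column_support K E\<close> carry all of \<open>K\<close> \<xi>, so the right side is its
  full squared norm.\<close>

lemma kernel_quadratic_form:
  assumes "column_finite K" "finite E"
  shows "(\<Sum>\<alpha>\<in>E. cnj (\<xi> \<alpha>) * (\<Sum>\<beta>\<in>E. kernel_mult (kernel_adj K) K \<alpha> \<beta> * \<xi> \<beta>))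
    = complex_of_real (\<Sum>\<gamma>\<in>column_support K E. (cmod (\<Sum>\<beta>\<in>E. K \<gamma> \<beta> * \<xi> \<beta>))\<^sup>2)"
proof -
  define C where "C = column_support K E"
  define s where "s = (\<lambda>\<gamma>. \<Sum>\<beta>\<in>E. K \<gamma> \<beta> * \<xi> \<beta>)"
  have "(\<Sum>\<alpha>\<in>E. cnj (\<xi> \<alpha>) * (\<Sum>\<gamma>\<in>C. kernel_adj K \<alpha> \<gamma> * s \<gamma>))
      = (\<Sum>\<gamma>\<in>C. \<Sum>\<alpha>\<in>E. cnj (K \<gamma> \<alpha> * \<xi> \<alpha>) * s \<gamma>)"
    unfolding sum_distrib_left kernel_adj_def
    by (subst sum.swap) (simp add: mult_ac)
  also have "\<dots> = (\<Sum>\<gamma>\<in>C. cnj (s \<gamma>) * s \<gamma>)"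
    by (simp only: s_def cnj_sum sum_distrib_right)
  also have "\<dots> = complex_of_real (\<Sum>\<gamma>\<in>C. (cmod (s \<gamma>))\<^sup>2)"
    by (simp add: complex_norm_square mult.commute del: of_real_power)
  finally show ?thesis unfolding kernel_mult_apply[OF assms] s_def C_def .
qed

text \<open>|K \<xi>|^2 is the pairing of \<xi> with K* K \<xi>, and Cauchy-Schwarz bounds it by M^2
  |\<xi>|^2. This is the half of the C*-identity that does not follow from
  submultiplicativity.\<close>

lemma kernel_bounded_cstar:
  assumes "column_finite K" and b: "kernel_bounded (kernel_mult (kernel_adj K) K) (M\<^sup>2)" and M: "0 \<le> M"
  shows "kernel_bounded K M"
proof (rule kernel_boundedI_sq[OF M])
  fix F E :: "'a set" and \<xi> :: "'a \<Rightarrow> complex"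
  assume fin: "finite F" "finite E"
  define C where "C = column_support K E"
  have C: "finite C" "\<And>\<gamma> \<beta>. \<beta> \<in> E \<Longrightarrow> \<gamma> \<notin> C \<Longrightarrow> K \<gamma> \<beta> = 0"
    using finite_column_support[OF assms(1) fin(2)] by (auto simp: C_def column_support_outside)
  note app = kernel_mult_apply[OF assms(1) fin(2), folded C_def]
  let ?x = "L2_set (\<lambda>\<beta>. cmod (\<xi> \<beta>)) E"
  let ?s = "\<lambda>\<gamma>. \<Sum>\<beta>\<in>E. K \<gamma> \<beta> * \<xi> \<beta>"
  \<comment> \<open>Rows outside \<open>C\<close> contribute nothing, so \<open>F\<close> may be
    replaced by \<open>C\<close>, over which the quadratic form is known.\<close>
  have "(\<Sum>\<alpha>\<in>F. (cmod (?s \<alpha>))\<^sup>2) \<le> (\<Sum>\<alpha>\<in>C. (cmod (?s \<alpha>))\<^sup>2)"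
  proof -
    have "(\<Sum>\<alpha>\<in>F. (cmod (?s \<alpha>))\<^sup>2) = (\<Sum>\<alpha>\<in>F \<inter> C. (cmod (?s \<alpha>))\<^sup>2)"
      by (rule sum.mono_neutral_right) (use fin C(2) in auto)
    also have "\<dots> \<le> (\<Sum>\<alpha>\<in>C. (cmod (?s \<alpha>))\<^sup>2)" by (rule sum_mono2) (auto simp: C)
    finally show ?thesis .
  qed
  also have "\<dots> = cmod (\<Sum>\<alpha>\<in>E. cnj (\<xi> \<alpha>) * (\<Sum>\<beta>\<in>E. kernel_mult (kernel_adj K) K \<alpha> \<beta> * \<xi> \<beta>))"
    unfolding kernel_quadratic_form[OF assms(1) fin(2), folded C_def] by (simp only: norm_of_real) (simp add: sum_nonneg)
  also have "\<dots> \<le> ?x * L2_set (\<lambda>\<alpha>. cmod (\<Sum>\<beta>\<in>E. kernel_mult (kernel_adj K) K \<alpha> \<beta> * \<xi> \<beta>)) E"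
    using cmod_sum_mult_le_L2_set[of "\<lambda>\<beta>. cnj (\<xi> \<beta>)"] by simp
  also have "\<dots> \<le> ?x * (M\<^sup>2 * ?x)"
    using fin by (intro mult_left_mono kernel_boundedD b) auto
  also have "\<dots> = M\<^sup>2 * ?x\<^sup>2" by (simp add: power2_eq_square)
  finally show "(\<Sum>\<alpha>\<in>F. (cmod (?s \<alpha>))\<^sup>2) \<le> M\<^sup>2 * (\<Sum>\<beta>\<in>E. (cmod (\<xi> \<beta>))\<^sup>2)"
    by (simp add: L2_set_power2)
qed

text \<open>Expanding the square, |\<xi> - K* K \<xi>|^2 = |\<xi>|^2 - 2 |K \<xi>|^2 + |K* K
  \<xi>|^2, and the last term is at most |K \<xi>|^2 because the adjoint is a contraction as well.
  This inequality feeds the square root iteration.\<close>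

lemma kernel_bounded_defect:
  assumes cf: "column_finite K" and K: "kernel_bounded K 1"
  shows "kernel_bounded (\<lambda>\<alpha> \<beta>. (if \<alpha> = \<beta> then 1 else 0) - kernel_mult (kernel_adj K) K \<alpha> \<beta>) 1"
proof (rule kernel_boundedI_sq[OF zero_le_one])
  fix F E :: "'a set" and \<xi> :: "'a \<Rightarrow> complex"
  assume fin: "finite F" "finite E"
  define C where "C = column_support K E"
  have C: "finite C" "\<And>\<gamma> \<beta>. \<beta> \<in> E \<Longrightarrow> \<gamma> \<notin> C \<Longrightarrow> K \<gamma> \<beta> = 0"
    using finite_column_support[OF cf fin(2)] by (auto simp: C_def column_support_outside)
  note app = kernel_mult_apply[OF cf fin(2), folded C_def]
  define s where "s = (\<lambda>\<gamma>. \<Sum>\<beta>\<in>E. K \<gamma> \<beta> * \<xi> \<beta>)"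
  define t where "t = (\<lambda>\<alpha>. \<Sum>\<gamma>\<in>C. kernel_adj K \<alpha> \<gamma> * s \<gamma>)"
  define z where "z = (\<lambda>\<alpha>. if \<alpha> \<in> E then \<xi> \<alpha> else 0)"
  \<comment> \<open>The rows are enlarged by \<open>E\<close>: the cross term equals the quadratic
    form only if every index of \<open>E\<close> is summed.\<close>
  let ?G = "F \<union> E"
  have app2: "(\<Sum>\<beta>\<in>E. ((if \<alpha> = \<beta> then 1 else 0) - kernel_mult (kernel_adj K) K \<alpha> \<beta>) * \<xi> \<beta>) = z \<alpha> - t \<alpha>" for \<alpha>
  proof -
    have "(\<Sum>\<beta>\<in>E. (if \<alpha> = \<beta> then 1 else 0) * \<xi> \<beta>) = (\<Sum>\<beta>\<in>E. if \<beta> = \<alpha> then \<xi> \<beta> else 0)"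
      by (rule sum.cong) auto
    also have "\<dots> = z \<alpha>" using fin by (simp add: z_def)
    finally have "(\<Sum>\<beta>\<in>E. (if \<alpha> = \<beta> then 1 else 0) * \<xi> \<beta>) = z \<alpha>" .
    then show ?thesis by (simp add: left_diff_distrib sum_subtractf app t_def s_def)
  qed
  have sq: "(cmod (z \<alpha> - t \<alpha>))\<^sup>2 = (cmod (z \<alpha>))\<^sup>2 - 2 * Re (cnj (z \<alpha>) * t \<alpha>) + (cmod (t \<alpha>))\<^sup>2" for \<alpha>
    unfolding cmod_power2 by (simp add: power2_eq_square algebra_simps)
  have "(\<Sum>\<alpha>\<in>?G. cnj (z \<alpha>) * t \<alpha>) = (\<Sum>\<alpha>\<in>E. cnj (\<xi> \<alpha>) * t \<alpha>)"
    unfolding z_def by (rule sum.mono_neutral_cong_right) (use fin in auto)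
  also have "\<dots> = complex_of_real (\<Sum>\<gamma>\<in>C. (cmod (s \<gamma>))\<^sup>2)"
    using kernel_quadratic_form[OF cf fin(2), folded C_def] by (simp only: app t_def s_def)
  finally have "(\<Sum>\<alpha>\<in>?G. Re (cnj (z \<alpha>) * t \<alpha>)) = (\<Sum>\<gamma>\<in>C. (cmod (s \<gamma>))\<^sup>2)"
    by (simp only: Re_sum[symmetric] Re_complex_of_real)
  moreover have "(\<Sum>\<alpha>\<in>?G. (cmod (t \<alpha>))\<^sup>2) \<le> 1\<^sup>2 * (\<Sum>\<gamma>\<in>C. (cmod (s \<gamma>))\<^sup>2)"
    unfolding t_def
    by (rule kernel_boundedD_sq[OF kernel_bounded_adj[OF K]]) (use fin C in auto)
  ultimately have "(\<Sum>\<alpha>\<in>?G. (cmod (z \<alpha> - t \<alpha>))\<^sup>2) \<le> (\<Sum>\<alpha>\<in>?G. (cmod (z \<alpha>))\<^sup>2) - (\<Sum>\<gamma>\<in>C. (cmod (s \<gamma>))\<^sup>2)"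
    unfolding sq by (simp add: sum.distrib sum_subtractf flip: sum_distrib_left)
  also have "\<dots> \<le> (\<Sum>\<alpha>\<in>?G. (cmod (z \<alpha>))\<^sup>2)" by (simp add: sum_nonneg)
  also have "\<dots> = (\<Sum>\<alpha>\<in>E. (cmod (\<xi> \<alpha>))\<^sup>2)"
    unfolding z_def by (rule sum.mono_neutral_cong_right) (use fin in auto)
  finally have *: "(\<Sum>\<alpha>\<in>?G. (cmod (z \<alpha> - t \<alpha>))\<^sup>2) \<le> (\<Sum>\<alpha>\<in>E. (cmod (\<xi> \<alpha>))\<^sup>2)" .
  have "(\<Sum>\<alpha>\<in>F. (cmod (z \<alpha> - t \<alpha>))\<^sup>2) \<le> (\<Sum>\<alpha>\<in>?G. (cmod (z \<alpha> - t \<alpha>))\<^sup>2)"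
    by (rule sum_mono2) (use fin in auto)
  with * show "(\<Sum>\<alpha>\<in>F. (cmod (\<Sum>\<beta>\<in>E. ((if \<alpha> = \<beta> then 1 else 0) - kernel_mult (kernel_adj K) K \<alpha> \<beta>) * \<xi> \<beta>))\<^sup>2)
    \<le> 1\<^sup>2 * (\<Sum>\<beta>\<in>E. (cmod (\<xi> \<beta>))\<^sup>2)"
    unfolding app2 by simp
qed

section \<open>Block decompositions, compressions and relabellings\<close>

lemma kernel_bounded_blocks:
  assumes M: "0 \<le> M"
    and b: "\<And>l. kernel_bounded (\<lambda>\<alpha> \<beta>. if q \<alpha> = l \<and> q \<beta> = l then K \<alpha> \<beta> else 0) M"
    and off: "\<And>\<alpha> \<beta>. q \<alpha> \<noteq> q \<beta> \<Longrightarrow> K \<alpha> \<beta> = 0"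
  shows "kernel_bounded K M"
proof (rule kernel_boundedI_sq[OF M])
  fix F E :: "'b set" and \<xi> :: "'b \<Rightarrow> complex"
  assume fin: "finite F" "finite E"
  let ?Q = "q ` (F \<union> E)"
  let ?f = "\<lambda>\<alpha>. (cmod (\<Sum>\<beta>\<in>E. K \<alpha> \<beta> * \<xi> \<beta>))\<^sup>2"
  \<comment> \<open>Pythagoras: rows are grouped by label, only columns with the same label
    contribute to a group, and the squared norms of the groups add up.\<close>
  have "(\<Sum>\<alpha>\<in>F. ?f \<alpha>) = (\<Sum>l\<in>?Q. \<Sum>\<alpha> | \<alpha> \<in> F \<and> q \<alpha> = l. ?f \<alpha>)"
    by (rule sum.group[symmetric]) (use fin in auto)
  also have "\<dots> \<le> (\<Sum>l\<in>?Q. M\<^sup>2 * (\<Sum>\<beta> | \<beta> \<in> E \<and> q \<beta> = l. (cmod (\<xi> \<beta>))\<^sup>2))"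
  proof (rule sum_mono)
    fix l
    have "(\<Sum>\<alpha> | \<alpha> \<in> F \<and> q \<alpha> = l. ?f \<alpha>)
      = (\<Sum>\<alpha> | \<alpha> \<in> F \<and> q \<alpha> = l. (cmod (\<Sum>\<beta> | \<beta> \<in> E \<and> q \<beta> = l. (if q \<alpha> = l \<and> q \<beta> = l then K \<alpha> \<beta> else 0) * \<xi> \<beta>))\<^sup>2)"
    proof (rule sum.cong[OF refl])
      fix \<alpha> assume "\<alpha> \<in> {\<alpha>. \<alpha> \<in> F \<and> q \<alpha> = l}"
      then have "(\<Sum>\<beta>\<in>E. K \<alpha> \<beta> * \<xi> \<beta>)
          = (\<Sum>\<beta> | \<beta> \<in> E \<and> q \<beta> = l. (if q \<alpha> = l \<and> q \<beta> = l then K \<alpha> \<beta> else 0) * \<xi> \<beta>)"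
      proof (intro sum.mono_neutral_cong_right ballI)
        fix \<beta> assume "\<beta> \<in> E - {\<beta>. \<beta> \<in> E \<and> q \<beta> = l}"
        then show "K \<alpha> \<beta> * \<xi> \<beta> = 0" using \<open>\<alpha> \<in> _\<close> off[of \<alpha> \<beta>] by auto
      qed (use fin in auto)
      then show "?f \<alpha> = (cmod (\<Sum>\<beta> | \<beta> \<in> E \<and> q \<beta> = l. (if q \<alpha> = l \<and> q \<beta> = l then K \<alpha> \<beta> else 0) * \<xi> \<beta>))\<^sup>2"
        by simp
    qed
    also have "\<dots> \<le> M\<^sup>2 * (\<Sum>\<beta> | \<beta> \<in> E \<and> q \<beta> = l. (cmod (\<xi> \<beta>))\<^sup>2)"
      by (rule kernel_boundedD_sq[OF b]) (use fin in auto)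
    finally show "(\<Sum>\<alpha> | \<alpha> \<in> F \<and> q \<alpha> = l. ?f \<alpha>) \<le> M\<^sup>2 * (\<Sum>\<beta> | \<beta> \<in> E \<and> q \<beta> = l. (cmod (\<xi> \<beta>))\<^sup>2)" .
  qed
  also have "\<dots> = M\<^sup>2 * (\<Sum>l\<in>?Q. \<Sum>\<beta> | \<beta> \<in> E \<and> q \<beta> = l. (cmod (\<xi> \<beta>))\<^sup>2)"
    by (simp add: sum_distrib_left)
  also have "(\<Sum>l\<in>?Q. \<Sum>\<beta> | \<beta> \<in> E \<and> q \<beta> = l. (cmod (\<xi> \<beta>))\<^sup>2) = (\<Sum>\<beta>\<in>E. (cmod (\<xi> \<beta>))\<^sup>2)"
    by (rule sum.group) (use fin in auto)
  finally show "(\<Sum>\<alpha>\<in>F. ?f \<alpha>) \<le> M\<^sup>2 * (\<Sum>\<beta>\<in>E. (cmod (\<xi> \<beta>))\<^sup>2)" .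
qed

lemma kernel_bounded_compress:
  assumes K: "kernel_bounded K M" and M: "0 \<le> M"
  shows "kernel_bounded (\<lambda>\<alpha> \<beta>. if p \<alpha> \<and> p \<beta> then K \<alpha> \<beta> else 0) M"
proof (rule kernel_boundedI_sq[OF M])
  fix F E :: "'a set" and \<xi> :: "'a \<Rightarrow> complex"
  assume fin: "finite F" "finite E"
  have "(\<Sum>\<alpha>\<in>F. (cmod (\<Sum>\<beta>\<in>E. (if p \<alpha> \<and> p \<beta> then K \<alpha> \<beta> else 0) * \<xi> \<beta>))\<^sup>2)
    = (\<Sum>\<alpha> | \<alpha> \<in> F \<and> p \<alpha>. (cmod (\<Sum>\<beta> | \<beta> \<in> E \<and> p \<beta>. K \<alpha> \<beta> * \<xi> \<beta>))\<^sup>2)"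
  proof (rule sum.mono_neutral_cong_right)
    fix \<alpha> assume "\<alpha> \<in> {\<alpha>. \<alpha> \<in> F \<and> p \<alpha>}"
    then have "(\<Sum>\<beta>\<in>E. (if p \<alpha> \<and> p \<beta> then K \<alpha> \<beta> else 0) * \<xi> \<beta>) = (\<Sum>\<beta> | \<beta> \<in> E \<and> p \<beta>. K \<alpha> \<beta> * \<xi> \<beta>)"
      by (intro sum.mono_neutral_cong_right) (use fin in auto)
    then show "(cmod (\<Sum>\<beta>\<in>E. (if p \<alpha> \<and> p \<beta> then K \<alpha> \<beta> else 0) * \<xi> \<beta>))\<^sup>2
        = (cmod (\<Sum>\<beta> | \<beta> \<in> E \<and> p \<beta>. K \<alpha> \<beta> * \<xi> \<beta>))\<^sup>2" by simp
  qed (use fin in auto)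
  also have "\<dots> \<le> M\<^sup>2 * (\<Sum>\<beta> | \<beta> \<in> E \<and> p \<beta>. (cmod (\<xi> \<beta>))\<^sup>2)"
    by (rule kernel_boundedD_sq[OF K]) (use fin in auto)
  also have "\<dots> \<le> M\<^sup>2 * (\<Sum>\<beta>\<in>E. (cmod (\<xi> \<beta>))\<^sup>2)"
    by (intro mult_left_mono sum_mono2) (use fin in auto)
  finally show "(\<Sum>\<alpha>\<in>F. (cmod (\<Sum>\<beta>\<in>E. (if p \<alpha> \<and> p \<beta> then K \<alpha> \<beta> else 0) * \<xi> \<beta>))\<^sup>2)
    \<le> M\<^sup>2 * (\<Sum>\<beta>\<in>E. (cmod (\<xi> \<beta>))\<^sup>2)" .
qed

text \<open>Each diagonal block is a compression of \<open>K\<close>, and a block diagonal matrix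
  inherits a common bound of its blocks. With cosets of \<open>S\<close> as labels this is the
  contractivity of the expectation.\<close>

lemma kernel_bounded_pinch:
  assumes K: "kernel_bounded K M" and M: "0 \<le> M"
  shows "kernel_bounded (\<lambda>\<alpha> \<beta>. if q \<alpha> = q \<beta> then K \<alpha> \<beta> else 0) M"
proof (rule kernel_bounded_blocks[OF M, of q])
  fix l
  have "(\<lambda>\<alpha> \<beta>. if q \<alpha> = l \<and> q \<beta> = l then if q \<alpha> = q \<beta> then K \<alpha> \<beta> else 0 else 0)
    = (\<lambda>\<alpha> \<beta>. if q \<alpha> = l \<and> q \<beta> = l then K \<alpha> \<beta> else 0)" by (auto simp: fun_eq_iff)
  then show "kernel_bounded (\<lambda>\<alpha> \<beta>. if q \<alpha> = l \<and> q \<beta> = l then if q \<alpha> = q \<beta> then K \<alpha> \<beta> else 0 else 0) M"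
    using kernel_bounded_compress[OF K M, of "\<lambda>\<alpha>. q \<alpha> = l"] by simp
qed auto

text \<open>A weighted partial permutation matrix: every row or column sum has at most one nonzero
  term, so squares may be summed entry by entry. Functions living where range and source are
  injective have such matrices.\<close>

lemma kernel_bounded_matching:
  assumes M: "0 \<le> M" and bd: "\<And>\<alpha> \<beta>. cmod (K \<alpha> \<beta>) \<le> M"
    and row: "\<And>\<alpha> \<beta> \<beta>'. K \<alpha> \<beta> \<noteq> 0 \<Longrightarrow> K \<alpha> \<beta>' \<noteq> 0 \<Longrightarrow> \<beta> = \<beta>'"
    and col: "\<And>\<alpha> \<alpha>' \<beta>. K \<alpha> \<beta> \<noteq> 0 \<Longrightarrow> K \<alpha>' \<beta> \<noteq> 0 \<Longrightarrow> \<alpha> = \<alpha>'"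
  shows "kernel_bounded K M"
proof (rule kernel_boundedI_sq[OF M])
  fix F E :: "'a set" and \<xi> :: "'a \<Rightarrow> complex"
  assume fin: "finite F" "finite E"
  have one: "(cmod (\<Sum>\<beta>\<in>E. K \<alpha> \<beta> * \<xi> \<beta>))\<^sup>2 = (\<Sum>\<beta>\<in>E. (cmod (K \<alpha> \<beta> * \<xi> \<beta>))\<^sup>2)" for \<alpha>
  proof (cases "\<exists>\<beta>\<in>E. K \<alpha> \<beta> \<noteq> 0")
    case True
    then obtain b where b: "b \<in> E" "K \<alpha> b \<noteq> 0" by blast
    have z: "K \<alpha> \<beta> = 0" if "\<beta> \<noteq> b" for \<beta> using row[of \<alpha> \<beta> b] b(2) that by auto
    have "(\<Sum>\<beta>\<in>E. K \<alpha> \<beta> * \<xi> \<beta>) = K \<alpha> b * \<xi> b"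
      by (subst sum.remove[OF fin(2) b(1)]) (simp add: z)
    moreover have "(\<Sum>\<beta>\<in>E. (cmod (K \<alpha> \<beta> * \<xi> \<beta>))\<^sup>2) = (cmod (K \<alpha> b * \<xi> b))\<^sup>2"
      by (subst sum.remove[OF fin(2) b(1)]) (simp add: z)
    ultimately show ?thesis by simp
  qed simp
  have "(\<Sum>\<alpha>\<in>F. (cmod (\<Sum>\<beta>\<in>E. K \<alpha> \<beta> * \<xi> \<beta>))\<^sup>2) = (\<Sum>\<beta>\<in>E. \<Sum>\<alpha>\<in>F. (cmod (K \<alpha> \<beta> * \<xi> \<beta>))\<^sup>2)"
    unfolding one by (rule sum.swap)
  also have "\<dots> \<le> (\<Sum>\<beta>\<in>E. M\<^sup>2 * (cmod (\<xi> \<beta>))\<^sup>2)"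
  proof (rule sum_mono)
    fix \<beta>
    show "(\<Sum>\<alpha>\<in>F. (cmod (K \<alpha> \<beta> * \<xi> \<beta>))\<^sup>2) \<le> M\<^sup>2 * (cmod (\<xi> \<beta>))\<^sup>2"
    proof (cases "\<exists>\<alpha>\<in>F. K \<alpha> \<beta> \<noteq> 0")
      case True
      then obtain a where a: "a \<in> F" "K a \<beta> \<noteq> 0" by blast
      have z: "K \<alpha> \<beta> = 0" if "\<alpha> \<noteq> a" for \<alpha> using col[of \<alpha> \<beta> a] a(2) that by auto
      have "(\<Sum>\<alpha>\<in>F. (cmod (K \<alpha> \<beta> * \<xi> \<beta>))\<^sup>2) = (cmod (K a \<beta>))\<^sup>2 * (cmod (\<xi> \<beta>))\<^sup>2"
      proof -
        have "(\<Sum>\<alpha>\<in>F - {a}. (cmod (K \<alpha> \<beta> * \<xi> \<beta>))\<^sup>2) = 0"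
          by (rule sum.neutral) (use z in auto)
        then show ?thesis
          unfolding sum.remove[OF fin(1) a(1)] by (simp add: norm_mult power_mult_distrib)
      qed
      also have "\<dots> \<le> M\<^sup>2 * (cmod (\<xi> \<beta>))\<^sup>2"
        by (intro mult_right_mono power_mono bd) auto
      finally show ?thesis .
    qed simp
  qed
  finally show "(\<Sum>\<alpha>\<in>F. (cmod (\<Sum>\<beta>\<in>E. K \<alpha> \<beta> * \<xi> \<beta>))\<^sup>2) \<le> M\<^sup>2 * (\<Sum>\<beta>\<in>E. (cmod (\<xi> \<beta>))\<^sup>2)"
    by (simp add: sum_distrib_left)
qed

lemma kernel_bounded_column:
  assumes "kernel_bounded K M" "finite F"
  shows "L2_set (\<lambda>\<alpha>. cmod (K \<alpha> \<beta>)) F \<le> M"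
  using kernel_boundedD[OF assms, of "{\<beta>}" "\<lambda>_. 1"] by simp

text \<open>For fixed finite \<open>F\<close> and \<open>E\<close> the estimate involves finitely
  many entries, so it survives an entrywise limit without any convergence in norm.\<close>

lemma kernel_bounded_limit:
  assumes b: "\<And>n. kernel_bounded (K n) (M n)" and "M \<longlonglongrightarrow> m"
    and lim: "\<And>\<alpha> \<beta>. (\<lambda>n. K n \<alpha> \<beta>) \<longlonglongrightarrow> L \<alpha> \<beta>"
  shows "kernel_bounded L m"
proof (rule kernel_boundedI)
  fix F E :: "'a set" and \<xi> :: "'a \<Rightarrow> complex"
  assume fin: "finite F" "finite E"
  show "L2_set (\<lambda>\<alpha>. cmod (\<Sum>\<beta>\<in>E. L \<alpha> \<beta> * \<xi> \<beta>)) F \<le> m * L2_set (\<lambda>\<beta>. cmod (\<xi> \<beta>)) E"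
  proof (rule LIMSEQ_le)
    show "(\<lambda>n. L2_set (\<lambda>\<alpha>. cmod (\<Sum>\<beta>\<in>E. K n \<alpha> \<beta> * \<xi> \<beta>)) F) \<longlonglongrightarrow> L2_set (\<lambda>\<alpha>. cmod (\<Sum>\<beta>\<in>E. L \<alpha> \<beta> * \<xi> \<beta>)) F"
      unfolding L2_set_def by (intro tendsto_intros lim)
    show "(\<lambda>n. M n * L2_set (\<lambda>\<beta>. cmod (\<xi> \<beta>)) E) \<longlonglongrightarrow> m * L2_set (\<lambda>\<beta>. cmod (\<xi> \<beta>)) E"
      by (intro tendsto_intros assms)
    show "\<exists>N. \<forall>n\<ge>N. L2_set (\<lambda>\<alpha>. cmod (\<Sum>\<beta>\<in>E. K n \<alpha> \<beta> * \<xi> \<beta>)) F \<le> M n * L2_set (\<lambda>\<beta>. cmod (\<xi> \<beta>)) E"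
      by (intro exI allI impI kernel_boundedD[OF b fin])
  qed
qed

text \<open>\<open>L\<close> is a piece of \<open>K\<close>, relabelled by the injection \<phi> and
  multiplied by diagonal weights of modulus at most 1. With cocycle values as weights this is the
  equivalence between blocks in different source fibres.\<close>

lemma kernel_bounded_transport:
  assumes K: "kernel_bounded K M" and M: "0 \<le> M" and inj: "inj_on \<phi> P"
    and a: "\<And>\<alpha>. \<alpha> \<in> P \<Longrightarrow> cmod (a \<alpha>) \<le> 1" and b: "\<And>\<beta>. \<beta> \<in> P \<Longrightarrow> cmod (b \<beta>) \<le> 1"
    and L: "\<And>\<alpha> \<beta>. L \<alpha> \<beta> = (if \<alpha> \<in> P \<and> \<beta> \<in> P then a \<alpha> * K (\<phi> \<alpha>) (\<phi> \<beta>) * b \<beta> else 0)"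
  shows "kernel_bounded L M"
proof (rule kernel_boundedI_sq[OF M])
  fix F E :: "'b set" and \<xi> :: "'b \<Rightarrow> complex"
  assume fin: "finite F" "finite E"
  \<comment> \<open>The vector \<xi> on \<open>P\<close> is carried along \<phi> with the weight
    \<open>b\<close> absorbed; only its values on the image of \<open>P\<close> enter.\<close>
  define \<eta> where "\<eta> = (\<lambda>y. b (the_inv_into P \<phi> y) * \<xi> (the_inv_into P \<phi> y))"
  have eta: "\<eta> (\<phi> \<beta>) = b \<beta> * \<xi> \<beta>" if "\<beta> \<in> P" for \<beta>
    using that inj by (simp add: \<eta>_def the_inv_into_f_f)
  have injF: "inj_on \<phi> (F \<inter> P)" "inj_on \<phi> (E \<inter> P)" using inj by (auto intro: inj_on_subset)
  have "(\<Sum>\<alpha>\<in>F. (cmod (\<Sum>\<beta>\<in>E. L \<alpha> \<beta> * \<xi> \<beta>))\<^sup>2) = (\<Sum>\<alpha>\<in>F \<inter> P. (cmod (\<Sum>\<beta>\<in>E. L \<alpha> \<beta> * \<xi> \<beta>))\<^sup>2)"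
    by (rule sum.mono_neutral_right) (use fin L in auto)
  also have "\<dots> \<le> (\<Sum>\<alpha>\<in>F \<inter> P. (cmod (\<Sum>y\<in>\<phi> ` (E \<inter> P). K (\<phi> \<alpha>) y * \<eta> y))\<^sup>2)"
  proof (rule sum_mono, rule power_mono)
    fix \<alpha> assume \<alpha>: "\<alpha> \<in> F \<inter> P"
    have "(\<Sum>\<beta>\<in>E. L \<alpha> \<beta> * \<xi> \<beta>) = (\<Sum>\<beta>\<in>E \<inter> P. L \<alpha> \<beta> * \<xi> \<beta>)"
      by (rule sum.mono_neutral_right) (use fin L in auto)
    also have "\<dots> = (\<Sum>\<beta>\<in>E \<inter> P. a \<alpha> * (K (\<phi> \<alpha>) (\<phi> \<beta>) * \<eta> (\<phi> \<beta>)))"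
      by (rule sum.cong) (use \<alpha> L eta in auto)
    also have "\<dots> = a \<alpha> * (\<Sum>y\<in>\<phi> ` (E \<inter> P). K (\<phi> \<alpha>) y * \<eta> y)"
      by (simp add: sum.reindex[OF injF(2)] sum_distrib_left)
    finally have "cmod (\<Sum>\<beta>\<in>E. L \<alpha> \<beta> * \<xi> \<beta>) = cmod (a \<alpha>) * cmod (\<Sum>y\<in>\<phi> ` (E \<inter> P). K (\<phi> \<alpha>) y * \<eta> y)"
      by (simp add: norm_mult)
    then show "cmod (\<Sum>\<beta>\<in>E. L \<alpha> \<beta> * \<xi> \<beta>) \<le> cmod (\<Sum>y\<in>\<phi> ` (E \<inter> P). K (\<phi> \<alpha>) y * \<eta> y)"
      using a[of \<alpha>] \<alpha> by (simp add: mult_left_le_one_le)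
  qed auto
  also have "\<dots> = (\<Sum>x\<in>\<phi> ` (F \<inter> P). (cmod (\<Sum>y\<in>\<phi> ` (E \<inter> P). K x y * \<eta> y))\<^sup>2)"
    by (simp add: sum.reindex[OF injF(1)])
  also have "\<dots> \<le> M\<^sup>2 * (\<Sum>y\<in>\<phi> ` (E \<inter> P). (cmod (\<eta> y))\<^sup>2)"
    by (rule kernel_boundedD_sq[OF K]) (use fin in auto)
  also have "(\<Sum>y\<in>\<phi> ` (E \<inter> P). (cmod (\<eta> y))\<^sup>2) = (\<Sum>\<beta>\<in>E \<inter> P. (cmod (b \<beta> * \<xi> \<beta>))\<^sup>2)"
    by (simp add: sum.reindex[OF injF(2)] eta)
  also have "\<dots> \<le> (\<Sum>\<beta>\<in>E \<inter> P. (cmod (\<xi> \<beta>))\<^sup>2)"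
    by (rule sum_mono, rule power_mono) (use b in \<open>auto simp: norm_mult mult_left_le_one_le\<close>)
  also have "\<dots> \<le> (\<Sum>\<beta>\<in>E. (cmod (\<xi> \<beta>))\<^sup>2)"
    by (rule sum_mono2) (use fin in auto)
  finally show "(\<Sum>\<alpha>\<in>F. (cmod (\<Sum>\<beta>\<in>E. L \<alpha> \<beta> * \<xi> \<beta>))\<^sup>2) \<le> M\<^sup>2 * (\<Sum>\<beta>\<in>E. (cmod (\<xi> \<beta>))\<^sup>2)"
    using M by (simp add: mult_left_mono)
qed

section \<open>Completion of a normed *-algebra satisfying the C*-identity\<close>

text \<open>\<open>cstar_algebra\<close> without completeness. Both the functions with compact
  support and their completion satisfy it, so the same arithmetic serves on either side of the
  completion.\<close>

locale pre_cstar_algebra =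
  fixes A :: "'a star_alg" (structure)
  assumes zer_closed: "zer A \<in> carr A"
    and add_closed: "x \<in> carr A \<Longrightarrow> y \<in> carr A \<Longrightarrow> x \<oplus> y \<in> carr A"
    and scl_closed: "x \<in> carr A \<Longrightarrow> a \<odot> x \<in> carr A"
    and mul_closed: "x \<in> carr A \<Longrightarrow> y \<in> carr A \<Longrightarrow> x \<otimes> y \<in> carr A"
    and adj_closed: "x \<in> carr A \<Longrightarrow> adj A x \<in> carr A"
    and add_assoc: "x \<in> carr A \<Longrightarrow> y \<in> carr A \<Longrightarrow> z \<in> carr A \<Longrightarrow> (x \<oplus> y) \<oplus> z = x \<oplus> (y \<oplus> z)"
    and add_comm: "x \<in> carr A \<Longrightarrow> y \<in> carr A \<Longrightarrow> x \<oplus> y = y \<oplus> x"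
    and add_zer: "x \<in> carr A \<Longrightarrow> x \<oplus> zer A = x"
    and add_neg: "x \<in> carr A \<Longrightarrow> x \<oplus> (-1) \<odot> x = zer A"
    and scl_add_right: "x \<in> carr A \<Longrightarrow> y \<in> carr A \<Longrightarrow> a \<odot> (x \<oplus> y) = a \<odot> x \<oplus> a \<odot> y"
    and scl_add_left: "x \<in> carr A \<Longrightarrow> (a + b) \<odot> x = a \<odot> x \<oplus> b \<odot> x"
    and scl_scl: "x \<in> carr A \<Longrightarrow> a \<odot> (b \<odot> x) = (a * b) \<odot> x"
    and scl_one: "x \<in> carr A \<Longrightarrow> 1 \<odot> x = x"
    and mul_assoc: "x \<in> carr A \<Longrightarrow> y \<in> carr A \<Longrightarrow> z \<in> carr A \<Longrightarrow> (x \<otimes> y) \<otimes> z = x \<otimes> (y \<otimes> z)"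
    and mul_add_right:
      "x \<in> carr A \<Longrightarrow> y \<in> carr A \<Longrightarrow> z \<in> carr A \<Longrightarrow> x \<otimes> (y \<oplus> z) = x \<otimes> y \<oplus> x \<otimes> z"
    and mul_add_left:
      "x \<in> carr A \<Longrightarrow> y \<in> carr A \<Longrightarrow> z \<in> carr A \<Longrightarrow> (x \<oplus> y) \<otimes> z = x \<otimes> z \<oplus> y \<otimes> z"
    and mul_scl_left: "x \<in> carr A \<Longrightarrow> y \<in> carr A \<Longrightarrow> (a \<odot> x) \<otimes> y = a \<odot> (x \<otimes> y)"
    and mul_scl_right: "x \<in> carr A \<Longrightarrow> y \<in> carr A \<Longrightarrow> x \<otimes> (a \<odot> y) = a \<odot> (x \<otimes> y)"
    and adj_adj: "x \<in> carr A \<Longrightarrow> adj A (adj A x) = x"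
    and adj_add: "x \<in> carr A \<Longrightarrow> y \<in> carr A \<Longrightarrow> adj A (x \<oplus> y) = adj A x \<oplus> adj A y"
    and adj_scl: "x \<in> carr A \<Longrightarrow> adj A (a \<odot> x) = cnj a \<odot> adj A x"
    and adj_mul: "x \<in> carr A \<Longrightarrow> y \<in> carr A \<Longrightarrow> adj A (x \<otimes> y) = adj A y \<otimes> adj A x"
    and nrm_nonneg: "x \<in> carr A \<Longrightarrow> 0 \<le> nrm A x"
    and nrm_eq_0: "x \<in> carr A \<Longrightarrow> nrm A x = 0 \<longleftrightarrow> x = zer A"
    and nrm_triangle: "x \<in> carr A \<Longrightarrow> y \<in> carr A \<Longrightarrow> nrm A (x \<oplus> y) \<le> nrm A x + nrm A y"
    and nrm_scl: "x \<in> carr A \<Longrightarrow> nrm A (a \<odot> x) = cmod a * nrm A x"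
    and nrm_mul: "x \<in> carr A \<Longrightarrow> y \<in> carr A \<Longrightarrow> nrm A (x \<otimes> y) \<le> nrm A x * nrm A y"
    and cstar_identity: "x \<in> carr A \<Longrightarrow> nrm A (adj A x \<otimes> x) = (nrm A x)\<^sup>2"

begin

section \<open>Arithmetic and norm estimates\<close>

lemma zer_add: "x \<in> carr A \<Longrightarrow> zer A \<oplus> x = x"
  using add_comm[of "zer A" x] by (simp add: zer_closed add_zer)

lemma scl_0: "x \<in> carr A \<Longrightarrow> 0 \<odot> x = zer A"
  using scl_add_left[of x 1 "-1"] by (simp add: scl_one add_neg)

lemma scl_zer: "a \<odot> zer A = zer A"
  using scl_scl[of "zer A" a 0] by (simp add: zer_closed scl_0)

lemma sub_closed: "x \<in> carr A \<Longrightarrow> y \<in> carr A \<Longrightarrow> sub A x y \<in> carr A"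
  by (simp add: sub_def add_closed scl_closed)

lemmas closed = zer_closed add_closed scl_closed mul_closed adj_closed sub_closed

lemma add_left_comm:
  "x \<in> carr A \<Longrightarrow> y \<in> carr A \<Longrightarrow> z \<in> carr A \<Longrightarrow> x \<oplus> (y \<oplus> z) = y \<oplus> (x \<oplus> z)"
  by (metis add_assoc add_comm)

lemmas add_ac = add_assoc add_comm add_left_comm

lemma neg_add: "x \<in> carr A \<Longrightarrow> (-1) \<odot> x \<oplus> x = zer A"
  using add_neg[of x] add_comm[of x "(-1) \<odot> x"] by (simp add: closed)

lemma sub_self: "x \<in> carr A \<Longrightarrow> sub A x x = zer A"
  by (simp add: sub_def add_neg)

lemma sub_add_cancel: "x \<in> carr A \<Longrightarrow> y \<in> carr A \<Longrightarrow> sub A x y \<oplus> y = x"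
  by (simp add: sub_def add_assoc closed neg_add add_zer)

lemma sub_eq_zer: "x \<in> carr A \<Longrightarrow> y \<in> carr A \<Longrightarrow> sub A x y = zer A \<longleftrightarrow> x = y"
  using sub_add_cancel[of x y] by (auto simp: zer_add sub_self)

lemma sub_trans:
  assumes "x \<in> carr A" "y \<in> carr A" "z \<in> carr A"
  shows "sub A x z = sub A x y \<oplus> sub A y z"
proof -
  have "sub A x y \<oplus> sub A y z = (sub A x y \<oplus> y) \<oplus> (-1) \<odot> z"
    using assms by (simp add: sub_def[of A y z] add_assoc closed)
  then show ?thesis using assms by (simp add: sub_add_cancel) (simp add: sub_def)
qed

lemma sub_commute: "x \<in> carr A \<Longrightarrow> y \<in> carr A \<Longrightarrow> sub A y x = (-1) \<odot> sub A x y"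
  by (simp add: sub_def scl_add_right closed scl_scl scl_one add_comm)

lemma sub_zer: "x \<in> carr A \<Longrightarrow> sub A x (zer A) = x"
  by (simp add: sub_def scl_zer add_zer)

lemma nrm_zer: "nrm A (zer A) = 0"
  by (simp add: nrm_eq_0 zer_closed)

lemma nrm_sub_commute: "x \<in> carr A \<Longrightarrow> y \<in> carr A \<Longrightarrow> nrm A (sub A x y) = nrm A (sub A y x)"
  using sub_commute[of x y] by (simp add: nrm_scl closed)

lemma nrm_sub_triangle:
  "x \<in> carr A \<Longrightarrow> y \<in> carr A \<Longrightarrow> z \<in> carr A \<Longrightarrow>
    nrm A (sub A x z) \<le> nrm A (sub A x y) + nrm A (sub A y z)"
  using nrm_triangle[of "sub A x y" "sub A y z"] by (simp add: closed sub_trans[of x y z])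

lemma sub_add_add:
  "x \<in> carr A \<Longrightarrow> y \<in> carr A \<Longrightarrow> x' \<in> carr A \<Longrightarrow> y' \<in> carr A \<Longrightarrow>
    sub A (x \<oplus> y) (x' \<oplus> y') = sub A x x' \<oplus> sub A y y'"
  by (simp add: sub_def scl_add_right closed add_ac)

lemma sub_scl: "x \<in> carr A \<Longrightarrow> y \<in> carr A \<Longrightarrow> sub A (a \<odot> x) (a \<odot> y) = a \<odot> sub A x y"
  by (simp add: sub_def scl_add_right closed scl_scl)

lemma mul_sub_right:
  "x \<in> carr A \<Longrightarrow> y \<in> carr A \<Longrightarrow> z \<in> carr A \<Longrightarrow> x \<otimes> sub A y z = sub A (x \<otimes> y) (x \<otimes> z)"
  by (simp add: sub_def mul_add_right mul_scl_right closed)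

lemma mul_sub_left:
  "x \<in> carr A \<Longrightarrow> y \<in> carr A \<Longrightarrow> z \<in> carr A \<Longrightarrow> sub A x y \<otimes> z = sub A (x \<otimes> z) (y \<otimes> z)"
  by (simp add: sub_def mul_add_left mul_scl_left closed)

lemma sub_mul_mul:
  "x \<in> carr A \<Longrightarrow> y \<in> carr A \<Longrightarrow> x' \<in> carr A \<Longrightarrow> y' \<in> carr A \<Longrightarrow>
    sub A (x \<otimes> y) (x' \<otimes> y') = x \<otimes> sub A y y' \<oplus> sub A x x' \<otimes> y'"
  by (simp add: mul_sub_left mul_sub_right closed sub_trans[of "x \<otimes> y" "x \<otimes> y'" "x' \<otimes> y'"])

lemma sub_adj: "x \<in> carr A \<Longrightarrow> y \<in> carr A \<Longrightarrow> sub A (adj A x) (adj A y) = adj A (sub A x y)"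
  by (simp add: sub_def adj_add adj_scl closed)

lemma adj_zer: "adj A (zer A) = zer A"
  using adj_scl[of "zer A" 0] by (simp add: scl_0 closed)

text \<open>|x|^2 = |x* x| \<le> |x*| |x|, and one factor cancels. Applied to the adjoint as well,
  this makes the involution isometric.\<close>

lemma nrm_adj_ge: "x \<in> carr A \<Longrightarrow> nrm A x \<le> nrm A (adj A x)"
proof (cases "nrm A x = 0")
  case False
  assume x: "x \<in> carr A"
  have "(nrm A x)\<^sup>2 \<le> nrm A (adj A x) * nrm A x"
    using nrm_mul[of "adj A x" x] x by (simp add: closed cstar_identity)
  then show ?thesis using False nrm_nonneg[OF x] by (simp add: power2_eq_square)
qed (simp add: nrm_nonneg closed)

lemma nrm_adj: "x \<in> carr A \<Longrightarrow> nrm A (adj A x) = nrm A x"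
  using nrm_adj_ge[of x] nrm_adj_ge[of "adj A x"] by (simp add: adj_adj closed)

lemma nrm_le_sub: "x \<in> carr A \<Longrightarrow> y \<in> carr A \<Longrightarrow> nrm A x \<le> nrm A (sub A x y) + nrm A y"
  using nrm_triangle[of "sub A x y" y] by (simp add: closed sub_add_cancel)

lemma nrm_diff_le: "x \<in> carr A \<Longrightarrow> y \<in> carr A \<Longrightarrow> \<bar>nrm A x - nrm A y\<bar> \<le> nrm A (sub A x y)"
  using nrm_le_sub[of x y] nrm_le_sub[of y x] nrm_sub_commute[of x y] by simp

lemma nrm_sub_mul_mul:
  "x \<in> carr A \<Longrightarrow> y \<in> carr A \<Longrightarrow> x' \<in> carr A \<Longrightarrow> y' \<in> carr A \<Longrightarrow>
    nrm A (sub A (x \<otimes> y) (x' \<otimes> y')) \<le> nrm A x * nrm A (sub A y y') + nrm A (sub A x x') * nrm A y'"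
  using nrm_triangle[of "x \<otimes> sub A y y'" "sub A x x' \<otimes> y'"]
    nrm_mul[of x "sub A y y'"] nrm_mul[of "sub A x x'" y']
  by (simp add: sub_mul_mul closed)

lemma adist_eq: "x \<in> carr A \<Longrightarrow> y \<in> carr A \<Longrightarrow> adist A x y = nrm A (sub A x y)"
  by (simp add: adist_def)

sublocale met: Metric_space "carr A" "adist A"
proof
  fix x y z
  show "0 \<le> adist A x y" by (simp add: adist_def nrm_nonneg closed)
  show "adist A x y = adist A y x" by (simp add: adist_def nrm_sub_commute)
  show "adist A x y = 0 \<longleftrightarrow> x = y" if "x \<in> carr A" "y \<in> carr A"
    using that by (simp add: adist_def nrm_eq_0 closed sub_eq_zer)
  show "adist A x z \<le> adist A x y + adist A y z" if "x \<in> carr A" "y \<in> carr A" "z \<in> carr A"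
    using that by (simp add: adist_def nrm_sub_triangle)
qed

section \<open>Cauchy sequences and the operations on their classes\<close>

definition cauchy :: "(nat \<Rightarrow> 'a) \<Rightarrow> bool" where
  "cauchy \<sigma> \<longleftrightarrow> met.MCauchy \<sigma>"

lemma cauchy_closed: "cauchy \<sigma> \<Longrightarrow> \<sigma> n \<in> carr A"
  by (auto simp: cauchy_def met.MCauchy_def)

lemma cauchy_iff:
  "cauchy \<sigma> \<longleftrightarrow> (\<forall>n. \<sigma> n \<in> carr A) \<and> (\<forall>e>0. \<exists>N. \<forall>m\<ge>N. \<forall>n\<ge>N. nrm A (sub A (\<sigma> m) (\<sigma> n)) < e)"
proof (cases "\<forall>n. \<sigma> n \<in> carr A")
  case True
  then show ?thesis by (auto simp: cauchy_def met.MCauchy_def adist_def)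
qed (auto simp: cauchy_def met.MCauchy_def)

text \<open>Sums, multiples, adjoints and, on bounded sequences, products are Lipschitz in the
  differences of their arguments, so one criterion covers them all.\<close>

lemma cauchyI:
  assumes "\<And>n. \<rho> n \<in> carr A" "cauchy \<sigma>" "cauchy \<tau>" "0 < K"
    and "\<And>m n. nrm A (sub A (\<rho> m) (\<rho> n))
      \<le> K * (nrm A (sub A (\<sigma> m) (\<sigma> n)) + nrm A (sub A (\<tau> m) (\<tau> n)))"
  shows "cauchy \<rho>"
  unfolding cauchy_iff
proof (intro conjI allI impI)
  fix e :: real assume "0 < e"
  then have "0 < e / (2 * K)" using assms by simp
  then obtain N1 N2 where N: "\<forall>m\<ge>N1. \<forall>n\<ge>N1. nrm A (sub A (\<sigma> m) (\<sigma> n)) < e / (2 * K)"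
    "\<forall>m\<ge>N2. \<forall>n\<ge>N2. nrm A (sub A (\<tau> m) (\<tau> n)) < e / (2 * K)"
    using assms(2,3) unfolding cauchy_iff by blast
  have "nrm A (sub A (\<rho> m) (\<rho> n)) < e" if "m \<ge> max N1 N2" "n \<ge> max N1 N2" for m n
  proof -
    have "nrm A (sub A (\<sigma> m) (\<sigma> n)) + nrm A (sub A (\<tau> m) (\<tau> n)) < e / (2 * K) + e / (2 * K)"
      using N that by (intro add_strict_mono) auto
    then have "K * (nrm A (sub A (\<sigma> m) (\<sigma> n)) + nrm A (sub A (\<tau> m) (\<tau> n))) < K * (e / K)"
      using assms(4) by (intro mult_strict_left_mono) auto
    then show ?thesis using assms(4) order_le_less_trans[OF assms(5)[of m n]] by simp
  qed
  then show "\<exists>N. \<forall>m\<ge>N. \<forall>n\<ge>N. nrm A (sub A (\<rho> m) (\<rho> n)) < e" by blast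
qed (rule assms)

lemma cauchy_bounded: assumes "cauchy \<sigma>" obtains K where "0 < K" "\<And>n. nrm A (\<sigma> n) \<le> K"
proof -
  obtain N where N: "\<forall>m\<ge>N. \<forall>n\<ge>N. nrm A (sub A (\<sigma> m) (\<sigma> n)) < 1"
    using assms unfolding cauchy_iff by (meson zero_less_one)
  define K where "K = Max ((\<lambda>n. nrm A (\<sigma> n)) ` {..N}) + 1"
  have le: "nrm A (\<sigma> n) \<le> K - 1" if "n \<le> N" for n
    unfolding K_def using that by (simp add: Max_ge)
  have "nrm A (\<sigma> n) \<le> K" for n
  proof (cases "n \<le> N")
    case False
    then have "nrm A (sub A (\<sigma> n) (\<sigma> N)) < 1" using N by simp
    then show ?thesis using nrm_le_sub[of "\<sigma> n" "\<sigma> N"] le[of N] cauchy_closed[OF assms] by fastforce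
  qed (use le in fastforce)
  moreover have "0 < K"
    using le[of N] nrm_nonneg[OF cauchy_closed[OF assms, of N]] by simp
  ultimately show thesis using that by blast
qed

lemma cauchy_const: "x \<in> carr A \<Longrightarrow> cauchy (\<lambda>n. x)"
  by (simp add: cauchy_def met.MCauchy_const)

lemma cauchy_add:
  assumes "cauchy \<sigma>" "cauchy \<tau>" shows "cauchy (\<lambda>n. \<sigma> n \<oplus> \<tau> n)"
  by (rule cauchyI[OF _ assms, of _ 1])
    (auto simp: closed cauchy_closed[OF assms(1)] cauchy_closed[OF assms(2)] sub_add_add nrm_triangle)

lemma cauchy_scl:
  assumes "cauchy \<sigma>" shows "cauchy (\<lambda>n. a \<odot> \<sigma> n)"
\<comment> \<open>The added 1 keeps the Lipschitz constant positive when
  \<open>a = 0\<close>.\<close>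
proof (rule cauchyI[OF _ assms assms, of _ "cmod a + 1"])
  fix m n
  have "0 \<le> nrm A (sub A (\<sigma> m) (\<sigma> n))" by (simp add: nrm_nonneg closed cauchy_closed[OF assms])
  then show "nrm A (sub A (a \<odot> \<sigma> m) (a \<odot> \<sigma> n))
      \<le> (cmod a + 1) * (nrm A (sub A (\<sigma> m) (\<sigma> n)) + nrm A (sub A (\<sigma> m) (\<sigma> n)))"
    by (simp add: sub_scl nrm_scl closed cauchy_closed[OF assms] algebra_simps)
qed (auto simp: closed cauchy_closed[OF assms] add_nonneg_pos)

lemma cauchy_adj:
  assumes "cauchy \<sigma>" shows "cauchy (\<lambda>n. adj A (\<sigma> n))"
  by (rule cauchyI[OF _ assms assms, of _ 1])
    (auto simp: closed cauchy_closed[OF assms] sub_adj nrm_adj nrm_nonneg)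

lemma cauchy_mul:
  assumes "cauchy \<sigma>" "cauchy \<tau>" shows "cauchy (\<lambda>n. \<sigma> n \<otimes> \<tau> n)"
proof -
  obtain K L where K: "0 < K" "\<And>n. nrm A (\<sigma> n) \<le> K" and L: "0 < L" "\<And>n. nrm A (\<tau> n) \<le> L"
    using cauchy_bounded assms by metis
  note c = cauchy_closed[OF assms(1)] cauchy_closed[OF assms(2)]
  show ?thesis
  proof (rule cauchyI[OF _ assms, of _ "K + L"])
    fix m n
    have nn: "0 \<le> nrm A (sub A (\<sigma> m) (\<sigma> n))" "0 \<le> nrm A (sub A (\<tau> m) (\<tau> n))"
      by (simp_all add: nrm_nonneg closed c)
    have "nrm A (sub A (\<sigma> m \<otimes> \<tau> m) (\<sigma> n \<otimes> \<tau> n))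
        \<le> nrm A (\<sigma> m) * nrm A (sub A (\<tau> m) (\<tau> n)) + nrm A (sub A (\<sigma> m) (\<sigma> n)) * nrm A (\<tau> n)"
      by (simp add: nrm_sub_mul_mul c)
    also have "\<dots> \<le> K * nrm A (sub A (\<tau> m) (\<tau> n)) + nrm A (sub A (\<sigma> m) (\<sigma> n)) * L"
      using nn K L by (intro add_mono mult_left_mono mult_right_mono) auto
    also have "\<dots> \<le> (K + L) * (nrm A (sub A (\<sigma> m) (\<sigma> n)) + nrm A (sub A (\<tau> m) (\<tau> n)))"
      using nn K L by (simp add: algebra_simps)
    finally show "nrm A (sub A (\<sigma> m \<otimes> \<tau> m) (\<sigma> n \<otimes> \<tau> n))
        \<le> (K + L) * (nrm A (sub A (\<sigma> m) (\<sigma> n)) + nrm A (sub A (\<tau> m) (\<tau> n)))" .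
  qed (use K L in \<open>auto simp: closed c\<close>)
qed

lemma cauchy_sub: assumes "cauchy \<sigma>" "cauchy \<tau>" shows "cauchy (\<lambda>n. sub A (\<sigma> n) (\<tau> n))"
  unfolding sub_def by (intro cauchy_add cauchy_scl assms)

lemma cauchy_rel_iff:
  "(\<sigma>, \<tau>) \<in> cauchy_rel A \<longleftrightarrow> cauchy \<sigma> \<and> cauchy \<tau> \<and> (\<lambda>n. nrm A (sub A (\<sigma> n) (\<tau> n))) \<longlonglongrightarrow> 0"
proof (cases "cauchy \<sigma> \<and> cauchy \<tau>")
  case True
  then have "adist A (\<sigma> n) (\<tau> n) = nrm A (sub A (\<sigma> n) (\<tau> n))" for n
    by (intro adist_eq) (auto simp: cauchy_closed)
  then show ?thesis by (simp add: cauchy_rel_def cauchy_def)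
qed (auto simp: cauchy_rel_def cauchy_def)

lemma equiv_cauchy_rel: "equiv {\<sigma>. cauchy \<sigma>} (cauchy_rel A)"
proof (rule equivI)
  show "cauchy_rel A \<subseteq> {\<sigma>. cauchy \<sigma>} \<times> {\<sigma>. cauchy \<sigma>}" by (auto simp: cauchy_rel_iff)
  show "refl_on {\<sigma>. cauchy \<sigma>} (cauchy_rel A)"
    by (auto simp: refl_on_def cauchy_rel_iff sub_self cauchy_closed nrm_zer)
  show "sym (cauchy_rel A)"
  proof (rule symI)
    fix \<sigma> \<tau> assume "(\<sigma>, \<tau>) \<in> cauchy_rel A"
    then show "(\<tau>, \<sigma>) \<in> cauchy_rel A"
      unfolding cauchy_rel_iff using nrm_sub_commute[OF cauchy_closed cauchy_closed, of \<sigma> \<tau>] by simp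
  qed
  show "trans (cauchy_rel A)"
  proof (rule transI)
    fix \<sigma> \<tau> \<rho> assume a: "(\<sigma>, \<tau>) \<in> cauchy_rel A" "(\<tau>, \<rho>) \<in> cauchy_rel A"
    then have c: "\<sigma> n \<in> carr A" "\<tau> n \<in> carr A" "\<rho> n \<in> carr A" for n
      by (auto simp: cauchy_rel_iff cauchy_closed)
    have "(\<lambda>n. nrm A (sub A (\<sigma> n) (\<rho> n))) \<longlonglongrightarrow> 0"
    proof (rule tendsto_sandwich[OF _ _ tendsto_const])
      show "(\<lambda>n. nrm A (sub A (\<sigma> n) (\<tau> n)) + nrm A (sub A (\<tau> n) (\<rho> n))) \<longlonglongrightarrow> 0"
        using tendsto_add a unfolding cauchy_rel_iff by fastforce
    qed (auto simp: nrm_sub_triangle c nrm_nonneg closed)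
    then show "(\<sigma>, \<rho>) \<in> cauchy_rel A" using a by (simp add: cauchy_rel_iff)
  qed
qed

definition cls :: "(nat \<Rightarrow> 'a) \<Rightarrow> (nat \<Rightarrow> 'a) set" where
  "cls \<sigma> = cauchy_rel A `` {\<sigma>}"

lemma cls_eq_iff:
  "cauchy \<sigma> \<Longrightarrow> cauchy \<tau> \<Longrightarrow> cls \<sigma> = cls \<tau> \<longleftrightarrow> (\<lambda>n. nrm A (sub A (\<sigma> n) (\<tau> n))) \<longlonglongrightarrow> 0"
  unfolding cls_def using eq_equiv_class_iff[OF equiv_cauchy_rel, of \<sigma> \<tau>]
  by (simp add: cauchy_rel_iff)

lemma cls_eqI:
  assumes "cauchy \<sigma>" "cauchy \<tau>" "\<And>n. nrm A (sub A (\<sigma> n) (\<tau> n)) \<le> b n" "b \<longlonglongrightarrow> 0"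
  shows "cls \<sigma> = cls \<tau>"
  unfolding cls_eq_iff[OF assms(1,2)]
proof (rule tendsto_sandwich[OF _ _ tendsto_const assms(4)])
  show "\<forall>\<^sub>F n in sequentially. 0 \<le> nrm A (sub A (\<sigma> n) (\<tau> n))"
    using assms(1,2) by (simp add: nrm_nonneg closed cauchy_closed)
qed (simp add: assms)

lemma carr_completion: "carr (completion A) = {cls \<sigma> |\<sigma>. cauchy \<sigma>}"
  by (auto simp: completion_def quotient_def cls_def cauchy_def)

lemma cls_carr: "cauchy \<sigma> \<Longrightarrow> cls \<sigma> \<in> carr (completion A)"
  by (auto simp: carr_completion)

text \<open>The operations of the completion are unions over all representatives. By congruence all
  members of such a union coincide, so any one representative computes it.\<close>

lemma UN_cls:
  assumes "cauchy \<sigma>"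
    and "\<And>\<sigma> \<tau>. cauchy \<sigma> \<Longrightarrow> cauchy \<tau> \<Longrightarrow> (\<lambda>n. nrm A (sub A (\<sigma> n) (\<tau> n))) \<longlonglongrightarrow> 0 \<Longrightarrow> f \<sigma> = f \<tau>"
  shows "(\<Union>\<sigma>\<in>cls \<sigma>. f \<sigma>) = f \<sigma>"
  unfolding cls_def
  by (rule UN_equiv_class[OF equiv_cauchy_rel]) (use assms in \<open>auto simp: congruent_def cauchy_rel_iff\<close>)

lemma UN_cls2:
  assumes "cauchy \<sigma>" "cauchy \<tau>"
    and "\<And>\<sigma> \<sigma>' \<tau> \<tau>'. cauchy \<sigma> \<Longrightarrow> cauchy \<sigma>' \<Longrightarrow> cauchy \<tau> \<Longrightarrow> cauchy \<tau>' \<Longrightarrow>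
      (\<lambda>n. nrm A (sub A (\<sigma> n) (\<sigma>' n))) \<longlonglongrightarrow> 0 \<Longrightarrow> (\<lambda>n. nrm A (sub A (\<tau> n) (\<tau>' n))) \<longlonglongrightarrow> 0 \<Longrightarrow>
      f \<sigma> \<tau> = f \<sigma>' \<tau>'"
  shows "(\<Union>\<sigma>\<in>cls \<sigma>. \<Union>\<tau>\<in>cls \<tau>. f \<sigma> \<tau>) = f \<sigma> \<tau>"
  unfolding cls_def
  by (rule UN_equiv_class2[OF equiv_cauchy_rel equiv_cauchy_rel])
    (use assms in \<open>auto simp: congruent2_def cauchy_rel_iff\<close>)

lemma zer_completion: "zer (completion A) = cls (\<lambda>n. zer A)"
  by (simp add: completion_def cls_def)

lemma add_cls:
  assumes "cauchy \<sigma>" "cauchy \<tau>"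
  shows "cls \<sigma> \<oplus>\<^bsub>completion A\<^esub> cls \<tau> = cls (\<lambda>n. \<sigma> n \<oplus> \<tau> n)"
proof -
  have "(\<Union>\<sigma>\<in>cls \<sigma>. \<Union>\<tau>\<in>cls \<tau>. cls (\<lambda>n. \<sigma> n \<oplus> \<tau> n)) = cls (\<lambda>n. \<sigma> n \<oplus> \<tau> n)"
  proof (rule UN_cls2[OF assms])
    fix \<sigma> \<sigma>' \<tau> \<tau>' assume c: "cauchy \<sigma>" "cauchy \<sigma>'" "cauchy \<tau>" "cauchy \<tau>'"
      and l: "(\<lambda>n. nrm A (sub A (\<sigma> n) (\<sigma>' n))) \<longlonglongrightarrow> 0" "(\<lambda>n. nrm A (sub A (\<tau> n) (\<tau>' n))) \<longlonglongrightarrow> 0"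
    show "cls (\<lambda>n. \<sigma> n \<oplus> \<tau> n) = cls (\<lambda>n. \<sigma>' n \<oplus> \<tau>' n)"
    proof (rule cls_eqI[OF cauchy_add cauchy_add])
      show "(\<lambda>n. nrm A (sub A (\<sigma> n) (\<sigma>' n)) + nrm A (sub A (\<tau> n) (\<tau>' n))) \<longlonglongrightarrow> 0"
        using tendsto_add[OF l] by simp
    qed (use c in \<open>auto simp: sub_add_add cauchy_closed nrm_triangle closed\<close>)
  qed
  then show ?thesis by (simp add: completion_def cls_def)
qed

lemma scl_cls:
  assumes "cauchy \<sigma>"
  shows "a \<odot>\<^bsub>completion A\<^esub> cls \<sigma> = cls (\<lambda>n. a \<odot> \<sigma> n)"
proof -
  have "(\<Union>\<sigma>\<in>cls \<sigma>. cls (\<lambda>n. a \<odot> \<sigma> n)) = cls (\<lambda>n. a \<odot> \<sigma> n)"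
  proof (rule UN_cls[OF assms])
    fix \<sigma> \<sigma>' assume c: "cauchy \<sigma>" "cauchy \<sigma>'"
      and l: "(\<lambda>n. nrm A (sub A (\<sigma> n) (\<sigma>' n))) \<longlonglongrightarrow> 0"
    show "cls (\<lambda>n. a \<odot> \<sigma> n) = cls (\<lambda>n. a \<odot> \<sigma>' n)"
    proof (rule cls_eqI[OF cauchy_scl cauchy_scl])
      show "(\<lambda>n. cmod a * nrm A (sub A (\<sigma> n) (\<sigma>' n))) \<longlonglongrightarrow> 0"
        using tendsto_mult_right_zero[OF l] .
    qed (use c in \<open>auto simp: sub_scl cauchy_closed nrm_scl closed\<close>)
  qed
  then show ?thesis by (simp add: completion_def cls_def)
qed

lemma adj_cls:
  assumes "cauchy \<sigma>"
  shows "adj (completion A) (cls \<sigma>) = cls (\<lambda>n. adj A (\<sigma> n))"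
proof -
  have "(\<Union>\<sigma>\<in>cls \<sigma>. cls (\<lambda>n. adj A (\<sigma> n))) = cls (\<lambda>n. adj A (\<sigma> n))"
  proof (rule UN_cls[OF assms])
    fix \<sigma> \<sigma>' assume c: "cauchy \<sigma>" "cauchy \<sigma>'"
      and l: "(\<lambda>n. nrm A (sub A (\<sigma> n) (\<sigma>' n))) \<longlonglongrightarrow> 0"
    show "cls (\<lambda>n. adj A (\<sigma> n)) = cls (\<lambda>n. adj A (\<sigma>' n))"
      by (rule cls_eqI[OF cauchy_adj cauchy_adj _ l])
        (use c in \<open>auto simp: sub_adj cauchy_closed nrm_adj closed\<close>)
  qed
  then show ?thesis by (simp add: completion_def cls_def)
qed

lemma mul_cls:
  assumes "cauchy \<sigma>" "cauchy \<tau>"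
  shows "cls \<sigma> \<otimes>\<^bsub>completion A\<^esub> cls \<tau> = cls (\<lambda>n. \<sigma> n \<otimes> \<tau> n)"
proof -
  have "(\<Union>\<sigma>\<in>cls \<sigma>. \<Union>\<tau>\<in>cls \<tau>. cls (\<lambda>n. \<sigma> n \<otimes> \<tau> n)) = cls (\<lambda>n. \<sigma> n \<otimes> \<tau> n)"
  proof (rule UN_cls2[OF assms])
    fix \<sigma> \<sigma>' \<tau> \<tau>' assume c: "cauchy \<sigma>" "cauchy \<sigma>'" "cauchy \<tau>" "cauchy \<tau>'"
      and l: "(\<lambda>n. nrm A (sub A (\<sigma> n) (\<sigma>' n))) \<longlonglongrightarrow> 0" "(\<lambda>n. nrm A (sub A (\<tau> n) (\<tau>' n))) \<longlonglongrightarrow> 0"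
    obtain K where K: "0 < K" "\<And>n. nrm A (\<sigma> n) \<le> K" using cauchy_bounded[OF c(1)] by metis
    obtain L where L: "0 < L" "\<And>n. nrm A (\<tau>' n) \<le> L" using cauchy_bounded[OF c(4)] by metis
    note cl = c[THEN cauchy_closed]
    show "cls (\<lambda>n. \<sigma> n \<otimes> \<tau> n) = cls (\<lambda>n. \<sigma>' n \<otimes> \<tau>' n)"
    proof (rule cls_eqI[OF cauchy_mul cauchy_mul])
      show "(\<lambda>n. K * nrm A (sub A (\<tau> n) (\<tau>' n)) + nrm A (sub A (\<sigma> n) (\<sigma>' n)) * L) \<longlonglongrightarrow> 0"
        using tendsto_add[OF tendsto_mult_right_zero[OF l(2), of K] tendsto_mult_left_zero[OF l(1), of L]]
        by simp
      show "nrm A (sub A (\<sigma> n \<otimes> \<tau> n) (\<sigma>' n \<otimes> \<tau>' n))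
          \<le> K * nrm A (sub A (\<tau> n) (\<tau>' n)) + nrm A (sub A (\<sigma> n) (\<sigma>' n)) * L" for n
      proof (rule order_trans[OF nrm_sub_mul_mul[OF cl(1) cl(3) cl(2) cl(4)]])
        show "nrm A (\<sigma> n) * nrm A (sub A (\<tau> n) (\<tau>' n)) + nrm A (sub A (\<sigma> n) (\<sigma>' n)) * nrm A (\<tau>' n)
            \<le> K * nrm A (sub A (\<tau> n) (\<tau>' n)) + nrm A (sub A (\<sigma> n) (\<sigma>' n)) * L"
          using K L by (intro add_mono mult_left_mono mult_right_mono) (auto simp: nrm_nonneg closed cl)
      qed
    qed (use c in auto)
  qed
  then show ?thesis by (simp add: completion_def cls_def)
qed

lemma sub_cls:
  assumes "cauchy \<sigma>" "cauchy \<tau>"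
  shows "sub (completion A) (cls \<sigma>) (cls \<tau>) = cls (\<lambda>n. sub A (\<sigma> n) (\<tau> n))"
  unfolding sub_def by (simp add: scl_cls add_cls cauchy_scl assms)

lemma nrm_cls_convergent:
  assumes "cauchy \<sigma>" shows "convergent (\<lambda>n. nrm A (\<sigma> n))"
proof (rule Cauchy_convergent, rule metric_CauchyI)
  fix e :: real assume "0 < e"
  then obtain N where N: "\<forall>m\<ge>N. \<forall>n\<ge>N. nrm A (sub A (\<sigma> m) (\<sigma> n)) < e"
    using assms unfolding cauchy_iff by blast
  have "dist (nrm A (\<sigma> m)) (nrm A (\<sigma> n)) < e" if "m \<ge> N" "n \<ge> N" for m n
    using N that nrm_diff_le[OF cauchy_closed[OF assms] cauchy_closed[OF assms], of m n]
    by (auto simp: dist_real_def intro: le_less_trans)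
  then show "\<exists>N. \<forall>m\<ge>N. \<forall>n\<ge>N. dist (nrm A (\<sigma> m)) (nrm A (\<sigma> n)) < e" by blast
qed

text \<open>The norm of a class is a definite description: existence comes from the Cauchy property
  of the norms, and independence of the representative from the reverse triangle inequality.\<close>

lemma nrm_cls:
  assumes "cauchy \<sigma>"
  shows "(\<lambda>n. nrm A (\<sigma> n)) \<longlonglongrightarrow> nrm (completion A) (cls \<sigma>)"
proof -
  obtain l where l: "(\<lambda>n. nrm A (\<sigma> n)) \<longlonglongrightarrow> l"
    using nrm_cls_convergent[OF assms] unfolding convergent_def by blast
  have all: "(\<lambda>n. nrm A (\<tau> n)) \<longlonglongrightarrow> l" if "\<tau> \<in> cls \<sigma>" for \<tau>
  proof -
    have t: "cauchy \<tau>" "(\<lambda>n. nrm A (sub A (\<sigma> n) (\<tau> n))) \<longlonglongrightarrow> 0"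
      using that by (auto simp: cls_def cauchy_rel_iff)
    have "(\<lambda>n. nrm A (\<sigma> n) - nrm A (\<tau> n)) \<longlonglongrightarrow> 0"
      by (rule Lim_null_comparison[OF _ t(2)])
        (simp add: nrm_diff_le cauchy_closed[OF assms] cauchy_closed[OF t(1)])
    from tendsto_diff[OF l this] show ?thesis by simp
  qed
  have "\<sigma> \<in> cls \<sigma>"
    using assms by (auto simp: cls_def cauchy_rel_iff sub_self cauchy_closed nrm_zer)
  then have "nrm (completion A) (cls \<sigma>) = l"
    unfolding completion_def using all
    by (auto intro!: the_equality intro: LIMSEQ_unique)
  with l show ?thesis by simp
qed

lemma nrm_cls_eqI: "cauchy \<sigma> \<Longrightarrow> (\<lambda>n. nrm A (\<sigma> n)) \<longlonglongrightarrow> l \<Longrightarrow> nrm (completion A) (cls \<sigma>) = l"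
  using nrm_cls LIMSEQ_unique by blast

lemma completion_cases:
  assumes "X \<in> carr (completion A)" obtains \<sigma> where "cauchy \<sigma>" "X = cls \<sigma>"
  using assms by (auto simp: carr_completion)

text \<open>Algebraic equations hold term by term for representatives, and the norm relations are
  limits of those of the terms. Definiteness holds because a class is zero exactly when the norms of
  its terms tend to zero.\<close>

lemma pre_cstar_completion: "pre_cstar_algebra (completion A)"
proof
  note cs = cauchy_add cauchy_scl cauchy_mul cauchy_adj cauchy_const zer_closed
  note ops = add_cls scl_cls mul_cls adj_cls zer_completion
  note cc = cauchy_closed
  fix X Y Z :: "(nat \<Rightarrow> 'a) set" and a b :: complex
  show "zer (completion A) \<in> carr (completion A)"
    by (simp add: zer_completion cls_carr cs)
  assume "X \<in> carr (completion A)"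
  then obtain x where x: "cauchy x" "X = cls x" by (rule completion_cases)
  show "a \<odot>\<^bsub>completion A\<^esub> X \<in> carr (completion A)" "adj (completion A) X \<in> carr (completion A)"
    by (simp_all add: x ops cs cls_carr)
  show "X \<oplus>\<^bsub>completion A\<^esub> zer (completion A) = X"
    "X \<oplus>\<^bsub>completion A\<^esub> (-1) \<odot>\<^bsub>completion A\<^esub> X = zer (completion A)"
    "(a + b) \<odot>\<^bsub>completion A\<^esub> X = a \<odot>\<^bsub>completion A\<^esub> X \<oplus>\<^bsub>completion A\<^esub> b \<odot>\<^bsub>completion A\<^esub> X"
    "a \<odot>\<^bsub>completion A\<^esub> b \<odot>\<^bsub>completion A\<^esub> X = (a * b) \<odot>\<^bsub>completion A\<^esub> X"
    "1 \<odot>\<^bsub>completion A\<^esub> X = X"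
    "adj (completion A) (adj (completion A) X) = X"
    "adj (completion A) (a \<odot>\<^bsub>completion A\<^esub> X) = cnj a \<odot>\<^bsub>completion A\<^esub> adj (completion A) X"
    by (simp_all add: x ops cs cc add_zer add_neg scl_add_left scl_scl scl_one adj_adj adj_scl)
  show "0 \<le> nrm (completion A) X"
    using nrm_cls[OF x(1)] x by (auto intro!: LIMSEQ_le_const simp: nrm_nonneg cc)
  show "nrm (completion A) X = 0 \<longleftrightarrow> X = zer (completion A)"
  proof -
    have "X = zer (completion A) \<longleftrightarrow> (\<lambda>n. nrm A (x n)) \<longlonglongrightarrow> 0"
      by (simp add: x zer_completion cls_eq_iff cs sub_zer cc)
    also have "\<dots> \<longleftrightarrow> nrm (completion A) X = 0"
      using nrm_cls[OF x(1)] x by (metis LIMSEQ_unique)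
    finally show ?thesis by simp
  qed
  show "nrm (completion A) (a \<odot>\<^bsub>completion A\<^esub> X) = cmod a * nrm (completion A) X"
    unfolding x(2) scl_cls[OF x(1)]
  proof (rule nrm_cls_eqI[OF cauchy_scl[OF x(1)]])
    show "(\<lambda>n. nrm A (a \<odot> x n)) \<longlonglongrightarrow> cmod a * nrm (completion A) (cls x)"
      by (simp add: nrm_scl cc x tendsto_mult_left nrm_cls)
  qed
  show "nrm (completion A) (adj (completion A) X \<otimes>\<^bsub>completion A\<^esub> X) = (nrm (completion A) X)\<^sup>2"
    unfolding x(2) adj_cls[OF x(1)] mul_cls[OF cauchy_adj[OF x(1)] x(1)]
  proof (rule nrm_cls_eqI[OF cauchy_mul[OF cauchy_adj[OF x(1)] x(1)]])
    show "(\<lambda>n. nrm A (adj A (x n) \<otimes> x n)) \<longlonglongrightarrow> (nrm (completion A) (cls x))\<^sup>2"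
      by (simp add: cstar_identity cc x tendsto_power nrm_cls)
  qed
  assume "Y \<in> carr (completion A)"
  then obtain y where y: "cauchy y" "Y = cls y" by (rule completion_cases)
  show "X \<oplus>\<^bsub>completion A\<^esub> Y \<in> carr (completion A)" "X \<otimes>\<^bsub>completion A\<^esub> Y \<in> carr (completion A)"
    by (simp_all add: x y ops cs cls_carr)
  show "X \<oplus>\<^bsub>completion A\<^esub> Y = Y \<oplus>\<^bsub>completion A\<^esub> X"
    by (simp add: x y ops cs cc add_comm[of "x _"])
  show "a \<odot>\<^bsub>completion A\<^esub> (X \<oplus>\<^bsub>completion A\<^esub> Y) = a \<odot>\<^bsub>completion A\<^esub> X \<oplus>\<^bsub>completion A\<^esub> a \<odot>\<^bsub>completion A\<^esub> Y"
    "a \<odot>\<^bsub>completion A\<^esub> X \<otimes>\<^bsub>completion A\<^esub> Y = a \<odot>\<^bsub>completion A\<^esub> (X \<otimes>\<^bsub>completion A\<^esub> Y)"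
    "X \<otimes>\<^bsub>completion A\<^esub> a \<odot>\<^bsub>completion A\<^esub> Y = a \<odot>\<^bsub>completion A\<^esub> (X \<otimes>\<^bsub>completion A\<^esub> Y)"
    "adj (completion A) (X \<oplus>\<^bsub>completion A\<^esub> Y) = adj (completion A) X \<oplus>\<^bsub>completion A\<^esub> adj (completion A) Y"
    "adj (completion A) (X \<otimes>\<^bsub>completion A\<^esub> Y) = adj (completion A) Y \<otimes>\<^bsub>completion A\<^esub> adj (completion A) X"
    by (simp_all add: x y ops cs cc scl_add_right mul_scl_left mul_scl_right adj_add adj_mul)
  show "nrm (completion A) (X \<oplus>\<^bsub>completion A\<^esub> Y) \<le> nrm (completion A) X + nrm (completion A) Y"
    unfolding x(2) y(2) add_cls[OF x(1) y(1)]
    by (rule LIMSEQ_le[OF nrm_cls[OF cauchy_add[OF x(1) y(1)]] tendsto_add[OF nrm_cls[OF x(1)] nrm_cls[OF y(1)]]])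
      (simp add: nrm_triangle cc x y)
  show "nrm (completion A) (X \<otimes>\<^bsub>completion A\<^esub> Y) \<le> nrm (completion A) X * nrm (completion A) Y"
    unfolding x(2) y(2) mul_cls[OF x(1) y(1)]
    by (rule LIMSEQ_le[OF nrm_cls[OF cauchy_mul[OF x(1) y(1)]] tendsto_mult[OF nrm_cls[OF x(1)] nrm_cls[OF y(1)]]])
      (simp add: nrm_mul cc x y)
  assume "Z \<in> carr (completion A)"
  then obtain z where z: "cauchy z" "Z = cls z" by (rule completion_cases)
  show "X \<oplus>\<^bsub>completion A\<^esub> Y \<oplus>\<^bsub>completion A\<^esub> Z = X \<oplus>\<^bsub>completion A\<^esub> (Y \<oplus>\<^bsub>completion A\<^esub> Z)"
    "X \<otimes>\<^bsub>completion A\<^esub> Y \<otimes>\<^bsub>completion A\<^esub> Z = X \<otimes>\<^bsub>completion A\<^esub> (Y \<otimes>\<^bsub>completion A\<^esub> Z)"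
    "X \<otimes>\<^bsub>completion A\<^esub> (Y \<oplus>\<^bsub>completion A\<^esub> Z) = X \<otimes>\<^bsub>completion A\<^esub> Y \<oplus>\<^bsub>completion A\<^esub> X \<otimes>\<^bsub>completion A\<^esub> Z"
    "(X \<oplus>\<^bsub>completion A\<^esub> Y) \<otimes>\<^bsub>completion A\<^esub> Z = X \<otimes>\<^bsub>completion A\<^esub> Z \<oplus>\<^bsub>completion A\<^esub> Y \<otimes>\<^bsub>completion A\<^esub> Z"
    by (simp_all add: x y z ops cs cc add_assoc mul_assoc mul_add_right mul_add_left)
qed

definition embed :: "'a \<Rightarrow> (nat \<Rightarrow> 'a) set" where
  "embed x = cls (\<lambda>n. x)"

lemma embed_closed: "x \<in> carr A \<Longrightarrow> embed x \<in> carr (completion A)"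
  by (simp add: embed_def cls_carr cauchy_const)

lemma nrm_embed: "x \<in> carr A \<Longrightarrow> nrm (completion A) (embed x) = nrm A x"
  unfolding embed_def by (rule nrm_cls_eqI) (auto simp: cauchy_const)

lemma embed_sub: "x \<in> carr A \<Longrightarrow> y \<in> carr A \<Longrightarrow> sub (completion A) (embed x) (embed y) = embed (sub A x y)"
  by (simp add: embed_def sub_cls cauchy_const)

lemma nrm_sub_embed_cls:
  assumes "cauchy \<sigma>" "0 < e"
  obtains N where "\<And>n. N \<le> n \<Longrightarrow> nrm (completion A) (sub (completion A) (cls \<sigma>) (embed (\<sigma> n))) \<le> e"
proof -
  obtain N where N: "\<forall>m\<ge>N. \<forall>n\<ge>N. nrm A (sub A (\<sigma> m) (\<sigma> n)) < e"
    using assms unfolding cauchy_iff by blast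
  have "nrm (completion A) (sub (completion A) (cls \<sigma>) (embed (\<sigma> n))) \<le> e" if n: "N \<le> n" for n
  proof -
    have c: "cauchy (\<lambda>k. sub A (\<sigma> k) (\<sigma> n))"
      by (intro cauchy_sub cauchy_const cauchy_closed assms)
    have "nrm (completion A) (cls (\<lambda>k. sub A (\<sigma> k) (\<sigma> n))) \<le> e"
      by (rule LIMSEQ_le_const2[OF nrm_cls[OF c]]) (use N n in \<open>auto intro!: exI[of _ N] less_imp_le\<close>)
    then show ?thesis
      by (simp add: embed_def sub_cls assms cauchy_const cauchy_closed)
  qed
  then show thesis by (rule that)
qed

lemma embed_dense:
  assumes "X \<in> carr (completion A)" "0 < e"
  obtains x where "x \<in> carr A" "nrm (completion A) (sub (completion A) X (embed x)) < e"
proof -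
  obtain \<sigma> where s: "cauchy \<sigma>" "X = cls \<sigma>" using assms completion_cases by blast
  obtain N where "\<And>n. N \<le> n \<Longrightarrow> nrm (completion A) (sub (completion A) (cls \<sigma>) (embed (\<sigma> n))) \<le> e / 2"
    using nrm_sub_embed_cls[OF s(1), of "e/2"] assms by auto
  from this[of N] show thesis using that[OF cauchy_closed[OF s(1), of N]] assms s by simp
qed

text \<open>Completeness is a diagonal argument: the k-th member of a Cauchy sequence of classes is
  replaced by a constant class at distance less than 1/(k+1); the chosen elements form a Cauchy
  sequence whose class is the limit.\<close>

theorem cstar_completion: "cstar_algebra (completion A)"
proof -
  interpret C: pre_cstar_algebra "completion A" by (rule pre_cstar_completion)
  let ?C = "completion A"
  have complete: "C.met.mcomplete"
    unfolding C.met.mcomplete_def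
  proof (intro allI impI)
    fix X assume "C.met.MCauchy X"
    then have X: "C.cauchy X" by (simp add: C.cauchy_def)
    note Xc = C.cauchy_closed[OF X]
    have "\<forall>k. \<exists>x. x \<in> carr A \<and> nrm ?C (sub ?C (X k) (embed x)) < 1 / (real k + 1)"
      using embed_dense[OF Xc] by (metis add_nonneg_pos divide_pos_pos of_nat_0_le_iff zero_less_one)
    then obtain x where x: "\<And>k. x k \<in> carr A" "\<And>k. nrm ?C (sub ?C (X k) (embed (x k))) < 1 / (real k + 1)"
      by metis
    have small: "\<exists>N. \<forall>k\<ge>N. 1 / (real k + 1) < e" if "0 < e" for e
    proof -
      have "(\<lambda>k. 1 / (real k + 1)) \<longlonglongrightarrow> 0"
        using LIMSEQ_inverse_real_of_nat by (simp add: inverse_eq_divide add.commute)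
      from order_tendstoD(2)[OF this that] show ?thesis by (simp add: eventually_sequentially)
    qed
    have cx: "cauchy x"
      unfolding cauchy_iff
    proof (intro conjI allI impI)
      fix e :: real assume "0 < e"
      then have e3: "0 < e / 3" by simp
      obtain N1 where N1: "\<forall>k\<ge>N1. 1 / (real k + 1) < e / 3" using small[OF e3] by blast
      obtain N2 where N2: "\<forall>m\<ge>N2. \<forall>n\<ge>N2. nrm ?C (sub ?C (X m) (X n)) < e / 3"
        using X e3 unfolding C.cauchy_iff by blast
      have "nrm A (sub A (x m) (x n)) < e" if "m \<ge> max N1 N2" "n \<ge> max N1 N2" for m n
      proof -
        have "nrm A (sub A (x m) (x n)) = nrm ?C (sub ?C (embed (x m)) (embed (x n)))"
          by (simp add: embed_sub nrm_embed x closed)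
        also have "\<dots> \<le> nrm ?C (sub ?C (embed (x m)) (X m)) + nrm ?C (sub ?C (X m) (embed (x n)))"
          by (intro C.nrm_sub_triangle embed_closed x Xc)
        also have "\<dots> \<le> nrm ?C (sub ?C (embed (x m)) (X m)) +
            (nrm ?C (sub ?C (X m) (X n)) + nrm ?C (sub ?C (X n) (embed (x n))))"
          by (intro add_left_mono C.nrm_sub_triangle embed_closed x Xc)
        also have "nrm ?C (sub ?C (embed (x m)) (X m)) = nrm ?C (sub ?C (X m) (embed (x m)))"
          by (intro C.nrm_sub_commute embed_closed x Xc)
        finally have le: "nrm A (sub A (x m) (x n)) \<le> nrm ?C (sub ?C (X m) (embed (x m))) +
            (nrm ?C (sub ?C (X m) (X n)) + nrm ?C (sub ?C (X n) (embed (x n))))" .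
        have "nrm ?C (sub ?C (X m) (embed (x m))) < e / 3" "nrm ?C (sub ?C (X n) (embed (x n))) < e / 3"
        proof -
          have mn: "N1 \<le> m" "N1 \<le> n" using that by auto
          show "nrm ?C (sub ?C (X m) (embed (x m))) < e / 3" "nrm ?C (sub ?C (X n) (embed (x n))) < e / 3"
            using x(2)[of m] x(2)[of n] N1[rule_format, OF mn(1)] N1[rule_format, OF mn(2)] by linarith+
        qed
        moreover have "nrm ?C (sub ?C (X m) (X n)) < e / 3" using N2 that by simp
        ultimately show ?thesis using le by linarith
      qed
      then show "\<exists>N. \<forall>m\<ge>N. \<forall>n\<ge>N. nrm A (sub A (x m) (x n)) < e" by blast
    qed (rule x)
    have "limitin C.met.mtopology X (cls x) sequentially"
      unfolding C.met.limit_metric_sequentially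
    proof (intro conjI allI impI)
      show "cls x \<in> carr ?C" by (rule cls_carr[OF cx])
      fix e :: real assume "0 < e"
      then have e: "0 < e / 2" by simp
      obtain N1 where N1: "\<forall>k\<ge>N1. 1 / (real k + 1) < e / 2" using small[OF e] by blast
      obtain N2 where N2: "\<And>n. N2 \<le> n \<Longrightarrow> nrm ?C (sub ?C (cls x) (embed (x n))) \<le> e / 2"
        using nrm_sub_embed_cls[OF cx e] by blast
      have "X n \<in> carr ?C \<and> adist ?C (X n) (cls x) < e" if n: "n \<ge> max N1 N2" for n
      proof -
        have "nrm ?C (sub ?C (X n) (cls x))
          \<le> nrm ?C (sub ?C (X n) (embed (x n))) + nrm ?C (sub ?C (embed (x n)) (cls x))"
          by (intro C.nrm_sub_triangle embed_closed x Xc cls_carr cx)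
        also have "nrm ?C (sub ?C (embed (x n)) (cls x)) = nrm ?C (sub ?C (cls x) (embed (x n)))"
          by (intro C.nrm_sub_commute embed_closed x cls_carr cx)
        finally have "nrm ?C (sub ?C (X n) (cls x)) < e"
          using x(2)[of n] N1 N2[of n] n by fastforce
        then show ?thesis by (simp add: Xc C.adist_eq cls_carr cx)
      qed
      then show "\<exists>N. \<forall>n\<ge>N. X n \<in> carr ?C \<and> adist ?C (X n) (cls x) < e" by blast
    qed
    then show "\<exists>x. limitin C.met.mtopology X x sequentially" by blast
  qed
  show ?thesis
    by unfold_locales
      (fact C.zer_closed C.add_closed C.scl_closed C.mul_closed C.adj_closed C.add_assoc C.add_comm C.add_zer C.add_neg C.scl_add_right C.scl_add_left C.scl_scl C.scl_one C.mul_assoc C.mul_add_right C.mul_add_left C.mul_scl_left C.mul_scl_right C.adj_adj C.adj_add C.adj_scl C.adj_mul C.nrm_nonneg C.nrm_eq_0 C.nrm_triangle C.nrm_scl C.nrm_mul C.cstar_identity complete)+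
qed

text \<open>A contraction compatible with subtraction preserves Cauchy sequences and null
  differences, so the union over representatives collapses.\<close>

lemma completion_map_cls:
  assumes s: "cauchy \<sigma>" and \<phi>: "\<And>x. x \<in> carr A \<Longrightarrow> \<phi> x \<in> carr A"
    and sub: "\<And>x y. x \<in> carr A \<Longrightarrow> y \<in> carr A \<Longrightarrow> sub A (\<phi> x) (\<phi> y) = \<phi> (sub A x y)"
    and le: "\<And>x. x \<in> carr A \<Longrightarrow> nrm A (\<phi> x) \<le> nrm A x"
  shows "cauchy (\<lambda>n. \<phi> (\<sigma> n))" "completion_map A \<phi> (cls \<sigma>) = cls (\<lambda>n. \<phi> (\<sigma> n))"
proof -
  have c: "cauchy (\<lambda>n. \<phi> (\<tau> n))" if "cauchy \<tau>" for \<tau>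
  proof (rule cauchyI[OF _ that that zero_less_one])
    fix m n
    have "nrm A (sub A (\<phi> (\<tau> m)) (\<phi> (\<tau> n))) \<le> nrm A (sub A (\<tau> m) (\<tau> n))"
      by (simp add: sub le closed cauchy_closed[OF that])
    then show "nrm A (sub A (\<phi> (\<tau> m)) (\<phi> (\<tau> n)))
        \<le> 1 * (nrm A (sub A (\<tau> m) (\<tau> n)) + nrm A (sub A (\<tau> m) (\<tau> n)))"
      using nrm_nonneg[OF sub_closed[OF cauchy_closed[OF that] cauchy_closed[OF that]], of m n] by simp
  qed (simp add: \<phi> cauchy_closed[OF that])
  show "cauchy (\<lambda>n. \<phi> (\<sigma> n))" by (rule c[OF s])
  have "(\<Union>\<sigma>\<in>cls \<sigma>. cls (\<lambda>n. \<phi> (\<sigma> n))) = cls (\<lambda>n. \<phi> (\<sigma> n))"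
  proof (rule UN_cls[OF s])
    fix \<sigma> \<tau> assume st: "cauchy \<sigma>" "cauchy \<tau>" "(\<lambda>n. nrm A (sub A (\<sigma> n) (\<tau> n))) \<longlonglongrightarrow> 0"
    show "cls (\<lambda>n. \<phi> (\<sigma> n)) = cls (\<lambda>n. \<phi> (\<tau> n))"
      by (rule cls_eqI[OF c[OF st(1)] c[OF st(2)] _ st(3)])
        (simp add: sub le closed cauchy_closed[OF st(1)] cauchy_closed[OF st(2)])
  qed
  then show "completion_map A \<phi> (cls \<sigma>) = cls (\<lambda>n. \<phi> (\<sigma> n))"
    by (simp add: completion_map_def cls_def)
qed

end

section \<open>Square roots in C*-algebras\<close>

sublocale cstar_algebra \<subseteq> pre_cstar_algebra
  by unfold_locales
    (fact zer_closed add_closed scl_closed mul_closed adj_closed add_assoc add_comm add_zer add_neg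
      scl_add_right scl_add_left scl_scl scl_one mul_assoc mul_add_right mul_add_left mul_scl_left
      mul_scl_right adj_adj adj_add adj_scl adj_mul nrm_nonneg nrm_eq_0 nrm_triangle nrm_scl nrm_mul
      cstar_identity)+

context pre_cstar_algebra
begin

definition tends :: "(nat \<Rightarrow> 'a) \<Rightarrow> 'a \<Rightarrow> bool" where
  "tends \<sigma> x \<longleftrightarrow> (\<forall>n. \<sigma> n \<in> carr A) \<and> x \<in> carr A \<and> (\<lambda>n. nrm A (sub A (\<sigma> n) x)) \<longlonglongrightarrow> 0"

lemma tendsI:
  assumes "\<And>n. \<sigma> n \<in> carr A" "x \<in> carr A" "\<And>n. nrm A (sub A (\<sigma> n) x) \<le> b n" "b \<longlonglongrightarrow> 0"
  shows "tends \<sigma> x"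
  unfolding tends_def
  using tendsto_sandwich[OF _ _ tendsto_const assms(4), of "\<lambda>n. nrm A (sub A (\<sigma> n) x)"] assms
  by (simp add: nrm_nonneg closed)

lemma tends_closed: "tends \<sigma> x \<Longrightarrow> \<sigma> n \<in> carr A" "tends \<sigma> x \<Longrightarrow> x \<in> carr A"
  by (auto simp: tends_def)

lemma tends_null: "tends \<sigma> x \<Longrightarrow> (\<lambda>n. nrm A (sub A (\<sigma> n) x)) \<longlonglongrightarrow> 0"
  by (auto simp: tends_def)

lemma tends_const: "x \<in> carr A \<Longrightarrow> tends (\<lambda>n. x) x"
  by (simp add: tends_def sub_self nrm_zer)

lemma tends_unique:
  assumes "tends \<sigma> x" "tends \<sigma> y" shows "x = y"
proof -
  note c = tends_closed[OF assms(1)] tends_closed[OF assms(2)]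
  have "(\<lambda>n. nrm A (sub A (\<sigma> n) x) + nrm A (sub A (\<sigma> n) y)) \<longlonglongrightarrow> 0"
    using tendsto_add[OF tends_null[OF assms(1)] tends_null[OF assms(2)]] by simp
  moreover have "nrm A (sub A x y) \<le> nrm A (sub A (\<sigma> n) x) + nrm A (sub A (\<sigma> n) y)" for n
    using nrm_sub_triangle[of x "\<sigma> n" y] nrm_sub_commute[of x "\<sigma> n"] c by simp
  ultimately have "nrm A (sub A x y) \<le> 0" by (intro LIMSEQ_le_const) auto
  then have "nrm A (sub A x y) = 0" using nrm_nonneg[of "sub A x y"] c by (simp add: closed)
  then show ?thesis using c by (simp add: nrm_eq_0 closed sub_eq_zer)
qed

lemma tends_add:
  assumes "tends \<sigma> x" "tends \<tau> y" shows "tends (\<lambda>n. \<sigma> n \<oplus> \<tau> n) (x \<oplus> y)"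
proof (rule tendsI)
  note c = tends_closed[OF assms(1)] tends_closed[OF assms(2)]
  show "(\<lambda>n. nrm A (sub A (\<sigma> n) x) + nrm A (sub A (\<tau> n) y)) \<longlonglongrightarrow> 0"
    using tendsto_add[OF tends_null[OF assms(1)] tends_null[OF assms(2)]] by simp
  show "nrm A (sub A (\<sigma> n \<oplus> \<tau> n) (x \<oplus> y)) \<le> nrm A (sub A (\<sigma> n) x) + nrm A (sub A (\<tau> n) y)" for n
    by (simp add: sub_add_add c nrm_triangle closed)
qed (auto simp: closed tends_closed[OF assms(1)] tends_closed[OF assms(2)])

lemma tends_scl:
  assumes "a \<longlonglongrightarrow> l" "tends \<sigma> x" shows "tends (\<lambda>n. a n \<odot> \<sigma> n) (l \<odot> x)"
proof (rule tendsI)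
  note c = tends_closed[OF assms(2)]
  have "(\<lambda>n. cmod (a n) * nrm A (sub A (\<sigma> n) x)) \<longlonglongrightarrow> cmod l * 0"
    by (intro tendsto_intros assms tends_null)
  moreover have "(\<lambda>n. cmod (a n - l) * nrm A x) \<longlonglongrightarrow> cmod (l - l) * nrm A x"
    by (intro tendsto_intros assms)
  ultimately show "(\<lambda>n. cmod (a n) * nrm A (sub A (\<sigma> n) x) + cmod (a n - l) * nrm A x) \<longlonglongrightarrow> 0"
    using tendsto_add by fastforce
  fix n
  have "sub A (a n \<odot> \<sigma> n) (l \<odot> x) = sub A (a n \<odot> \<sigma> n) (a n \<odot> x) \<oplus> sub A (a n \<odot> x) (l \<odot> x)"
    by (intro sub_trans closed c)
  also have "sub A (a n \<odot> x) (l \<odot> x) = (a n - l) \<odot> x"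
    using scl_add_left[of x "a n" "- l"] c by (simp add: sub_def scl_scl)
  finally show "nrm A (sub A (a n \<odot> \<sigma> n) (l \<odot> x))
      \<le> cmod (a n) * nrm A (sub A (\<sigma> n) x) + cmod (a n - l) * nrm A x"
    using nrm_triangle[of "sub A (a n \<odot> \<sigma> n) (a n \<odot> x)" "(a n - l) \<odot> x"]
    by (simp add: sub_scl nrm_scl closed c)
qed (auto simp: closed tends_closed[OF assms(2)])

lemma tends_nrm:
  assumes "tends \<sigma> x" shows "(\<lambda>n. nrm A (\<sigma> n)) \<longlonglongrightarrow> nrm A x"
proof -
  have "(\<lambda>n. nrm A (\<sigma> n) - nrm A x) \<longlonglongrightarrow> 0"
    by (rule Lim_null_comparison[OF _ tends_null[OF assms]]) (simp add: nrm_diff_le tends_closed[OF assms])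
  then show ?thesis by (simp add: LIM_zero_iff)
qed

lemma tends_mul:
  assumes "tends \<sigma> x" "tends \<tau> y" shows "tends (\<lambda>n. \<sigma> n \<otimes> \<tau> n) (x \<otimes> y)"
proof (rule tendsI)
  note c = tends_closed[OF assms(1)] tends_closed[OF assms(2)]
  have "(\<lambda>n. nrm A (\<sigma> n) * nrm A (sub A (\<tau> n) y)) \<longlonglongrightarrow> nrm A x * 0"
    by (intro tendsto_intros tends_nrm tends_null assms)
  moreover have "(\<lambda>n. nrm A (sub A (\<sigma> n) x) * nrm A y) \<longlonglongrightarrow> 0 * nrm A y"
    by (intro tendsto_intros tends_null assms)
  ultimately show "(\<lambda>n. nrm A (\<sigma> n) * nrm A (sub A (\<tau> n) y) + nrm A (sub A (\<sigma> n) x) * nrm A y) \<longlonglongrightarrow> 0"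
    using tendsto_add by fastforce
  show "nrm A (sub A (\<sigma> n \<otimes> \<tau> n) (x \<otimes> y))
      \<le> nrm A (\<sigma> n) * nrm A (sub A (\<tau> n) y) + nrm A (sub A (\<sigma> n) x) * nrm A y" for n
    by (intro nrm_sub_mul_mul c)
qed (auto simp: closed tends_closed[OF assms(1)] tends_closed[OF assms(2)])

lemma tends_adj:
  assumes "tends \<sigma> x" shows "tends (\<lambda>n. adj A (\<sigma> n)) (adj A x)"
  by (rule tendsI[OF _ _ _ tends_null[OF assms]])
    (auto simp: closed tends_closed[OF assms] sub_adj nrm_adj)

text \<open>Testing on \<open>x = adj A a\<close> gives |a|^2 \<le> K |a|. Norms can thus be
  estimated through left multiplication, with no unit to test on.\<close>

lemma nrm_le_multiplier:
  assumes a: "a \<in> carr A" and "0 \<le> K" and K: "\<And>x. x \<in> carr A \<Longrightarrow> nrm A (a \<otimes> x) \<le> K * nrm A x"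
  shows "nrm A a \<le> K"
proof (cases "nrm A a = 0")
  case False
  have "(nrm A a)\<^sup>2 = nrm A (a \<otimes> adj A a)"
    using cstar_identity[of "adj A a"] a by (simp add: adj_adj nrm_adj closed)
  also have "\<dots> \<le> K * nrm A a" using K[of "adj A a"] a by (simp add: nrm_adj closed)
  finally show ?thesis using False nrm_nonneg[OF a] by (simp add: power2_eq_square)
qed (use assms in simp)

end

text \<open>The majorant of the square root iteration: it obeys the same recursion with the algebra
  element replaced by 1, so its increments bound those in the algebra.\<close>

primrec root_scalar :: "nat \<Rightarrow> real" where
  "root_scalar 0 = 0"
| "root_scalar (Suc n) = (1 + (root_scalar n)\<^sup>2) / 2"

lemma root_scalar_bounds: "0 \<le> root_scalar n \<and> root_scalar n \<le> 1"
proof (induction n)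
  case (Suc n)
  then have "(root_scalar n)\<^sup>2 \<le> 1" by (simp add: power_le_one)
  then show ?case by simp
qed simp

lemma root_scalar_mono: "root_scalar n \<le> root_scalar (Suc n)"
proof -
  have "0 \<le> (1 - root_scalar n)\<^sup>2" by simp
  then show ?thesis by (simp add: power2_eq_square algebra_simps)
qed

text \<open>The sequence increases and is bounded by 1, and its limit solves (l - 1)^2 = 0. The root
  is double, so convergence is not geometric; this is why the estimates below telescope in
  \<open>root_scalar\<close> instead of summing a geometric series.\<close>

lemma root_scalar_tendsto: "root_scalar \<longlonglongrightarrow> 1"
proof -
  have "incseq root_scalar" by (rule incseq_SucI) (rule root_scalar_mono)
  then obtain l where l: "root_scalar \<longlonglongrightarrow> l"
    using incseq_convergent[of root_scalar 1] root_scalar_bounds by blast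
  have "(\<lambda>n. (1 + (root_scalar n)\<^sup>2) / 2) \<longlonglongrightarrow> (1 + l\<^sup>2) / 2"
    by (intro tendsto_intros l) auto
  then have "root_scalar \<longlonglongrightarrow> (1 + l\<^sup>2) / 2"
    by (subst filterlim_sequentially_Suc[symmetric]) simp
  with l have "l = (1 + l\<^sup>2) / 2" by (rule LIMSEQ_unique)
  then have "(l - 1)\<^sup>2 = 0" by (simp add: power2_eq_square algebra_simps)
  with l show ?thesis by simp
qed

text \<open>With \<open>z = 1 - b\<close>, the iteration \<open>w\<^sub>0 = 0\<close>, \<open>w\<^sub>n\<^sub>+\<^sub>1 = (z + w\<^sub>n\<^sup>2) / 2\<close> converges to \<open>1 - \<surd>b\<close>.
  There is no unit in the algebra, so one iterates \<open>v\<^sub>n = q\<^sub>n - w\<^sub>n\<close>, where \<open>q\<^sub>n\<close> solves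
  the same recursion for \<open>z = 1\<close>; then \<open>v\<^sub>n\<close> has no scalar part and still tends to \<open>\<surd>b\<close>.\<close>

primrec root_iter :: "'a star_alg \<Rightarrow> 'a \<Rightarrow> nat \<Rightarrow> 'a" where
  "root_iter A b 0 = zer A"
| "root_iter A b (Suc n) = (1/2) \<odot>\<^bsub>A\<^esub> b \<oplus>\<^bsub>A\<^esub> (complex_of_real (root_scalar n) \<odot>\<^bsub>A\<^esub> root_iter A b n \<oplus>\<^bsub>A\<^esub>
    (-1/2) \<odot>\<^bsub>A\<^esub> (root_iter A b n \<otimes>\<^bsub>A\<^esub> root_iter A b n))"

context cstar_algebra
begin

lemma cauchy_tends: assumes "cauchy \<sigma>" obtains x where "tends \<sigma> x"
proof -
  obtain x where x: "limitin met.mtopology \<sigma> x sequentially"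
    using complete assms unfolding met.mcomplete_def cauchy_def by blast
  then have "x \<in> carr A" "(\<lambda>n. adist A (\<sigma> n) x) \<longlonglongrightarrow> 0"
    by (auto simp: met.limitin_metric_dist_null)
  then have "tends \<sigma> x"
    unfolding tends_def using cauchy_closed[OF assms] by (simp add: adist_eq)
  then show thesis by (rule that)
qed

context
  fixes b assumes b: "b \<in> carr A" and contr: "\<And>x. x \<in> carr A \<Longrightarrow> nrm A (sub A x (b \<otimes> x)) \<le> nrm A x"
begin

abbreviation (input) "v \<equiv> root_iter A b"
abbreviation (input) "q n \<equiv> complex_of_real (root_scalar n)"

text \<open>Left multiplication by \<open>w\<^sub>n = q\<^sub>n - v\<^sub>n\<close>. The operator
  makes sense on the algebra even when \<open>w\<^sub>n\<close> does not belong to it.\<close>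

definition root_op :: "nat \<Rightarrow> 'a \<Rightarrow> 'a" where
  "root_op n x = sub A (q n \<odot> x) (v n \<otimes> x)"

lemma root_iter_closed: "v n \<in> carr A"
  by (induction n) (simp_all add: closed b)

lemma root_op_closed: "x \<in> carr A \<Longrightarrow> root_op n x \<in> carr A"
  by (simp add: root_op_def closed root_iter_closed)

text \<open>The recursion \<open>w\<^sub>n\<^sub>+\<^sub>1 = (z + w\<^sub>n\<^sup>2) / 2\<close>
  with \<open>z = 1 - b\<close>, read as an identity between operators. In this form the hypothesis
  on \<open>b\<close>, contractivity of \<open>z\<close>, can be applied.\<close>

lemma root_op_Suc:
  assumes x: "x \<in> carr A"
  shows "root_op (Suc n) x = (1/2) \<odot> sub A x (b \<otimes> x) \<oplus> (1/2) \<odot> root_op n (root_op n x)"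
proof -
  define y where "y = v n \<otimes> x"
  define z where "z = v n \<otimes> y"
  note c = x b root_iter_closed[of n]
  have yz: "y \<in> carr A" "z \<in> carr A" by (simp_all add: y_def z_def c closed)
  have q: "q (Suc n) \<odot> x = (1/2) \<odot> x \<oplus> (q n * q n / 2) \<odot> x"
    using scl_add_left[of x "1/2" "q n * q n / 2"] x by (simp add: power2_eq_square add_divide_distrib)
  have h: "(- q n) \<odot> y = (- q n / 2) \<odot> y \<oplus> (- q n / 2) \<odot> y"
    using scl_add_left[of y "- q n / 2" "- q n / 2"] yz by simp
  have l: "root_op (Suc n) x = (1/2) \<odot> x \<oplus> ((q n * q n / 2) \<odot> x \<oplus>
      ((-1/2) \<odot> (b \<otimes> x) \<oplus> ((- q n / 2) \<odot> y \<oplus> ((- q n / 2) \<odot> y \<oplus> (1/2) \<odot> z))))"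
    unfolding root_op_def sub_def q
    by (simp add: mul_add_left mul_scl_left mul_assoc scl_add_right scl_scl closed c yz add_assoc
        flip: y_def z_def) (simp add: h add_assoc closed yz c)
  have r: "root_op n (root_op n x) = (q n * q n) \<odot> x \<oplus> ((- q n) \<odot> y \<oplus> ((- q n) \<odot> y \<oplus> z))"
    unfolding root_op_def sub_def
    by (simp add: mul_add_right mul_scl_right mul_assoc scl_add_right scl_scl closed c yz add_assoc scl_one
        flip: y_def z_def)
  show ?thesis
    unfolding l r sub_def
    by (simp add: scl_add_right scl_scl closed c yz add_ac)
qed

text \<open>As \<open>z\<close> is a contraction, the recursion for the operators is dominated step
  by step by the one for the scalars.\<close>

lemma root_op_bound: "x \<in> carr A \<Longrightarrow> nrm A (root_op n x) \<le> root_scalar n * nrm A x"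
proof (induction n arbitrary: x)
  case 0
  have "zer A \<otimes> x = zer A" using mul_scl_left[of "zer A" x 0] 0 by (simp add: scl_0 closed)
  then show ?case using 0 by (simp add: root_op_def scl_0 sub_self closed nrm_zer)
next
  case (Suc n)
  let ?q = "root_scalar n"
  have "nrm A (root_op n (root_op n x)) \<le> ?q * nrm A (root_op n x)"
    by (intro Suc root_op_closed)
  also have "\<dots> \<le> ?q * (?q * nrm A x)"
    using root_scalar_bounds by (intro mult_left_mono Suc) auto
  finally have "nrm A (root_op n (root_op n x)) \<le> ?q\<^sup>2 * nrm A x" by (simp add: power2_eq_square)
  moreover have "nrm A (root_op (Suc n) x)
      \<le> nrm A (sub A x (b \<otimes> x)) / 2 + nrm A (root_op n (root_op n x)) / 2"
    using nrm_triangle[of "(1/2) \<odot> sub A x (b \<otimes> x)" "(1/2) \<odot> root_op n (root_op n x)"] Suc.prems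
    by (simp add: root_op_Suc nrm_scl closed b root_op_closed)
  ultimately show ?case using contr[OF Suc.prems] by (simp add: algebra_simps)
qed

lemma root_op_sub:
  assumes "x \<in> carr A" "y \<in> carr A"
  shows "root_op n (sub A x y) = sub A (root_op n x) (root_op n y)"
  using assms unfolding root_op_def sub_def
  by (simp add: mul_add_right mul_scl_right scl_add_right scl_scl closed root_iter_closed add_ac mult.commute)

text \<open>In the difference of two successive recursion steps \<open>z\<close> cancels, and with
  w, w' for consecutive operators w'^2 - w^2 = w' (w' - w) + (w' - w) w. The bounds of the two
  summands add up to the difference of squares of the scalars.\<close>

lemma root_op_diff:
  "x \<in> carr A \<Longrightarrow> nrm A (sub A (root_op (Suc n) x) (root_op n x)) \<le> (root_scalar (Suc n) - root_scalar n) * nrm A x"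
proof (induction n arbitrary: x)
  case 0
  have "zer A \<otimes> x = zer A" using mul_scl_left[of "zer A" x 0] 0 by (simp add: scl_0 closed)
  then have "root_op 0 y = zer A" if "y \<in> carr A" for y
    using that mul_scl_left[of "zer A" y 0] by (simp add: root_op_def scl_0 sub_self closed)
  then show ?case using 0 contr[of x]
    by (simp add: root_op_Suc sub_zer closed b nrm_scl scl_zer add_zer)
next
  case (Suc n)
  note c = Suc.prems root_op_closed
  let ?d = "root_scalar (Suc n) - root_scalar n"
  have d: "0 \<le> ?d" using root_scalar_mono[of n] by simp
  have "sub A (root_op (Suc (Suc n)) x) (root_op (Suc n) x)
      = (1/2) \<odot> sub A (root_op (Suc n) (root_op (Suc n) x)) (root_op n (root_op n x))"
    unfolding root_op_Suc[OF Suc.prems, of "Suc n"] root_op_Suc[OF Suc.prems, of n]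
    by (subst sub_add_add) (simp_all add: closed b c sub_self zer_add sub_scl del: root_iter.simps)
  also have "sub A (root_op (Suc n) (root_op (Suc n) x)) (root_op n (root_op n x))
      = root_op (Suc n) (sub A (root_op (Suc n) x) (root_op n x))
        \<oplus> sub A (root_op (Suc n) (root_op n x)) (root_op n (root_op n x))"
    by (simp add: root_op_sub c closed
        sub_trans[of "root_op (Suc n) (root_op (Suc n) x)" "root_op (Suc n) (root_op n x)" "root_op n (root_op n x)"])
  finally have "nrm A (sub A (root_op (Suc (Suc n)) x) (root_op (Suc n) x))
      \<le> (nrm A (root_op (Suc n) (sub A (root_op (Suc n) x) (root_op n x)))
        + nrm A (sub A (root_op (Suc n) (root_op n x)) (root_op n (root_op n x)))) / 2"
    by (simp add: nrm_scl closed c nrm_triangle)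
  moreover have "nrm A (root_op (Suc n) (sub A (root_op (Suc n) x) (root_op n x)))
      \<le> root_scalar (Suc n) * (?d * nrm A x)"
    by (rule order_trans[OF root_op_bound])
      (use root_scalar_bounds[of "Suc n"] in \<open>auto intro!: mult_left_mono Suc.IH simp: c closed simp del: root_scalar.simps\<close>)
  moreover have "nrm A (sub A (root_op (Suc n) (root_op n x)) (root_op n (root_op n x)))
      \<le> ?d * (root_scalar n * nrm A x)"
    by (rule order_trans[OF Suc.IH])
      (use d in \<open>auto intro!: mult_left_mono root_op_bound simp: c simp del: root_scalar.simps\<close>)
  ultimately have "nrm A (sub A (root_op (Suc (Suc n)) x) (root_op (Suc n) x))
      \<le> (root_scalar (Suc n) * (?d * nrm A x) + ?d * (root_scalar n * nrm A x)) / 2"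
    by argo
  also have "\<dots> = ((root_scalar (Suc n) + root_scalar n) * ?d / 2) * nrm A x"
    by (simp add: algebra_simps del: root_scalar.simps)
  also have "(root_scalar (Suc n) + root_scalar n) * ?d / 2 = root_scalar (Suc (Suc n)) - root_scalar (Suc n)"
  proof -
    have "2 * root_scalar (Suc n) = 1 + (root_scalar n)\<^sup>2"
      "2 * root_scalar (Suc (Suc n)) = 1 + (root_scalar (Suc n))\<^sup>2" by simp_all
    moreover have "(root_scalar (Suc n) + root_scalar n) * ?d = (root_scalar (Suc n))\<^sup>2 - (root_scalar n)\<^sup>2"
      by (simp add: power2_eq_square algebra_simps del: root_scalar.simps)
    ultimately show ?thesis by argo
  qed
  finally show ?case .
qed

text \<open>The increment of \<open>v\<close> is the scalar increment minus the increment of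
  \<open>w\<close>; each is bounded by the increment of \<open>root_scalar\<close>, which accounts
  for the factor 2.\<close>

lemma root_iter_diff: "nrm A (sub A (v (Suc n)) (v n)) \<le> 2 * (root_scalar (Suc n) - root_scalar n)"
proof (rule nrm_le_multiplier)
  let ?d = "root_scalar (Suc n) - root_scalar n"
  have d: "0 \<le> ?d" using root_scalar_mono[of n] by simp
  then show "0 \<le> 2 * ?d" by simp
  note rc = root_iter_closed[of n] root_iter_closed[of "Suc n"]
  show "sub A (v (Suc n)) (v n) \<in> carr A" by (intro closed rc)
  fix x assume x: "x \<in> carr A"
  have "sub A (v (Suc n)) (v n) \<otimes> x
      = sub A ((q (Suc n) - q n) \<odot> x) (sub A (root_op (Suc n) x) (root_op n x))"
  proof -
    define y y' where "y = v n \<otimes> x" and "y' = v (Suc n) \<otimes> x"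
    have c: "y \<in> carr A" "y' \<in> carr A" by (simp_all add: y_def y'_def closed rc x del: root_iter.simps)
    have e: "(q (Suc n) - q n) \<odot> x = q (Suc n) \<odot> x \<oplus> (- q n) \<odot> x"
      using scl_add_left[of x "q (Suc n)" "- q n"] x by simp
    have "sub A ((q (Suc n) - q n) \<odot> x) (sub A (root_op (Suc n) x) (root_op n x))
      = (q (Suc n) \<odot> x \<oplus> (-1) \<odot> q (Suc n) \<odot> x) \<oplus> ((q n \<odot> x \<oplus> (-1) \<odot> q n \<odot> x) \<oplus> (y' \<oplus> (-1) \<odot> y))"
      unfolding e root_op_def sub_def y_def[symmetric] y'_def[symmetric]
      by (simp add: scl_add_right scl_scl scl_one closed c x add_ac del: root_iter.simps root_scalar.simps)
    also have "\<dots> = y' \<oplus> (-1) \<odot> y"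
      using c x by (simp add: add_neg zer_add closed del: root_iter.simps root_scalar.simps)
    also have "\<dots> = sub A (v (Suc n)) (v n) \<otimes> x"
      by (simp add: mul_sub_left rc x y_def y'_def sub_def[symmetric] del: root_iter.simps)
    finally show ?thesis by simp
  qed
  then have "nrm A (sub A (v (Suc n)) (v n) \<otimes> x)
      \<le> nrm A ((q (Suc n) - q n) \<odot> x) + nrm A (sub A (root_op (Suc n) x) (root_op n x))"
    using nrm_triangle[of "(q (Suc n) - q n) \<odot> x" "(-1) \<odot> sub A (root_op (Suc n) x) (root_op n x)"]
    by (simp add: sub_def[of A "(q (Suc n) - q n) \<odot> x"] nrm_scl closed root_op_closed x
        del: root_iter.simps root_scalar.simps)
  also have "nrm A ((q (Suc n) - q n) \<odot> x) = ?d * nrm A x"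
    using d x by (simp add: nrm_scl flip: of_real_diff del: root_scalar.simps)
  finally show "nrm A (sub A (v (Suc n)) (v n) \<otimes> x) \<le> 2 * ?d * nrm A x"
    using root_op_diff[OF x, of n] by (simp add: algebra_simps del: root_iter.simps root_scalar.simps)
qed

lemma root_iter_le:
  "m \<le> n \<Longrightarrow> nrm A (sub A (v n) (v m)) \<le> 2 * (root_scalar n - root_scalar m)"
proof (induction n rule: dec_induct)
  case base
  then show ?case by (simp add: sub_self root_iter_closed nrm_zer)
next
  case (step n)
  have "nrm A (sub A (v (Suc n)) (v m)) \<le> nrm A (sub A (v (Suc n)) (v n)) + nrm A (sub A (v n) (v m))"
    by (intro nrm_sub_triangle root_iter_closed)
  then show ?case using step.IH root_iter_diff[of n] by argo
qed

lemma cauchy_root_iter: "cauchy v"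
  unfolding cauchy_iff
proof (intro conjI allI impI)
  fix e :: real assume "0 < e"
  then have "0 < e / 2" by simp
  moreover have "Cauchy root_scalar"
    using root_scalar_tendsto by (intro convergent_Cauchy) (auto simp: convergent_def)
  ultimately obtain N where N: "\<forall>m\<ge>N. \<forall>n\<ge>N. dist (root_scalar m) (root_scalar n) < e / 2"
    unfolding Cauchy_def by blast
  have "nrm A (sub A (v m) (v n)) < e" if "m \<ge> N" "n \<ge> N" for m n
  proof (cases "m \<le> n")
    case True
    have "\<bar>root_scalar m - root_scalar n\<bar> < e / 2" using N that by (simp add: dist_real_def)
    then show ?thesis using root_iter_le[OF True] nrm_sub_commute[OF root_iter_closed root_iter_closed, of m n]
      by argo
  next
    case False
    then have "n \<le> m" by simp
    have "\<bar>root_scalar m - root_scalar n\<bar> < e / 2" using N that by (simp add: dist_real_def)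
    then show ?thesis using root_iter_le[OF \<open>n \<le> m\<close>] by argo
  qed
  then show "\<exists>N. \<forall>m\<ge>N. \<forall>n\<ge>N. nrm A (sub A (v m) (v n)) < e" by blast
qed (rule root_iter_closed)

lemma root_iter_adj: "adj A b = b \<Longrightarrow> adj A (v n) = v n"
  by (induction n) (simp_all add: adj_zer adj_add adj_scl adj_mul closed b root_iter_closed)

text \<open>The limit y of the iteration satisfies y = b/2 + y - y^2/2, so b = y^2; and y is
  self-adjoint as a limit of self-adjoint elements, so b = y* y.\<close>

lemma positive_of_contraction:
  assumes "adj A b = b" shows "positive A b"
proof -
  obtain y where y: "tends v y" using cauchy_tends[OF cauchy_root_iter] .
  note yc = tends_closed(2)[OF y]
  have "tends (\<lambda>n. v (Suc n)) y"
    using y LIMSEQ_Suc[OF tends_null[OF y]] unfolding tends_def by blast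
  moreover have "tends (\<lambda>n. v (Suc n)) ((1/2) \<odot> b \<oplus> (1 \<odot> y \<oplus> (-1/2) \<odot> (y \<otimes> y)))"
    unfolding root_iter.simps
    by (intro tends_add tends_scl tends_mul tends_const y b tendsto_const tendsto_of_real[OF root_scalar_tendsto, simplified])
  ultimately have eq: "y = (1/2) \<odot> b \<oplus> (1 \<odot> y \<oplus> (-1/2) \<odot> (y \<otimes> y))" by (rule tends_unique)
  have "sub A ((1/2) \<odot> b) ((1/2) \<odot> (y \<otimes> y)) = zer A"
  proof -
    have "y = y \<oplus> sub A ((1/2) \<odot> b) ((1/2) \<odot> (y \<otimes> y))"
      by (subst eq) (simp add: sub_def scl_scl scl_one closed yc b add_ac)
    then have "(-1) \<odot> y \<oplus> y = ((-1) \<odot> y \<oplus> y) \<oplus> sub A ((1/2) \<odot> b) ((1/2) \<odot> (y \<otimes> y))"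
      by (metis add_assoc closed(2,3,4,6) yc b)
    then show ?thesis by (simp add: neg_add zer_add yc closed b)
  qed
  then have "(1/2) \<odot> b = (1/2) \<odot> (y \<otimes> y)" by (simp add: sub_eq_zer closed b yc)
  then have "2 \<odot> (1/2) \<odot> b = 2 \<odot> (1/2) \<odot> (y \<otimes> y)" by simp
  then have "b = y \<otimes> y" by (simp add: scl_scl scl_one closed b yc)
  moreover have "adj A y = y"
    using tends_unique[OF tends_adj[OF y]] y by (simp add: root_iter_adj assms)
  ultimately show ?thesis using yc unfolding positive_def by (intro bexI[of _ y]) auto
qed

end

end

section \<open>Twisted groupoids and their convolution kernels\<close>

context groupoid
begin

lemma composable_iff: "(g, h) \<in> composable G \<longleftrightarrow> g \<in> arrows G \<and> h \<in> arrows G \<and> src G g = rng G h"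
  by (simp add: composable_def)

lemma src_inv: "g \<in> arrows G \<Longrightarrow> src G (ginv G g) = rng G g"
  by (simp add: src_def rng_def inv_inv)

lemma rng_inv: "g \<in> arrows G \<Longrightarrow> rng G (ginv G g) = src G g"
  by (simp add: src_def rng_def inv_inv)

lemma inv_mul_self: "ginv G g \<cdot> g = src G g"
  by (simp add: src_def)

lemma mul_inv_self: "g \<cdot> ginv G g = rng G g"
  by (simp add: rng_def)

lemma mul_arrow: "g \<in> arrows G \<Longrightarrow> h \<in> arrows G \<Longrightarrow> src G g = rng G h \<Longrightarrow> g \<cdot> h \<in> arrows G"
  by (intro mul_closed) (simp add: composable_iff)

lemma src_arrow: "g \<in> arrows G \<Longrightarrow> src G g \<in> arrows G"
  unfolding src_def by (intro mul_arrow inv_closed src_inv) (auto simp: rng_def)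

lemma rng_arrow: "g \<in> arrows G \<Longrightarrow> rng G g \<in> arrows G"
  using src_arrow[OF inv_closed, of g] by (simp add: src_inv)

lemma src_mul: "g \<in> arrows G \<Longrightarrow> h \<in> arrows G \<Longrightarrow> src G g = rng G h \<Longrightarrow> src G (g \<cdot> h) = src G h"
  using assoc_composable[of g h "ginv G h"] by (simp add: composable_iff rng_inv inv_closed)

lemma rng_mul: "g \<in> arrows G \<Longrightarrow> h \<in> arrows G \<Longrightarrow> src G g = rng G h \<Longrightarrow> rng G (g \<cdot> h) = rng G g"
  using assoc_composable[of "ginv G g" g h] by (simp add: composable_iff src_inv inv_closed)

lemma mul_ac:
  "g \<in> arrows G \<Longrightarrow> h \<in> arrows G \<Longrightarrow> k \<in> arrows G \<Longrightarrow> src G g = rng G h \<Longrightarrow> src G h = rng G k \<Longrightarrow>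
    (g \<cdot> h) \<cdot> k = g \<cdot> (h \<cdot> k)"
  by (intro assoc) (auto simp: composable_iff)

lemma inv_mul_cancel: "g \<in> arrows G \<Longrightarrow> h \<in> arrows G \<Longrightarrow> src G g = rng G h \<Longrightarrow> ginv G g \<cdot> (g \<cdot> h) = h"
  by (intro cancel_left) (auto simp: composable_iff)

lemma mul_inv_cancel: "g \<in> arrows G \<Longrightarrow> h \<in> arrows G \<Longrightarrow> rng G g = rng G h \<Longrightarrow> g \<cdot> (ginv G g \<cdot> h) = h"
  using inv_mul_cancel[of "ginv G g" h] by (simp add: inv_inv inv_closed src_inv)

lemma rng_mul_self: "g \<in> arrows G \<Longrightarrow> rng G g \<cdot> g = g"
  unfolding rng_def using cancel_right[of g "ginv G g"] by (simp add: composable_iff inv_inv inv_closed rng_inv)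

lemma mul_src_self: "g \<in> arrows G \<Longrightarrow> g \<cdot> src G g = g"
  unfolding src_def using mul_inv_cancel[of g g] by simp

lemma src_src: "g \<in> arrows G \<Longrightarrow> src G (src G g) = src G g"
  using src_mul[of "ginv G g" g] by (simp add: inv_mul_self inv_closed src_inv)

lemma rng_src: "g \<in> arrows G \<Longrightarrow> rng G (src G g) = src G g"
  using rng_mul[of "ginv G g" g] by (simp add: inv_mul_self inv_closed src_inv rng_inv)

lemma src_rng: "g \<in> arrows G \<Longrightarrow> src G (rng G g) = rng G g"
  using src_src[of "ginv G g"] by (simp add: inv_closed src_inv)

lemma rng_rng: "g \<in> arrows G \<Longrightarrow> rng G (rng G g) = rng G g"
  using rng_src[of "ginv G g"] by (simp add: inv_closed src_inv)

lemma inv_unique: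
  assumes "g \<in> arrows G" "h \<in> arrows G" "src G g = rng G h" "g \<cdot> h = rng G g"
  shows "h = ginv G g"
proof -
  have "h = ginv G g \<cdot> rng G g" using inv_mul_cancel[OF assms(1-3)] assms(4) by simp
  also have "\<dots> = ginv G g" using mul_src_self[OF inv_closed[OF assms(1)]] assms(1) by (simp add: src_inv)
  finally show ?thesis .
qed

lemma inv_mul:
  assumes "g \<in> arrows G" "h \<in> arrows G" "src G g = rng G h"
  shows "ginv G (g \<cdot> h) = ginv G h \<cdot> ginv G g"
proof (rule inv_unique[symmetric])
  show "g \<cdot> h \<cdot> (ginv G h \<cdot> ginv G g) = rng G (g \<cdot> h)"
    using assms by (simp add: mul_ac mul_arrow inv_closed src_inv rng_inv rng_mul mul_inv_cancel mul_inv_self)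
qed (use assms in \<open>simp_all add: mul_arrow inv_closed src_inv rng_inv rng_mul src_mul\<close>)

lemma inv_src: "g \<in> arrows G \<Longrightarrow> ginv G (src G g) = src G g"
  using inv_mul[of "ginv G g" g] by (simp add: inv_mul_self inv_closed src_inv inv_inv)

lemma inv_rng: "g \<in> arrows G \<Longrightarrow> ginv G (rng G g) = rng G g"
  using inv_src[of "ginv G g"] by (simp add: inv_closed src_inv)

lemma mul_src_inv: "g \<in> arrows G \<Longrightarrow> src G g \<cdot> ginv G g = ginv G g"
  using rng_mul_self[of "ginv G g"] by (simp add: inv_closed rng_inv)

lemmas grp = inv_closed inv_inv src_inv rng_inv mul_arrow src_arrow rng_arrow src_mul rng_mul mul_ac
  inv_mul_self mul_inv_self inv_mul_cancel mul_inv_cancel rng_mul_self mul_src_self src_src rng_src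
  src_rng rng_rng inv_mul inv_src inv_rng mul_src_inv

lemma mul_rng: "g \<in> arrows G \<Longrightarrow> src G g = rng G h \<Longrightarrow> g \<cdot> rng G h = g"
  using mul_src_self[of g] by simp

lemma units_iff: "u \<in> units G \<longleftrightarrow> u \<in> arrows G \<and> src G u = u"
proof
  show "u \<in> units G \<Longrightarrow> u \<in> arrows G \<and> src G u = u"
    unfolding units_def using src_arrow src_src by auto
  show "u \<in> arrows G \<and> src G u = u \<Longrightarrow> u \<in> units G"
    unfolding units_def by (metis imageI)
qed

lemma unit_rng: "u \<in> units G \<Longrightarrow> rng G u = u"
  by (metis rng_src units_iff)

lemma units_arrow: "u \<in> units G \<Longrightarrow> u \<in> arrows G"
  by (simp add: units_iff)

lemma src_unit: "g \<in> arrows G \<Longrightarrow> src G g \<in> units G"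
  by (simp add: units_iff grp)

lemma rng_unit: "g \<in> arrows G \<Longrightarrow> rng G g \<in> units G"
  by (simp add: units_iff grp)

end

locale twisted_groupoid = groupoid +
  fixes c :: "'a \<times> 'a \<Rightarrow> complex"
  assumes cocycle: "cocycle2 G c"
begin

section \<open>Cocycle identities and the matrix of a function\<close>

lemma cocycle_norm: "g \<in> arrows G \<Longrightarrow> h \<in> arrows G \<Longrightarrow> src G g = rng G h \<Longrightarrow> cmod (c (g, h)) = 1"
  using cocycle by (auto simp: cocycle2_def composable_iff)

lemma cocycle_nonzero: "g \<in> arrows G \<Longrightarrow> h \<in> arrows G \<Longrightarrow> src G g = rng G h \<Longrightarrow> c (g, h) \<noteq> 0"
  using cocycle_norm by fastforce

lemma cocycle_src: "g \<in> arrows G \<Longrightarrow> c (g, src G g) = 1"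
  and cocycle_rng: "g \<in> arrows G \<Longrightarrow> c (rng G g, g) = 1"
  using cocycle by (auto simp: cocycle2_def)

lemma cocycle_eq:
  "g \<in> arrows G \<Longrightarrow> h \<in> arrows G \<Longrightarrow> k \<in> arrows G \<Longrightarrow> src G g = rng G h \<Longrightarrow> src G h = rng G k \<Longrightarrow>
    c (g, h \<cdot> k) * c (h, k) = c (g \<cdot> h, k) * c (g, h)"
  using cocycle unfolding cocycle2_def composable_iff by blast

lemma cocycle_inv: assumes "g \<in> arrows G" shows "c (g, ginv G g) = c (ginv G g, g)"
  using cocycle_eq[of g "ginv G g" g] assms by (simp add: grp cocycle_src cocycle_rng)

lemma cocycle_inv_mul:
  assumes "g \<in> arrows G" "h \<in> arrows G" "src G g = rng G h"
  shows "c (ginv G g, g \<cdot> h) * c (g, h) = c (g, ginv G g)"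
  using cocycle_eq[of "ginv G g" g h] assms by (simp add: grp cocycle_rng cocycle_inv)

text \<open>All source fibres are treated at once: entries between different fibres are 0, so a
  bound for this matrix is a bound uniform in the unit.\<close>

definition ker :: "('a \<Rightarrow> complex) \<Rightarrow> 'a \<Rightarrow> 'a \<Rightarrow> complex" where
  "ker f \<alpha> \<beta> = (if \<alpha> \<in> arrows G \<and> \<beta> \<in> arrows G \<and> src G \<alpha> = src G \<beta>
    then f (\<alpha> \<cdot> ginv G \<beta>) * c (\<alpha> \<cdot> ginv G \<beta>, \<beta>) else 0)"

text \<open>Finiteness over source fibres gives finite columns of the matrix, finiteness over range
  fibres finite rows. A convolution is then a finite sum whichever factor has the property.\<close>

definition fibre_finite :: "('a \<Rightarrow> complex) \<Rightarrow> bool" where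
  "fibre_finite f \<longleftrightarrow> (\<forall>u. finite {g \<in> arrows G. f g \<noteq> 0 \<and> src G g = u} \<and>
    finite {g \<in> arrows G. f g \<noteq> 0 \<and> rng G g = u})"

lemma fibre_finite_mono:
  assumes "fibre_finite f" "\<And>g. h g \<noteq> 0 \<Longrightarrow> f g \<noteq> 0" shows "fibre_finite h"
  unfolding fibre_finite_def
proof (intro allI conjI)
  fix u
  have fin: "finite {g \<in> arrows G. f g \<noteq> 0 \<and> src G g = u}" "finite {g \<in> arrows G. f g \<noteq> 0 \<and> rng G g = u}"
    using assms(1) by (auto simp: fibre_finite_def)
  show "finite {g \<in> arrows G. h g \<noteq> 0 \<and> src G g = u}"
    by (rule finite_subset[OF _ fin(1)]) (use assms(2) in blast)
  show "finite {g \<in> arrows G. h g \<noteq> 0 \<and> rng G g = u}"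
    by (rule finite_subset[OF _ fin(2)]) (use assms(2) in blast)
qed

lemma ker_src: "g \<in> arrows G \<Longrightarrow> ker f g (src G g) = f g"
  by (simp add: ker_def grp cocycle_src)

lemma ker_nonzero: "ker f \<alpha> \<beta> \<noteq> 0 \<longleftrightarrow>
    \<alpha> \<in> arrows G \<and> \<beta> \<in> arrows G \<and> src G \<alpha> = src G \<beta> \<and> f (\<alpha> \<cdot> ginv G \<beta>) \<noteq> 0"
  by (auto simp: ker_def cocycle_nonzero grp)

lemma finite_column_ker: assumes "fibre_finite f" shows "finite {\<alpha>. ker f \<alpha> \<beta> \<noteq> 0}"
proof (rule finite_surj)
  show "finite {g \<in> arrows G. f g \<noteq> 0 \<and> src G g = rng G \<beta>}" using assms by (simp add: fibre_finite_def)
  show "{\<alpha>. ker f \<alpha> \<beta> \<noteq> 0} \<subseteq> (\<lambda>\<delta>. \<delta> \<cdot> \<beta>) ` {g \<in> arrows G. f g \<noteq> 0 \<and> src G g = rng G \<beta>}"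
  proof
    fix \<alpha> assume "\<alpha> \<in> {\<alpha>. ker f \<alpha> \<beta> \<noteq> 0}"
    then have a: "\<alpha> \<in> arrows G" "\<beta> \<in> arrows G" "src G \<alpha> = src G \<beta>" "f (\<alpha> \<cdot> ginv G \<beta>) \<noteq> 0"
      by (auto simp: ker_nonzero)
    then have "\<alpha> = (\<alpha> \<cdot> ginv G \<beta>) \<cdot> \<beta>" using mul_src_self[of \<alpha>] by (simp add: grp)
    then show "\<alpha> \<in> (\<lambda>\<delta>. \<delta> \<cdot> \<beta>) ` {g \<in> arrows G. f g \<noteq> 0 \<and> src G g = rng G \<beta>}"
      by (rule image_eqI) (use a in \<open>auto simp: grp\<close>)
  qed
qed

lemma finite_row_ker: assumes "fibre_finite f" shows "finite {\<beta>. ker f \<alpha> \<beta> \<noteq> 0}"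
proof (rule finite_surj)
  show "finite {g \<in> arrows G. f g \<noteq> 0 \<and> rng G g = rng G \<alpha>}" using assms by (simp add: fibre_finite_def)
  show "{\<beta>. ker f \<alpha> \<beta> \<noteq> 0} \<subseteq> (\<lambda>\<delta>. ginv G \<delta> \<cdot> \<alpha>) ` {g \<in> arrows G. f g \<noteq> 0 \<and> rng G g = rng G \<alpha>}"
  proof
    fix \<beta> assume "\<beta> \<in> {\<beta>. ker f \<alpha> \<beta> \<noteq> 0}"
    then have a: "\<alpha> \<in> arrows G" "\<beta> \<in> arrows G" "src G \<alpha> = src G \<beta>" "f (\<alpha> \<cdot> ginv G \<beta>) \<noteq> 0"
      by (auto simp: ker_nonzero)
    then have "\<beta> = ginv G (\<alpha> \<cdot> ginv G \<beta>) \<cdot> \<alpha>" using mul_src_self[of \<beta>] by (simp add: grp)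
    then show "\<beta> \<in> (\<lambda>\<delta>. ginv G \<delta> \<cdot> \<alpha>) ` {g \<in> arrows G. f g \<noteq> 0 \<and> rng G g = rng G \<alpha>}"
      by (rule image_eqI) (use a in \<open>auto simp: grp\<close>)
  qed
qed

lemma column_finite_ker: "fibre_finite f \<Longrightarrow> column_finite (ker f)"
  by (simp add: column_finite_def finite_column_ker)

text \<open>Substituting \<beta> for the inverse of \<eta> turns the convolution into the matrix of
  \<open>f\<close> applied to \<open>h\<close>. Any finite \<open>T\<close> containing the nonzero
  terms is allowed, so each application can choose its own.\<close>

lemma conv_ker:
  assumes \<gamma>: "\<gamma> \<in> arrows G" and T: "finite T" "\<And>\<beta>. \<beta> \<notin> T \<Longrightarrow> ker f \<gamma> \<beta> * h \<beta> = 0"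
  shows "conv G c f h \<gamma> = (\<Sum>\<beta>\<in>T. ker f \<gamma> \<beta> * h \<beta>)"
proof -
  let ?u = "src G \<gamma>"
  let ?t = "\<lambda>\<eta>. f (\<gamma> \<cdot> \<eta>) * h (ginv G \<eta>) * c (\<gamma> \<cdot> \<eta>, ginv G \<eta>)"
  have bij: "bij_betw (ginv G) (src_fibre G ?u) (rng_fibre G ?u)"
    by (rule bij_betw_byWitness[of _ "ginv G"]) (auto simp: src_fibre_def rng_fibre_def grp)
  have "conv G c f h \<gamma> = (\<Sum>\<^sub>\<infinity>\<eta>\<in>rng_fibre G ?u. ?t \<eta>)"
    using \<gamma> by (simp add: conv_def)
  also have "\<dots> = (\<Sum>\<^sub>\<infinity>\<beta>\<in>src_fibre G ?u. ?t (ginv G \<beta>))"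
    by (rule infsum_reindex_bij_betw[OF bij, symmetric])
  also have "\<dots> = (\<Sum>\<^sub>\<infinity>\<beta>\<in>T. ker f \<gamma> \<beta> * h \<beta>)"
  proof (rule infsum_cong_neutral)
    fix \<beta>
    show "?t (ginv G \<beta>) = 0" if "\<beta> \<in> src_fibre G ?u - T"
      using T(2)[of \<beta>] that \<gamma> by (auto simp: src_fibre_def ker_def grp)
    show "ker f \<gamma> \<beta> * h \<beta> = 0" if "\<beta> \<in> T - src_fibre G ?u"
      using that \<gamma> by (auto simp: src_fibre_def ker_def)
    show "?t (ginv G \<beta>) = ker f \<gamma> \<beta> * h \<beta>" if "\<beta> \<in> src_fibre G ?u \<inter> T"
      using that \<gamma> by (auto simp: src_fibre_def ker_def grp)
  qed
  also have "\<dots> = (\<Sum>\<beta>\<in>T. ker f \<gamma> \<beta> * h \<beta>)" using T(1) by simp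
  finally show ?thesis .
qed

lemma conv_outside: "\<gamma> \<notin> arrows G \<Longrightarrow> conv G c f h \<gamma> = 0"
  by (simp add: conv_def)

lemma conv_ker_right:
  assumes "fibre_finite h" "\<gamma> \<in> arrows G"
  shows "conv G c f h \<gamma> = (\<Sum>\<beta> | \<beta> \<in> arrows G \<and> h \<beta> \<noteq> 0 \<and> src G \<beta> = src G \<gamma>. ker f \<gamma> \<beta> * h \<beta>)"
proof (rule conv_ker[OF assms(2)])
  show "finite {\<beta>. \<beta> \<in> arrows G \<and> h \<beta> \<noteq> 0 \<and> src G \<beta> = src G \<gamma>}"
    using assms(1) by (simp add: fibre_finite_def)
qed (auto simp: ker_def)

lemma conv_ker_left:
  assumes "fibre_finite f" "\<gamma> \<in> arrows G"
  shows "conv G c f h \<gamma> = (\<Sum>\<beta> | ker f \<gamma> \<beta> \<noteq> 0. ker f \<gamma> \<beta> * h \<beta>)"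
  by (rule conv_ker[OF assms(2) finite_row_ker[OF assms(1)]]) auto

text \<open>Put \<kappa> = \<delta> \<beta> in the matrix product. With \<gamma> = \<alpha>
  \<beta>^{-1}, the phases agree by the cocycle identity for the triple \<gamma> \<delta>^{-1},
  \<delta>, \<beta>.\<close>

lemma ker_conv:
  assumes h: "fibre_finite h"
  shows "ker (conv G c f h) = kernel_mult (ker f) (ker h)"
proof (intro ext)
  fix \<alpha> \<beta>
  show "ker (conv G c f h) \<alpha> \<beta> = kernel_mult (ker f) (ker h) \<alpha> \<beta>"
  proof (cases "\<alpha> \<in> arrows G \<and> \<beta> \<in> arrows G \<and> src G \<alpha> = src G \<beta>")
    case True
    let ?\<gamma> = "\<alpha> \<cdot> ginv G \<beta>"
    have "ker (conv G c f h) \<alpha> \<beta>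
        = (\<Sum>\<delta> | \<delta> \<in> arrows G \<and> h \<delta> \<noteq> 0 \<and> src G \<delta> = src G ?\<gamma>. ker f ?\<gamma> \<delta> * h \<delta>) * c (?\<gamma>, \<beta>)"
      using True conv_ker_right[OF h, of ?\<gamma> f] by (simp add: ker_def[of "conv G c f h"] grp)
    also have "\<dots> = (\<Sum>\<delta> | \<delta> \<in> arrows G \<and> h \<delta> \<noteq> 0 \<and> src G \<delta> = src G ?\<gamma>. ker f ?\<gamma> \<delta> * h \<delta> * c (?\<gamma>, \<beta>))"
      by (simp add: sum_distrib_right)
    also have "\<dots> = (\<Sum>\<kappa> | ker h \<kappa> \<beta> \<noteq> 0. ker f \<alpha> \<kappa> * ker h \<kappa> \<beta>)"
    proof (rule sum.reindex_bij_witness[of _ "\<lambda>\<kappa>. \<kappa> \<cdot> ginv G \<beta>" "\<lambda>\<delta>. \<delta> \<cdot> \<beta>"])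
      fix \<delta> assume "\<delta> \<in> {\<delta>. \<delta> \<in> arrows G \<and> h \<delta> \<noteq> 0 \<and> src G \<delta> = src G ?\<gamma>}"
      then have d: "\<delta> \<in> arrows G" "h \<delta> \<noteq> 0" "src G \<delta> = rng G \<beta>" using True by (auto simp: grp)
      show e: "\<delta> \<cdot> \<beta> \<cdot> ginv G \<beta> = \<delta>" using d True mul_src_self[of \<delta>] by (simp add: grp)
      then show "\<delta> \<cdot> \<beta> \<in> {\<kappa>. ker h \<kappa> \<beta> \<noteq> 0}"
        using d True by (auto simp: ker_nonzero grp)
      have "ker h (\<delta> \<cdot> \<beta>) \<beta> = h \<delta> * c (\<delta>, \<beta>)"
        using d True e by (simp add: ker_def src_mul mul_arrow)
      moreover have "ker f \<alpha> (\<delta> \<cdot> \<beta>) = f (?\<gamma> \<cdot> ginv G \<delta>) * c (?\<gamma> \<cdot> ginv G \<delta>, \<delta> \<cdot> \<beta>)"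
        using d True by (simp add: ker_def grp)
      moreover have "ker f ?\<gamma> \<delta> = f (?\<gamma> \<cdot> ginv G \<delta>) * c (?\<gamma> \<cdot> ginv G \<delta>, \<delta>)"
        using d True by (simp add: ker_def src_mul rng_mul mul_arrow grp)
      moreover have "c (?\<gamma> \<cdot> ginv G \<delta>, \<delta> \<cdot> \<beta>) * c (\<delta>, \<beta>) = c (?\<gamma>, \<beta>) * c (?\<gamma> \<cdot> ginv G \<delta>, \<delta>)"
        using cocycle_eq[of "?\<gamma> \<cdot> ginv G \<delta>" \<delta> \<beta>] d True mul_src_self[of "ginv G \<beta>"]
        by (simp add: grp)
      ultimately show "ker f \<alpha> (\<delta> \<cdot> \<beta>) * ker h (\<delta> \<cdot> \<beta>) \<beta> = ker f ?\<gamma> \<delta> * h \<delta> * c (?\<gamma>, \<beta>)"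
        by (simp add: algebra_simps)
    next
      fix \<kappa> assume "\<kappa> \<in> {\<kappa>. ker h \<kappa> \<beta> \<noteq> 0}"
      then have k: "\<kappa> \<in> arrows G" "src G \<kappa> = src G \<beta>" "h (\<kappa> \<cdot> ginv G \<beta>) \<noteq> 0"
        by (auto simp: ker_nonzero)
      show "\<kappa> \<cdot> ginv G \<beta> \<cdot> \<beta> = \<kappa>" using k True mul_src_self[of \<kappa>] by (simp add: grp)
      show "\<kappa> \<cdot> ginv G \<beta> \<in> {\<delta>. \<delta> \<in> arrows G \<and> h \<delta> \<noteq> 0 \<and> src G \<delta> = src G ?\<gamma>}"
        using k True by (simp add: grp)
    qed
    finally show ?thesis by (simp add: kernel_mult_def)
  next
    case False
    then have z: "ker f \<alpha> \<kappa> * ker h \<kappa> \<beta> = 0" for \<kappa> by (auto simp: ker_def)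
    have "ker (conv G c f h) \<alpha> \<beta> = 0" using False by (auto simp: ker_def)
    moreover have "kernel_mult (ker f) (ker h) \<alpha> \<beta> = 0"
      unfolding kernel_mult_def by (rule sum.neutral) (simp add: z del: mult_eq_0_iff)
    ultimately show ?thesis by simp
  qed
qed

text \<open>For \<alpha> = g \<beta>, the cocycle identity for g^{-1}, g, \<beta> gives c(g^{-1},
  \<alpha>) c(g, \<beta>) = c(g, g^{-1}). This is where the factor c(\<gamma>, \<gamma>^{-1}) in the
  involution comes from.\<close>

lemma ker_conv_star: "ker (conv_star G c f) = kernel_adj (ker f)"
proof (intro ext)
  fix \<alpha> \<beta>
  show "ker (conv_star G c f) \<alpha> \<beta> = kernel_adj (ker f) \<alpha> \<beta>"
  proof (cases "\<alpha> \<in> arrows G \<and> \<beta> \<in> arrows G \<and> src G \<alpha> = src G \<beta>")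
    case True
    define g where "g = \<alpha> \<cdot> ginv G \<beta>"
    have g: "g \<in> arrows G" "src G g = rng G \<beta>" using True by (auto simp: g_def grp)
    have a: "\<alpha> = g \<cdot> \<beta>" using True mul_src_self[of \<alpha>] by (simp add: g_def grp)
    have ig: "\<beta> \<cdot> ginv G \<alpha> = ginv G g" using True by (simp add: g_def grp)
    have "c (ginv G g, \<alpha>) * c (g, \<beta>) = c (g, ginv G g)"
      using cocycle_inv_mul[of g \<beta>] g True a by simp
    then have "cnj (c (g, ginv G g)) * c (g, \<beta>) = cnj (c (ginv G g, \<alpha>)) * (cnj (c (g, \<beta>)) * c (g, \<beta>))"
      by (metis complex_cnj_mult mult.assoc)
    also have "cnj (c (g, \<beta>)) * c (g, \<beta>) = 1"
      using cocycle_norm[of g \<beta>] g True complex_norm_square[of "c (g, \<beta>)"] by (simp add: mult.commute)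
    finally have "cnj (c (g, ginv G g)) * c (g, \<beta>) = cnj (c (ginv G g, \<alpha>))" by simp
    then show ?thesis
      using True g ig by (simp add: ker_def kernel_adj_def conv_star_def flip: g_def)
  qed (auto simp: ker_def kernel_adj_def)
qed

lemma ker_inject:
  assumes "\<And>g. g \<notin> arrows G \<Longrightarrow> f g = 0" "\<And>g. g \<notin> arrows G \<Longrightarrow> h g = 0" "ker f = ker h"
  shows "f = h"
  using assms by (metis ext ker_src)

lemma ker_add: "ker (\<lambda>g. f g + h g) = (\<lambda>\<alpha> \<beta>. ker f \<alpha> \<beta> + ker h \<alpha> \<beta>)"
  by (auto simp: ker_def fun_eq_iff algebra_simps)

lemma ker_scale: "ker (\<lambda>g. a * f g) = (\<lambda>\<alpha> \<beta>. a * ker f \<alpha> \<beta>)"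
  by (auto simp: ker_def fun_eq_iff algebra_simps)

section \<open>The reduced norm as a matrix norm\<close>

definition bounded_function :: "('a \<Rightarrow> complex) \<Rightarrow> bool" where
  "bounded_function f \<longleftrightarrow> fibre_finite f \<and> (\<exists>M\<ge>0. kernel_bounded (ker f) M)"

lemma ell2_conv_le:
  assumes f: "fibre_finite f" and b: "kernel_bounded (ker f) M" and M: "0 \<le> M"
    and xi: "\<xi> \<in> ell2 (src_fibre G u)" "ell2_norm (src_fibre G u) \<xi> = 1"
  shows "(\<lambda>g. (cmod (conv G c f \<xi> g))\<^sup>2) summable_on src_fibre G u"
    and "ell2_norm (src_fibre G u) (conv G c f \<xi>) \<le> M"
proof -
  let ?X = "src_fibre G u"
  have fin: "(\<Sum>\<alpha>\<in>F. (cmod (conv G c f \<xi> \<alpha>))\<^sup>2) \<le> M\<^sup>2" if F: "finite F" "F \<subseteq> ?X" for F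
  proof -
    \<comment> \<open>Rows are finite, so finitely many outputs see finitely many coordinates of
      \<xi>; this reduces the estimate to a finite section of the matrix.\<close>
    define E where "E = (\<Union>\<alpha>\<in>F. {\<beta>. ker f \<alpha> \<beta> \<noteq> 0})"
    have E: "finite E" using F finite_row_ker[OF f] by (auto simp: E_def)
    have EX: "E \<subseteq> ?X" using F(2) by (auto simp: E_def ker_nonzero src_fibre_def)
    have "(\<Sum>\<alpha>\<in>F. (cmod (conv G c f \<xi> \<alpha>))\<^sup>2) = (\<Sum>\<alpha>\<in>F. (cmod (\<Sum>\<beta>\<in>E. ker f \<alpha> \<beta> * \<xi> \<beta>))\<^sup>2)"
    proof (rule sum.cong[OF refl])
      fix \<alpha> assume "\<alpha> \<in> F"
      then have "conv G c f \<xi> \<alpha> = (\<Sum>\<beta>\<in>E. ker f \<alpha> \<beta> * \<xi> \<beta>)"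
        using F(2) E by (intro conv_ker) (auto simp: E_def src_fibre_def)
      then show "(cmod (conv G c f \<xi> \<alpha>))\<^sup>2 = (cmod (\<Sum>\<beta>\<in>E. ker f \<alpha> \<beta> * \<xi> \<beta>))\<^sup>2" by simp
    qed
    also have "\<dots> \<le> M\<^sup>2 * (\<Sum>\<beta>\<in>E. (cmod (\<xi> \<beta>))\<^sup>2)" by (rule kernel_boundedD_sq[OF b F(1) E])
    also have "(\<Sum>\<beta>\<in>E. (cmod (\<xi> \<beta>))\<^sup>2) \<le> (\<Sum>\<^sub>\<infinity>g\<in>?X. (cmod (\<xi> g))\<^sup>2)"
      by (rule finite_sum_le_infsum) (use xi E EX in \<open>auto simp: ell2_def\<close>)
    also have "\<dots> = 1"
      using xi(2) unfolding ell2_norm_def by (simp add: real_sqrt_eq_1_iff)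
    finally show ?thesis by (simp add: mult_left_mono)
  qed
  show s: "(\<lambda>g. (cmod (conv G c f \<xi> g))\<^sup>2) summable_on ?X"
    by (rule nonneg_bdd_above_summable_on) (use fin in \<open>auto intro!: bdd_aboveI[of _ "M\<^sup>2"]\<close>)
  have "(\<Sum>\<^sub>\<infinity>g\<in>?X. (cmod (conv G c f \<xi> g))\<^sup>2) \<le> M\<^sup>2"
    by (rule infsum_le_finite_sums[OF s]) (use fin in auto)
  then show "ell2_norm ?X (conv G c f \<xi>) \<le> M"
    unfolding ell2_norm_def using M real_le_lsqrt by simp
qed

lemma reduced_norm_le:
  assumes "fibre_finite f" "kernel_bounded (ker f) M" "0 \<le> M"
  shows "reduced_norm G c f \<le> M"
  unfolding reduced_norm_def
  by (rule cSup_least) (use ell2_conv_le(2)[OF assms] assms(3) in auto)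

lemma reduced_norm_bdd:
  assumes "bounded_function f"
  shows "bdd_above (insert 0 {ell2_norm (src_fibre G u) (conv G c f \<xi>) | u \<xi>.
    u \<in> units G \<and> \<xi> \<in> ell2 (src_fibre G u) \<and> ell2_norm (src_fibre G u) \<xi> = 1})"
proof -
  obtain M where "fibre_finite f" "kernel_bounded (ker f) M" "0 \<le> M"
    using assms by (auto simp: bounded_function_def)
  then show ?thesis using ell2_conv_le(2)[of f M] by (intro bdd_aboveI[of _ M]) auto
qed

lemma reduced_norm_nonneg: "bounded_function f \<Longrightarrow> 0 \<le> reduced_norm G c f"
  unfolding reduced_norm_def by (rule cSup_upper[OF _ reduced_norm_bdd]) auto

text \<open>Converse to \<open>reduced_norm_le\<close>: together they identify the reduced norm as
  the least bound of the matrix. Being a supremum over single fibres, it controls each diagonal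
  block with respect to the source, and the blocks suffice.\<close>

lemma kernel_bounded_reduced_norm:
  assumes bf: "bounded_function f"
  shows "kernel_bounded (ker f) (reduced_norm G c f)"
proof (rule kernel_bounded_blocks[of _ "src G"])
  let ?R = "reduced_norm G c f"
  show R: "0 \<le> ?R" by (rule reduced_norm_nonneg[OF bf])
  show "ker f \<alpha> \<beta> = 0" if "src G \<alpha> \<noteq> src G \<beta>" for \<alpha> \<beta> using that by (simp add: ker_def)
  fix u
  obtain M where f: "fibre_finite f" and M: "kernel_bounded (ker f) M" "0 \<le> M"
    using bf by (auto simp: bounded_function_def)
  let ?X = "src_fibre G u"
  show "kernel_bounded (\<lambda>\<alpha> \<beta>. if src G \<alpha> = u \<and> src G \<beta> = u then ker f \<alpha> \<beta> else 0) ?R"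
  proof (rule kernel_boundedI_sq[OF R])
    fix F E :: "'a set" and \<xi> :: "'a \<Rightarrow> complex"
    assume fin: "finite F" "finite E"
    define z where "z = (\<lambda>g. if g \<in> E \<inter> ?X then \<xi> g else 0)"
    define n where "n = sqrt (\<Sum>g\<in>E \<inter> ?X. (cmod (\<xi> g))\<^sup>2)"
    have n2: "n\<^sup>2 = (\<Sum>g\<in>E \<inter> ?X. (cmod (\<xi> g))\<^sup>2)" by (simp add: n_def sum_nonneg)
    have le: "n\<^sup>2 \<le> (\<Sum>g\<in>E. (cmod (\<xi> g))\<^sup>2)" unfolding n2 by (rule sum_mono2) (use fin in auto)
    let ?L = "\<lambda>\<alpha>. \<Sum>\<beta>\<in>E. (if src G \<alpha> = u \<and> src G \<beta> = u then ker f \<alpha> \<beta> else 0) * \<xi> \<beta>"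
    have L: "?L \<alpha> = (\<Sum>\<beta>\<in>E \<inter> ?X. ker f \<alpha> \<beta> * z \<beta>)" if "\<alpha> \<in> ?X" for \<alpha>
      by (rule sum.mono_neutral_cong_right) (use fin that in \<open>auto simp: z_def src_fibre_def ker_def\<close>)
    have L0: "?L \<alpha> = 0" if "\<alpha> \<notin> ?X" for \<alpha>
      by (rule sum.neutral) (use that in \<open>auto simp: src_fibre_def ker_def\<close>)
    have "(\<Sum>\<alpha>\<in>F. (cmod (?L \<alpha>))\<^sup>2) = (\<Sum>\<alpha>\<in>F \<inter> ?X. (cmod (\<Sum>\<beta>\<in>E \<inter> ?X. ker f \<alpha> \<beta> * z \<beta>))\<^sup>2)"
      by (rule sum.mono_neutral_cong_right) (use fin L L0 in auto)
    also have "\<dots> \<le> ?R\<^sup>2 * n\<^sup>2"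
    \<comment> \<open>The supremum tests unit vectors over units only, so a vanishing vector and an
      empty fibre are set apart before \<xi> is normalized.\<close>
    proof (cases "n = 0 \<or> u \<notin> units G")
      case True
      have "z \<beta> = 0" for \<beta>
      proof (cases "n = 0")
        case True
        then have "\<forall>g\<in>E \<inter> ?X. (cmod (\<xi> g))\<^sup>2 = 0"
          using n2 fin by (subst sum_nonneg_eq_0_iff[symmetric]) auto
        then show ?thesis by (auto simp: z_def)
      next
        case False
        then have "?X = {}" using True src_unit by (auto simp: src_fibre_def)
        then show ?thesis by (simp add: z_def)
      qed
      then show ?thesis by simp
    next
      case False
      have n0: "n > 0" using False by (simp add: n_def sum_nonneg order_less_le)
      define w where "w = (\<lambda>g. z g / of_real n)"
      have zs: "((\<lambda>g. (cmod (w g))\<^sup>2) has_sum (\<Sum>g\<in>E \<inter> ?X. (cmod (w g))\<^sup>2)) ?X"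
        by (rule has_sum_finite_neutralI[of "E \<inter> ?X"]) (use fin in \<open>auto simp: w_def z_def\<close>)
      have w1: "(\<Sum>g\<in>E \<inter> ?X. (cmod (w g))\<^sup>2) = 1"
      proof -
        have "(\<Sum>g\<in>E \<inter> ?X. (cmod (w g))\<^sup>2) = (\<Sum>g\<in>E \<inter> ?X. (cmod (\<xi> g))\<^sup>2 / n\<^sup>2)"
          by (rule sum.cong) (auto simp: w_def z_def norm_divide power_divide)
        also have "\<dots> = n\<^sup>2 / n\<^sup>2" by (simp add: n2 flip: sum_divide_distrib)
        finally show ?thesis using n0 by simp
      qed
      have w: "w \<in> ell2 ?X" "ell2_norm ?X w = 1"
        using zs w1 infsumI[OF zs] by (auto simp: ell2_def ell2_norm_def w_def z_def summable_on_def)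
      have "ell2_norm ?X (conv G c f w) \<le> ?R"
        unfolding reduced_norm_def by (rule cSup_upper[OF _ reduced_norm_bdd[OF bf]]) (use w False in blast)
      then have "(ell2_norm ?X (conv G c f w))\<^sup>2 \<le> ?R\<^sup>2"
        by (rule power_mono) (simp add: ell2_norm_def infsum_nonneg)
      moreover have "(\<Sum>\<alpha>\<in>F \<inter> ?X. (cmod (conv G c f w \<alpha>))\<^sup>2) \<le> (ell2_norm ?X (conv G c f w))\<^sup>2"
        using finite_sum_le_infsum[OF ell2_conv_le(1)[OF f M w], of "F \<inter> ?X"] fin
        by (simp add: ell2_norm_def infsum_nonneg)
      ultimately have "(\<Sum>\<alpha>\<in>F \<inter> ?X. (cmod (conv G c f w \<alpha>))\<^sup>2) * n\<^sup>2 \<le> ?R\<^sup>2 * n\<^sup>2"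
        by (intro mult_right_mono) auto
      moreover have "(cmod (conv G c f w \<alpha>))\<^sup>2 * n\<^sup>2 = (cmod (\<Sum>\<beta>\<in>E \<inter> ?X. ker f \<alpha> \<beta> * z \<beta>))\<^sup>2"
        if "\<alpha> \<in> ?X" for \<alpha>
      proof -
        have "conv G c f w \<alpha> = (\<Sum>\<beta>\<in>E \<inter> ?X. ker f \<alpha> \<beta> * w \<beta>)"
          by (rule conv_ker) (use that fin in \<open>auto simp: src_fibre_def w_def z_def\<close>)
        also have "\<dots> = (\<Sum>\<beta>\<in>E \<inter> ?X. ker f \<alpha> \<beta> * z \<beta>) / of_real n"
          by (simp add: w_def sum_divide_distrib)
        finally show ?thesis using n0 by (simp add: norm_divide power_divide)
      qed
      ultimately show ?thesis by (simp add: sum_distrib_right)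
    qed
    also have "\<dots> \<le> ?R\<^sup>2 * (\<Sum>\<beta>\<in>E. (cmod (\<xi> \<beta>))\<^sup>2)" using le by (intro mult_left_mono) auto
    finally show "(\<Sum>\<alpha>\<in>F. (cmod (?L \<alpha>))\<^sup>2) \<le> ?R\<^sup>2 * (\<Sum>\<beta>\<in>E. (cmod (\<xi> \<beta>))\<^sup>2)" .
  qed
qed

text \<open>Right translation by \<open>g\<close> carries the fibre over its range to the fibre over
  its source. With s = \<alpha> g^{-1} and t = \<beta> g^{-1}, the cocycle identity for s t^{-1}, t,
  g shows that the matrix changes only by phases.\<close>

lemma ker_translate:
  assumes a: "\<alpha> \<in> arrows G" "\<beta> \<in> arrows G" "g \<in> arrows G" "src G \<alpha> = src G g" "src G \<beta> = src G g"
  shows "ker f \<alpha> \<beta> = c (\<alpha> \<cdot> ginv G g, g) * ker f (\<alpha> \<cdot> ginv G g) (\<beta> \<cdot> ginv G g) * cnj (c (\<beta> \<cdot> ginv G g, g))"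
proof -
  define s t where "s = \<alpha> \<cdot> ginv G g" and "t = \<beta> \<cdot> ginv G g"
  have st: "s \<in> arrows G" "t \<in> arrows G" "src G s = rng G g" "src G t = rng G g"
    using a by (simp_all add: s_def t_def grp)
  have ab: "s \<cdot> g = \<alpha>" "t \<cdot> g = \<beta>"
    using a mul_src_self[of \<alpha>] mul_src_self[of \<beta>] by (simp_all add: s_def t_def grp)
  have q: "\<alpha> \<cdot> ginv G \<beta> = s \<cdot> ginv G t" using st a unfolding ab[symmetric] by (simp add: grp)
  have "c (s \<cdot> ginv G t, \<beta>) * c (t, g) = c (s, g) * c (s \<cdot> ginv G t, t)"
    using cocycle_eq[of "s \<cdot> ginv G t" t g] st a mul_src_self[of s] ab by (simp add: grp)
  moreover have "c (t, g) * cnj (c (t, g)) = 1"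
    using cocycle_norm[of t g] st a complex_norm_square[of "c (t, g)"] by simp
  ultimately have "c (s \<cdot> ginv G t, \<beta>) = c (s, g) * c (s \<cdot> ginv G t, t) * cnj (c (t, g))"
    by (metis mult.assoc mult.right_neutral)
  moreover have "ker f \<alpha> \<beta> = f (s \<cdot> ginv G t) * c (s \<cdot> ginv G t, \<beta>)"
    unfolding q[symmetric] using a by (simp add: ker_def)
  moreover have "ker f s t = f (s \<cdot> ginv G t) * c (s \<cdot> ginv G t, t)"
    using st by (simp add: ker_def)
  ultimately have "ker f \<alpha> \<beta> = c (s, g) * ker f s t * cnj (c (t, g))" by (simp add: mult_ac)
  then show ?thesis by (simp only: s_def t_def)
qed

text \<open>The column of the matrix at a unit is the function itself on that source fibre, where
  the phases are 1. Convergence in norm thus implies pointwise convergence.\<close>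

lemma norm_le_reduced_norm:
  assumes "bounded_function f" "g \<in> arrows G" shows "cmod (f g) \<le> reduced_norm G c f"
  using kernel_bounded_column[OF kernel_bounded_reduced_norm[OF assms(1)], of "{g}" "src G g"] assms(2)
  by (simp add: ker_src)

lemma L2_source_fibre_le:
  assumes "bounded_function f" "finite F" "F \<subseteq> src_fibre G u"
  shows "L2_set (\<lambda>g. cmod (f g)) F \<le> reduced_norm G c f"
proof -
  have "L2_set (\<lambda>g. cmod (f g)) F = L2_set (\<lambda>g. cmod (ker f g u)) F"
  proof (rule L2_set_cong[OF refl])
    fix g assume "g \<in> F"
    then have "g \<in> arrows G" "src G g = u" using assms(3) by (auto simp: src_fibre_def)
    then show "cmod (f g) = cmod (ker f g u)" using ker_src[of g f] by simp
  qed
  then show ?thesis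
    using kernel_bounded_column[OF kernel_bounded_reduced_norm[OF assms(1)] assms(2), of u] by simp
qed

lemma kernel_bounded_conv:
  assumes "bounded_function f" "bounded_function h"
  shows "kernel_bounded (ker (conv G c f h)) (reduced_norm G c f * reduced_norm G c h)"
proof -
  have h: "fibre_finite h" using assms(2) by (simp add: bounded_function_def)
  show ?thesis
    unfolding ker_conv[OF h]
    by (intro kernel_bounded_mult kernel_bounded_reduced_norm column_finite_ker reduced_norm_nonneg assms h)
qed

lemma conv_star_self_unit:
  assumes f: "fibre_finite f" and u: "u \<in> units G"
  shows "conv G c (conv_star G c f) f u
    = of_real (\<Sum>g | g \<in> arrows G \<and> f g \<noteq> 0 \<and> src G g = u. (cmod (f g))\<^sup>2)"
proof -
  have uu: "u \<in> arrows G" "src G u = u" using u by (auto simp: units_iff)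
  have "conv G c (conv_star G c f) f u
      = (\<Sum>\<beta> | \<beta> \<in> arrows G \<and> f \<beta> \<noteq> 0 \<and> src G \<beta> = u. ker (conv_star G c f) u \<beta> * f \<beta>)"
    using conv_ker_right[OF f uu(1)] uu by simp
  also have "\<dots> = (\<Sum>\<beta> | \<beta> \<in> arrows G \<and> f \<beta> \<noteq> 0 \<and> src G \<beta> = u. of_real ((cmod (f \<beta>))\<^sup>2))"
  proof (rule sum.cong[OF refl])
    fix \<beta> assume "\<beta> \<in> {\<beta>. \<beta> \<in> arrows G \<and> f \<beta> \<noteq> 0 \<and> src G \<beta> = u}"
    then have "ker (conv_star G c f) u \<beta> = cnj (f \<beta>)"
      using ker_src[of \<beta> f] by (auto simp: ker_conv_star kernel_adj_def)
    then show "ker (conv_star G c f) u \<beta> * f \<beta> = of_real ((cmod (f \<beta>))\<^sup>2)"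
      by (simp only: complex_norm_square mult.commute)
  qed
  finally show ?thesis by simp
qed

text \<open>The matrix of \<open>f n\<close> is the entrywise limit of those of the differences
  \<open>f n - f m\<close>, whose bounds are at most e/2 for large indices. Consequently an element
  of the completion is determined by its pointwise limit function.\<close>

lemma bounded_function_limit_zero:
  assumes b: "\<And>n. bounded_function (f n)"
    and cau: "\<And>e. 0 < e \<Longrightarrow> \<exists>N. \<forall>m\<ge>N. \<forall>n\<ge>N. reduced_norm G c (\<lambda>g. f m g - f n g) < e"
    and bd: "\<And>m n. bounded_function (\<lambda>g. f m g - f n g)"
    and lim: "\<And>g. g \<in> arrows G \<Longrightarrow> (\<lambda>n. f n g) \<longlonglongrightarrow> 0"
  shows "(\<lambda>n. reduced_norm G c (f n)) \<longlonglongrightarrow> 0"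
proof (rule LIMSEQ_I)
  fix e :: real assume "0 < e"
  then have e: "0 < e / 2" by simp
  obtain N where N: "\<forall>m\<ge>N. \<forall>n\<ge>N. reduced_norm G c (\<lambda>g. f m g - f n g) < e / 2" using cau[OF e] by blast
  have "reduced_norm G c (f n) \<le> e / 2" if n: "N \<le> n" for n
  proof (rule reduced_norm_le)
    show "fibre_finite (f n)" using b by (simp add: bounded_function_def)
    show "kernel_bounded (ker (f n)) (e / 2)"
    proof (rule kernel_bounded_limit)
      fix m
      show "kernel_bounded (ker (\<lambda>g. f n g - f (m + N) g)) (e / 2)"
        by (rule kernel_bounded_mono[OF kernel_bounded_reduced_norm[OF bd]]) (use N n in \<open>simp add: less_imp_le\<close>)
    next
      fix \<alpha> \<beta>
      have "(\<lambda>m. (f n g - f (m + N) g) * a) \<longlonglongrightarrow> (f n g - 0) * a" if "g \<in> arrows G" for g a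
        using LIMSEQ_ignore_initial_segment[OF lim[OF that], of N] by (intro tendsto_intros)
      then show "(\<lambda>m. ker (\<lambda>g. f n g - f (m + N) g) \<alpha> \<beta>) \<longlonglongrightarrow> ker (f n) \<alpha> \<beta>"
        by (auto simp: ker_def grp)
    qed simp
  qed (use e in simp)
  then have "norm (reduced_norm G c (f n) - 0) < e" if "N \<le> n" for n
    using that reduced_norm_nonneg[OF b, of n] \<open>0 < e\<close> by fastforce
  then show "\<exists>N. \<forall>n\<ge>N. norm (reduced_norm G c (f n) - 0) < e" by blast
qed

end

section \<open>Restriction to a subgroupoid containing the units\<close>

locale twisted_subgroupoid = twisted_groupoid +
  fixes S :: "'a set"
  assumes subgroupoid: "subgroupoid G S" and units_subset: "units G \<subseteq> S"
begin

lemma S_arrow: "g \<in> S \<Longrightarrow> g \<in> arrows G"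
  and S_inv: "g \<in> S \<Longrightarrow> ginv G g \<in> S"
  and S_mul: "g \<in> S \<Longrightarrow> h \<in> S \<Longrightarrow> src G g = rng G h \<Longrightarrow> g \<cdot> h \<in> S"
  using subgroupoid unfolding subgroupoid_def composable_iff by blast+

text \<open>The right coset \<open>S \<alpha>\<close>: as \<open>S\<close> is closed under inverses,
  \<alpha> \<beta>^{-1} \<in> S amounts to \<beta> \<in> S \<alpha>.\<close>

definition coset :: "'a \<Rightarrow> 'a set" where
  "coset \<alpha> = {\<beta> \<in> arrows G. src G \<beta> = src G \<alpha> \<and> \<alpha> \<cdot> ginv G \<beta> \<in> S}"

lemma coset_eq_iff:
  assumes a: "\<alpha> \<in> arrows G" and b: "\<beta> \<in> arrows G" and s: "src G \<alpha> = src G \<beta>"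
  shows "coset \<alpha> = coset \<beta> \<longleftrightarrow> \<alpha> \<cdot> ginv G \<beta> \<in> S"
proof
  assume eq: "coset \<alpha> = coset \<beta>"
  have "\<beta> \<in> coset \<beta>" using b rng_unit units_subset by (auto simp: coset_def grp)
  then have "\<beta> \<in> coset \<alpha>" by (simp add: eq)
  then show "\<alpha> \<cdot> ginv G \<beta> \<in> S" by (simp add: coset_def)
next
  have *: "coset y \<subseteq> coset x"
    if x: "x \<in> arrows G" and y: "y \<in> arrows G" and s: "src G x = src G y" and xy: "x \<cdot> ginv G y \<in> S" for x y
  proof
    fix z assume z: "z \<in> coset y"
    then have zz: "z \<in> arrows G" "src G z = src G y" "y \<cdot> ginv G z \<in> S" by (auto simp: coset_def)
    have "(x \<cdot> ginv G y) \<cdot> (y \<cdot> ginv G z) \<in> S"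
      by (rule S_mul) (use xy zz x y s in \<open>simp_all add: grp\<close>)
    moreover have "(x \<cdot> ginv G y) \<cdot> (y \<cdot> ginv G z) = x \<cdot> ginv G z"
      using zz x y s by (simp add: grp)
    ultimately show "z \<in> coset x" using zz s by (simp add: coset_def)
  qed
  assume ab: "\<alpha> \<cdot> ginv G \<beta> \<in> S"
  then have "ginv G (\<alpha> \<cdot> ginv G \<beta>) \<in> S" by (rule S_inv)
  then have ba: "\<beta> \<cdot> ginv G \<alpha> \<in> S" using a b s by (simp add: grp)
  show "coset \<alpha> = coset \<beta>" using *[OF a b s ab] *[OF b a s[symmetric] ba] by blast
qed

text \<open>Within one source fibre \<alpha> \<beta>^{-1} lies in \<open>S\<close> exactly if the
  cosets agree; elsewhere both matrices vanish. Thus cutting a function off outside \<open>S\<close>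
  is a pinching of its matrix.\<close>

lemma ker_restrict:
  "ker (extend_by_zero S f) = (\<lambda>\<alpha> \<beta>. if coset \<alpha> = coset \<beta> then ker f \<alpha> \<beta> else 0)"
  by (auto simp: ker_def extend_by_zero_def fun_eq_iff coset_eq_iff)

lemma fibre_finite_restrict: "fibre_finite f \<Longrightarrow> fibre_finite (extend_by_zero S f)"
  by (erule fibre_finite_mono) (simp add: extend_by_zero_def split: if_splits)

lemma kernel_bounded_restrict:
  assumes "bounded_function f"
  shows "kernel_bounded (ker (extend_by_zero S f)) (reduced_norm G c f)"
  unfolding ker_restrict
  by (rule kernel_bounded_pinch[OF kernel_bounded_reduced_norm[OF assms] reduced_norm_nonneg[OF assms]])

lemma reduced_norm_restrict: "bounded_function f \<Longrightarrow> reduced_norm G c (extend_by_zero S f) \<le> reduced_norm G c f"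
  using kernel_bounded_restrict[of f] reduced_norm_nonneg[of f] fibre_finite_restrict
  by (intro reduced_norm_le) (auto simp: bounded_function_def)

lemma ker_restrict_outside:
  assumes "\<And>g. g \<notin> S \<Longrightarrow> f g = 0" "coset \<alpha> \<noteq> coset \<beta>"
  shows "ker f \<alpha> \<beta> = 0"
proof (rule ccontr)
  assume "ker f \<alpha> \<beta> \<noteq> 0"
  then have *: "\<alpha> \<in> arrows G" "\<beta> \<in> arrows G" "src G \<alpha> = src G \<beta>" "f (\<alpha> \<cdot> ginv G \<beta>) \<noteq> 0"
    by (auto simp: ker_nonzero)
  then have "\<alpha> \<cdot> ginv G \<beta> \<in> S" using assms(1) by blast
  then show False using coset_eq_iff[OF *(1-3)] assms(2) by simp
qed

lemma arrows_restrict: "arrows (restrict_groupoid G S) = S"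
  using S_arrow by (auto simp: arrows_def restrict_groupoid_def)

lemma restrict_simps:
  "gmul (restrict_groupoid G S) = gmul G" "ginv (restrict_groupoid G S) = ginv G"
  "src (restrict_groupoid G S) = src G" "rng (restrict_groupoid G S) = rng G"
  by (auto simp: restrict_groupoid_def src_def rng_def fun_eq_iff)

lemma composable_restrict: "composable (restrict_groupoid G S) = composable G \<inter> S \<times> S"
  using S_arrow by (auto simp: composable_def arrows_restrict restrict_simps)

lemma src_S: "g \<in> S \<Longrightarrow> src G g \<in> S" and rng_S: "g \<in> S \<Longrightarrow> rng G g \<in> S"
  using units_subset src_unit rng_unit S_arrow by blast+

lemma twisted_restrict: "twisted_groupoid (restrict_groupoid G S) c"
proof
  show "cocycle2 (restrict_groupoid G S) c"
    using cocycle S_arrow unfolding cocycle2_def composable_restrict arrows_restrict restrict_simps by blast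
qed (auto simp: arrows_restrict composable_restrict restrict_simps S_inv S_mul composable_iff grp S_arrow
    intro: mul_rng)

text \<open>One inequality is a compression to the rows and columns in \<open>S\<close>. For the
  other, translation by a representative g moves the block of its coset into \<open>S\<close>,
  because \<alpha> g^{-1} lies in \<open>S\<close> for every \<alpha> in the block.\<close>

lemma reduced_norm_restrict_groupoid:
  assumes bf: "bounded_function f" and z: "\<And>g. g \<notin> S \<Longrightarrow> f g = 0"
  shows "reduced_norm (restrict_groupoid G S) c f = reduced_norm G c f"
proof -
  interpret R: twisted_groupoid "restrict_groupoid G S" c by (rule twisted_restrict)
  have ff: "fibre_finite f" using bf by (simp add: bounded_function_def)
  have kerR: "R.ker f = (\<lambda>\<alpha> \<beta>. if \<alpha> \<in> S \<and> \<beta> \<in> S then ker f \<alpha> \<beta> else 0)"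
    using S_arrow by (auto simp: R.ker_def ker_def fun_eq_iff arrows_restrict restrict_simps)
  have kb: "kernel_bounded (R.ker f) (reduced_norm G c f)"
    unfolding kerR by (intro kernel_bounded_compress kernel_bounded_reduced_norm reduced_norm_nonneg bf)
  have ffR: "R.fibre_finite f"
    unfolding R.fibre_finite_def arrows_restrict restrict_simps
  proof (intro allI conjI)
    fix u
    have fin: "finite {g \<in> arrows G. f g \<noteq> 0 \<and> src G g = u}" "finite {g \<in> arrows G. f g \<noteq> 0 \<and> rng G g = u}"
      using ff by (auto simp: fibre_finite_def)
    show "finite {g \<in> S. f g \<noteq> 0 \<and> src G g = u}"
      by (rule finite_subset[OF _ fin(1)]) (use S_arrow in blast)
    show "finite {g \<in> S. f g \<noteq> 0 \<and> rng G g = u}"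
      by (rule finite_subset[OF _ fin(2)]) (use S_arrow in blast)
  qed
  have bfR: "R.bounded_function f"
    unfolding R.bounded_function_def using ffR kb reduced_norm_nonneg[OF bf] by blast
  let ?r = "reduced_norm (restrict_groupoid G S) c f"
  \<comment> \<open>The source is recorded beside the coset because equality of cosets is turned
    into membership in \<open>S\<close> only within one source fibre.\<close>
  define q where "q = (\<lambda>\<alpha>. (coset \<alpha>, src G \<alpha>))"
  have R0: "0 \<le> ?r" by (rule R.reduced_norm_nonneg[OF bfR])
  have "kernel_bounded (ker f) ?r"
  proof (rule kernel_bounded_blocks[OF R0, of q])
    show "ker f \<alpha> \<beta> = 0" if "q \<alpha> \<noteq> q \<beta>" for \<alpha> \<beta>
    proof (cases "coset \<alpha> = coset \<beta>")
      case True
      then show ?thesis using that by (simp add: ker_def q_def)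
    next
      case False
      with z show ?thesis by (rule ker_restrict_outside)
    qed
    fix l
    show "kernel_bounded (\<lambda>\<alpha> \<beta>. if q \<alpha> = l \<and> q \<beta> = l then ker f \<alpha> \<beta> else 0) ?r"
    proof (cases "\<exists>g\<in>arrows G. q g = l")
      case False
      then have "(\<lambda>\<alpha> \<beta>. if q \<alpha> = l \<and> q \<beta> = l then ker f \<alpha> \<beta> else 0) = (\<lambda>\<alpha> \<beta>. 0)"
        by (auto simp: fun_eq_iff ker_def)
      then show ?thesis
        using R0 by (auto intro!: kernel_boundedI simp: L2_set_def[of "\<lambda>_. 0"])
    next
      case True
      then obtain g where g: "g \<in> arrows G" "q g = l" by blast
      define P where "P = {\<alpha> \<in> arrows G. q \<alpha> = l}"
      have P: "\<alpha> \<in> arrows G \<and> \<alpha> \<cdot> ginv G g \<in> S \<and> src G \<alpha> = src G g" if "\<alpha> \<in> P" for \<alpha>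
        using that g coset_eq_iff[of \<alpha> g] by (auto simp: P_def q_def)
      show ?thesis
      proof (rule kernel_bounded_transport[OF R.kernel_bounded_reduced_norm[OF bfR] R0,
            of "\<lambda>\<alpha>. \<alpha> \<cdot> ginv G g" P "\<lambda>\<alpha>. c (\<alpha> \<cdot> ginv G g, g)" "\<lambda>\<beta>. cnj (c (\<beta> \<cdot> ginv G g, g))"])
        show "inj_on (\<lambda>\<alpha>. \<alpha> \<cdot> ginv G g) P"
        proof (rule inj_onI)
          fix x y assume xy: "x \<in> P" "y \<in> P" and eq: "x \<cdot> ginv G g = y \<cdot> ginv G g"
          note x = P[OF xy(1)] and y = P[OF xy(2)]
          have "x = (x \<cdot> ginv G g) \<cdot> g" using x g mul_src_self[of x] by (simp add: grp)
          also have "\<dots> = y" using y g mul_src_self[of y] unfolding eq by (simp add: grp)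
          finally show "x = y" .
        qed
        show le: "cmod (c (\<alpha> \<cdot> ginv G g, g)) \<le> 1" if "\<alpha> \<in> P" for \<alpha>
          using cocycle_norm[of "\<alpha> \<cdot> ginv G g" g] P[OF that] g by (simp add: grp)
        show "cmod (cnj (c (\<beta> \<cdot> ginv G g, g))) \<le> 1" if "\<beta> \<in> P" for \<beta>
          using le[OF that] by simp
        fix \<alpha> \<beta>
        show "(if q \<alpha> = l \<and> q \<beta> = l then ker f \<alpha> \<beta> else 0)
          = (if \<alpha> \<in> P \<and> \<beta> \<in> P then c (\<alpha> \<cdot> ginv G g, g) * R.ker f (\<alpha> \<cdot> ginv G g) (\<beta> \<cdot> ginv G g)
              * cnj (c (\<beta> \<cdot> ginv G g, g)) else 0)"
        proof (cases "\<alpha> \<in> P \<and> \<beta> \<in> P")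
          case True
          then have a: "\<alpha> \<in> P" and b: "\<beta> \<in> P" by blast+
          note Pa = P[OF a, THEN conjunct1] P[OF a, THEN conjunct2, THEN conjunct1] P[OF a, THEN conjunct2, THEN conjunct2]
            and Pb = P[OF b, THEN conjunct1] P[OF b, THEN conjunct2, THEN conjunct1] P[OF b, THEN conjunct2, THEN conjunct2]
          have eq: "ker f \<alpha> \<beta> = c (\<alpha> \<cdot> ginv G g, g) * ker f (\<alpha> \<cdot> ginv G g) (\<beta> \<cdot> ginv G g) * cnj (c (\<beta> \<cdot> ginv G g, g))"
            by (rule ker_translate[OF Pa(1) Pb(1) g(1) Pa(3) Pb(3)])
          have eqR: "R.ker f (\<alpha> \<cdot> ginv G g) (\<beta> \<cdot> ginv G g) = ker f (\<alpha> \<cdot> ginv G g) (\<beta> \<cdot> ginv G g)"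
            unfolding kerR by (rule if_P) (rule conjI[OF Pa(2) Pb(2)])
          have ql: "q \<alpha> = l \<and> q \<beta> = l" using a b unfolding P_def by blast
          show ?thesis unfolding if_P[OF ql] if_P[OF True] eqR by (rule eq)
        next
          case False
          then have "\<not> (q \<alpha> = l \<and> q \<beta> = l) \<or> ker f \<alpha> \<beta> = 0" by (auto simp: P_def ker_def)
          with False show ?thesis by auto
        qed
      qed
    qed
  qed
  then have "reduced_norm G c f \<le> ?r"
    by (rule reduced_norm_le[OF ff _ R.reduced_norm_nonneg[OF bfR]])
  moreover have "?r \<le> reduced_norm G c f"
    by (rule R.reduced_norm_le[OF ffR kb reduced_norm_nonneg[OF bf]])
  ultimately show ?thesis by simp
qed

end

section \<open>Continuous functions with compact support\<close>

text \<open>Finite columns of the two right factors confine both iterated sums to finite sets, where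
  the order of summation may be changed. Associativity of convolution is read off from this.\<close>

lemma kernel_mult_assoc:
  assumes "column_finite L" "column_finite N"
  shows "kernel_mult (kernel_mult K L) N = kernel_mult K (kernel_mult L N)"
proof (intro ext)
  fix \<alpha> \<beta>
  define E where "E = {\<delta>. N \<delta> \<beta> \<noteq> 0}"
  have E: "finite E" using assms(2) by (simp add: E_def column_finite_def)
  define C where "C = column_support L E"
  have C: "finite C" unfolding C_def by (rule finite_column_support[OF assms(1) E])
  have LN: "kernel_mult L N \<gamma> \<beta> = (\<Sum>\<delta>\<in>E. L \<gamma> \<delta> * N \<delta> \<beta>)" for \<gamma>
    by (simp add: kernel_mult_def E_def)
  have z: "kernel_mult L N \<gamma> \<beta> = 0" if "\<gamma> \<notin> C" for \<gamma>
    unfolding LN by (rule sum.neutral) (use that in \<open>auto simp: C_def column_support_def\<close>)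
  have "kernel_mult (kernel_mult K L) N \<alpha> \<beta> = (\<Sum>\<delta>\<in>E. kernel_mult K L \<alpha> \<delta> * N \<delta> \<beta>)"
    by (simp add: kernel_mult_def[of "kernel_mult K L"] E_def)
  also have "\<dots> = (\<Sum>\<gamma>\<in>C. K \<alpha> \<gamma> * kernel_mult L N \<gamma> \<beta>)"
    unfolding kernel_mult_apply[OF assms(1) E] C_def LN ..
  also have "\<dots> = kernel_mult K (kernel_mult L N) \<alpha> \<beta>"
  proof (rule kernel_mult_eq[symmetric, OF C])
    show "K \<alpha> \<gamma> * kernel_mult L N \<gamma> \<beta> = 0" if "\<gamma> \<notin> C" for \<gamma> using z[OF that] by simp
    show "finite {\<gamma>. kernel_mult L N \<gamma> \<beta> \<noteq> 0}"
      by (rule finite_subset[OF _ C]) (use z in blast)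
  qed
  finally show "kernel_mult (kernel_mult K L) N \<alpha> \<beta> = kernel_mult K (kernel_mult L N) \<alpha> \<beta>" .
qed

lemma kernel_adj_mult:
  assumes "column_finite L" "column_finite (kernel_adj K)"
  shows "kernel_adj (kernel_mult K L) = kernel_mult (kernel_adj L) (kernel_adj K)"
proof (intro ext)
  fix \<alpha> \<beta>
  have fin: "finite {\<gamma>. L \<gamma> \<alpha> \<noteq> 0}" using assms(1) by (simp add: column_finite_def)
  have "kernel_mult (kernel_adj L) (kernel_adj K) \<alpha> \<beta>
      = (\<Sum>\<gamma> | L \<gamma> \<alpha> \<noteq> 0. kernel_adj L \<alpha> \<gamma> * kernel_adj K \<gamma> \<beta>)"
    by (rule kernel_mult_eq[OF fin]) (use assms(2) in \<open>auto simp: column_finite_def kernel_adj_def\<close>)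
  also have "\<dots> = kernel_adj (kernel_mult K L) \<alpha> \<beta>"
    by (simp add: kernel_adj_def kernel_mult_def mult.commute)
  finally show "kernel_adj (kernel_mult K L) \<alpha> \<beta> = kernel_mult (kernel_adj L) (kernel_adj K) \<alpha> \<beta>" ..
qed

lemma kernel_adj_adj: "kernel_adj (kernel_adj K) = K"
  by (simp add: kernel_adj_def fun_eq_iff)

context twisted_groupoid
begin

section \<open>Bilinearity, and convolution with functions living on sections\<close>

lemma column_finite_kernel_adj_ker: "fibre_finite f \<Longrightarrow> column_finite (kernel_adj (ker f))"
  using finite_row_ker by (simp add: column_finite_def kernel_adj_def)

lemma conv_add_left:
  assumes "fibre_finite h"
  shows "conv G c (\<lambda>g. f g + f' g) h \<gamma> = conv G c f h \<gamma> + conv G c f' h \<gamma>"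
proof (cases "\<gamma> \<in> arrows G")
  case True
  show ?thesis unfolding conv_ker_right[OF assms True] ker_add
    by (simp add: distrib_right sum.distrib)
qed (simp add: conv_outside)

lemma conv_scale_left:
  assumes "fibre_finite h"
  shows "conv G c (\<lambda>g. a * f g) h \<gamma> = a * conv G c f h \<gamma>"
proof (cases "\<gamma> \<in> arrows G")
  case True
  show ?thesis unfolding conv_ker_right[OF assms True] ker_scale
    by (simp add: sum_distrib_left mult.assoc)
qed (simp add: conv_outside)

lemma conv_add_right:
  assumes "fibre_finite f"
  shows "conv G c f (\<lambda>g. h g + h' g) \<gamma> = conv G c f h \<gamma> + conv G c f h' \<gamma>"
proof (cases "\<gamma> \<in> arrows G")
  case True
  show ?thesis unfolding conv_ker_left[OF assms True]
    by (simp add: distrib_left sum.distrib)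
qed (simp add: conv_outside)

lemma conv_scale_right:
  assumes "fibre_finite f"
  shows "conv G c f (\<lambda>g. a * h g) \<gamma> = a * conv G c f h \<gamma>"
proof (cases "\<gamma> \<in> arrows G")
  case True
  show ?thesis unfolding conv_ker_left[OF assms True]
    by (simp add: sum_distrib_left mult_ac)
qed (simp add: conv_outside)

lemma conv_zero_left: "conv G c (\<lambda>g. 0) h \<gamma> = 0"
  by (simp add: conv_def)

lemma bounded_function_zero: "bounded_function (\<lambda>g. 0)"
proof -
  have "ker (\<lambda>g. 0) = (\<lambda>\<alpha> \<beta>. 0)" by (simp add: ker_def fun_eq_iff)
  then have "kernel_bounded (ker (\<lambda>g. 0)) 0" by (simp add: kernel_bounded_def L2_set_def)
  then show ?thesis by (auto simp: bounded_function_def fibre_finite_def)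
qed

lemma fibre_finite_add:
  assumes "fibre_finite f" "fibre_finite h" shows "fibre_finite (\<lambda>g. f g + h g)"
  unfolding fibre_finite_def
proof (intro allI conjI)
  fix u
  have s: "finite ({g \<in> arrows G. f g \<noteq> 0 \<and> src G g = u} \<union> {g \<in> arrows G. h g \<noteq> 0 \<and> src G g = u})"
    and r: "finite ({g \<in> arrows G. f g \<noteq> 0 \<and> rng G g = u} \<union> {g \<in> arrows G. h g \<noteq> 0 \<and> rng G g = u})"
    using assms by (auto simp: fibre_finite_def)
  show "finite {g \<in> arrows G. f g + h g \<noteq> 0 \<and> src G g = u}"
    by (rule finite_subset[OF _ s]) auto
  show "finite {g \<in> arrows G. f g + h g \<noteq> 0 \<and> rng G g = u}"
    by (rule finite_subset[OF _ r]) auto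
qed

lemma bounded_function_add:
  assumes "bounded_function f" "bounded_function h" shows "bounded_function (\<lambda>g. f g + h g)"
proof -
  obtain M N where "kernel_bounded (ker f) M" "kernel_bounded (ker h) N" "0 \<le> M" "0 \<le> N"
    using assms by (auto simp: bounded_function_def)
  then have "kernel_bounded (ker (\<lambda>g. f g + h g)) (M + N)" "0 \<le> M + N"
    unfolding ker_add by (auto intro: kernel_bounded_add)
  then show ?thesis using assms fibre_finite_add unfolding bounded_function_def by blast
qed

text \<open>A nonzero entry at row \<alpha> and column \<beta> places \<alpha> \<beta>^{-1} in
  \<open>V\<close>, with the range of \<alpha> as range and the range of \<beta> as source.
  Injectivity on \<open>V\<close> therefore leaves one entry per row and per column, equal to a
  value of \<open>f\<close> up to a phase.\<close>

lemma kernel_bounded_ker_matching: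
  assumes M: "\<And>g. cmod (f g) \<le> M" and V: "\<And>g. f g \<noteq> 0 \<Longrightarrow> g \<in> V"
    and r: "inj_on (rng G) V" and s: "inj_on (src G) V"
  shows "fibre_finite f \<and> kernel_bounded (ker f) M \<and> 0 \<le> M"
proof -
  have M0: "0 \<le> M" using M[of undefined] norm_ge_zero order_trans by blast
  have one: "finite A" if "\<And>x y. x \<in> A \<Longrightarrow> y \<in> A \<Longrightarrow> x = y" for A :: "'a set"
  proof (cases "A = {}")
    case False
    then obtain x where "x \<in> A" by blast
    then have "A \<subseteq> {x}" using that by blast
    then show ?thesis by (rule finite_subset) simp
  qed simp
  have "fibre_finite f"
    unfolding fibre_finite_def
  proof (intro allI conjI)
    fix u
    show "finite {g \<in> arrows G. f g \<noteq> 0 \<and> src G g = u}"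
      by (rule one) (use V inj_onD[OF s] in auto)
    show "finite {g \<in> arrows G. f g \<noteq> 0 \<and> rng G g = u}"
      by (rule one) (use V inj_onD[OF r] in auto)
  qed
  moreover have "kernel_bounded (ker f) M"
  proof (rule kernel_bounded_matching[OF M0])
    fix \<alpha> \<beta>
    show "cmod (ker f \<alpha> \<beta>) \<le> M"
      using M[of "\<alpha> \<cdot> ginv G \<beta>"] M0 by (auto simp: ker_def norm_mult cocycle_norm grp)
    fix \<alpha>' \<beta>'
    have rec: "x = (x \<cdot> ginv G y) \<cdot> y" "y = ginv G (x \<cdot> ginv G y) \<cdot> x"
      if "x \<in> arrows G" "y \<in> arrows G" "src G x = src G y" for x y
      using that mul_src_self[of x] mul_src_self[of y] by (simp_all add: grp)
    show "\<beta> = \<beta>'" if "ker f \<alpha> \<beta> \<noteq> 0" "ker f \<alpha> \<beta>' \<noteq> 0"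
    proof -
      have a: "\<alpha> \<in> arrows G" "\<beta> \<in> arrows G" "src G \<alpha> = src G \<beta>" "\<alpha> \<cdot> ginv G \<beta> \<in> V"
        "\<beta>' \<in> arrows G" "src G \<alpha> = src G \<beta>'" "\<alpha> \<cdot> ginv G \<beta>' \<in> V"
        using that V by (auto simp: ker_nonzero)
      have "\<alpha> \<cdot> ginv G \<beta> = \<alpha> \<cdot> ginv G \<beta>'"
        by (rule inj_onD[OF r _ a(4) a(7)]) (use a in \<open>simp add: grp\<close>)
      then show ?thesis using rec(2)[OF a(1,2,3)] rec(2)[OF a(1,5,6)] by simp
    qed
    show "\<alpha> = \<alpha>'" if "ker f \<alpha> \<beta> \<noteq> 0" "ker f \<alpha>' \<beta> \<noteq> 0"
    proof -
      have a: "\<alpha> \<in> arrows G" "\<beta> \<in> arrows G" "src G \<alpha> = src G \<beta>" "\<alpha> \<cdot> ginv G \<beta> \<in> V"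
        "\<alpha>' \<in> arrows G" "src G \<alpha>' = src G \<beta>" "\<alpha>' \<cdot> ginv G \<beta> \<in> V"
        using that V by (auto simp: ker_nonzero)
      have "\<alpha> \<cdot> ginv G \<beta> = \<alpha>' \<cdot> ginv G \<beta>"
        by (rule inj_onD[OF s _ a(4) a(7)]) (use a in \<open>simp add: grp\<close>)
      then show ?thesis using rec(1)[OF a(1,2,3)] rec(1)[OF a(5,2,6)] by simp
    qed
  qed
  ultimately show ?thesis using M0 by blast
qed

text \<open>Each contributing \<gamma> \<delta>^{-1} lies in \<open>V\<close> and has the range of
  \<gamma>, so by injectivity it is \<beta> and a single term survives.\<close>

lemma conv_section_left:
  assumes V: "\<And>g. f g \<noteq> 0 \<Longrightarrow> g \<in> V" and r: "inj_on (rng G) V"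
    and b: "\<beta> \<in> V" "\<beta> \<in> arrows G" and g: "\<gamma> \<in> arrows G" "rng G \<beta> = rng G \<gamma>"
  shows "conv G c f h \<gamma> = f \<beta> * h (ginv G \<beta> \<cdot> \<gamma>) * c (\<beta>, ginv G \<beta> \<cdot> \<gamma>)"
proof -
  have "ker f \<gamma> \<delta> * h \<delta> = 0" if "\<delta> \<notin> {ginv G \<beta> \<cdot> \<gamma>}" for \<delta>
  proof (rule ccontr)
    assume "ker f \<gamma> \<delta> * h \<delta> \<noteq> 0"
    then have a: "\<delta> \<in> arrows G" "src G \<gamma> = src G \<delta>" "\<gamma> \<cdot> ginv G \<delta> \<in> V" using V by (auto simp: ker_nonzero)
    have "\<gamma> \<cdot> ginv G \<delta> = \<beta>" by (rule inj_onD[OF r _ a(3) b(1)]) (use a g in \<open>simp add: grp\<close>)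
    then have "ginv G \<beta> \<cdot> \<gamma> = \<delta>" using a g mul_src_self[of \<delta>] by (auto simp: grp)
    with that show False by simp
  qed
  then have "conv G c f h \<gamma> = (\<Sum>\<delta>\<in>{ginv G \<beta> \<cdot> \<gamma>}. ker f \<gamma> \<delta> * h \<delta>)"
    by (intro conv_ker[OF g(1)]) auto
  moreover have "\<gamma> \<cdot> ginv G (ginv G \<beta> \<cdot> \<gamma>) = \<beta>"
    using b g mul_inv_cancel[of \<gamma> \<beta>] by (simp add: grp)
  ultimately show ?thesis using b g by (simp add: ker_def grp)
qed

lemma conv_section_right:
  assumes V: "\<And>g. f g \<noteq> 0 \<Longrightarrow> g \<in> V" and s: "inj_on (src G) V"
    and t: "t \<in> V" "t \<in> arrows G" and g: "\<gamma> \<in> arrows G" "src G t = src G \<gamma>"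
  shows "conv G c h f \<gamma> = h (\<gamma> \<cdot> ginv G t) * c (\<gamma> \<cdot> ginv G t, t) * f t"
proof -
  have "ker h \<gamma> \<delta> * f \<delta> = 0" if "\<delta> \<notin> {t}" for \<delta>
  proof (rule ccontr)
    assume "ker h \<gamma> \<delta> * f \<delta> \<noteq> 0"
    then have a: "src G \<gamma> = src G \<delta>" "\<delta> \<in> V" using V by (auto simp: ker_nonzero)
    have "\<delta> = t" by (rule inj_onD[OF s _ a(2) t(1)]) (use a g in simp)
    with that show False by simp
  qed
  then have "conv G c h f \<gamma> = (\<Sum>\<delta>\<in>{t}. ker h \<gamma> \<delta> * f \<delta>)"
    by (intro conv_ker[OF g(1)]) auto
  then show ?thesis using t g by (simp add: ker_def)
qed

lemma inj_on_units: "inj_on (rng G) (units G)" "inj_on (src G) (units G)"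
  by (auto intro!: inj_onI simp: unit_rng units_iff)

lemma conv_units_left:
  assumes "\<And>g. f g \<noteq> 0 \<Longrightarrow> g \<in> units G" "\<gamma> \<in> arrows G"
  shows "conv G c f h \<gamma> = f (rng G \<gamma>) * h \<gamma>"
  using conv_section_left[of f "units G" "rng G \<gamma>" \<gamma> h] inj_on_units rng_unit assms
  by (simp add: grp cocycle_rng)

lemma conv_units_right:
  assumes "\<And>g. f g \<noteq> 0 \<Longrightarrow> g \<in> units G" "\<gamma> \<in> arrows G"
  shows "conv G c h f \<gamma> = h \<gamma> * f (src G \<gamma>)"
  using conv_section_right[of f "units G" "src G \<gamma>" \<gamma> h] inj_on_units src_unit assms
  by (simp add: grp cocycle_src)

lemma conv_section_left_zero:
  assumes V: "\<And>g. f g \<noteq> 0 \<Longrightarrow> g \<in> V" and g: "rng G \<gamma> \<notin> rng G ` V"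
  shows "conv G c f h \<gamma> = 0"
proof (cases "\<gamma> \<in> arrows G")
  case True
  have "ker f \<gamma> \<delta> * h \<delta> = 0" for \<delta>
  proof (rule ccontr)
    assume "ker f \<gamma> \<delta> * h \<delta> \<noteq> 0"
    then have "\<delta> \<in> arrows G" "src G \<gamma> = src G \<delta>" "\<gamma> \<cdot> ginv G \<delta> \<in> V" using V by (auto simp: ker_nonzero)
    then have "rng G (\<gamma> \<cdot> ginv G \<delta>) = rng G \<gamma>" "\<gamma> \<cdot> ginv G \<delta> \<in> V" using True by (auto simp: grp)
    with g show False by (metis imageI)
  qed
  then have "conv G c f h \<gamma> = (\<Sum>\<delta>\<in>{}. ker f \<gamma> \<delta> * h \<delta>)" by (intro conv_ker[OF True]) auto
  then show ?thesis by simp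
qed (simp add: conv_outside)

lemma conv_nonzero:
  assumes "fibre_finite h" "conv G c f h \<gamma> \<noteq> 0"
  obtains \<delta> where "\<gamma> \<in> arrows G" "\<delta> \<in> arrows G" "src G \<gamma> = src G \<delta>" "f (\<gamma> \<cdot> ginv G \<delta>) \<noteq> 0" "h \<delta> \<noteq> 0"
proof -
  have g: "\<gamma> \<in> arrows G" using assms(2) conv_outside by blast
  from assms(2) obtain \<delta> where "ker f \<gamma> \<delta> * h \<delta> \<noteq> 0"
    unfolding conv_ker_right[OF assms(1) g] by (meson sum.neutral)
  then show thesis using that by (auto simp: ker_nonzero)
qed

end

text \<open>Neighbourhoods are nested as K, U1, L1, U2, L2, W with L1 and L2 compact, and Urysohn is
  applied to L1 and the complement of U2. The value 1 on an open set, not merely on K, is what lets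
  the factor 1 - \<phi> shrink supports later.\<close>

lemma bump_function:
  assumes "Hausdorff_space X" "locally_compact_space X" "compactin X K" "openin X W" "K \<subseteq> W"
  obtains \<phi> U C where "continuous_map X euclideanreal \<phi>" "openin X U" "K \<subseteq> U" "\<And>x. x \<in> U \<Longrightarrow> \<phi> x = 1"
    "\<And>x. x \<in> topspace X \<Longrightarrow> 0 \<le> \<phi> x \<and> \<phi> x \<le> 1" "compactin X C" "C \<subseteq> W"
    "\<And>x. x \<in> topspace X \<Longrightarrow> x \<notin> C \<Longrightarrow> \<phi> x = 0"
proof -
  have nbhd: "\<exists>U L. openin X U \<and> compactin X L \<and> L \<subseteq> W \<and> K' \<subseteq> U \<and> U \<subseteq> L" if "compactin X K'" "K' \<subseteq> W" for K'
  proof -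
    have "Hausdorff_space (subtopology X W)" "locally_compact_space (subtopology X W)"
      using assms by (simp_all add: Hausdorff_space_subtopology locally_compact_space_open_subset)
    moreover have "compactin (subtopology X W) K'" using that by (simp add: compactin_subtopology)
    ultimately obtain U L where UL: "openin (subtopology X W) U" "compactin (subtopology X W) L" "K' \<subseteq> U" "U \<subseteq> L"
      using locally_compact_space_compact_closed_compact[of "subtopology X W"] by blast
    then have "openin X U" using assms(4) by (simp add: openin_open_subtopology)
    then show ?thesis using UL by (auto simp: compactin_subtopology)
  qed
  obtain U1 L1 where 1: "openin X U1" "compactin X L1" "L1 \<subseteq> W" "K \<subseteq> U1" "U1 \<subseteq> L1"
    using nbhd[OF assms(3,5)] by blast
  obtain U2 L2 where 2: "openin X U2" "compactin X L2" "L2 \<subseteq> W" "L1 \<subseteq> U2" "U2 \<subseteq> L2"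
    using nbhd[OF 1(2,3)] by blast
  have cr: "completely_regular_space X"
    using assms(1,2) by (simp add: locally_compact_regular_imp_completely_regular_space)
  have cl: "closedin X (topspace X - U2)" using 2(1) by blast
  have dj: "disjnt L1 (topspace X - U2)" using 2(4) by (auto simp: disjnt_def)
  obtain \<phi> :: "_ \<Rightarrow> real" where phi: "continuous_map X (top_of_set {0..1}) \<phi>" "\<phi> ` (topspace X - U2) \<subseteq> {0}" "\<phi> ` L1 \<subseteq> {1}"
    using Urysohn_completely_regular_compact_closed[OF zero_le_one cr 1(2) cl dj] by blast
  show thesis
  proof (rule that[OF _ 1(1) 1(4) _ _ 2(2,3)])
    show "continuous_map X euclideanreal \<phi>" using phi(1) by (simp add: continuous_map_in_subtopology)
    show "\<phi> x = 1" if "x \<in> U1" for x using that 1 phi(3) by blast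
    show "0 \<le> \<phi> x \<and> \<phi> x \<le> 1" if "x \<in> topspace X" for x
      using phi(1) that by (auto simp: continuous_map_in_subtopology)
    show "\<phi> x = 0" if "x \<in> topspace X" "x \<notin> L2" for x using that 2(5) phi(2) by blast
  qed
qed

lemma continuous_map_complex_mult:
  fixes f h :: "'a \<Rightarrow> complex"
  assumes "continuous_map X euclidean f" "continuous_map X euclidean h"
  shows "continuous_map X euclidean (\<lambda>x. f x * h x)"
proof -
  have "continuous_map X euclidean (\<lambda>x. (f x, h x))"
    using continuous_map_pairedI[OF assms] by (simp add: euclidean_product_topology)
  moreover have "continuous_map euclidean euclidean (\<lambda>p :: complex \<times> complex. fst p * snd p)"
    by (simp add: continuous_on_mult continuous_on_fst continuous_on_snd)
  ultimately have "continuous_map X euclidean ((\<lambda>p. fst p * snd p) \<circ> (\<lambda>x. (f x, h x)))"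
    by (rule continuous_map_compose)
  then show ?thesis by (simp add: o_def)
qed

lemma continuous_map_complex_of_real:
  assumes "continuous_map X euclideanreal f" shows "continuous_map X euclidean (\<lambda>x. complex_of_real (f x))"
proof -
  have "continuous_map euclidean euclidean complex_of_real" by (simp add: continuous_on_of_real)
  from continuous_map_compose[OF assms this] show ?thesis by (simp add: o_def)
qed

lemma continuous_map_cnj:
  assumes "continuous_map X euclidean f" shows "continuous_map X euclidean (\<lambda>x. cnj (f x))"
proof -
  have "continuous_map euclidean euclidean cnj" by (simp add: continuous_on_cnj)
  from continuous_map_compose[OF assms this] show ?thesis by (simp add: o_def)
qed

locale twisted_etale_groupoid = etale_groupoid +
  fixes c :: "'a \<times> 'a \<Rightarrow> complex"
  assumes continuous_cocycle: "continuous_cocycle2 G c"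
    and hausdorff: "Hausdorff_space (gtop G)"
    and locally_compact: "locally_compact_space (gtop G)"

sublocale twisted_etale_groupoid \<subseteq> twisted_groupoid
  by unfold_locales (use continuous_cocycle in \<open>simp add: continuous_cocycle2_def\<close>)

context twisted_etale_groupoid
begin

section \<open>Topology of the groupoid and its bisections\<close>

lemma topspace_gtop: "topspace (gtop G) = arrows G"
  by (simp add: arrows_def)

lemma continuous_map_gmul:
  assumes "continuous_map Z (gtop G) f" "continuous_map Z (gtop G) h"
    and "\<And>z. z \<in> topspace Z \<Longrightarrow> src G (f z) = rng G (h z)"
  shows "continuous_map Z (gtop G) (\<lambda>z. f z \<cdot> h z)"
proof -
  have fh: "f z \<in> arrows G" "h z \<in> arrows G" if "z \<in> topspace Z" for z
    using assms(1,2) that by (auto simp: continuous_map_def arrows_def)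
  have "continuous_map Z (subtopology (prod_topology (gtop G) (gtop G)) (composable G)) (\<lambda>z. (f z, h z))"
    unfolding continuous_map_in_subtopology
    using continuous_map_pairedI[OF assms(1,2)] assms(3) fh by (auto simp: composable_iff)
  from continuous_map_compose[OF this continuous_mul] show ?thesis by (simp add: o_def)
qed

lemma continuous_map_cocycle:
  assumes "continuous_map Z (gtop G) f" "continuous_map Z (gtop G) h"
    and "\<And>z. z \<in> topspace Z \<Longrightarrow> src G (f z) = rng G (h z)"
  shows "continuous_map Z euclidean (\<lambda>z. c (f z, h z))"
proof -
  have fh: "f z \<in> arrows G" "h z \<in> arrows G" if "z \<in> topspace Z" for z
    using assms(1,2) that by (auto simp: continuous_map_def arrows_def)
  have "continuous_map Z (subtopology (prod_topology (gtop G) (gtop G)) (composable G)) (\<lambda>z. (f z, h z))"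
    unfolding continuous_map_in_subtopology
    using continuous_map_pairedI[OF assms(1,2)] assms(3) fh by (auto simp: composable_iff)
  moreover have "continuous_map (subtopology (prod_topology (gtop G) (gtop G)) (composable G)) euclidean c"
    using continuous_cocycle by (simp add: continuous_cocycle2_def continuous_map_in_subtopology)
  ultimately have "continuous_map Z euclidean (c \<circ> (\<lambda>z. (f z, h z)))"
    by (rule continuous_map_compose)
  then show ?thesis by (simp add: o_def)
qed

lemma continuous_map_ident: "continuous_map (gtop G) (gtop G) (\<lambda>g. g)"
  using continuous_map_id[of "gtop G"] by (simp add: id_def)

lemma continuous_src: "continuous_map (gtop G) (gtop G) (src G)"
proof -
  have "continuous_map (gtop G) (gtop G) (\<lambda>g. ginv G g \<cdot> g)"
    by (rule continuous_map_gmul[OF continuous_inv continuous_map_ident]) (simp add: topspace_gtop grp)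
  then show ?thesis by (simp add: src_def[abs_def])
qed

lemma continuous_rng: "continuous_map (gtop G) (gtop G) (rng G)"
proof -
  have "continuous_map (gtop G) (gtop G) (\<lambda>g. g \<cdot> ginv G g)"
    by (rule continuous_map_gmul[OF continuous_map_ident continuous_inv]) (simp add: topspace_gtop grp)
  then show ?thesis by (simp add: rng_def[abs_def])
qed

text \<open>The range map is injective on some neighbourhood U of a unit. If g and its range both
  lie in U, they have the same range and so coincide.\<close>

lemma open_units: "openin (gtop G) (units G)"
proof (subst openin_subopen, intro ballI)
  fix u assume u: "u \<in> units G"
  obtain U V where UV: "openin (gtop G) U" "u \<in> U"
    "homeomorphic_map (subtopology (gtop G) U) (subtopology (subtopology (gtop G) (units G)) V) (rng G)"
    using local_homeomorphism_rng units_arrow[OF u] unfolding local_homeomorphism_def topspace_gtop by blast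
  have inj: "inj_on (rng G) U"
    using homeomorphic_imp_injective_map[OF UV(3)] openin_subset[OF UV(1)] by (simp add: inf_absorb2)
  let ?W = "U \<inter> {g \<in> topspace (gtop G). rng G g \<in> U}"
  have "openin (gtop G) ?W"
    by (intro openin_Int UV openin_continuous_map_preimage[OF continuous_rng])
  moreover have "u \<in> ?W" using UV u by (simp add: unit_rng topspace_gtop units_arrow)
  moreover have "?W \<subseteq> units G"
  proof
    fix g assume g: "g \<in> ?W"
    then have ga: "g \<in> arrows G" by (simp add: topspace_gtop)
    have "rng G g = g" by (rule inj_onD[OF inj]) (use g ga in \<open>auto simp: grp\<close>)
    then show "g \<in> units G" using rng_unit[OF ga] by simp
  qed
  ultimately show "\<exists>T. openin (gtop G) T \<and> u \<in> T \<and> T \<subseteq> units G" by blast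
qed

text \<open>Besides injectivity, a continuous section \<rho> of the range map over the image of
  \<open>V\<close> is demanded: through it the single term of a convolution depends continuously on
  the arrow.\<close>

definition bisection :: "'a set \<Rightarrow> bool" where
  "bisection V \<longleftrightarrow> openin (gtop G) V \<and> inj_on (rng G) V \<and> inj_on (src G) V \<and> openin (gtop G) (rng G ` V) \<and>
    (\<exists>\<rho>. continuous_map (subtopology (gtop G) (rng G ` V)) (gtop G) \<rho> \<and> (\<forall>g\<in>V. \<rho> (rng G g) = g))"

text \<open>The range map near g provides the section and injectivity of the range; injectivity of
  the source comes from the range map near the inverse of g.\<close>

lemma bisection_around:
  assumes g: "g \<in> arrows G" and O: "openin (gtop G) W" "g \<in> W"
  obtains V where "bisection V" "g \<in> V" "V \<subseteq> W"
proof -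
  obtain U Y where U: "openin (gtop G) U" "g \<in> U" and Y: "openin (subtopology (gtop G) (units G)) Y"
    and hom: "homeomorphic_map (subtopology (gtop G) U) (subtopology (subtopology (gtop G) (units G)) Y) (rng G)"
    using local_homeomorphism_rng g unfolding local_homeomorphism_def topspace_gtop by blast
  obtain U' Y' where U': "openin (gtop G) U'" "ginv G g \<in> U'"
    and hom': "homeomorphic_map (subtopology (gtop G) U') (subtopology (subtopology (gtop G) (units G)) Y') (rng G)"
    using local_homeomorphism_rng inv_closed[OF g] unfolding local_homeomorphism_def topspace_gtop by blast
  have Yu: "Y \<subseteq> units G" using openin_subset[OF Y] by simp
  have topY: "subtopology (subtopology (gtop G) (units G)) Y = subtopology (gtop G) Y"
    using Yu by (simp add: subtopology_subtopology inf_absorb2)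
  have openY: "openin (gtop G) Y" using Y open_units openin_trans_full by blast
  have Utop: "U \<subseteq> topspace (gtop G)" "U' \<subseteq> topspace (gtop G)" using U U' openin_subset by blast+
  have inj: "inj_on (rng G) U" using homeomorphic_imp_injective_map[OF hom] Utop by (simp add: inf_absorb2)
  have inj': "inj_on (rng G) U'" using homeomorphic_imp_injective_map[OF hom'] Utop by (simp add: inf_absorb2)
  let ?V = "(U \<inter> W) \<inter> {x \<in> topspace (gtop G). ginv G x \<in> U'}"
  have V: "openin (gtop G) ?V"
    by (intro openin_Int U O openin_continuous_map_preimage[OF continuous_inv] U')
  have "inj_on (src G) ?V"
  proof (rule inj_onI)
    fix x y assume x: "x \<in> ?V" and y: "y \<in> ?V" and eq: "src G x = src G y"
    then have xy: "x \<in> arrows G" "y \<in> arrows G" by (auto simp: topspace_gtop)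
    have "ginv G x = ginv G y"
      by (rule inj_onD[OF inj']) (use x y xy eq in \<open>auto simp: grp\<close>)
    then show "x = y" using xy by (metis inv_inv)
  qed
  moreover have "inj_on (rng G) ?V" by (rule inj_on_subset[OF inj]) blast
  moreover have "openin (gtop G) (rng G ` ?V)"
  proof -
    have "openin (subtopology (gtop G) U) ?V" using V unfolding openin_open_subtopology[OF U(1)] by blast
    then have "openin (subtopology (gtop G) Y) (rng G ` ?V)"
      using homeomorphic_imp_open_map[OF hom] unfolding topY open_map_def by blast
    then show ?thesis using openY openin_trans_full by blast
  qed
  moreover obtain \<rho> where \<rho>: "homeomorphic_maps (subtopology (gtop G) U) (subtopology (gtop G) Y) (rng G) \<rho>"
    using hom unfolding topY homeomorphic_map_maps by blast
  have "continuous_map (subtopology (gtop G) (rng G ` ?V)) (gtop G) \<rho> \<and> (\<forall>x\<in>?V. \<rho> (rng G x) = x)"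
  proof
    have "rng G ` ?V \<subseteq> Y"
      using homeomorphic_imp_surjective_map[OF hom] Utop unfolding topY by auto
    moreover have "continuous_map (subtopology (gtop G) Y) (gtop G) \<rho>"
      using \<rho> by (simp add: homeomorphic_maps_def continuous_map_in_subtopology)
    ultimately show "continuous_map (subtopology (gtop G) (rng G ` ?V)) (gtop G) \<rho>"
      by (rule continuous_map_from_subtopology_mono[rotated])
    show "\<forall>x\<in>?V. \<rho> (rng G x) = x" using \<rho> by (auto simp: homeomorphic_maps_def)
  qed
  ultimately have "bisection ?V" using V unfolding bisection_def by blast
  moreover have "g \<in> ?V" using U O U' g by (simp add: topspace_gtop)
  ultimately show thesis using that by blast
qed

text \<open>Compact sets are closed in a Hausdorff space, so one that contains all arrows with
  nonzero value also contains their closure.\<close>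

lemma CcI:
  assumes "continuous_map (gtop G) euclidean f" "compactin (gtop G) C" "\<And>g. f g \<noteq> 0 \<Longrightarrow> g \<in> C"
  shows "f \<in> Cc G"
proof -
  have C: "closedin (gtop G) C" using compactin_imp_closedin[OF hausdorff assms(2)] .
  have "gtop G closure_of {g \<in> arrows G. f g \<noteq> 0} \<subseteq> C"
    by (rule closure_of_minimal[OF _ C]) (use assms(3) in blast)
  then have "compactin (gtop G) (gtop G closure_of {g \<in> arrows G. f g \<noteq> 0})"
    using closed_compactin[OF assms(2)] by simp
  moreover have "f g = 0" if "g \<notin> arrows G" for g
    using assms(3)[of g] that closedin_subset[OF C] by (auto simp: topspace_gtop)
  ultimately show ?thesis using assms(1) by (simp add: Cc_def)
qed

section \<open>Functions with compact support as a normed *-algebra\<close>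

lemma Cc_continuous: "f \<in> Cc G \<Longrightarrow> continuous_map (gtop G) euclidean f"
  by (simp add: Cc_def)

lemma Cc_outside: "f \<in> Cc G \<Longrightarrow> g \<notin> arrows G \<Longrightarrow> f g = 0"
  by (simp add: Cc_def)

lemma Cc_support:
  assumes "f \<in> Cc G" obtains C where "compactin (gtop G) C" "\<And>g. f g \<noteq> 0 \<Longrightarrow> g \<in> C"
proof
  show "compactin (gtop G) (gtop G closure_of {g \<in> arrows G. f g \<noteq> 0})"
    using assms by (simp add: Cc_def)
  show "g \<in> gtop G closure_of {g \<in> arrows G. f g \<noteq> 0}" if "f g \<noteq> 0" for g
    using closure_of_subset[of "{g \<in> arrows G. f g \<noteq> 0}" "gtop G"] that Cc_outside[OF assms, of g]
    by (auto simp: topspace_gtop)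
qed

lemma Cc_zero: "(\<lambda>g. 0) \<in> Cc G"
  by (rule CcI[of _ "{}"]) auto

lemma Cc_add: assumes "f \<in> Cc G" "h \<in> Cc G" shows "(\<lambda>g. f g + h g) \<in> Cc G"
proof -
  obtain C where C: "compactin (gtop G) C" "\<And>g. f g \<noteq> 0 \<Longrightarrow> g \<in> C" using Cc_support[OF assms(1)] by metis
  obtain D where D: "compactin (gtop G) D" "\<And>g. h g \<noteq> 0 \<Longrightarrow> g \<in> D" using Cc_support[OF assms(2)] by metis
  show ?thesis
  proof (rule CcI[OF continuous_map_add[OF Cc_continuous[OF assms(1)] Cc_continuous[OF assms(2)]] compactin_Un[OF C(1) D(1)]])
    fix g assume "f g + h g \<noteq> 0"
    then have "f g \<noteq> 0 \<or> h g \<noteq> 0" by auto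
    then show "g \<in> C \<union> D" using C(2) D(2) by blast
  qed
qed

lemma Cc_mult:
  assumes "f \<in> Cc G" "continuous_map (gtop G) euclidean k" shows "(\<lambda>g. f g * k g) \<in> Cc G"
proof -
  obtain C where C: "compactin (gtop G) C" "\<And>g. f g \<noteq> 0 \<Longrightarrow> g \<in> C" using Cc_support[OF assms(1)] by metis
  show ?thesis
    by (rule CcI[OF continuous_map_complex_mult[OF Cc_continuous[OF assms(1)] assms(2)] C(1)]) (use C(2) in auto)
qed

lemma Cc_scale: assumes "f \<in> Cc G" shows "(\<lambda>g. a * f g) \<in> Cc G"
  using Cc_mult[OF assms, of "\<lambda>_. a"] by (simp add: mult.commute)

lemma Cc_bounded: assumes "f \<in> Cc G" obtains M where "\<And>g. cmod (f g) \<le> M"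
proof -
  obtain C where C: "compactin (gtop G) C" "\<And>g. f g \<noteq> 0 \<Longrightarrow> g \<in> C" using Cc_support[OF assms] by metis
  have "compactin euclidean (f ` C)" by (rule image_compactin[OF C(1) Cc_continuous[OF assms]])
  then have "bounded (f ` C)" by (simp add: compact_imp_bounded)
  then obtain M where M: "\<And>x. x \<in> C \<Longrightarrow> cmod (f x) \<le> M" by (auto simp: bounded_iff)
  have "cmod (f g) \<le> max M 0" for g
    using M[of g] C(2)[of g] by (cases "f g = 0") auto
  then show thesis by (rule that)
qed

text \<open>Multiplying with bump functions \<open>\<phi>\<^sub>i\<close> that cover the support, the product of the factors
  \<open>1 - \<phi>\<^sub>i\<close> annihilates a function: this decomposes it without a partition of unity.\<close>

lemma Cc_induct:
  assumes f: "f \<in> Cc G"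
    and cover: "\<And>g. g \<in> arrows G \<Longrightarrow> \<exists>V. Q V \<and> openin (gtop G) V \<and> g \<in> V"
    and zero: "P (\<lambda>g. 0)"
    and add: "\<And>f h. f \<in> Cc G \<Longrightarrow> h \<in> Cc G \<Longrightarrow> P f \<Longrightarrow> P h \<Longrightarrow> P (\<lambda>g. f g + h g)"
    and local: "\<And>f V C. f \<in> Cc G \<Longrightarrow> Q V \<Longrightarrow> compactin (gtop G) C \<Longrightarrow> C \<subseteq> V \<Longrightarrow>
      (\<And>g. f g \<noteq> 0 \<Longrightarrow> g \<in> C) \<Longrightarrow> P f"
  shows "P f"
proof -
  define B where "B = (\<lambda>x \<phi> U. continuous_map (gtop G) euclideanreal \<phi> \<and> openin (gtop G) U \<and> x \<in> U \<and>
    (\<forall>y\<in>U. \<phi> y = 1) \<and>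
    (\<exists>V C. Q V \<and> compactin (gtop G) C \<and> C \<subseteq> V \<and> (\<forall>y\<in>arrows G. y \<notin> C \<longrightarrow> \<phi> y = 0)))"
  have "\<exists>\<phi> U. B x \<phi> U"
    if x: "x \<in> arrows G" for x
  proof -
    obtain V where V: "Q V" "openin (gtop G) V" "x \<in> V" using cover[OF x] by blast
    have cx: "compactin (gtop G) {x}" using x by (simp add: topspace_gtop)
    have sub: "{x} \<subseteq> V" using V(3) by simp
    obtain \<phi> U C where p: "continuous_map (gtop G) euclideanreal \<phi>" "openin (gtop G) U" "{x} \<subseteq> U"
      "\<And>y. y \<in> U \<Longrightarrow> \<phi> y = 1" "\<And>y. y \<in> topspace (gtop G) \<Longrightarrow> 0 \<le> \<phi> y \<and> \<phi> y \<le> 1"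
      "compactin (gtop G) C" "C \<subseteq> V" "\<And>y. y \<in> topspace (gtop G) \<Longrightarrow> y \<notin> C \<Longrightarrow> \<phi> y = 0"
      by (rule bump_function[OF hausdorff locally_compact cx V(2) sub]) (rule that)
    show ?thesis
      unfolding B_def
    proof (intro exI conjI)
      show "x \<in> U" using p(3) by simp
      show "\<forall>y\<in>U. \<phi> y = 1" using p(4) by blast
      show "\<forall>y\<in>arrows G. y \<notin> C \<longrightarrow> \<phi> y = 0" using p(8) by (simp add: topspace_gtop)
    qed (fact p V)+
  qed
  then obtain \<phi> U where "\<And>x. x \<in> arrows G \<Longrightarrow> B x (\<phi> x) (U x)" by metis
  note b = this[unfolded B_def]
  have \<phi>: "continuous_map (gtop G) euclideanreal (\<phi> x)" and U: "openin (gtop G) (U x) \<and> x \<in> U x"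
    and one: "y \<in> U x \<Longrightarrow> \<phi> x y = 1"
    and loc: "\<exists>V C. Q V \<and> compactin (gtop G) C \<and> C \<subseteq> V \<and> (\<forall>y\<in>arrows G. y \<notin> C \<longrightarrow> \<phi> x y = 0)"
    if "x \<in> arrows G" for x y
    using b[OF that] by simp_all
  have main: "P f" if "finite F" "F \<subseteq> arrows G" "f \<in> Cc G" "\<And>g. f g \<noteq> 0 \<Longrightarrow> g \<in> (\<Union>x\<in>F. U x)" for F f
    using that
  proof (induction F arbitrary: f rule: finite_induct)
    case empty
    then have "f = (\<lambda>g. 0)" by auto
    then show ?case using zero by simp
  next
    case (insert x F)
    let ?k = "\<lambda>g. complex_of_real (\<phi> x g)"
    let ?f1 = "\<lambda>g. f g * ?k g" and ?f2 = "\<lambda>g. f g * (1 - ?k g)"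
    have x: "x \<in> arrows G" using insert.prems by simp
    have kc: "continuous_map (gtop G) euclidean ?k" by (rule continuous_map_complex_of_real[OF \<phi>[OF x]])
    have 1: "?f1 \<in> Cc G" by (rule Cc_mult[OF insert.prems(2) kc])
    have 2: "?f2 \<in> Cc G" by (rule Cc_mult[OF insert.prems(2)]) (intro continuous_map_diff kc continuous_map_canonical_const)
    obtain V C where V: "Q V" "compactin (gtop G) C" "C \<subseteq> V" "\<And>y. y \<in> arrows G \<Longrightarrow> y \<notin> C \<Longrightarrow> \<phi> x y = 0"
      using loc[OF x] by blast
    have "P ?f1"
    proof (rule local[OF 1 V(1-3)])
      fix g assume "f g * ?k g \<noteq> 0"
      then show "g \<in> C" using V(4)[of g] Cc_outside[OF insert.prems(2), of g] by auto
    qed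
    moreover have "P ?f2"
    proof (rule insert.IH[OF _ 2])
      show "F \<subseteq> arrows G" using insert.prems by simp
      fix g assume "f g * (1 - ?k g) \<noteq> 0"
      then have "f g \<noteq> 0" "g \<notin> U x" using one[OF x, of g] by auto
      then show "g \<in> (\<Union>x\<in>F. U x)" using insert.prems(3)[of g] by auto
    qed
    ultimately have "P (\<lambda>g. ?f1 g + ?f2 g)" by (rule add[OF 1 2])
    then show ?case by (simp add: algebra_simps)
  qed
  obtain C where C: "compactin (gtop G) C" "\<And>g. f g \<noteq> 0 \<Longrightarrow> g \<in> C" using Cc_support[OF f] by metis
  have Ca: "C \<subseteq> arrows G" using compactin_subset_topspace[OF C(1)] by (simp add: topspace_gtop)
  have "\<exists>\<F>. finite \<F> \<and> \<F> \<subseteq> U ` C \<and> C \<subseteq> \<Union> \<F>"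
  proof (rule compactinD[OF C(1)])
    show "openin (gtop G) T" if "T \<in> U ` C" for T using that U Ca by blast
    show "C \<subseteq> \<Union> (U ` C)" using U Ca by blast
  qed
  then obtain F where F: "finite F" "F \<subseteq> C" "C \<subseteq> (\<Union>x\<in>F. U x)" by (metis finite_subset_image)
  show "P f" by (rule main[OF F(1) _ f]) (use F Ca C(2) in blast)+
qed

lemma bisection_open: "bisection V \<Longrightarrow> openin (gtop G) V"
  by (simp add: bisection_def)

lemma bisection_cover: "g \<in> arrows G \<Longrightarrow> \<exists>V. bisection V \<and> openin (gtop G) V \<and> g \<in> V"
  using bisection_around[of g "topspace (gtop G)"] bisection_open topspace_gtop by (metis openin_topspace)

lemma Cc_bounded_function: assumes "f \<in> Cc G" shows "bounded_function f"
proof (rule Cc_induct[where P=bounded_function and Q=bisection, OF assms bisection_cover])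
  show "bounded_function (\<lambda>g. 0)" by (rule bounded_function_zero)
  show "bounded_function (\<lambda>g. f g + h g)" if "bounded_function f" "bounded_function h" for f h
    using that by (rule bounded_function_add)
  fix f V C
  assume local: "f \<in> Cc G" "bisection V" "compactin (gtop G) C" "C \<subseteq> V" "\<And>g. f g \<noteq> 0 \<Longrightarrow> g \<in> C"
  obtain M where M: "\<And>g. cmod (f g) \<le> M" using Cc_bounded[OF local(1)] by metis
  have "fibre_finite f \<and> kernel_bounded (ker f) M \<and> 0 \<le> M"
    by (rule kernel_bounded_ker_matching[OF M, where V=V]) (use local in \<open>auto simp: bisection_def\<close>)
  then show "bounded_function f" unfolding bounded_function_def by blast
qed

lemma Cc_fibre_finite: "f \<in> Cc G \<Longrightarrow> fibre_finite f"
  using Cc_bounded_function by (simp add: bounded_function_def)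

text \<open>The composable pairs are the equalizer of two continuous maps into a Hausdorff space,
  hence closed, and multiplication is continuous on them.\<close>

lemma compactin_composable_product:
  assumes "compactin (gtop G) C" "compactin (gtop G) D"
  shows "compactin (gtop G) ((\<lambda>(g, h). g \<cdot> h) ` (composable G \<inter> C \<times> D))"
proof -
  let ?XX = "prod_topology (gtop G) (gtop G)"
  have "composable G = {p \<in> topspace ?XX. (src G \<circ> fst) p = (rng G \<circ> snd) p}"
    by (auto simp: composable_iff topspace_gtop)
  moreover have "closedin ?XX {p \<in> topspace ?XX. (src G \<circ> fst) p = (rng G \<circ> snd) p}"
    by (intro closedin_continuous_maps_eq[OF hausdorff] continuous_map_compose[OF continuous_map_fst continuous_src]
        continuous_map_compose[OF continuous_map_snd continuous_rng])
  ultimately have "closedin ?XX (composable G)" by simp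
  then have "compactin ?XX (composable G \<inter> C \<times> D)"
    by (rule closed_Int_compactin) (simp add: compactin_Times assms)
  then have "compactin (subtopology ?XX (composable G)) (composable G \<inter> C \<times> D)"
    by (simp add: compactin_subtopology)
  then show ?thesis by (rule image_compactin[OF _ continuous_mul])
qed

text \<open>Over the range of \<open>V\<close> the convolution has one term, continuous by means of
  \<rho>; where the range avoids that of \<open>C\<close> it vanishes. These two open sets cover the
  groupoid.\<close>

lemma continuous_conv_bisection:
  assumes f: "f \<in> Cc G" and h: "h \<in> Cc G" and V: "bisection V"
    and C: "compactin (gtop G) C" "C \<subseteq> V" "\<And>g. f g \<noteq> 0 \<Longrightarrow> g \<in> C"
  shows "continuous_map (gtop G) euclidean (conv G c f h)"
proof -
  obtain \<rho> where \<rho>: "continuous_map (subtopology (gtop G) (rng G ` V)) (gtop G) \<rho>" "\<And>g. g \<in> V \<Longrightarrow> \<rho> (rng G g) = g"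
    using V unfolding bisection_def by blast
  have Va: "V \<subseteq> arrows G" using openin_subset[OF bisection_open[OF V]] by (simp add: topspace_gtop)
  have rV: "openin (gtop G) (rng G ` V)" and inj: "inj_on (rng G) V" using V by (auto simp: bisection_def)
  let ?T1 = "{\<gamma> \<in> topspace (gtop G). rng G \<gamma> \<in> rng G ` V}"
  \<comment> \<open>The region of vanishing is cut out by \<open>C\<close>, not by \<open>V\<close>:
    the range image of \<open>C\<close> is compact and thus closed, while that of \<open>V\<close>
    is open.\<close>
  let ?T2 = "topspace (gtop G) - {\<gamma> \<in> topspace (gtop G). rng G \<gamma> \<in> rng G ` C}"
  let ?F = "\<lambda>\<gamma>. f (\<rho> (rng G \<gamma>)) * h (ginv G (\<rho> (rng G \<gamma>)) \<cdot> \<gamma>) * c (\<rho> (rng G \<gamma>), ginv G (\<rho> (rng G \<gamma>)) \<cdot> \<gamma>)"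
  define T where "T = (\<lambda>b. if b then ?T1 else ?T2)"
  define F where "F = (\<lambda>b. if b then ?F else (\<lambda>\<gamma>. 0))"
  have T1: "openin (gtop G) ?T1" by (rule openin_continuous_map_preimage[OF continuous_rng rV])
  have cl: "closedin (gtop G) (rng G ` C)"
    by (intro compactin_imp_closedin[OF hausdorff] image_compactin[OF C(1) continuous_rng])
  have T2: "openin (gtop G) ?T2"
    using closedin_continuous_map_preimage[OF continuous_rng cl] by blast
  have F1: "conv G c f h \<gamma> = ?F \<gamma>" if T: "\<gamma> \<in> ?T1" for \<gamma>
  proof -
    obtain b where b: "b \<in> V" "rng G \<gamma> = rng G b" using T by auto
    then have "\<rho> (rng G \<gamma>) = b" using \<rho>(2) by simp
    then show ?thesis
      using conv_section_left[of f V b \<gamma> h] C inj b Va T by (auto simp: topspace_gtop)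
  qed
  have F2: "conv G c f h \<gamma> = 0" if "\<gamma> \<in> ?T2" for \<gamma>
    by (rule conv_section_left_zero[OF C(3)]) (use that in auto)
  show ?thesis
  proof (rule pasting_lemma[where I=UNIV and T=T and f=F])
    show "openin (gtop G) (T i)" for i using T1 T2 by (simp add: T_def)
    show "continuous_map (subtopology (gtop G) (T i)) euclidean (F i)" for i
    proof (cases i)
      case True
      let ?Z = "subtopology (gtop G) ?T1"
      have id: "continuous_map ?Z (gtop G) (\<lambda>\<gamma>. \<gamma>)" by (rule continuous_map_from_subtopology[OF continuous_map_ident])
      have "continuous_map ?Z (subtopology (gtop G) (rng G ` V)) (rng G)"
        unfolding continuous_map_in_subtopology using continuous_map_from_subtopology[OF continuous_rng] by auto
      from continuous_map_compose[OF this \<rho>(1)]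
      have b: "continuous_map ?Z (gtop G) (\<lambda>\<gamma>. \<rho> (rng G \<gamma>))" by (simp add: o_def)
      have bi: "continuous_map ?Z (gtop G) (\<lambda>\<gamma>. ginv G (\<rho> (rng G \<gamma>)))"
        using continuous_map_compose[OF b continuous_inv] by (simp add: o_def)
      have props: "\<rho> (rng G \<gamma>) \<in> arrows G \<and> rng G (\<rho> (rng G \<gamma>)) = rng G \<gamma> \<and> \<gamma> \<in> arrows G" if "\<gamma> \<in> topspace ?Z" for \<gamma>
        using that \<rho>(2) Va by (auto simp: topspace_gtop)
      have m: "continuous_map ?Z (gtop G) (\<lambda>\<gamma>. ginv G (\<rho> (rng G \<gamma>)) \<cdot> \<gamma>)"
        by (rule continuous_map_gmul[OF bi id]) (use props in \<open>simp add: grp\<close>)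
      have "continuous_map ?Z euclidean (\<lambda>\<gamma>. c (\<rho> (rng G \<gamma>), ginv G (\<rho> (rng G \<gamma>)) \<cdot> \<gamma>))"
        by (rule continuous_map_cocycle[OF b m]) (use props in \<open>simp add: grp\<close>)
      moreover have "continuous_map ?Z euclidean (\<lambda>\<gamma>. f (\<rho> (rng G \<gamma>)))"
        using continuous_map_compose[OF b Cc_continuous[OF f]] by (simp add: o_def)
      moreover have "continuous_map ?Z euclidean (\<lambda>\<gamma>. h (ginv G (\<rho> (rng G \<gamma>)) \<cdot> \<gamma>))"
        using continuous_map_compose[OF m Cc_continuous[OF h]] by (simp add: o_def)
      ultimately have "continuous_map ?Z euclidean ?F" by (intro continuous_map_complex_mult)
      then show ?thesis using True by (simp add: T_def F_def)
    qed (simp add: T_def F_def)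
    have val: "conv G c f h x = F i x" if "x \<in> T i" for i x
      using that F1[of x] F2[of x] by (cases i) (simp_all add: T_def F_def)
    show "F i x = F j x" if "x \<in> topspace (gtop G) \<inter> T i \<inter> T j" for i j x
      using val[of x i] val[of x j] that by simp
    show "\<exists>j. j \<in> UNIV \<and> x \<in> T j \<and> conv G c f h x = F j x" if "x \<in> topspace (gtop G)" for x
    proof (cases "x \<in> ?T1")
      case True
      then have "x \<in> T True" by (simp add: T_def)
      then show ?thesis using val by blast
    next
      case False
      then have "x \<in> T False" using that C(2) by (auto simp: T_def)
      then show ?thesis using val by blast
    qed
  qed
qed

lemma Cc_conv: assumes "f \<in> Cc G" and h: "h \<in> Cc G" shows "conv G c f h \<in> Cc G"
proof (rule Cc_induct[where P="\<lambda>f. conv G c f h \<in> Cc G" and Q=bisection, OF assms(1) bisection_cover])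
  have "conv G c (\<lambda>g. 0) h = (\<lambda>g. 0)" by (simp add: conv_zero_left fun_eq_iff)
  then show "conv G c (\<lambda>g. 0) h \<in> Cc G" by (simp add: Cc_zero)
next
  fix f f' assume add: "conv G c f h \<in> Cc G" "conv G c f' h \<in> Cc G"
  have "conv G c (\<lambda>g. f g + f' g) h = (\<lambda>g. conv G c f h g + conv G c f' h g)"
    by (simp add: fun_eq_iff conv_add_left Cc_fibre_finite h)
  then show "conv G c (\<lambda>g. f g + f' g) h \<in> Cc G" using add by (simp add: Cc_add)
next
  fix f V C
  assume local: "f \<in> Cc G" "bisection V" "compactin (gtop G) C" "C \<subseteq> V" "\<And>g. f g \<noteq> 0 \<Longrightarrow> g \<in> C"
  obtain D where D: "compactin (gtop G) D" "\<And>g. h g \<noteq> 0 \<Longrightarrow> g \<in> D" using Cc_support[OF h] by metis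
  show "conv G c f h \<in> Cc G"
  proof (rule CcI[OF _ compactin_composable_product[OF local(3) D(1)]])
    show "continuous_map (gtop G) euclidean (conv G c f h)"
      by (rule continuous_conv_bisection[OF local(1) h local(2-5)])
    fix g assume "conv G c f h g \<noteq> 0"
    then obtain \<delta> where d: "g \<in> arrows G" "\<delta> \<in> arrows G" "src G g = src G \<delta>" "f (g \<cdot> ginv G \<delta>) \<noteq> 0" "h \<delta> \<noteq> 0"
      using conv_nonzero[OF Cc_fibre_finite[OF h]] by metis
    have "g = (\<lambda>(g, h). g \<cdot> h) (g \<cdot> ginv G \<delta>, \<delta>)" using d mul_src_self[of g] by (simp add: grp)
    moreover have "(g \<cdot> ginv G \<delta>, \<delta>) \<in> composable G \<inter> C \<times> D"
      using d D local(5) by (auto simp: composable_iff grp)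
    ultimately show "g \<in> (\<lambda>(g, h). g \<cdot> h) ` (composable G \<inter> C \<times> D)" by (rule image_eqI)
  qed
qed

lemma Cc_conv_star: assumes f: "f \<in> Cc G" shows "conv_star G c f \<in> Cc G"
proof -
  obtain C where C: "compactin (gtop G) C" "\<And>g. f g \<noteq> 0 \<Longrightarrow> g \<in> C" using Cc_support[OF f] by metis
  have Ca: "C \<subseteq> arrows G" using compactin_subset_topspace[OF C(1)] by (simp add: topspace_gtop)
  show ?thesis
  proof (rule CcI[OF _ image_compactin[OF C(1) continuous_inv]])
    have "continuous_map (gtop G) euclidean (\<lambda>g. c (g, ginv G g))"
      by (rule continuous_map_cocycle[OF continuous_map_ident continuous_inv]) (simp add: topspace_gtop grp)
    moreover have "continuous_map (gtop G) euclidean (\<lambda>g. f (ginv G g))"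
      using continuous_map_compose[OF continuous_inv Cc_continuous[OF f]] by (simp add: o_def)
    ultimately have "continuous_map (gtop G) euclidean (\<lambda>g. cnj (f (ginv G g) * c (g, ginv G g)))"
      by (intro continuous_map_cnj continuous_map_complex_mult)
    then show "continuous_map (gtop G) euclidean (conv_star G c f)"
      by (rule continuous_map_eq) (simp add: conv_star_def topspace_gtop)
    fix g assume "conv_star G c f g \<noteq> 0"
    then have "g \<in> arrows G" "f (ginv G g) \<noteq> 0" by (auto simp: conv_star_def split: if_splits)
    then show "g \<in> ginv G ` C" using C(2)[of "ginv G g"] by (metis image_eqI inv_inv)
  qed
qed

lemma Cc_alg_simps [simp]:
  "carr (Cc_alg G c) = Cc G" "zer (Cc_alg G c) = (\<lambda>g. 0)" "add (Cc_alg G c) f h = (\<lambda>g. f g + h g)"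
  "scl (Cc_alg G c) a f = (\<lambda>g. a * f g)" "mul (Cc_alg G c) = conv G c" "adj (Cc_alg G c) = conv_star G c"
  "nrm (Cc_alg G c) = reduced_norm G c"
  by (auto simp: Cc_alg_def)

lemma sub_Cc_alg: "sub (Cc_alg G c) f h = (\<lambda>g. f g - h g)"
  by (simp add: sub_def)

lemma reduced_norm_le_Cc:
  "f \<in> Cc G \<Longrightarrow> kernel_bounded (ker f) M \<Longrightarrow> 0 \<le> M \<Longrightarrow> reduced_norm G c f \<le> M"
  by (rule reduced_norm_le[OF Cc_fibre_finite])

lemma kernel_bounded_Cc: "f \<in> Cc G \<Longrightarrow> kernel_bounded (ker f) (reduced_norm G c f)"
  by (rule kernel_bounded_reduced_norm[OF Cc_bounded_function])

lemma reduced_norm_nonneg_Cc: "f \<in> Cc G \<Longrightarrow> 0 \<le> reduced_norm G c f"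
  by (rule reduced_norm_nonneg[OF Cc_bounded_function])

lemma reduced_norm_conv:
  "f \<in> Cc G \<Longrightarrow> h \<in> Cc G \<Longrightarrow> reduced_norm G c (conv G c f h) \<le> reduced_norm G c f * reduced_norm G c h"
  by (intro reduced_norm_le_Cc kernel_bounded_conv Cc_bounded_function Cc_conv mult_nonneg_nonneg reduced_norm_nonneg_Cc)

lemma reduced_norm_scale_le: "f \<in> Cc G \<Longrightarrow> reduced_norm G c (\<lambda>g. a * f g) \<le> cmod a * reduced_norm G c f"
  by (rule reduced_norm_le_Cc) (simp_all add: Cc_scale ker_scale kernel_bounded_scale kernel_bounded_Cc reduced_norm_nonneg_Cc)

lemma Cc_ker_inject: "f \<in> Cc G \<Longrightarrow> h \<in> Cc G \<Longrightarrow> ker f = ker h \<Longrightarrow> f = h"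
  by (rule ker_inject) (auto simp: Cc_outside)

text \<open>A function is recovered from its matrix, so associativity and the rules for adjoints
  reduce to matrix identities; the linear laws are pointwise, and bilinearity is read off from the
  finite sums.\<close>

lemma pre_cstar_Cc_alg: "pre_cstar_algebra (Cc_alg G c)"
proof
  note cl = Cc_zero Cc_add Cc_scale Cc_conv Cc_conv_star Cc_fibre_finite column_finite_ker column_finite_kernel_adj_ker
  fix x y z and a b :: complex
  show "zer (Cc_alg G c) \<in> carr (Cc_alg G c)" by (simp add: cl)
  assume "x \<in> carr (Cc_alg G c)"
  then have x: "x \<in> Cc G" by simp
  show "scl (Cc_alg G c) a x \<in> carr (Cc_alg G c)" "adj (Cc_alg G c) x \<in> carr (Cc_alg G c)" using x by (simp_all add: cl)
  show "add (Cc_alg G c) x (zer (Cc_alg G c)) = x"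
    "add (Cc_alg G c) x (scl (Cc_alg G c) (-1) x) = zer (Cc_alg G c)"
    "scl (Cc_alg G c) (a + b) x = add (Cc_alg G c) (scl (Cc_alg G c) a x) (scl (Cc_alg G c) b x)"
    "scl (Cc_alg G c) a (scl (Cc_alg G c) b x) = scl (Cc_alg G c) (a * b) x"
    "scl (Cc_alg G c) 1 x = x"
    by (simp_all add: algebra_simps)
  show "adj (Cc_alg G c) (adj (Cc_alg G c) x) = x"
    by (simp, rule Cc_ker_inject) (simp_all add: cl x ker_conv_star kernel_adj_adj)
  show "adj (Cc_alg G c) (scl (Cc_alg G c) a x) = scl (Cc_alg G c) (cnj a) (adj (Cc_alg G c) x)"
    by (auto simp: conv_star_def fun_eq_iff)
  show "0 \<le> nrm (Cc_alg G c) x" using x by (simp add: reduced_norm_nonneg_Cc)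
  show "nrm (Cc_alg G c) x = 0 \<longleftrightarrow> x = zer (Cc_alg G c)"
  proof
    assume "nrm (Cc_alg G c) x = 0"
    then have "x g = 0" for g
      using norm_le_reduced_norm[OF Cc_bounded_function[OF x], of g] Cc_outside[OF x, of g] by fastforce
    then show "x = zer (Cc_alg G c)" by auto
  next
    assume "x = zer (Cc_alg G c)"
    then have "reduced_norm G c x \<le> 0"
      using reduced_norm_scale_le[OF x, of 0] by simp
    then show "nrm (Cc_alg G c) x = 0" using reduced_norm_nonneg_Cc[OF x] by simp
  qed
  show "nrm (Cc_alg G c) (scl (Cc_alg G c) a x) = cmod a * nrm (Cc_alg G c) x"
  proof (cases "a = 0")
    case True
    then show ?thesis
      using reduced_norm_scale_le[OF x, of 0] reduced_norm_nonneg_Cc[OF Cc_scale[OF x, of 0]] by simp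
  next
    case False
    \<comment> \<open>Homogeneity follows from its upper half, applied to the function a x and the
      scalar 1/a.\<close>
    have "reduced_norm G c (\<lambda>g. (1 / a) * (a * x g)) \<le> cmod (1 / a) * reduced_norm G c (\<lambda>g. a * x g)"
      by (rule reduced_norm_scale_le[OF Cc_scale[OF x]])
    then have "cmod a * reduced_norm G c x \<le> reduced_norm G c (\<lambda>g. a * x g)"
      using False by (simp add: norm_divide field_simps)
    then show ?thesis using reduced_norm_scale_le[OF x, of a] by simp
  qed
  show "nrm (Cc_alg G c) (mul (Cc_alg G c) (adj (Cc_alg G c) x) x) = (nrm (Cc_alg G c) x)\<^sup>2"
  proof -
    let ?n = "reduced_norm G c (conv G c (conv_star G c x) x)"
    have xx: "conv G c (conv_star G c x) x \<in> Cc G" using x by (simp add: cl)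
    have "reduced_norm G c (conv_star G c x) \<le> reduced_norm G c x"
      by (rule reduced_norm_le_Cc)
        (simp_all add: cl x ker_conv_star kernel_bounded_adj kernel_bounded_Cc reduced_norm_nonneg_Cc)
    then have "?n \<le> reduced_norm G c x * reduced_norm G c x"
      using reduced_norm_conv[OF Cc_conv_star[OF x] x] mult_right_mono[OF _ reduced_norm_nonneg_Cc[OF x]] order_trans by blast
    \<comment> \<open>The reverse inequality: a bound n for the matrix of x* x gives the bound sqrt
      n for the matrix of x.\<close>
    moreover have "reduced_norm G c x \<le> sqrt ?n"
    proof (rule reduced_norm_le_Cc[OF x kernel_bounded_cstar])
      show "kernel_bounded (kernel_mult (kernel_adj (ker x)) (ker x)) ((sqrt ?n)\<^sup>2)"
        using kernel_bounded_Cc[OF xx] reduced_norm_nonneg_Cc[OF xx] x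
        by (simp add: ker_conv cl ker_conv_star)
    qed (use x reduced_norm_nonneg_Cc[OF xx] in \<open>simp_all add: cl\<close>)
    then have "(reduced_norm G c x)\<^sup>2 \<le> ?n"
      using power_mono[of "reduced_norm G c x" "sqrt ?n" 2] reduced_norm_nonneg_Cc[OF x] reduced_norm_nonneg_Cc[OF xx] by simp
    ultimately show ?thesis by (simp add: power2_eq_square)
  qed
  assume "y \<in> carr (Cc_alg G c)"
  then have y: "y \<in> Cc G" by simp
  show "add (Cc_alg G c) x y \<in> carr (Cc_alg G c)" "mul (Cc_alg G c) x y \<in> carr (Cc_alg G c)" using x y by (simp_all add: cl)
  show "add (Cc_alg G c) x y = add (Cc_alg G c) y x"
    "scl (Cc_alg G c) a (add (Cc_alg G c) x y) = add (Cc_alg G c) (scl (Cc_alg G c) a x) (scl (Cc_alg G c) a y)"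
    by (simp_all add: algebra_simps)
  show "mul (Cc_alg G c) (scl (Cc_alg G c) a x) y = scl (Cc_alg G c) a (mul (Cc_alg G c) x y)"
    "mul (Cc_alg G c) x (scl (Cc_alg G c) a y) = scl (Cc_alg G c) a (mul (Cc_alg G c) x y)"
    using x y by (simp_all add: fun_eq_iff conv_scale_left conv_scale_right cl)
  show "adj (Cc_alg G c) (add (Cc_alg G c) x y) = add (Cc_alg G c) (adj (Cc_alg G c) x) (adj (Cc_alg G c) y)"
    by (auto simp: conv_star_def fun_eq_iff algebra_simps)
  show "adj (Cc_alg G c) (mul (Cc_alg G c) x y) = mul (Cc_alg G c) (adj (Cc_alg G c) y) (adj (Cc_alg G c) x)"
    by (simp, rule Cc_ker_inject) (simp_all add: cl x y ker_conv_star ker_conv kernel_adj_mult)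
  show "nrm (Cc_alg G c) (add (Cc_alg G c) x y) \<le> nrm (Cc_alg G c) x + nrm (Cc_alg G c) y"
    by (simp, rule reduced_norm_le_Cc)
      (simp_all add: cl x y ker_add kernel_bounded_add kernel_bounded_Cc reduced_norm_nonneg_Cc)
  show "nrm (Cc_alg G c) (mul (Cc_alg G c) x y) \<le> nrm (Cc_alg G c) x * nrm (Cc_alg G c) y"
    using x y by (simp add: reduced_norm_conv)
  assume "z \<in> carr (Cc_alg G c)"
  then have z: "z \<in> Cc G" by simp
  show "add (Cc_alg G c) (add (Cc_alg G c) x y) z = add (Cc_alg G c) x (add (Cc_alg G c) y z)"
    by (simp add: algebra_simps)
  show "mul (Cc_alg G c) (mul (Cc_alg G c) x y) z = mul (Cc_alg G c) x (mul (Cc_alg G c) y z)"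
    by (simp, rule Cc_ker_inject) (simp_all add: cl x y z ker_conv kernel_mult_assoc)
  show "mul (Cc_alg G c) x (add (Cc_alg G c) y z) = add (Cc_alg G c) (mul (Cc_alg G c) x y) (mul (Cc_alg G c) x z)"
    "mul (Cc_alg G c) (add (Cc_alg G c) x y) z = add (Cc_alg G c) (mul (Cc_alg G c) x z) (mul (Cc_alg G c) y z)"
    using x y z by (simp_all add: fun_eq_iff conv_add_left conv_add_right cl)
qed

lemma Cc_bump:
  assumes "compactin (gtop G) K" "openin (gtop G) W" "K \<subseteq> W"
  obtains \<phi> :: "'a \<Rightarrow> real" where "continuous_map (gtop G) euclideanreal \<phi>" "(\<lambda>g. complex_of_real (\<phi> g)) \<in> Cc G"
    "\<And>g. g \<in> K \<Longrightarrow> \<phi> g = 1" "\<And>g. 0 \<le> \<phi> g \<and> \<phi> g \<le> 1" "\<And>g. \<phi> g \<noteq> 0 \<Longrightarrow> g \<in> W"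
proof -
  obtain \<psi> U C where p: "continuous_map (gtop G) euclideanreal \<psi>" "openin (gtop G) U" "K \<subseteq> U"
    "\<And>y. y \<in> U \<Longrightarrow> \<psi> y = 1" "\<And>y. y \<in> topspace (gtop G) \<Longrightarrow> 0 \<le> \<psi> y \<and> \<psi> y \<le> 1"
    "compactin (gtop G) C" "C \<subseteq> W" "\<And>y. y \<in> topspace (gtop G) \<Longrightarrow> y \<notin> C \<Longrightarrow> \<psi> y = 0"
    by (rule bump_function[OF hausdorff locally_compact assms]) (rule that)
  \<comment> \<open>Off the arrows \<psi> is unconstrained; the value there is set to 0, as
    membership in \<open>Cc\<close> demands.\<close>
  define \<phi> where "\<phi> = (\<lambda>g. if g \<in> arrows G then \<psi> g else 0)"
  have cont: "continuous_map (gtop G) euclideanreal \<phi>"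
    by (rule continuous_map_eq[OF p(1)]) (simp add: \<phi>_def topspace_gtop)
  have supp: "g \<in> C" if "\<phi> g \<noteq> 0" for g
    using p(8)[of g] that by (auto simp: \<phi>_def topspace_gtop split: if_splits)
  show thesis
  proof (rule that[OF cont])
    show "(\<lambda>g. complex_of_real (\<phi> g)) \<in> Cc G"
      by (rule CcI[OF continuous_map_complex_of_real[OF cont] p(6)]) (use supp in simp)
    show "\<phi> g = 1" if "g \<in> K" for g
      using that p(3) p(4) openin_subset[OF p(2)] by (auto simp: \<phi>_def topspace_gtop)
    show "0 \<le> \<phi> g \<and> \<phi> g \<le> 1" for g using p(5)[of g] by (simp add: \<phi>_def topspace_gtop)
    show "g \<in> W" if "\<phi> g \<noteq> 0" for g using supp[OF that] p(7) by blast
  qed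
qed

end

section \<open>Maximal abelian symmetric subgroupoids\<close>

context twisted_groupoid
begin

text \<open>A unit acts trivially on the isotropy arrows composable with it, and the cocycle is 1
  there, so adjoining all units to \<open>S\<close> stays within the family.\<close>

lemma maximal_contains_units:
  assumes S: "S \<in> abelian_symmetric_subgroupoids G c"
    and max: "\<forall>T \<in> abelian_symmetric_subgroupoids G c. S \<subseteq> T \<longrightarrow> T = S"
  shows "units G \<subseteq> S"
proof -
  let ?T = "S \<union> units G"
  have s: "S \<subseteq> arrows G" "\<And>g. g \<in> S \<Longrightarrow> ginv G g \<in> S"
    "\<And>g h. g \<in> S \<Longrightarrow> h \<in> S \<Longrightarrow> (g, h) \<in> composable G \<Longrightarrow> g \<cdot> h \<in> S"
    "\<And>g. g \<in> S \<Longrightarrow> src G g = rng G g"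
    "\<And>g h. g \<in> S \<Longrightarrow> h \<in> S \<Longrightarrow> (g, h) \<in> composable G \<Longrightarrow> (h, g) \<in> composable G \<and> g \<cdot> h = h \<cdot> g"
    "\<And>g h. g \<in> S \<Longrightarrow> h \<in> S \<Longrightarrow> (g, h) \<in> composable G \<Longrightarrow> c (g, h) = c (h, g)"
    using S by (auto simp: abelian_symmetric_subgroupoids_def subgroupoid_def Iso_def abelian_subset_def symmetric_on_def)
  have u: "u \<in> arrows G" "src G u = u" "rng G u = u" if "u \<in> units G" for u
    using that by (auto simp: units_iff unit_rng)
  have left: "u \<cdot> h = h" "c (u, h) = 1" if "u \<in> units G" "(u, h) \<in> composable G" for u h
    using that u[of u] rng_mul_self[of h] cocycle_rng[of h] by (auto simp: composable_iff)
  have right: "h \<cdot> u = h" "c (h, u) = 1" if "u \<in> units G" "(h, u) \<in> composable G" for u h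
    using that u[of u] mul_src_self[of h] cocycle_src[of h] by (auto simp: composable_iff)
  have iso: "src G g = rng G g" if "g \<in> ?T" for g using that s u by auto
  have sym: "(h, g) \<in> composable G" if "g \<in> ?T" "h \<in> ?T" "(g, h) \<in> composable G" for g h
    using that iso[OF that(1)] iso[OF that(2)] by (simp add: composable_iff)
  have "subgroupoid G ?T"
    unfolding subgroupoid_def
  proof (intro conjI ballI impI)
    show "?T \<subseteq> arrows G" using s u by blast
    show "ginv G g \<in> ?T" if "g \<in> ?T" for g using that s(2) u inv_src by (metis Un_iff)
    show "g \<cdot> h \<in> ?T" if "g \<in> ?T" "h \<in> ?T" "(g, h) \<in> composable G" for g h
      using that s(3)[of g h] left(1)[of g h] right(1)[of h g] by auto
  qed
  moreover have "?T \<subseteq> Iso G" using s u by (auto simp: Iso_def)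
  moreover have "abelian_subset G ?T"
    unfolding abelian_subset_def
  proof (intro ballI impI conjI)
    fix g h assume a: "g \<in> ?T" "h \<in> ?T" "(g, h) \<in> composable G"
    show "(h, g) \<in> composable G" by (rule sym[OF a])
    then show "g \<cdot> h = h \<cdot> g"
      using a s(5)[of g h] left(1)[of g h] right(1)[of h g] left(1)[of h g] right(1)[of g h] by auto
  qed
  moreover have "symmetric_on G c ?T"
    unfolding symmetric_on_def
  proof (intro ballI impI)
    fix g h assume a: "g \<in> ?T" "h \<in> ?T" "(g, h) \<in> composable G"
    then show "c (g, h) = c (h, g)"
      using sym[OF a] s(6)[of g h] left(2)[of g h] right(2)[of h g] left(2)[of h g] right(2)[of g h] by auto
  qed
  ultimately have "?T \<in> abelian_symmetric_subgroupoids G c"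
    by (simp add: abelian_symmetric_subgroupoids_def)
  then show ?thesis using max by blast
qed

text \<open>Point masses in the twisted algebra of an isotropy group multiply as delta_g delta_h =
  c(g, h) delta_gh. For isotropy arrows at one unit the relation says that these two point masses
  commute, which is why it is stable under products and inverses.\<close>

definition symcomm :: "'a \<Rightarrow> 'a \<Rightarrow> bool" where
  "symcomm g h \<longleftrightarrow> g \<cdot> h = h \<cdot> g \<and> c (g, h) = c (h, g)"

lemma symcomm_sym: "symcomm g h \<Longrightarrow> symcomm h g"
  by (simp add: symcomm_def)

lemma isotropy_iff: "g \<in> isotropy_at G u \<longleftrightarrow> g \<in> arrows G \<and> src G g = u \<and> rng G g = u"
  by (auto simp: isotropy_at_def src_fibre_def rng_fibre_def)

lemma isotropy_mul: "g \<in> isotropy_at G u \<Longrightarrow> h \<in> isotropy_at G u \<Longrightarrow> g \<cdot> h \<in> isotropy_at G u"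
  by (simp add: isotropy_iff grp)

lemma isotropy_inv: "g \<in> isotropy_at G u \<Longrightarrow> ginv G g \<in> isotropy_at G u"
  by (simp add: isotropy_iff grp)

text \<open>Commutation moves g through h and then k, while the cocycle identity is applied to the
  triples (g, h, k), (h, g, k) and (h, k, g); the common factor c(h, k) cancels at the end.\<close>

lemma symcomm_mul:
  assumes i: "g \<in> isotropy_at G u" "h \<in> isotropy_at G u" "k \<in> isotropy_at G u"
    and gh: "symcomm g h" and gk: "symcomm g k"
  shows "symcomm g (h \<cdot> k)"
proof -
  have a: "g \<in> arrows G" "h \<in> arrows G" "k \<in> arrows G" "src G g = u" "rng G g = u"
    "src G h = u" "rng G h = u" "src G k = u" "rng G k = u" using i by (auto simp: isotropy_iff)
  have comm: "g \<cdot> h = h \<cdot> g" "g \<cdot> k = k \<cdot> g" and cc: "c (g, h) = c (h, g)" "c (g, k) = c (k, g)"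
    using gh gk by (auto simp: symcomm_def)
  have "g \<cdot> (h \<cdot> k) = (g \<cdot> h) \<cdot> k" using a by (simp add: mul_ac)
  also have "\<dots> = h \<cdot> (g \<cdot> k)" using a comm(1) by (simp add: mul_ac)
  also have "\<dots> = (h \<cdot> k) \<cdot> g" using a comm(2) by (simp add: mul_ac)
  finally have 1: "g \<cdot> (h \<cdot> k) = (h \<cdot> k) \<cdot> g" .
  have "c (g, h \<cdot> k) * c (h, k) = c (g \<cdot> h, k) * c (g, h)" by (rule cocycle_eq) (use a in auto)
  also have "\<dots> = c (h \<cdot> g, k) * c (h, g)" by (simp add: comm cc)
  also have "\<dots> = c (h, g \<cdot> k) * c (g, k)" by (rule cocycle_eq[symmetric]) (use a in auto)
  also have "\<dots> = c (h, k \<cdot> g) * c (k, g)" by (simp add: comm cc)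
  also have "\<dots> = c (h \<cdot> k, g) * c (h, k)" by (rule cocycle_eq) (use a in auto)
  finally have "c (g, h \<cdot> k) = c (h \<cdot> k, g)"
    using cocycle_nonzero[of h k] a by simp
  with 1 show ?thesis by (simp add: symcomm_def)
qed

lemma symcomm_inv:
  assumes i: "g \<in> isotropy_at G u" "h \<in> isotropy_at G u" and gh: "symcomm g h"
  shows "symcomm g (ginv G h)"
proof -
  let ?k = "ginv G h"
  have a: "g \<in> arrows G" "h \<in> arrows G" "?k \<in> arrows G" "src G g = u" "rng G g = u"
    "src G h = u" "rng G h = u" "src G ?k = u" "rng G ?k = u" using i by (auto simp: isotropy_iff grp)
  have comm: "g \<cdot> h = h \<cdot> g" and cc: "c (g, h) = c (h, g)" using gh by (auto simp: symcomm_def)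
  have g1: "g \<cdot> u = g" "u \<cdot> g = g" and c1: "c (g, u) = 1" "c (u, g) = 1"
    using a mul_src_self[of g] rng_mul_self[of g] cocycle_src[of g] cocycle_rng[of g] by auto
  have hk: "h \<cdot> ?k = u" "?k \<cdot> h = u" using a by (auto simp: grp)
  have "?k \<cdot> g = ?k \<cdot> ((g \<cdot> h) \<cdot> ?k)" using a g1 hk by (simp add: mul_ac)
  also have "\<dots> = ?k \<cdot> (h \<cdot> (g \<cdot> ?k))" unfolding comm using a by (simp add: mul_ac)
  also have "\<dots> = g \<cdot> ?k" using a by (simp add: grp)
  finally have 1: "g \<cdot> ?k = ?k \<cdot> g" by simp
  have "c (g, h \<cdot> ?k) * c (h, ?k) = c (g \<cdot> h, ?k) * c (g, h)" by (rule cocycle_eq) (use a in auto)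
  also have "\<dots> = c (h \<cdot> g, ?k) * c (h, g)" by (simp add: comm cc)
  also have "\<dots> = c (h, g \<cdot> ?k) * c (g, ?k)" by (rule cocycle_eq[symmetric]) (use a in auto)
  finally have e1: "c (h, ?k \<cdot> g) * c (g, ?k) = c (h, ?k)" using hk c1 1 by simp
  have "c (h, ?k \<cdot> g) * c (?k, g) = c (h \<cdot> ?k, g) * c (h, ?k)" by (rule cocycle_eq) (use a in auto)
  then have e2: "c (h, ?k \<cdot> g) * c (?k, g) = c (h, ?k)" using hk c1 by simp
  have "c (h, ?k \<cdot> g) \<noteq> 0" using a by (intro cocycle_nonzero) (auto simp: grp)
  with e1 e2 have "c (g, ?k) = c (?k, g)" by (metis mult_left_cancel)
  with 1 show ?thesis by (simp add: symcomm_def)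
qed

text \<open>The double commutant of \<open>\<nu>\<close> and the isotropy of \<open>S\<close>, taken with respect to the relation
  \<open>symcomm\<close>, can be added to \<open>S\<close>.\<close>

lemma maximal_contains_symcomm:
  assumes S: "S \<in> abelian_symmetric_subgroupoids G c"
    and max: "\<forall>T \<in> abelian_symmetric_subgroupoids G c. S \<subseteq> T \<longrightarrow> T = S"
    and nu: "\<nu> \<in> isotropy_at G u" and comm: "\<And>t. t \<in> S \<Longrightarrow> t \<in> isotropy_at G u \<Longrightarrow> symcomm \<nu> t"
  shows "\<nu> \<in> S"
proof -
  define I where "I = isotropy_at G u"
  define P where "P = insert \<nu> (S \<inter> I)"
  define Z where "Z = {g \<in> I. \<forall>p\<in>P. symcomm g p}"
  define H where "H = {h \<in> I. \<forall>g\<in>Z. symcomm g h}"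
  let ?T = "S \<union> H"
  have s: "S \<subseteq> arrows G" "\<And>g. g \<in> S \<Longrightarrow> ginv G g \<in> S"
    "\<And>g h. g \<in> S \<Longrightarrow> h \<in> S \<Longrightarrow> (g, h) \<in> composable G \<Longrightarrow> g \<cdot> h \<in> S"
    "\<And>g. g \<in> S \<Longrightarrow> src G g = rng G g"
    "\<And>g h. g \<in> S \<Longrightarrow> h \<in> S \<Longrightarrow> (g, h) \<in> composable G \<Longrightarrow> (h, g) \<in> composable G \<and> g \<cdot> h = h \<cdot> g"
    "\<And>g h. g \<in> S \<Longrightarrow> h \<in> S \<Longrightarrow> (g, h) \<in> composable G \<Longrightarrow> c (g, h) = c (h, g)"
    using S by (auto simp: abelian_symmetric_subgroupoids_def subgroupoid_def Iso_def abelian_subset_def symmetric_on_def)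
  have PI: "P \<subseteq> I" using nu by (auto simp: P_def I_def)
  have I: "g \<in> arrows G" "src G g = u" "rng G g = u" if "g \<in> I" for g using that by (auto simp: I_def isotropy_iff)
  have Icomp: "(g, h) \<in> composable G" if "g \<in> I" "h \<in> I" for g h using that I by (simp add: composable_iff)
  have PP: "symcomm p q" if "p \<in> P" "q \<in> P" for p q
  proof -
    have "symcomm p q" if "p \<in> S \<inter> I" "q \<in> S \<inter> I" for p q
      using that s(5)[of p q] s(6)[of p q] Icomp[of p q] by (simp add: symcomm_def)
    moreover have "symcomm \<nu> q" if "q \<in> S \<inter> I" for q using comm that by (simp add: I_def)
    moreover have "symcomm \<nu> \<nu>" by (simp add: symcomm_def)
    ultimately show ?thesis using that symcomm_sym unfolding P_def by blast
  qed
  \<comment> \<open>The double commutant pattern: members of \<open>P\<close> commute mutually, so P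
    \<subseteq> Z, and what commutes with all of \<open>Z\<close> commutes with \<open>P\<close>.
    Hence P \<subseteq> H \<subseteq> Z, and \<open>H\<close> commutes with itself.\<close>
  have PZ: "P \<subseteq> Z" using PP PI by (auto simp: Z_def)
  have PH: "P \<subseteq> H" using PI symcomm_sym by (auto simp: H_def Z_def)
  have HZ: "H \<subseteq> Z" using PZ symcomm_sym by (auto simp: H_def Z_def)
  have HH: "symcomm g h" if "g \<in> H" "h \<in> H" for g h using that HZ by (auto simp: H_def)
  have HI: "H \<subseteq> I" by (auto simp: H_def)
  have Hmul: "g \<cdot> h \<in> H" if "g \<in> H" "h \<in> H" for g h
    using that symcomm_mul[of _ u g h] isotropy_mul[of g u h] unfolding H_def Z_def I_def by blast
  have Hinv: "ginv G g \<in> H" if "g \<in> H" for g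
    using that symcomm_inv[of _ u g] isotropy_inv[of g u] unfolding H_def Z_def I_def by blast
  have iso: "g \<in> arrows G \<and> src G g = rng G g" if "g \<in> ?T" for g using that s HI I by auto
  \<comment> \<open>Composable isotropy arrows share their unit. At u both lie in \<open>H\<close>,
    which contains the isotropy of \<open>S\<close> there; away from u both lie in \<open>S\<close>.
    No mixed pairs remain.\<close>
  have both: "(g \<in> S \<and> h \<in> S) \<or> (g \<in> H \<and> h \<in> H)" if "g \<in> ?T" "h \<in> ?T" "(g, h) \<in> composable G" for g h
  proof (cases "src G g = u")
    case True
    then have "g \<in> I" "h \<in> I"
      using iso[OF that(1)] iso[OF that(2)] that(3) by (auto simp: I_def isotropy_iff composable_iff)
    then show ?thesis using that PH by (auto simp: P_def)
  next
    case False
    then have "g \<notin> I" "h \<notin> I" using that(3) I by (auto simp: composable_iff)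
    then show ?thesis using that HI by auto
  qed
  have "subgroupoid G ?T"
    unfolding subgroupoid_def
  proof (intro conjI ballI impI)
    show "?T \<subseteq> arrows G" using iso by blast
    show "ginv G g \<in> ?T" if "g \<in> ?T" for g using that s(2) Hinv by blast
    show "g \<cdot> h \<in> ?T" if "g \<in> ?T" "h \<in> ?T" "(g, h) \<in> composable G" for g h
      using both[OF that] s(3)[of g h] that(3) Hmul[of g h] by blast
  qed
  moreover have "?T \<subseteq> Iso G" using iso by (auto simp: Iso_def)
  moreover have "abelian_subset G ?T"
    unfolding abelian_subset_def
  proof (intro ballI impI)
    fix g h assume a: "g \<in> ?T" "h \<in> ?T" "(g, h) \<in> composable G"
    show "(h, g) \<in> composable G \<and> g \<cdot> h = h \<cdot> g"
      using both[OF a]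
    proof
      assume "g \<in> S \<and> h \<in> S"
      then show ?thesis using s(5) a(3) by blast
    next
      assume "g \<in> H \<and> h \<in> H"
      then show ?thesis using HH[of g h] Icomp[of h g] HI by (auto simp: symcomm_def)
    qed
  qed
  moreover have "symmetric_on G c ?T"
    unfolding symmetric_on_def
  proof (intro ballI impI)
    fix g h assume a: "g \<in> ?T" "h \<in> ?T" "(g, h) \<in> composable G"
    show "c (g, h) = c (h, g)"
      using both[OF a]
    proof
      assume "g \<in> S \<and> h \<in> S"
      then show ?thesis using s(6) a(3) by blast
    next
      assume "g \<in> H \<and> h \<in> H"
      then show ?thesis using HH[of g h] by (simp add: symcomm_def)
    qed
  qed
  ultimately have "?T \<in> abelian_symmetric_subgroupoids G c"
    by (simp add: abelian_symmetric_subgroupoids_def)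
  then have "?T = S" using max by blast
  then show ?thesis using PH by (auto simp: P_def)
qed

section \<open>Powers and conjugates in isotropy groups\<close>

lemma gpow_isotropy: "t \<in> isotropy_at G u \<Longrightarrow> gpow G t n \<in> isotropy_at G u"
  by (induction n) (auto simp: isotropy_iff grp)

lemma gpow_add: "t \<in> isotropy_at G u \<Longrightarrow> gpow G t (m + n) = gpow G t m \<cdot> gpow G t n"
proof (induction n)
  case 0
  then show ?case using gpow_isotropy[OF 0, of m] mul_src_self[of "gpow G t m"] by (auto simp: isotropy_iff)
next
  case (Suc n)
  then show ?case
    using gpow_isotropy[OF Suc.prems, of m] gpow_isotropy[OF Suc.prems, of n] by (simp add: isotropy_iff mul_ac)
qed

lemma gpow_1: "t \<in> isotropy_at G u \<Longrightarrow> gpow G t (Suc 0) = t"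
  using rng_mul_self[of t] by (simp add: isotropy_iff)

text \<open>If no power \<open>t\<^sup>j\<close> with \<open>1 \<le> j \<le> k\<close> commutes with \<open>\<nu>\<close>, then the conjugates of \<open>\<nu>\<close> by
  \<open>1, t, \<dots>, t\<^sup>k\<close> are distinct.\<close>

lemma inj_on_conjugates:
  assumes nu: "\<nu> \<in> isotropy_at G u" and t: "t \<in> isotropy_at G u"
    and no: "\<And>j. j \<in> {1..k} \<Longrightarrow> \<nu> \<cdot> gpow G t j \<noteq> gpow G t j \<cdot> \<nu>"
  shows "inj_on (\<lambda>n. ginv G (gpow G t n) \<cdot> (\<nu> \<cdot> gpow G t n)) {..k}"
proof (rule linorder_inj_onI)
  fix m n assume mn: "m < n" "m \<in> {..k}" "n \<in> {..k}"
  \<comment> \<open>For m < n equal conjugates would make the power of t with exponent n - m commute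
    with \<nu>, and this exponent lies between 1 and k.\<close>
  define p q where "p = gpow G t m" and "q = gpow G t (n - m)"
  have n: "gpow G t n = q \<cdot> p" using gpow_add[OF t, of "n - m" m] mn by (simp add: p_def q_def)
  have a: "p \<in> arrows G" "q \<in> arrows G" "src G p = u" "rng G p = u" "src G q = u" "rng G q = u"
    "\<nu> \<in> arrows G" "src G \<nu> = u" "rng G \<nu> = u"
    using gpow_isotropy[OF t] nu by (auto simp: p_def q_def isotropy_iff)
  show "ginv G (gpow G t m) \<cdot> (\<nu> \<cdot> gpow G t m) \<noteq> ginv G (gpow G t n) \<cdot> (\<nu> \<cdot> gpow G t n)"
  proof
    assume eq: "ginv G (gpow G t m) \<cdot> (\<nu> \<cdot> gpow G t m) = ginv G (gpow G t n) \<cdot> (\<nu> \<cdot> gpow G t n)"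
    then have "ginv G p \<cdot> (\<nu> \<cdot> p) = ginv G p \<cdot> (ginv G q \<cdot> (\<nu> \<cdot> (q \<cdot> p)))"
      unfolding n using a by (simp add: p_def[symmetric] grp)
    then have "p \<cdot> (ginv G p \<cdot> (\<nu> \<cdot> p)) = p \<cdot> (ginv G p \<cdot> (ginv G q \<cdot> (\<nu> \<cdot> (q \<cdot> p))))" by simp
    then have "\<nu> \<cdot> p = ginv G q \<cdot> (\<nu> \<cdot> (q \<cdot> p))" using a by (simp add: grp)
    then have "q \<cdot> (\<nu> \<cdot> p) = \<nu> \<cdot> (q \<cdot> p)" using a by (simp add: grp)
    then have "(q \<cdot> (\<nu> \<cdot> p)) \<cdot> ginv G p = (\<nu> \<cdot> (q \<cdot> p)) \<cdot> ginv G p" by simp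
    then have "q \<cdot> \<nu> = \<nu> \<cdot> q" using a mul_src_self[of \<nu>] mul_src_self[of q] by (simp add: grp)
    moreover have "n - m \<in> {1..k}" using mn by auto
    ultimately show False using no[of "n - m"] by (simp add: q_def)
  qed
qed auto

end

section \<open>The conditional expectation onto the subalgebra of an open and closed subgroupoid\<close>

locale cartan_groupoid = twisted_etale_groupoid +
  fixes S :: "'a set"
  assumes S_abelian_symmetric: "S \<in> abelian_symmetric_subgroupoids G c"
    and S_maximal: "\<forall>T \<in> abelian_symmetric_subgroupoids G c. S \<subseteq> T \<longrightarrow> T = S"
    and S_open: "openin (gtop G) S"
    and S_closed: "closedin (gtop G) S"
    and S_normal: "normal_subset G S"
    and S_immediately_centralizing: "immediately_centralizing G S"

sublocale cartan_groupoid \<subseteq> twisted_subgroupoid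
proof
  show "subgroupoid G S" using S_abelian_symmetric by (simp add: abelian_symmetric_subgroupoids_def)
  show "units G \<subseteq> S" by (rule maximal_contains_units[OF S_abelian_symmetric S_maximal])
qed

sublocale twisted_etale_groupoid \<subseteq> P: pre_cstar_algebra "Cc_alg G c"
  by (rule pre_cstar_Cc_alg)

sublocale twisted_etale_groupoid \<subseteq> A: cstar_algebra "Cstar_r G c"
  unfolding Cstar_r_def by (rule P.cstar_completion)

context twisted_etale_groupoid
begin

abbreviation "cls \<equiv> P.cls"

lemma cauchy_Cc: "P.cauchy \<sigma> \<Longrightarrow> \<sigma> n \<in> Cc G"
  using P.cauchy_closed by simp

lemma cls_eq_iff_Cc:
  "P.cauchy \<sigma> \<Longrightarrow> P.cauchy \<tau> \<Longrightarrow> cls \<sigma> = cls \<tau> \<longleftrightarrow> (\<lambda>n. reduced_norm G c (\<lambda>g. \<sigma> n g - \<tau> n g)) \<longlonglongrightarrow> 0"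
  using P.cls_eq_iff[of \<sigma> \<tau>] by (simp add: sub_Cc_alg)

lemma cls_zero_iff: "P.cauchy \<sigma> \<Longrightarrow> cls \<sigma> = zer (Cstar_r G c) \<longleftrightarrow> (\<lambda>n. reduced_norm G c (\<sigma> n)) \<longlonglongrightarrow> 0"
  unfolding Cstar_r_def P.zer_completion
  using cls_eq_iff_Cc[of \<sigma> "\<lambda>n. \<lambda>g. 0"] P.cauchy_const[of "\<lambda>g. 0"] by (simp add: Cc_zero)

lemmas cls_ops = P.add_cls[folded Cstar_r_def] P.scl_cls[folded Cstar_r_def]
  P.mul_cls[folded Cstar_r_def] P.adj_cls[folded Cstar_r_def] P.sub_cls[folded Cstar_r_def]

lemmas cls_carr = P.cls_carr[folded Cstar_r_def]
lemmas Cstar_r_cases = P.completion_cases[folded Cstar_r_def]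
lemmas nrm_cls_Cc = P.nrm_cls[folded Cstar_r_def]

lemma norm_le_reduced_norm_Cc: "f \<in> Cc G \<Longrightarrow> cmod (f g) \<le> reduced_norm G c f"
  using norm_le_reduced_norm[OF Cc_bounded_function, of f g] reduced_norm_nonneg_Cc[of f] Cc_outside[of f g]
  by (cases "g \<in> arrows G") auto

lemma Cc_diff: "f \<in> Cc G \<Longrightarrow> h \<in> Cc G \<Longrightarrow> (\<lambda>g. f g - h g) \<in> Cc G"
  using P.sub_closed[of f h] by (simp add: sub_Cc_alg)

lemma cauchy_pointwise:
  assumes "P.cauchy \<sigma>" shows "convergent (\<lambda>n. \<sigma> n g)"
proof (rule Cauchy_convergent, rule metric_CauchyI)
  fix e :: real assume "0 < e"
  then obtain N where N: "\<forall>m\<ge>N. \<forall>n\<ge>N. reduced_norm G c (\<lambda>g. \<sigma> m g - \<sigma> n g) < e"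
    using assms unfolding P.cauchy_iff by (auto simp: sub_Cc_alg)
  have "dist (\<sigma> m g) (\<sigma> n g) < e" if "m \<ge> N" "n \<ge> N" for m n
  proof -
    have "cmod (\<sigma> m g - \<sigma> n g) \<le> reduced_norm G c (\<lambda>g. \<sigma> m g - \<sigma> n g)"
      by (rule norm_le_reduced_norm_Cc[OF Cc_diff[OF cauchy_Cc[OF assms] cauchy_Cc[OF assms]]])
    then show ?thesis using N that by (auto simp: dist_norm intro: le_less_trans)
  qed
  then show "\<exists>N. \<forall>m\<ge>N. \<forall>n\<ge>N. dist (\<sigma> m g) (\<sigma> n g) < e" by blast
qed

lemma reduced_norm_tendsto_zero:
  assumes s: "P.cauchy \<sigma>" and lim: "\<And>g. g \<in> arrows G \<Longrightarrow> (\<lambda>n. \<sigma> n g) \<longlonglongrightarrow> 0"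
  shows "(\<lambda>n. reduced_norm G c (\<sigma> n)) \<longlonglongrightarrow> 0"
proof (rule bounded_function_limit_zero[OF _ _ _ lim])
  show "bounded_function (\<sigma> n)" for n by (rule Cc_bounded_function[OF cauchy_Cc[OF s]])
  show "bounded_function (\<lambda>g. \<sigma> m g - \<sigma> n g)" for m n
    by (intro Cc_bounded_function Cc_diff cauchy_Cc[OF s])
  show "\<exists>N. \<forall>m\<ge>N. \<forall>n\<ge>N. reduced_norm G c (\<lambda>g. \<sigma> m g - \<sigma> n g) < e" if "0 < e" for e
    using s that unfolding P.cauchy_iff by (auto simp: sub_Cc_alg)
qed

end

context cartan_groupoid
begin

section \<open>Functions supported in the subgroupoid\<close>

abbreviation "E \<equiv> extend_by_zero S"

definition CcS :: "('a \<Rightarrow> complex) set" where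
  "CcS = {f \<in> Cc G. \<forall>g. g \<notin> S \<longrightarrow> f g = 0}"

lemma CcS_Cc: "f \<in> CcS \<Longrightarrow> f \<in> Cc G"
  by (simp add: CcS_def)

lemma E_CcS: "f \<in> CcS \<Longrightarrow> E f = f"
  by (auto simp: CcS_def extend_by_zero_def)

text \<open>As \<open>S\<close> is open and closed, its indicator is continuous, and
  \<open>E\<close> is multiplication by it.\<close>

lemma E_closed: assumes "f \<in> Cc G" shows "E f \<in> CcS"
proof -
  let ?k = "\<lambda>g. if g \<in> S then 1 else (0 :: complex)"
  have "continuous_map (gtop G) euclidean ?k"
  proof (rule pasting_lemma[where I=UNIV and T="\<lambda>b. if b then S else topspace (gtop G) - S" and f="\<lambda>b _. if b then 1 else 0"])
    show "openin (gtop G) (if b then S else topspace (gtop G) - S)" for b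
      using S_open S_closed by auto
  qed (auto split: if_splits)
  then have "(\<lambda>g. f g * ?k g) \<in> Cc G" by (rule Cc_mult[OF assms])
  moreover have "(\<lambda>g. f g * ?k g) = E f" by (auto simp: extend_by_zero_def)
  ultimately show ?thesis by (auto simp: CcS_def extend_by_zero_def)
qed

lemma E_Cc: "f \<in> Cc G \<Longrightarrow> E f \<in> Cc G"
  using E_closed CcS_Cc by blast

lemma E_norm: "f \<in> Cc G \<Longrightarrow> reduced_norm G c (E f) \<le> reduced_norm G c f"
  by (rule reduced_norm_restrict[OF Cc_bounded_function])

lemma CcS_add: "f \<in> CcS \<Longrightarrow> h \<in> CcS \<Longrightarrow> (\<lambda>g. f g + h g) \<in> CcS"
  by (auto simp: CcS_def Cc_add)

lemma CcS_scale: "f \<in> CcS \<Longrightarrow> (\<lambda>g. a * f g) \<in> CcS"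
  by (auto simp: CcS_def Cc_scale)

lemma CcS_zero: "(\<lambda>g. 0) \<in> CcS"
  by (simp add: CcS_def Cc_zero)

lemma CcS_conv: assumes "f \<in> CcS" "h \<in> CcS" shows "conv G c f h \<in> CcS"
proof -
  have fh: "f \<in> Cc G" "h \<in> Cc G" using assms CcS_Cc by auto
  have "conv G c f h g = 0" if "g \<notin> S" for g
  proof (rule ccontr)
    assume "conv G c f h g \<noteq> 0"
    then obtain \<delta> where d: "g \<in> arrows G" "\<delta> \<in> arrows G" "src G g = src G \<delta>" "f (g \<cdot> ginv G \<delta>) \<noteq> 0" "h \<delta> \<noteq> 0"
      using conv_nonzero[OF Cc_fibre_finite[OF fh(2)]] by metis
    then have "g \<cdot> ginv G \<delta> \<in> S" "\<delta> \<in> S" using assms by (auto simp: CcS_def)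
    then have "(g \<cdot> ginv G \<delta>) \<cdot> \<delta> \<in> S" by (rule S_mul) (use d in \<open>simp add: grp\<close>)
    then show False using that d mul_src_self[of g] by (simp add: grp)
  qed
  then show ?thesis using fh by (simp add: CcS_def Cc_conv)
qed

lemma E_conv_star: "E (conv_star G c f) = conv_star G c (E f)"
  using S_inv S_arrow inv_inv by (fastforce simp: extend_by_zero_def conv_star_def fun_eq_iff)

lemma CcS_conv_star: "f \<in> CcS \<Longrightarrow> conv_star G c f \<in> CcS"
  using E_closed[of "conv_star G c f"] E_CcS[of f] by (simp add: E_conv_star Cc_conv_star CcS_Cc)

lemma mul_right_S_iff:
  assumes "g \<in> arrows G" "h \<in> arrows G" "src G g = src G h" "g \<cdot> ginv G h \<in> S"
  shows "g \<in> S \<longleftrightarrow> h \<in> S"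
proof
  assume "h \<in> S"
  with assms(4) have "(g \<cdot> ginv G h) \<cdot> h \<in> S" by (rule S_mul) (use assms in \<open>simp add: grp\<close>)
  then show "g \<in> S" using assms mul_src_self[of g] by (simp add: grp)
next
  assume g: "g \<in> S"
  have "ginv G (g \<cdot> ginv G h) \<cdot> g \<in> S" by (rule S_mul[OF S_inv[OF assms(4)] g]) (use assms in \<open>simp add: grp\<close>)
  then show "h \<in> S" using assms mul_src_self[of h] by (simp add: grp)
qed

text \<open>In each nonzero term at g the quotient g \<beta>^{-1} lies in \<open>S\<close>, so g
  \<in> S exactly if \<beta> \<in> S. Cutting off before or after convolving is thus the
  same.\<close>

lemma E_conv_left: assumes "f \<in> CcS" "h \<in> Cc G" shows "E (conv G c f h) = conv G c f (E h)"
proof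
  fix g
  show "E (conv G c f h) g = conv G c f (E h) g"
  proof (cases "g \<in> arrows G")
    case True
    have ff: "fibre_finite f" using assms by (simp add: Cc_fibre_finite CcS_Cc)
    have "conv G c f (E h) g = (\<Sum>\<beta> | ker f g \<beta> \<noteq> 0. ker f g \<beta> * E h \<beta>)" by (rule conv_ker_left[OF ff True])
    also have "\<dots> = (\<Sum>\<beta> | ker f g \<beta> \<noteq> 0. ker f g \<beta> * (if g \<in> S then h \<beta> else 0))"
    proof (rule sum.cong[OF refl])
      fix \<beta> assume "\<beta> \<in> {\<beta>. ker f g \<beta> \<noteq> 0}"
      then have "\<beta> \<in> arrows G" "src G g = src G \<beta>" "g \<cdot> ginv G \<beta> \<in> S" using assms by (auto simp: ker_nonzero CcS_def)
      then have "g \<in> S \<longleftrightarrow> \<beta> \<in> S" using mul_right_S_iff[OF True] by blast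
      then show "ker f g \<beta> * E h \<beta> = ker f g \<beta> * (if g \<in> S then h \<beta> else 0)" by (simp add: extend_by_zero_def)
    qed
    also have "\<dots> = E (conv G c f h) g" by (simp add: extend_by_zero_def conv_ker_left[OF ff True])
    finally show ?thesis by simp
  qed (use S_arrow in \<open>auto simp: conv_outside extend_by_zero_def\<close>)
qed

text \<open>Adjoints exchange the factors, and they commute with \<open>E\<close> because
  \<open>S\<close> is closed under inverses; so the left version applies.\<close>

lemma E_conv_right: assumes "f \<in> CcS" "h \<in> Cc G" shows "E (conv G c h f) = conv G c (E h) f"
proof -
  have "conv_star G c (E (conv G c h f)) = conv_star G c (conv G c (E h) f)"
    using E_conv_left[of "conv_star G c f" "conv_star G c h"] assms
      P.adj_mul[of h f] P.adj_mul[of "E h" f]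
    by (simp add: CcS_Cc CcS_conv_star Cc_conv_star E_Cc flip: E_conv_star)
  then have "conv_star G c (conv_star G c (E (conv G c h f))) = conv_star G c (conv_star G c (conv G c (E h) f))" by simp
  then show ?thesis
    using P.adj_adj[of "E (conv G c h f)"] P.adj_adj[of "conv G c (E h) f"] assms by (simp add: CcS_Cc E_Cc Cc_conv)
qed

section \<open>The embedded subalgebra and the expectation\<close>

abbreviation "\<Phi> \<equiv> completion_map (Cc_alg G c) E"

abbreviation "B \<equiv> Cstar_r_embedded G c S"

lemma E_sub: "sub (Cc_alg G c) (E f) (E h) = E (sub (Cc_alg G c) f h)"
  by (auto simp: sub_Cc_alg extend_by_zero_def)

lemma cauchy_E: "P.cauchy \<sigma> \<Longrightarrow> P.cauchy (\<lambda>n. E (\<sigma> n))"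
  and \<Phi>_cls: "P.cauchy \<sigma> \<Longrightarrow> \<Phi> (cls \<sigma>) = cls (\<lambda>n. E (\<sigma> n))"
  by (rule P.completion_map_cls; simp add: E_Cc E_sub E_norm)+

text \<open>Closedness of \<open>S\<close> keeps the trace of a compact set on \<open>S\<close>
  compact; since \<open>S\<close> and its complement are both open, a function on \<open>S\<close>
  extends continuously by 0.\<close>

lemma Cc_restrict: "Cc (restrict_groupoid G S) = CcS"
proof (intro set_eqI iffI)
  let ?R = "subtopology (gtop G) S"
  have top: "gtop (restrict_groupoid G S) = ?R" by (simp add: restrict_groupoid_def)
  fix f :: "'a \<Rightarrow> complex"
  { assume f: "f \<in> CcS"
    obtain C where C: "compactin (gtop G) C" "\<And>g. f g \<noteq> 0 \<Longrightarrow> g \<in> C" using Cc_support[OF CcS_Cc[OF f]] by metis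
    have cC: "compactin ?R (S \<inter> C)"
      using closed_Int_compactin[OF S_closed C(1)] by (simp add: compactin_subtopology)
    have "?R closure_of {g \<in> S. f g \<noteq> 0} \<subseteq> S \<inter> C"
      by (rule closure_of_minimal[OF _ compactin_imp_closedin[OF Hausdorff_space_subtopology[OF hausdorff] cC]])
        (use C in blast)
    then have "compactin ?R (?R closure_of {g \<in> S. f g \<noteq> 0})"
      by (rule closed_compactin[OF cC]) simp
    then show "f \<in> Cc (restrict_groupoid G S)"
      using f continuous_map_from_subtopology[OF Cc_continuous[OF CcS_Cc[OF f]]]
      by (simp add: Cc_def[of "restrict_groupoid G S"] arrows_restrict top CcS_def) }
  assume f: "f \<in> Cc (restrict_groupoid G S)"
  then have fc: "continuous_map ?R euclidean f" and f0: "\<And>g. g \<notin> S \<Longrightarrow> f g = 0"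
    and fK: "compactin ?R (?R closure_of {g \<in> S. f g \<noteq> 0})"
    by (auto simp: Cc_def[of "restrict_groupoid G S"] arrows_restrict top)
  have "f \<in> Cc G"
  proof (rule CcI)
    show "continuous_map (gtop G) euclidean f"
    proof (rule pasting_lemma[where I=UNIV and T="\<lambda>b. if b then S else topspace (gtop G) - S" and f="\<lambda>b. if b then f else (\<lambda>g. 0)"])
      show "openin (gtop G) (if b then S else topspace (gtop G) - S)" for b
        using S_open S_closed by auto
    qed (use fc f0 in \<open>auto split: if_splits\<close>)
    show "compactin (gtop G) (?R closure_of {g \<in> S. f g \<noteq> 0})"
      using fK by (simp add: compactin_subtopology)
    have "{g \<in> S. f g \<noteq> 0} \<subseteq> ?R closure_of {g \<in> S. f g \<noteq> 0}"
      by (rule closure_of_subset) (use S_arrow in \<open>auto simp: topspace_gtop\<close>)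
    then show "g \<in> ?R closure_of {g \<in> S. f g \<noteq> 0}" if "f g \<noteq> 0" for g using that f0 by blast
  qed
  then show "f \<in> CcS" using f0 by (simp add: CcS_def)
qed

lemma Cc_alg_restrict: "carr (Cc_alg (restrict_groupoid G S) c) = CcS"
  by (simp add: Cc_alg_def Cc_restrict)

lemma adist_restrict:
  assumes "f \<in> CcS" "h \<in> CcS"
  shows "adist (Cc_alg (restrict_groupoid G S) c) f h = adist (Cc_alg G c) f h"
proof -
  have "(\<lambda>g. f g - h g) \<in> CcS" using CcS_add[OF assms(1) CcS_scale[OF assms(2), of "-1"]] by simp
  then have "reduced_norm (restrict_groupoid G S) c (\<lambda>g. f g - h g) = reduced_norm G c (\<lambda>g. f g - h g)"
    by (intro reduced_norm_restrict_groupoid Cc_bounded_function CcS_Cc) (auto simp: CcS_def)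
  then show ?thesis
    using assms by (simp add: adist_def Cc_alg_restrict CcS_Cc sub_Cc_alg)
      (simp add: Cc_alg_def sub_def)
qed

lemma cauchy_restrict:
  "Metric_space.MCauchy (carr (Cc_alg (restrict_groupoid G S) c)) (adist (Cc_alg (restrict_groupoid G S) c)) \<sigma>
    \<longleftrightarrow> P.cauchy \<sigma> \<and> (\<forall>n. \<sigma> n \<in> CcS)"
proof -
  let ?d = "adist (Cc_alg (restrict_groupoid G S) c)"
  have d0: "?d x y = 0" if "\<not> (x \<in> CcS \<and> y \<in> CcS)" for x y using that by (auto simp: adist_def Cc_alg_restrict)
  interpret R: Metric_space CcS ?d
  proof
    fix x y z
    show "0 \<le> ?d x y" by (cases "x \<in> CcS \<and> y \<in> CcS") (simp_all add: d0 adist_restrict)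
    show "?d x y = ?d y x"
      using d0[of x y] d0[of y x] P.met.commute[of x y] by (cases "x \<in> CcS \<and> y \<in> CcS") (auto simp: adist_restrict)
    show "?d x y = 0 \<longleftrightarrow> x = y" if "x \<in> CcS" "y \<in> CcS"
      using that by (simp add: adist_restrict CcS_Cc)
    show "?d x z \<le> ?d x y + ?d y z" if "x \<in> CcS" "y \<in> CcS" "z \<in> CcS"
      using that P.met.triangle[of x y z] by (simp add: adist_restrict CcS_Cc)
  qed
  show ?thesis
  proof (cases "\<forall>n. \<sigma> n \<in> CcS")
    case True
    then have "?d (\<sigma> m) (\<sigma> n) = adist (Cc_alg G c) (\<sigma> m) (\<sigma> n)" for m n by (simp add: adist_restrict)
    then show ?thesis
      using True CcS_Cc unfolding Cc_alg_restrict P.cauchy_def R.MCauchy_def P.met.MCauchy_def by auto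
  next
    case False
    then show ?thesis unfolding Cc_alg_restrict by (auto simp: R.MCauchy_def)
  qed
qed

text \<open>A class formed over \<open>S\<close> contains only sequences in \<open>CcS\<close>, so
  it can be smaller than the class over \<open>G\<close> of the same sequence.
  \<open>completion_map\<close> enlarges it to the latter, as \<open>E\<close> fixes every member
  and the two norms agree.\<close>

lemma B_eq: "B = {cls \<sigma> |\<sigma>. P.cauchy \<sigma> \<and> (\<forall>n. \<sigma> n \<in> CcS)}"
proof -
  let ?AS = "Cc_alg (restrict_groupoid G S) c"
  let ?r = "cauchy_rel ?AS"
  have r: "(\<sigma>, \<tau>) \<in> ?r \<longleftrightarrow> (\<sigma>, \<tau>) \<in> cauchy_rel (Cc_alg G c) \<and> (\<forall>n. \<sigma> n \<in> CcS) \<and> (\<forall>n. \<tau> n \<in> CcS)" for \<sigma> \<tau>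
  proof (cases "(\<forall>n. \<sigma> n \<in> CcS) \<and> (\<forall>n. \<tau> n \<in> CcS)")
    case True
    then have "adist ?AS (\<sigma> n) (\<tau> n) = adist (Cc_alg G c) (\<sigma> n) (\<tau> n)" for n by (simp add: adist_restrict)
    then show ?thesis using True by (simp add: cauchy_rel_def cauchy_restrict P.cauchy_def)
  qed (auto simp: cauchy_rel_def cauchy_restrict)
  have map: "completion_map (Cc_alg G c) E (?r `` {\<sigma>}) = cls \<sigma>" if s: "P.cauchy \<sigma>" "\<forall>n. \<sigma> n \<in> CcS" for \<sigma>
  proof -
    have "cls (\<lambda>n. E (\<tau> n)) = cls \<sigma>" if "\<tau> \<in> ?r `` {\<sigma>}" for \<tau>
    proof -
      have t: "(\<sigma>, \<tau>) \<in> cauchy_rel (Cc_alg G c)" "\<forall>n. \<tau> n \<in> CcS" using that r by auto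
      then have "(\<lambda>n. E (\<tau> n)) = \<tau>" by (simp add: E_CcS)
      moreover have "cls \<sigma> = cls \<tau>"
        using t(1) equiv_class_eq[OF P.equiv_cauchy_rel] unfolding P.cls_def by blast
      ultimately show ?thesis by simp
    qed
    moreover have "\<sigma> \<in> ?r `` {\<sigma>}"
      using s r[of \<sigma> \<sigma>] equiv_class_self[OF P.equiv_cauchy_rel, of \<sigma>] by auto
    ultimately show ?thesis unfolding completion_map_def P.cls_def[symmetric] by blast
  qed
  have "carr (Cstar_r (restrict_groupoid G S) c) = {?r `` {\<sigma>} |\<sigma>. P.cauchy \<sigma> \<and> (\<forall>n. \<sigma> n \<in> CcS)}"
    unfolding Cstar_r_def completion_def by (auto simp: quotient_def cauchy_restrict)
  then show ?thesis unfolding Cstar_r_embedded_def using map by (auto simp: image_iff) blast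
qed

lemma B_cases: assumes "X \<in> B" obtains \<sigma> where "P.cauchy \<sigma>" "\<forall>n. \<sigma> n \<in> CcS" "X = cls \<sigma>"
  using assms unfolding B_eq by blast

lemma cls_B: "P.cauchy \<sigma> \<Longrightarrow> (\<And>n. \<sigma> n \<in> CcS) \<Longrightarrow> cls \<sigma> \<in> B"
  unfolding B_eq by blast

lemma \<Phi>_B: "X \<in> B \<Longrightarrow> \<Phi> X = X"
  by (elim B_cases) (simp add: \<Phi>_cls E_CcS)

lemma \<Phi>_closed: "X \<in> carr (Cstar_r G c) \<Longrightarrow> \<Phi> X \<in> B"
  by (elim Cstar_r_cases) (simp add: \<Phi>_cls cls_B cauchy_E E_closed cauchy_Cc)

lemma B_carr: "X \<in> B \<Longrightarrow> X \<in> carr (Cstar_r G c)"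
  by (elim B_cases) (simp add: cls_carr)

lemma \<Phi>_add: assumes "X \<in> carr (Cstar_r G c)" "Y \<in> carr (Cstar_r G c)"
  shows "\<Phi> (X \<oplus>\<^bsub>Cstar_r G c\<^esub> Y) = \<Phi> X \<oplus>\<^bsub>Cstar_r G c\<^esub> \<Phi> Y"
proof -
  obtain x y where x: "P.cauchy x" "X = cls x" and y: "P.cauchy y" "Y = cls y"
    using assms Cstar_r_cases by metis
  have "(\<lambda>n. E (\<lambda>g. x n g + y n g)) = (\<lambda>n g. E (x n) g + E (y n) g)"
    by (simp add: fun_eq_iff extend_by_zero_def)
  then show ?thesis
    using P.cauchy_add[OF x(1) y(1)] by (simp add: x y cls_ops \<Phi>_cls cauchy_E)
qed

lemma \<Phi>_scl: assumes "X \<in> carr (Cstar_r G c)"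
  shows "\<Phi> (a \<odot>\<^bsub>Cstar_r G c\<^esub> X) = a \<odot>\<^bsub>Cstar_r G c\<^esub> \<Phi> X"
proof -
  obtain x where x: "P.cauchy x" "X = cls x" using assms Cstar_r_cases by metis
  have "(\<lambda>n. E (\<lambda>g. a * x n g)) = (\<lambda>n g. a * E (x n) g)"
    by (simp add: fun_eq_iff extend_by_zero_def)
  then show ?thesis
    using P.cauchy_scl[OF x(1), of a] by (simp add: x cls_ops \<Phi>_cls cauchy_E)
qed

lemma \<Phi>_nrm: assumes "X \<in> carr (Cstar_r G c)"
  shows "nrm (Cstar_r G c) (\<Phi> X) \<le> nrm (Cstar_r G c) X"
proof -
  obtain x where x: "P.cauchy x" "X = cls x" using assms Cstar_r_cases by metis
  show ?thesis unfolding x(2) \<Phi>_cls[OF x(1)]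
    by (rule LIMSEQ_le[OF nrm_cls_Cc[OF cauchy_E[OF x(1)]] nrm_cls_Cc[OF x(1)]])
      (simp add: E_norm cauchy_Cc x)
qed

lemma \<Phi>_sub: assumes "X \<in> carr (Cstar_r G c)" "Y \<in> carr (Cstar_r G c)"
  shows "\<Phi> (sub (Cstar_r G c) X Y) = sub (Cstar_r G c) (\<Phi> X) (\<Phi> Y)"
  using assms by (simp add: sub_def \<Phi>_add \<Phi>_scl A.scl_closed)

lemma \<Phi>_bimodule:
  assumes "b \<in> B" "X \<in> carr (Cstar_r G c)"
  shows "\<Phi> (b \<otimes>\<^bsub>Cstar_r G c\<^esub> X) = b \<otimes>\<^bsub>Cstar_r G c\<^esub> \<Phi> X"
    "\<Phi> (X \<otimes>\<^bsub>Cstar_r G c\<^esub> b) = \<Phi> X \<otimes>\<^bsub>Cstar_r G c\<^esub> b"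
proof -
  obtain x where x: "P.cauchy x" "X = cls x" using assms(2) Cstar_r_cases by metis
  obtain y where y: "P.cauchy y" "\<forall>n. y n \<in> CcS" "b = cls y" using assms(1) by (rule B_cases)
  show "\<Phi> (b \<otimes>\<^bsub>Cstar_r G c\<^esub> X) = b \<otimes>\<^bsub>Cstar_r G c\<^esub> \<Phi> X"
    using P.cauchy_mul[OF y(1) x(1)] by (simp add: x y cls_ops \<Phi>_cls cauchy_E E_conv_left cauchy_Cc)
  show "\<Phi> (X \<otimes>\<^bsub>Cstar_r G c\<^esub> b) = \<Phi> X \<otimes>\<^bsub>Cstar_r G c\<^esub> b"
    using P.cauchy_mul[OF x(1) y(1)] by (simp add: x y cls_ops \<Phi>_cls cauchy_E E_conv_right cauchy_Cc)
qed

lemma subalgebra_B: "subalgebra (Cstar_r G c) B"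
  unfolding subalgebra_def
proof (intro conjI ballI allI)
  show "B \<subseteq> carr (Cstar_r G c)" using B_carr by blast
  show "zer (Cstar_r G c) \<in> B"
    unfolding Cstar_r_def P.zer_completion using P.cauchy_const[of "\<lambda>g. 0"]
    by (intro cls_B) (simp_all add: Cc_zero CcS_zero)
  fix X assume "X \<in> B"
  then obtain x where x: "P.cauchy x" "\<forall>n. x n \<in> CcS" "X = cls x" by (rule B_cases)
  show "a \<odot>\<^bsub>Cstar_r G c\<^esub> X \<in> B" for a
    using P.cauchy_scl[OF x(1), of a] by (simp add: x cls_ops cls_B CcS_scale)
  fix Y assume "Y \<in> B"
  then obtain y where y: "P.cauchy y" "\<forall>n. y n \<in> CcS" "Y = cls y" by (rule B_cases)
  show "X \<oplus>\<^bsub>Cstar_r G c\<^esub> Y \<in> B"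
    using P.cauchy_add[OF x(1) y(1)] by (simp add: x y cls_ops cls_B CcS_add)
  show "X \<otimes>\<^bsub>Cstar_r G c\<^esub> Y \<in> B"
    using P.cauchy_mul[OF x(1) y(1)] by (simp add: x y cls_ops cls_B CcS_conv)
qed

lemma adj_B: assumes "X \<in> B" shows "adj (Cstar_r G c) X \<in> B"
proof -
  obtain x where x: "P.cauchy x" "\<forall>n. x n \<in> CcS" "X = cls x" using assms by (rule B_cases)
  show ?thesis using P.cauchy_adj[OF x(1)] by (simp add: x cls_ops cls_B CcS_conv_star)
qed

text \<open>\<open>B\<close> consists of fixed points of the contraction \<Phi>. A sequence in
  \<open>B\<close> with limit X therefore also converges to \<Phi> X, and limits are unique.\<close>

lemma closedin_B: "closedin A.met.mtopology B"
  unfolding A.met.metric_closedin_iff_sequentially_closed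
proof (intro conjI allI impI)
  show "B \<subseteq> carr (Cstar_r G c)" using B_carr by blast
  fix \<sigma> X assume a: "range \<sigma> \<subseteq> B \<and> limitin A.met.mtopology \<sigma> X sequentially"
  then have s: "\<sigma> n \<in> B" for n by (meson rangeI subsetD)
  have sc: "\<sigma> n \<in> carr (Cstar_r G c)" for n by (rule B_carr[OF s])
  have X: "X \<in> carr (Cstar_r G c)" "(\<lambda>n. adist (Cstar_r G c) (\<sigma> n) X) \<longlonglongrightarrow> 0"
    using a unfolding A.met.limitin_metric_dist_null by simp_all
  have t: "A.tends \<sigma> X" unfolding A.tends_def using X sc by (simp add: A.adist_eq)
  have \<Phi>X: "\<Phi> X \<in> carr (Cstar_r G c)" by (rule B_carr[OF \<Phi>_closed[OF X(1)]])
  have "A.tends \<sigma> (\<Phi> X)"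
  proof (rule A.tendsI[OF sc \<Phi>X _ A.tends_null[OF t]])
    fix n
    have "sub (Cstar_r G c) (\<sigma> n) (\<Phi> X) = \<Phi> (sub (Cstar_r G c) (\<sigma> n) X)"
      by (simp add: \<Phi>_sub sc X \<Phi>_B s)
    then show "nrm (Cstar_r G c) (sub (Cstar_r G c) (\<sigma> n) (\<Phi> X)) \<le> nrm (Cstar_r G c) (sub (Cstar_r G c) (\<sigma> n) X)"
      by (simp add: \<Phi>_nrm A.sub_closed sc X)
  qed
  then have "X = \<Phi> X" by (rule A.tends_unique[OF t])
  then show "X \<in> B" using \<Phi>_closed[OF X(1)] by metis
qed

lemma cstar_subalgebra_B: "cstar_subalgebra (Cstar_r G c) B"
  unfolding cstar_subalgebra_def using subalgebra_B adj_B closedin_B by blast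

text \<open>At a unit the value of x* x is the sum of |x|^2 over the source fibre, and
  \<open>E\<close> keeps it because units lie in \<open>S\<close>. So a vanishing expectation forces
  the limit function to vanish, and with it the element.\<close>

lemma \<Phi>_faithful: "faithful (Cstar_r G c) \<Phi>"
  unfolding faithful_def
proof (intro ballI impI)
  fix X assume X: "X \<in> carr (Cstar_r G c)"
    and z: "\<Phi> (adj (Cstar_r G c) X \<otimes>\<^bsub>Cstar_r G c\<^esub> X) = zer (Cstar_r G c)"
  obtain x where x: "P.cauchy x" "X = cls x" using X Cstar_r_cases by metis
  let ?y = "\<lambda>n. E (conv G c (conv_star G c (x n)) (x n))"
  have xx: "P.cauchy (\<lambda>n. conv G c (conv_star G c (x n)) (x n))"
    using P.cauchy_mul[OF P.cauchy_adj[OF x(1)] x(1)] by simp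
  have "\<Phi> (adj (Cstar_r G c) X \<otimes>\<^bsub>Cstar_r G c\<^esub> X) = cls ?y"
    using xx P.cauchy_adj[OF x(1)] by (simp add: x cls_ops \<Phi>_cls)
  then have lim: "(\<lambda>n. reduced_norm G c (?y n)) \<longlonglongrightarrow> 0"
    using z cls_zero_iff[OF cauchy_E[OF xx]] by simp
  have "(\<lambda>n. x n g) \<longlonglongrightarrow> 0" if g: "g \<in> arrows G" for g
  proof -
    define u where "u = src G g"
    have u: "u \<in> units G" using g by (simp add: u_def src_unit)
    have "(cmod (x n g))\<^sup>2 \<le> reduced_norm G c (?y n)" for n
    proof -
      have xn: "x n \<in> Cc G" by (rule cauchy_Cc[OF x(1)])
      let ?F = "{h. h \<in> arrows G \<and> x n h \<noteq> 0 \<and> src G h = u}"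
      have fin: "finite ?F" using Cc_fibre_finite[OF xn] by (simp add: fibre_finite_def)
      have "(cmod (x n g))\<^sup>2 \<le> (\<Sum>h\<in>?F. (cmod (x n h))\<^sup>2)"
      proof (cases "x n g = 0")
        case False
        then show ?thesis using g by (intro member_le_sum[OF _ _ fin]) (auto simp: u_def)
      qed (simp add: sum_nonneg)
      also have "\<dots> = cmod (?y n u)"
        using conv_star_self_unit[OF Cc_fibre_finite[OF xn] u] u units_subset
        by (auto simp: extend_by_zero_def sum_nonneg simp flip: of_real_power of_real_sum)
      also have "\<dots> \<le> reduced_norm G c (?y n)"
        by (intro norm_le_reduced_norm_Cc E_Cc Cc_conv Cc_conv_star xn)
      finally show ?thesis .
    qed
    then have "(\<lambda>n. (cmod (x n g))\<^sup>2) \<longlonglongrightarrow> 0"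
      by (intro tendsto_sandwich[OF _ _ tendsto_const lim]) auto
    then have "(\<lambda>n. sqrt ((cmod (x n g))\<^sup>2)) \<longlonglongrightarrow> sqrt 0" by (rule tendsto_real_sqrt)
    then show ?thesis by (simp add: tendsto_norm_zero_iff)
  qed
  then show "X = zer (Cstar_r G c)"
    unfolding x(2) cls_zero_iff[OF x(1)] by (rule reduced_norm_tendsto_zero[OF x(1)])
qed

text \<open>For \<open>\<parallel>z\<parallel> \<le> 1\<close>, the kernel of \<open>1 - \<Phi>(z* z)\<close> is a pinching of the kernel of \<open>1 - z* z\<close>.\<close>

lemma E_square_contraction:
  assumes z: "z \<in> Cc G" "reduced_norm G c z \<le> 1" and w: "w \<in> Cc G"
  shows "reduced_norm G c (\<lambda>g. w g - conv G c (E (conv G c (conv_star G c z) z)) w g) \<le> reduced_norm G c w"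
proof -
  let ?f = "conv G c (conv_star G c z) z"
  have f: "?f \<in> Cc G" by (intro Cc_conv Cc_conv_star z)
  \<comment> \<open>The identity matrix need not come from a function in \<open>Cc G\<close>, so the
    estimate is stated for products with \<open>w\<close>. Pinching fixes it, its entries being
    diagonal.\<close>
  define I where "I = (\<lambda>\<alpha> \<beta> :: 'a. if \<alpha> = \<beta> then 1 else (0 :: complex))"
  have "kernel_bounded (ker z) 1" by (rule kernel_bounded_mono[OF kernel_bounded_Cc[OF z(1)] z(2)])
  then have "kernel_bounded (\<lambda>\<alpha> \<beta>. I \<alpha> \<beta> - ker ?f \<alpha> \<beta>) 1"
    using kernel_bounded_defect[OF column_finite_ker[OF Cc_fibre_finite[OF z(1)]]]
    by (simp add: ker_conv Cc_fibre_finite z ker_conv_star I_def)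
  then have "kernel_bounded (\<lambda>\<alpha> \<beta>. if coset \<alpha> = coset \<beta> then I \<alpha> \<beta> - ker ?f \<alpha> \<beta> else 0) 1"
    by (rule kernel_bounded_pinch) simp
  moreover have "(\<lambda>\<alpha> \<beta>. if coset \<alpha> = coset \<beta> then I \<alpha> \<beta> - ker ?f \<alpha> \<beta> else 0) = (\<lambda>\<alpha> \<beta>. I \<alpha> \<beta> - ker (E ?f) \<alpha> \<beta>)"
    by (auto simp: fun_eq_iff ker_restrict I_def)
  ultimately have b: "kernel_bounded (\<lambda>\<alpha> \<beta>. I \<alpha> \<beta> - ker (E ?f) \<alpha> \<beta>) 1" by simp
  have cfw: "column_finite (ker w)" by (rule column_finite_ker[OF Cc_fibre_finite[OF w]])
  have d: "(\<lambda>g. w g - conv G c (E ?f) w g) \<in> Cc G" by (intro Cc_diff w Cc_conv E_Cc f)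
  have "ker (\<lambda>g. w g - conv G c (E ?f) w g) = kernel_mult (\<lambda>\<alpha> \<beta>. I \<alpha> \<beta> - ker (E ?f) \<alpha> \<beta>) (ker w)"
  proof (intro ext)
    fix \<alpha> \<beta>
    have fin: "finite {\<gamma>. ker w \<gamma> \<beta> \<noteq> 0}" using cfw by (simp add: column_finite_def)
    have "(\<Sum>\<gamma> | ker w \<gamma> \<beta> \<noteq> 0. I \<alpha> \<gamma> * ker w \<gamma> \<beta>) = (\<Sum>\<gamma> | ker w \<gamma> \<beta> \<noteq> 0. if \<gamma> = \<alpha> then ker w \<gamma> \<beta> else 0)"
      by (rule sum.cong) (auto simp: I_def)
    also have "\<dots> = ker w \<alpha> \<beta>" using fin by simp
    finally have 1: "(\<Sum>\<gamma> | ker w \<gamma> \<beta> \<noteq> 0. I \<alpha> \<gamma> * ker w \<gamma> \<beta>) = ker w \<alpha> \<beta>" .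
    have "ker (\<lambda>g. w g - conv G c (E ?f) w g) \<alpha> \<beta> = ker w \<alpha> \<beta> - kernel_mult (ker (E ?f)) (ker w) \<alpha> \<beta>"
      unfolding ker_conv[OF Cc_fibre_finite[OF w], symmetric] by (simp add: ker_def algebra_simps)
    then show "ker (\<lambda>g. w g - conv G c (E ?f) w g) \<alpha> \<beta> = kernel_mult (\<lambda>\<alpha> \<beta>. I \<alpha> \<beta> - ker (E ?f) \<alpha> \<beta>) (ker w) \<alpha> \<beta>"
      by (simp add: kernel_mult_def left_diff_distrib sum_subtractf 1)
  qed
  then have "kernel_bounded (ker (\<lambda>g. w g - conv G c (E ?f) w g)) (1 * reduced_norm G c w)"
    using kernel_bounded_mult[OF b kernel_bounded_Cc[OF w] _ cfw] by simp
  then show ?thesis using reduced_norm_le_Cc[OF d _ reduced_norm_nonneg_Cc[OF w]] by simp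
qed

text \<open>With X = Y* Y and Y scaled to a contraction Z, \<open>E_square_contraction\<close>
  passes to the limit: 1 - \<Phi>(Z* Z) acts contractively. \<open>positive_of_contraction\<close>
  then supplies a square root, and scaling back gives X.\<close>

lemma positive_\<Phi>: assumes "X \<in> carr (Cstar_r G c)" "positive (Cstar_r G c) X" shows "positive (Cstar_r G c) (\<Phi> X)"
proof -
  obtain Y where Y: "Y \<in> carr (Cstar_r G c)" "X = adj (Cstar_r G c) Y \<otimes>\<^bsub>Cstar_r G c\<^esub> Y"
    using assms(2) unfolding positive_def by blast
  obtain y where y: "P.cauchy y" "Y = cls y" using Y(1) Cstar_r_cases by metis
  \<comment> \<open>A bound for all terms of the representative, not just for the norm of its class:
    every single \<open>z n\<close> has to be a contraction.\<close>
  obtain K where K: "0 < K" "\<And>n. reduced_norm G c (y n) \<le> K" using P.cauchy_bounded[OF y(1)] by auto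
  define z where "z = (\<lambda>n g. complex_of_real (1 / K) * y n g)"
  have z: "P.cauchy z" using P.cauchy_scl[OF y(1), of "complex_of_real (1/K)"] by (simp add: z_def[abs_def])
  have zn: "reduced_norm G c (z n) \<le> 1" for n
  proof -
    have "reduced_norm G c (z n) = (1 / K) * reduced_norm G c (y n)"
      using P.nrm_scl[of "y n" "complex_of_real (1/K)"] K(1) cauchy_Cc[OF y(1), of n] by (simp add: z_def norm_divide)
    then show ?thesis using K(1) K(2)[of n] by simp
  qed
  define Z where "Z = cls z"
  have Zc: "Z \<in> carr (Cstar_r G c)" by (simp add: Z_def cls_carr z)
  have YZ: "Y = complex_of_real K \<odot>\<^bsub>Cstar_r G c\<^esub> Z"
  proof -
    have "(\<lambda>n. \<lambda>g. complex_of_real K * z n g) = y" using K(1) by (simp add: z_def fun_eq_iff)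
    then show ?thesis by (simp add: y Z_def cls_ops z)
  qed
  let ?b = "\<Phi> (adj (Cstar_r G c) Z \<otimes>\<^bsub>Cstar_r G c\<^esub> Z)"
  let ?s = "\<lambda>n. E (conv G c (conv_star G c (z n)) (z n))"
  have zz: "P.cauchy (\<lambda>n. conv G c (conv_star G c (z n)) (z n))"
    using P.cauchy_mul[OF P.cauchy_adj[OF z] z] by simp
  have sc: "P.cauchy ?s" by (rule cauchy_E[OF zz])
  have b: "?b = cls ?s"
    using zz P.cauchy_adj[OF z] by (simp add: Z_def z cls_ops \<Phi>_cls)
  have bc: "?b \<in> carr (Cstar_r G c)" by (simp add: b cls_carr sc)
  have "adj (Cstar_r G c) ?b = ?b"
  proof -
    have "conv_star G c (?s n) = ?s n" for n
      using P.adj_mul[of "conv_star G c (z n)" "z n"] P.adj_adj[of "z n"] cauchy_Cc[OF z, of n]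
      by (simp add: E_conv_star[symmetric] Cc_conv_star)
    then show ?thesis unfolding b using sc by (simp add: cls_ops)
  qed
  moreover have "nrm (Cstar_r G c) (sub (Cstar_r G c) W (?b \<otimes>\<^bsub>Cstar_r G c\<^esub> W)) \<le> nrm (Cstar_r G c) W"
    if "W \<in> carr (Cstar_r G c)" for W
  proof -
    obtain w where w: "P.cauchy w" "W = cls w" using \<open>W \<in> _\<close> Cstar_r_cases by metis
    have sw: "P.cauchy (\<lambda>n. conv G c (?s n) (w n))" using P.cauchy_mul[OF sc w(1)] by simp
    have d: "P.cauchy (\<lambda>n. \<lambda>g. w n g - conv G c (?s n) (w n) g)"
      using P.cauchy_sub[OF w(1) sw] by (simp add: sub_Cc_alg)
    have "sub (Cstar_r G c) W (?b \<otimes>\<^bsub>Cstar_r G c\<^esub> W) = cls (\<lambda>n. \<lambda>g. w n g - conv G c (?s n) (w n) g)"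
      unfolding b using sw by (simp add: w cls_ops sc sub_Cc_alg)
    moreover have "nrm (Cstar_r G c) (cls (\<lambda>n. \<lambda>g. w n g - conv G c (?s n) (w n) g)) \<le> nrm (Cstar_r G c) (cls w)"
      by (rule LIMSEQ_le[OF nrm_cls_Cc[OF d] nrm_cls_Cc[OF w(1)]])
        (simp add: E_square_contraction cauchy_Cc z zn w)
    ultimately show ?thesis by (simp add: w)
  qed
  ultimately have "positive (Cstar_r G c) ?b" by (intro A.positive_of_contraction bc)
  then obtain V where V: "V \<in> carr (Cstar_r G c)" "?b = adj (Cstar_r G c) V \<otimes>\<^bsub>Cstar_r G c\<^esub> V"
    unfolding positive_def by blast
  have "X = complex_of_real (K * K) \<odot>\<^bsub>Cstar_r G c\<^esub> (adj (Cstar_r G c) Z \<otimes>\<^bsub>Cstar_r G c\<^esub> Z)"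
    unfolding Y(2) YZ using Zc by (simp add: A.adj_scl A.mul_scl_left A.mul_scl_right A.scl_scl A.closed)
  then have "\<Phi> X = complex_of_real (K * K) \<odot>\<^bsub>Cstar_r G c\<^esub> ?b" using Zc by (simp add: \<Phi>_scl A.closed)
  also have "\<dots> = adj (Cstar_r G c) (complex_of_real K \<odot>\<^bsub>Cstar_r G c\<^esub> V) \<otimes>\<^bsub>Cstar_r G c\<^esub> (complex_of_real K \<odot>\<^bsub>Cstar_r G c\<^esub> V)"
    unfolding V(2) using V(1) by (simp add: A.adj_scl A.mul_scl_left A.mul_scl_right A.scl_scl A.closed)
  finally show ?thesis unfolding positive_def using A.scl_closed[OF V(1)] by blast
qed

lemma conditional_expectation_\<Phi>: "conditional_expectation (Cstar_r G c) B \<Phi>"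
  unfolding conditional_expectation_def
  using \<Phi>_closed \<Phi>_add \<Phi>_scl \<Phi>_B \<Phi>_nrm positive_\<Phi> \<Phi>_bimodule by (simp add: Pi_iff)

end

section \<open>The commutant\<close>

context cartan_groupoid
begin

lemma S_iso: "g \<in> S \<Longrightarrow> rng G g = src G g"
  and S_comm: "g \<in> S \<Longrightarrow> h \<in> S \<Longrightarrow> src G g = src G h \<Longrightarrow> g \<cdot> h = h \<cdot> g"
  and S_symmetric: "g \<in> S \<Longrightarrow> h \<in> S \<Longrightarrow> src G g = src G h \<Longrightarrow> c (g, h) = c (h, g)"
proof -
  have iso: "rng G g = src G g" if "g \<in> S" for g
    using S_abelian_symmetric that by (auto simp: abelian_symmetric_subgroupoids_def Iso_def)
  have comp: "(g, h) \<in> composable G" if "g \<in> S" "h \<in> S" "src G g = src G h" for g h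
    using that iso S_arrow by (simp add: composable_iff)
  show "rng G g = src G g" if "g \<in> S" by (rule iso[OF that])
  show "g \<cdot> h = h \<cdot> g" if "g \<in> S" "h \<in> S" "src G g = src G h"
    using S_abelian_symmetric comp[OF that] that
    by (auto simp: abelian_symmetric_subgroupoids_def abelian_subset_def)
  show "c (g, h) = c (h, g)" if "g \<in> S" "h \<in> S" "src G g = src G h"
    using S_abelian_symmetric comp[OF that] that
    by (auto simp: abelian_symmetric_subgroupoids_def symmetric_on_def)
qed

text \<open>Over one unit, sending \<beta> to \<gamma> \<beta>^{-1} is an involution of the arrows
  of \<open>S\<close> because these commute. It exchanges the two factors, and symmetry of
  \<open>c\<close> matches the phases.\<close>

lemma CcS_conv_commute:
  assumes f: "f \<in> CcS" and h: "h \<in> CcS"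
  shows "conv G c f h = conv G c h f"
proof
  fix \<gamma>
  show "conv G c f h \<gamma> = conv G c h f \<gamma>"
  proof (cases "\<gamma> \<in> S")
    case False
    then show ?thesis using CcS_conv[OF f h] CcS_conv[OF h f] by (simp add: CcS_def)
  next
    case True
    have ga: "\<gamma> \<in> arrows G" and gr: "rng G \<gamma> = src G \<gamma>" using True S_arrow S_iso by auto
    \<comment> \<open>Requiring both factors to be nonzero makes the two index sets correspond
      exactly under the involution.\<close>
    define T where "T = (\<lambda>(f :: 'a \<Rightarrow> complex) (h :: 'a \<Rightarrow> complex). {\<beta> \<in> S. src G \<beta> = src G \<gamma> \<and> h \<beta> \<noteq> 0 \<and> f (\<gamma> \<cdot> ginv G \<beta>) \<noteq> 0})"
    have sum: "conv G c f h \<gamma> = (\<Sum>\<beta>\<in>T f h. ker f \<gamma> \<beta> * h \<beta>)" if "h \<in> CcS" for f h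
    proof (rule conv_ker[OF ga])
      have "finite {g \<in> arrows G. h g \<noteq> 0 \<and> src G g = src G \<gamma>}"
        using Cc_fibre_finite[OF CcS_Cc[OF that]] by (simp add: fibre_finite_def)
      then show "finite (T f h)" by (rule rev_finite_subset) (use S_arrow in \<open>auto simp: T_def\<close>)
      show "ker f \<gamma> \<beta> * h \<beta> = 0" if "\<beta> \<notin> T f h" for \<beta>
      proof (rule ccontr)
        assume "ker f \<gamma> \<beta> * h \<beta> \<noteq> 0"
        then have "h \<beta> \<noteq> 0" "src G \<gamma> = src G \<beta>" "f (\<gamma> \<cdot> ginv G \<beta>) \<noteq> 0" by (auto simp: ker_nonzero)
        moreover have "\<beta> \<in> S" using \<open>h \<in> CcS\<close> \<open>h \<beta> \<noteq> 0\<close> by (auto simp: CcS_def)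
        ultimately show False using that by (simp add: T_def)
      qed
    qed
    have quot: "\<gamma> \<cdot> ginv G \<beta> \<in> S" "src G (\<gamma> \<cdot> ginv G \<beta>) = src G \<gamma>" "\<gamma> \<cdot> ginv G (\<gamma> \<cdot> ginv G \<beta>) = \<beta>"
      if b: "\<beta> \<in> S" "src G \<beta> = src G \<gamma>" for \<beta>
    proof -
      have ba: "\<beta> \<in> arrows G" "rng G \<beta> = src G \<gamma>" using b S_arrow S_iso by auto
      show d: "\<gamma> \<cdot> ginv G \<beta> \<in> S" by (rule S_mul[OF True S_inv[OF b(1)]]) (use b ba in \<open>simp add: grp\<close>)
      show sd: "src G (\<gamma> \<cdot> ginv G \<beta>) = src G \<gamma>" using b ba ga by (simp add: grp)
      let ?d = "\<gamma> \<cdot> ginv G \<beta>"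
      have da: "?d \<in> arrows G" "rng G ?d = src G \<gamma>" using S_arrow[OF d] S_iso[OF d] sd by auto
      have "\<gamma> = ?d \<cdot> \<beta>" using b ba ga mul_src_self[of \<gamma>] by (simp add: grp)
      also have "\<dots> = \<beta> \<cdot> ?d" by (rule S_comm[OF d b(1)]) (use sd b in simp)
      finally have "\<gamma> \<cdot> ginv G ?d = (\<beta> \<cdot> ?d) \<cdot> ginv G ?d" by simp
      also have "\<dots> = \<beta> \<cdot> (?d \<cdot> ginv G ?d)" by (rule mul_ac) (use ba b da sd in \<open>simp_all add: inv_closed rng_inv\<close>)
      also have "\<dots> = \<beta>" using da ba b mul_src_self[of \<beta>] by (simp add: mul_inv_self)
      finally show "\<gamma> \<cdot> ginv G ?d = \<beta>" .
    qed
    have "(\<Sum>\<beta>\<in>T f h. ker f \<gamma> \<beta> * h \<beta>) = (\<Sum>\<beta>\<in>T h f. ker h \<gamma> \<beta> * f \<beta>)"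
    proof (rule sum.reindex_bij_witness[of _ "\<lambda>\<beta>. \<gamma> \<cdot> ginv G \<beta>" "\<lambda>\<beta>. \<gamma> \<cdot> ginv G \<beta>"])
      fix \<beta> assume "\<beta> \<in> T f h"
      then have b: "\<beta> \<in> S" "src G \<beta> = src G \<gamma>" "h \<beta> \<noteq> 0" "f (\<gamma> \<cdot> ginv G \<beta>) \<noteq> 0" by (auto simp: T_def)
      note q = quot[OF b(1,2)]
      show "\<gamma> \<cdot> ginv G (\<gamma> \<cdot> ginv G \<beta>) = \<beta>" by (rule q(3))
      show "\<gamma> \<cdot> ginv G \<beta> \<in> T h f" using b q by (simp add: T_def)
      have "ker h \<gamma> (\<gamma> \<cdot> ginv G \<beta>) = h \<beta> * c (\<beta>, \<gamma> \<cdot> ginv G \<beta>)"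
        using q ga S_arrow[OF q(1)] by (simp add: ker_def)
      moreover have "ker f \<gamma> \<beta> = f (\<gamma> \<cdot> ginv G \<beta>) * c (\<gamma> \<cdot> ginv G \<beta>, \<beta>)"
        using b ga S_arrow by (simp add: ker_def)
      moreover have "c (\<gamma> \<cdot> ginv G \<beta>, \<beta>) = c (\<beta>, \<gamma> \<cdot> ginv G \<beta>)"
        by (rule S_symmetric[OF q(1) b(1)]) (use q b in simp)
      ultimately show "ker h \<gamma> (\<gamma> \<cdot> ginv G \<beta>) * f (\<gamma> \<cdot> ginv G \<beta>) = ker f \<gamma> \<beta> * h \<beta>" by simp
    next
      fix \<beta> assume "\<beta> \<in> T h f"
      then have b: "\<beta> \<in> S" "src G \<beta> = src G \<gamma>" "f \<beta> \<noteq> 0" "h (\<gamma> \<cdot> ginv G \<beta>) \<noteq> 0" by (auto simp: T_def)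
      note q = quot[OF b(1,2)]
      show "\<gamma> \<cdot> ginv G (\<gamma> \<cdot> ginv G \<beta>) = \<beta>" by (rule q(3))
      show "\<gamma> \<cdot> ginv G \<beta> \<in> T f h" using b q by (simp add: T_def)
    qed
    then show ?thesis using sum[OF h] sum[OF f] by simp
  qed
qed

lemma abelian_B: "abelian_subalgebra (Cstar_r G c) B"
  unfolding abelian_subalgebra_def
proof (intro conjI subalgebra_B ballI)
  fix X Y assume "X \<in> B" "Y \<in> B"
  obtain x where x: "P.cauchy x" "\<forall>n. x n \<in> CcS" "X = cls x" using \<open>X \<in> B\<close> by (rule B_cases)
  obtain y where y: "P.cauchy y" "\<forall>n. y n \<in> CcS" "Y = cls y" using \<open>Y \<in> B\<close> by (rule B_cases)
  have "conv G c (x n) (y n) = conv G c (y n) (x n)" for n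
    using x y by (intro CcS_conv_commute) auto
  then show "X \<otimes>\<^bsub>Cstar_r G c\<^esub> Y = Y \<otimes>\<^bsub>Cstar_r G c\<^esub> X"
    using x y by (simp add: cls_ops)
qed

text \<open>A class \<open>cls \<sigma>\<close> has a limit function \<open>x\<close> on the groupoid. If it commutes with \<open>B\<close>, then
  \<open>\<bar>x\<bar>\<close> is constant on the conjugates of an arrow under \<open>S\<close>; being square summable over source fibres,
  \<open>x\<close> vanishes where a conjugacy orbit is large.\<close>

context
  fixes \<sigma> x
  assumes \<sigma>: "P.cauchy \<sigma>" and x: "\<And>g. (\<lambda>n. \<sigma> n g) \<longlonglongrightarrow> x g"
    and comm: "\<And>b. b \<in> B \<Longrightarrow> b \<otimes>\<^bsub>Cstar_r G c\<^esub> cls \<sigma> = cls \<sigma> \<otimes>\<^bsub>Cstar_r G c\<^esub> b"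
begin

text \<open>The constant sequence \<open>f\<close> represents an element of \<open>B\<close>, so the
  commutators tend to 0 in norm, and evaluation at an arrow is bounded by the norm.\<close>

lemma commutator_tendsto:
  assumes f: "f \<in> CcS" shows "(\<lambda>n. conv G c f (\<sigma> n) g - conv G c (\<sigma> n) f g) \<longlonglongrightarrow> 0"
proof -
  have cf: "P.cauchy (\<lambda>n. f)" by (rule P.cauchy_const) (simp add: CcS_Cc f)
  have b: "cls (\<lambda>n. f) \<in> B" by (rule cls_B[OF cf f])
  have 1: "P.cauchy (\<lambda>n. conv G c f (\<sigma> n))" and 2: "P.cauchy (\<lambda>n. conv G c (\<sigma> n) f)"
    using P.cauchy_mul[OF cf \<sigma>] P.cauchy_mul[OF \<sigma> cf] by simp_all
  have "cls (\<lambda>n. conv G c f (\<sigma> n)) = cls (\<lambda>n. conv G c (\<sigma> n) f)"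
    using comm[OF b] by (simp add: cls_ops cf \<sigma>)
  then have lim: "(\<lambda>n. reduced_norm G c (\<lambda>g. conv G c f (\<sigma> n) g - conv G c (\<sigma> n) f g)) \<longlonglongrightarrow> 0"
    by (simp add: cls_eq_iff_Cc[OF 1 2])
  show ?thesis
  proof (rule Lim_null_comparison[OF _ lim], rule always_eventually, rule allI)
    fix n
    show "cmod (conv G c f (\<sigma> n) g - conv G c (\<sigma> n) f g) \<le> reduced_norm G c (\<lambda>g. conv G c f (\<sigma> n) g - conv G c (\<sigma> n) f g)"
      by (rule norm_le_reduced_norm_Cc[OF Cc_diff[OF cauchy_Cc[OF 1] cauchy_Cc[OF 2]]])
  qed
qed

text \<open>If range and source differed, a function on the units with value 1 at the range of g and
  0 at its source would lie in \<open>CcS\<close>; commuting with it forces x(g) = 0.\<close>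

lemma commutant_isotropy:
  assumes g: "g \<in> arrows G" and nz: "x g \<noteq> 0"
  shows "src G g = rng G g"
proof (rule ccontr)
  assume ne: "src G g \<noteq> rng G g"
  have cK: "compactin (gtop G) {rng G g}" using g rng_arrow by (simp add: topspace_gtop)
  have "closedin (gtop G) {src G g}"
    by (rule compactin_imp_closedin[OF hausdorff]) (use g src_arrow in \<open>simp add: topspace_gtop\<close>)
  then have oW: "openin (gtop G) (units G - {src G g})" using open_units by blast
  have sub: "{rng G g} \<subseteq> units G - {src G g}" using ne g rng_unit by auto
  obtain \<phi> :: "'a \<Rightarrow> real" where p: "(\<lambda>g. complex_of_real (\<phi> g)) \<in> Cc G" "\<And>h. h \<in> {rng G g} \<Longrightarrow> \<phi> h = 1"
    "\<And>h. \<phi> h \<noteq> 0 \<Longrightarrow> h \<in> units G - {src G g}"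
    by (rule Cc_bump[OF cK oW sub]) (rule that)
  let ?f = "\<lambda>g. complex_of_real (\<phi> g)"
  have fu: "h \<in> units G" if "?f h \<noteq> 0" for h using p(3)[of h] that by auto
  have "?f \<in> CcS" using p(1) fu units_subset by (auto simp: CcS_def)
  from commutator_tendsto[OF this, of g]
  have "(\<lambda>n. ?f (rng G g) * \<sigma> n g - \<sigma> n g * ?f (src G g)) \<longlonglongrightarrow> 0"
  proof -
    have "conv G c ?f h g = ?f (rng G g) * h g" "conv G c h ?f g = h g * ?f (src G g)" for h
      by (rule conv_units_left[OF _ g] conv_units_right[OF _ g], rule fu, assumption)+
    then show "(\<lambda>n. conv G c ?f (\<sigma> n) g - conv G c (\<sigma> n) ?f g) \<longlonglongrightarrow> 0 \<Longrightarrow> ?thesis" by simp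
  qed
  moreover have "?f (rng G g) = 1" "?f (src G g) = 0" using p(2)[of "rng G g"] p(3)[of "src G g"] by auto
  ultimately have "(\<lambda>n. \<sigma> n g) \<longlonglongrightarrow> 0" by simp
  then show False using LIMSEQ_unique[OF x] nz by blast
qed

text \<open>Openness of \<open>S\<close> provides a bisection around t inside \<open>S\<close>. The
  commutator with a bump on it, evaluated at \<nu> t, has one term from each product, belonging to
  the factorizations t (t^{-1} \<nu> t) and \<nu> t.\<close>

lemma commutant_conjugate:
  assumes nu: "\<nu> \<in> isotropy_at G u" and t: "t \<in> S" "t \<in> isotropy_at G u"
  shows "x (ginv G t \<cdot> (\<nu> \<cdot> t)) * c (t, ginv G t \<cdot> (\<nu> \<cdot> t)) = x \<nu> * c (\<nu>, t)"
proof -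
  have a: "\<nu> \<in> arrows G" "src G \<nu> = u" "rng G \<nu> = u" "t \<in> arrows G" "src G t = u" "rng G t = u"
    using nu t by (auto simp: isotropy_iff)
  obtain V where V: "bisection V" "t \<in> V" "V \<subseteq> S" using bisection_around[OF a(4) S_open t(1)] by metis
  have inj: "inj_on (rng G) V" "inj_on (src G) V" using V(1) by (auto simp: bisection_def)
  have cK: "compactin (gtop G) {t}" using a(4) by (simp add: topspace_gtop)
  have sub: "{t} \<subseteq> V" using V(2) by simp
  obtain \<phi> :: "'a \<Rightarrow> real" where p: "(\<lambda>g. complex_of_real (\<phi> g)) \<in> Cc G" "\<And>h. h \<in> {t} \<Longrightarrow> \<phi> h = 1"
    "\<And>h. \<phi> h \<noteq> 0 \<Longrightarrow> h \<in> V"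
    by (rule Cc_bump[OF cK bisection_open[OF V(1)] sub]) (rule that)
  let ?f = "\<lambda>g. complex_of_real (\<phi> g)"
  have fV: "h \<in> V" if "?f h \<noteq> 0" for h using p(3)[of h] that by auto
  have ft: "?f t = 1" using p(2)[of t] by simp
  have fS: "?f \<in> CcS" using p(1) fV V(3) by (auto simp: CcS_def)
  let ?g = "\<nu> \<cdot> t"
  have ga: "?g \<in> arrows G" "rng G t = rng G ?g" "src G t = src G ?g" using a by (auto simp: grp)
  have gt: "?g \<cdot> ginv G t = \<nu>" using a mul_src_self[of \<nu>] by (simp add: grp)
  have "(\<lambda>n. \<sigma> n (ginv G t \<cdot> ?g) * c (t, ginv G t \<cdot> ?g) - \<sigma> n \<nu> * c (\<nu>, t)) \<longlonglongrightarrow> 0"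
    using commutator_tendsto[OF fS, of ?g]
  proof -
    have "conv G c ?f h ?g = ?f t * h (ginv G t \<cdot> ?g) * c (t, ginv G t \<cdot> ?g)"
      "conv G c h ?f ?g = h (?g \<cdot> ginv G t) * c (?g \<cdot> ginv G t, t) * ?f t" for h
      by (rule conv_section_left[OF _ inj(1) V(2) a(4) ga(1,2)] conv_section_right[OF _ inj(2) V(2) a(4) ga(1,3)],
          rule fV, assumption)+
    then show "(\<lambda>n. conv G c ?f (\<sigma> n) ?g - conv G c (\<sigma> n) ?f ?g) \<longlonglongrightarrow> 0 \<Longrightarrow> ?thesis"
      by (simp only: gt ft mult_1_left mult_1_right)
  qed
  moreover have "(\<lambda>n. \<sigma> n (ginv G t \<cdot> ?g) * c (t, ginv G t \<cdot> ?g) - \<sigma> n \<nu> * c (\<nu>, t))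
      \<longlonglongrightarrow> x (ginv G t \<cdot> ?g) * c (t, ginv G t \<cdot> ?g) - x \<nu> * c (\<nu>, t)"
    by (intro tendsto_intros x)
  ultimately have "x (ginv G t \<cdot> ?g) * c (t, ginv G t \<cdot> ?g) - x \<nu> * c (\<nu>, t) = 0"
    using LIMSEQ_unique by blast
  then show ?thesis by simp
qed

lemma commutant_abs_conjugate:
  assumes nu: "\<nu> \<in> isotropy_at G u" and t: "t \<in> S" "t \<in> isotropy_at G u"
  shows "cmod (x (ginv G t \<cdot> (\<nu> \<cdot> t))) = cmod (x \<nu>)"
proof -
  have a: "\<nu> \<in> arrows G" "src G \<nu> = u" "rng G \<nu> = u" "t \<in> arrows G" "src G t = u" "rng G t = u"
    using nu t by (auto simp: isotropy_iff)
  have "cmod (c (t, ginv G t \<cdot> (\<nu> \<cdot> t))) = 1" "cmod (c (\<nu>, t)) = 1"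
    by (rule cocycle_norm; use a in \<open>simp add: grp\<close>)+
  then show ?thesis using arg_cong[OF commutant_conjugate[OF assms], of cmod] by (simp add: norm_mult)
qed

text \<open>On finite subsets of a source fibre the square sum of each \<sigma> n is at most its
  squared norm, and finite sums pass to the limit. The bound does not depend on the fibre.\<close>

lemma commutant_square_summable:
  obtains K where "0 < K" "\<And>F u. finite F \<Longrightarrow> F \<subseteq> src_fibre G u \<Longrightarrow> (\<Sum>g\<in>F. (cmod (x g))\<^sup>2) \<le> K"
proof -
  obtain K where K: "0 < K" "\<And>n. reduced_norm G c (\<sigma> n) \<le> K" using P.cauchy_bounded[OF \<sigma>] by auto
  have "(\<Sum>g\<in>F. (cmod (x g))\<^sup>2) \<le> K\<^sup>2" if F: "finite F" "F \<subseteq> src_fibre G u" for F u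
  proof (rule LIMSEQ_le_const2)
    show "(\<lambda>n. \<Sum>g\<in>F. (cmod (\<sigma> n g))\<^sup>2) \<longlonglongrightarrow> (\<Sum>g\<in>F. (cmod (x g))\<^sup>2)"
      by (intro tendsto_intros x)
    have "(\<Sum>g\<in>F. (cmod (\<sigma> n g))\<^sup>2) \<le> K\<^sup>2" for n
    proof -
      have "L2_set (\<lambda>g. cmod (\<sigma> n g)) F \<le> K"
        using L2_source_fibre_le[OF Cc_bounded_function[OF cauchy_Cc[OF \<sigma>]] F, of n] K(2)[of n] by linarith
      then have "(L2_set (\<lambda>g. cmod (\<sigma> n g)) F)\<^sup>2 \<le> K\<^sup>2" by (rule power_mono) simp
      then show ?thesis by (simp add: L2_set_power2)
    qed
    then show "\<exists>N. \<forall>n\<ge>N. (\<Sum>g\<in>F. (cmod (\<sigma> n g))\<^sup>2) \<le> K\<^sup>2" by blast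
  qed
  moreover have "0 < K\<^sup>2" using K(1) by simp
  ultimately show thesis using that by blast
qed

lemma commutant_support:
  assumes g: "\<nu> \<in> arrows G" and nz: "x \<nu> \<noteq> 0"
  shows "\<nu> \<in> S"
proof -
  define u where "u = src G \<nu>"
  have u: "u \<in> units G" using g by (simp add: u_def src_unit)
  have nu: "\<nu> \<in> isotropy_at G u"
    using g commutant_isotropy[OF g nz] by (simp add: isotropy_iff u_def)
  obtain K where K: "0 < K" "\<And>F u. finite F \<Longrightarrow> F \<subseteq> src_fibre G u \<Longrightarrow> (\<Sum>g\<in>F. (cmod (x g))\<^sup>2) \<le> K"
    by (rule commutant_square_summable) (rule that)
  define d where "d = (cmod (x \<nu>))\<^sup>2"
  have d: "0 < d" using nz by (simp add: d_def)
  \<comment> \<open>Chosen before t: k + 1 distinct conjugates of weight d each would exceed the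
    bound K. Independence of t is what \<open>centralizing\<close> asks for.\<close>
  obtain k where k: "K < real (Suc k) * d"
    using reals_Archimedean3[OF d] by (metis Suc_pred' mult_zero_left neq0_conv not_less_iff_gr_or_eq of_nat_0 K(1))
  have pow: "gpow G t n \<in> S \<and> gpow G t n \<in> isotropy_at G u" if t: "t \<in> S" "t \<in> isotropy_at G u" for t n
  proof (induction n)
    case 0
    show ?case using t src_S gpow_isotropy[OF t(2), of 0] by simp
  next
    case (Suc n)
    then show ?case using t gpow_isotropy[OF t(2), of "Suc n"] S_mul[of "gpow G t n" t] by (simp add: isotropy_iff)
  qed
  have "\<exists>j\<in>{1..k}. \<nu> \<cdot> gpow G t j = gpow G t j \<cdot> \<nu>" if t: "t \<in> S" "t \<in> isotropy_at G u" for t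
  proof (rule ccontr)
    assume "\<not> ?thesis"
    then have no: "\<nu> \<cdot> gpow G t j \<noteq> gpow G t j \<cdot> \<nu>" if "j \<in> {1..k}" for j using that by blast
    let ?h = "\<lambda>n. ginv G (gpow G t n) \<cdot> (\<nu> \<cdot> gpow G t n)"
    have inj: "inj_on ?h {..k}" by (rule inj_on_conjugates[OF nu t(2) no])
    have "?h ` {..k} \<subseteq> src_fibre G u"
    proof (rule image_subsetI)
      fix n
      have "gpow G t n \<in> isotropy_at G u" by (rule gpow_isotropy[OF t(2)])
      then show "?h n \<in> src_fibre G u" using nu by (simp add: isotropy_iff src_fibre_def grp)
    qed
    then have "(\<Sum>g\<in>?h ` {..k}. (cmod (x g))\<^sup>2) \<le> K" by (intro K(2)) auto
    also have "(\<Sum>g\<in>?h ` {..k}. (cmod (x g))\<^sup>2) = (\<Sum>n\<in>{..k}. (cmod (x (?h n)))\<^sup>2)"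
      by (simp add: sum.reindex[OF inj])
    also have "\<dots> = (\<Sum>n\<in>{..k}. d)"
      by (rule sum.cong[OF refl]) (use commutant_abs_conjugate[OF nu] pow[OF t] in \<open>simp add: d_def\<close>)
    also have "\<dots> = real (Suc k) * d" by simp
    finally show False using k by simp
  qed
  then have ck: "\<nu> \<in> centralizing G S k" using nu u unfolding centralizing_def by blast
  have "\<nu> \<in> centralizing G S 1"
  \<comment> \<open>Immediate centralizing speaks of k \<ge> 1. For k = 0 the range of exponents is
    empty, and t = u already gives a contradiction.\<close>
  proof (cases "k = 0")
    case True
    have "u \<in> S" "u \<in> isotropy_at G u" using u units_subset by (auto simp: isotropy_iff units_iff unit_rng)
    then show ?thesis using \<open>\<And>t. t \<in> S \<Longrightarrow> t \<in> isotropy_at G u \<Longrightarrow> \<exists>j\<in>{1..k}. _ t j\<close>[of u] True by simp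
  next
    case False
    then have "1 \<le> k" by simp
    then show ?thesis using S_immediately_centralizing ck unfolding immediately_centralizing_def by blast
  qed
  then obtain u' where u': "\<nu> \<in> isotropy_at G u'"
    "\<forall>t \<in> S \<inter> isotropy_at G u'. \<exists>j \<in> {1..1}. \<nu> \<cdot> gpow G t j = gpow G t j \<cdot> \<nu>"
    unfolding centralizing_def by blast
  have uu: "u' = u" using u'(1) nu by (simp add: isotropy_iff)
  have symcomm: "symcomm \<nu> t" if t: "t \<in> S" "t \<in> isotropy_at G u" for t
  proof -
    have comm: "\<nu> \<cdot> t = t \<cdot> \<nu>"
    proof -
      have "\<exists>j\<in>{1..1}. \<nu> \<cdot> gpow G t j = gpow G t j \<cdot> \<nu>" using u'(2) t unfolding uu by blast
      then have "\<nu> \<cdot> gpow G t (Suc 0) = gpow G t (Suc 0) \<cdot> \<nu>" by (simp del: gpow.simps)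
      then show ?thesis by (simp only: gpow_1[OF t(2)])
    qed
    \<comment> \<open>Once \<nu> commutes with t, the conjugation formula compares x(\<nu>) with
      itself, and cancelling it leaves the symmetry of \<open>c\<close>.\<close>
    have "ginv G t \<cdot> (\<nu> \<cdot> t) = \<nu>"
      unfolding comm using nu t(2) by (simp add: isotropy_iff grp)
    then have "x \<nu> * c (t, \<nu>) = x \<nu> * c (\<nu>, t)" using commutant_conjugate[OF nu t] by simp
    then show ?thesis using comm nz by (simp add: symcomm_def)
  qed
  show ?thesis by (rule maximal_contains_symcomm[OF S_abelian_symmetric S_maximal nu symcomm])
qed

text \<open>The limit function vanishes off \<open>S\<close>, so \<sigma> - E \<sigma> tends to 0
  pointwise and, being Cauchy, in norm.\<close>

lemma commutant_in_B: "cls \<sigma> \<in> B"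
proof -
  have d: "P.cauchy (\<lambda>n. \<lambda>g. \<sigma> n g - E (\<sigma> n) g)"
    using P.cauchy_sub[OF \<sigma> cauchy_E[OF \<sigma>]] by (simp add: sub_Cc_alg)
  have "(\<lambda>n. reduced_norm G c (\<lambda>g. \<sigma> n g - E (\<sigma> n) g)) \<longlonglongrightarrow> 0"
  proof (rule reduced_norm_tendsto_zero[OF d])
    fix g assume g: "g \<in> arrows G"
    show "(\<lambda>n. \<sigma> n g - E (\<sigma> n) g) \<longlonglongrightarrow> 0"
    proof (cases "g \<in> S")
      case True
      then show ?thesis by (simp add: extend_by_zero_def)
    next
      case False
      then have "x g = 0" using commutant_support[OF g] by blast
      then show ?thesis using x[of g] False by (simp add: extend_by_zero_def)
    qed
  qed
  then have "cls \<sigma> = cls (\<lambda>n. E (\<sigma> n))" by (simp add: cls_eq_iff_Cc[OF \<sigma> cauchy_E[OF \<sigma>]])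
  then show ?thesis using cls_B[OF cauchy_E[OF \<sigma>] E_closed[OF cauchy_Cc[OF \<sigma>]]] by simp
qed

end

lemma maximal_abelian_B: "maximal_abelian_subalgebra (Cstar_r G c) B"
  unfolding maximal_abelian_subalgebra_def
proof (intro conjI abelian_B allI impI)
  fix C assume C: "abelian_subalgebra (Cstar_r G c) C \<and> B \<subseteq> C"
  then have Cc: "C \<subseteq> carr (Cstar_r G c)" and Cab: "\<And>X Y. X \<in> C \<Longrightarrow> Y \<in> C \<Longrightarrow> X \<otimes>\<^bsub>Cstar_r G c\<^esub> Y = Y \<otimes>\<^bsub>Cstar_r G c\<^esub> X"
    by (auto simp: abelian_subalgebra_def subalgebra_def)
  have "C \<subseteq> B"
  proof
    fix X assume X: "X \<in> C"
    then have "X \<in> carr (Cstar_r G c)" using Cc by blast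
    then obtain \<sigma> where \<sigma>: "P.cauchy \<sigma>" "X = cls \<sigma>" by (rule Cstar_r_cases)
    have "(\<lambda>n. \<sigma> n g) \<longlonglongrightarrow> lim (\<lambda>n. \<sigma> n g)" for g
      using cauchy_pointwise[OF \<sigma>(1)] by (simp add: convergent_LIMSEQ_iff)
    moreover have "b \<otimes>\<^bsub>Cstar_r G c\<^esub> cls \<sigma> = cls \<sigma> \<otimes>\<^bsub>Cstar_r G c\<^esub> b" if "b \<in> B" for b
      using Cab[of b X] X C that \<sigma>(2) by blast
    ultimately show "X \<in> B" unfolding \<sigma>(2) by (rule commutant_in_B[OF \<sigma>(1)])
  qed
  then show "C = B" using C by blast
qed

end

section \<open>Normalizers and the approximate identity\<close>

context cartan_groupoid
begin

text \<open>A nonzero value at g factors it as k \<epsilon> k'^{-1} with k, k' in \<open>V\<close>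
  and \<epsilon> in \<open>S\<close>. As \<epsilon> is isotropy, k and k' have the same source, so k
  = k' and normality of \<open>S\<close> applies.\<close>

lemma conv_sandwich_CcS:
  assumes f: "f \<in> Cc G" and V: "\<And>g. f g \<noteq> 0 \<Longrightarrow> g \<in> V" and inj: "inj_on (src G) V" and h: "h \<in> CcS"
  shows "conv G c (conv G c f h) (conv_star G c f) \<in> CcS"
proof -
  have hC: "h \<in> Cc G" by (rule CcS_Cc[OF h])
  have "conv G c (conv G c f h) (conv_star G c f) g = 0" if "g \<notin> S" for g
  proof (rule ccontr)
    assume "conv G c (conv G c f h) (conv_star G c f) g \<noteq> 0"
    then obtain \<delta> where d: "g \<in> arrows G" "\<delta> \<in> arrows G" "src G g = src G \<delta>"
      "conv G c f h (g \<cdot> ginv G \<delta>) \<noteq> 0" "conv_star G c f \<delta> \<noteq> 0"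
      using conv_nonzero[OF Cc_fibre_finite[OF Cc_conv_star[OF f]]] by metis
    let ?\<eta> = "g \<cdot> ginv G \<delta>"
    obtain \<epsilon> where e: "?\<eta> \<in> arrows G" "\<epsilon> \<in> arrows G" "src G ?\<eta> = src G \<epsilon>" "f (?\<eta> \<cdot> ginv G \<epsilon>) \<noteq> 0" "h \<epsilon> \<noteq> 0"
      using conv_nonzero[OF Cc_fibre_finite[OF hC] d(4)] by metis
    let ?k = "?\<eta> \<cdot> ginv G \<epsilon>"
    have eS: "\<epsilon> \<in> S" using e(5) h by (auto simp: CcS_def)
    have er: "rng G \<epsilon> = src G \<epsilon>" by (rule S_iso[OF eS])
    have se: "src G \<epsilon> = rng G \<delta>" using e(3) d by (simp add: grp)
    have k: "?k \<in> V" "?k \<in> arrows G" "src G ?k = src G \<epsilon>" using V[OF e(4)] e er by (simp_all add: grp)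
    have "ginv G \<delta> \<in> V" using V[of "ginv G \<delta>"] d by (auto simp: conv_star_def)
    then have kd: "?k = ginv G \<delta>" using inj_onD[OF inj _ k(1)] k(3) se d by (simp add: grp)
    have "?k \<cdot> \<epsilon> \<cdot> ginv G ?k \<in> S"
      using S_normal k eS er unfolding normal_subset_def by simp
    moreover have "?k \<cdot> \<epsilon> = ?\<eta>" using e mul_src_self[of ?\<eta>] by (simp only: mul_ac inv_closed src_inv rng_inv inv_mul_self)
    moreover have "ginv G ?k = \<delta>" unfolding kd using d by (simp add: inv_inv)
    ultimately have "?\<eta> \<cdot> \<delta> \<in> S" by simp
    then show False using that d mul_src_self[of g] by (simp add: grp)
  qed
  then show ?thesis using f hC by (simp add: CcS_def Cc_conv Cc_conv_star)
qed

text \<open>The second condition is the first one for the adjoint of \<open>f\<close>, which lives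
  on the inverses of \<open>V\<close>; there injectivity of the source is injectivity of the range
  on \<open>V\<close>.\<close>

lemma bisection_normalizer:
  assumes f: "f \<in> Cc G" and V: "\<And>g. f g \<noteq> 0 \<Longrightarrow> g \<in> V" "V \<subseteq> arrows G"
    and inj: "inj_on (rng G) V" "inj_on (src G) V"
  shows "cls (\<lambda>n. f) \<in> normalizer (Cstar_r G c) B"
proof -
  have fs: "conv_star G c f \<in> Cc G" by (rule Cc_conv_star[OF f])
  have ff: "conv_star G c (conv_star G c f) = f" using P.adj_adj[of f] f by simp
  have cf: "P.cauchy (\<lambda>n. f)" and cs: "P.cauchy (\<lambda>n. conv_star G c f)"
    by (rule P.cauchy_const; simp add: f fs)+
  have Vs: "g \<in> ginv G ` V" if "conv_star G c f g \<noteq> 0" for g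
  proof -
    have g: "g \<in> arrows G" "f (ginv G g) \<noteq> 0" using that by (auto simp: conv_star_def split: if_splits)
    then have "ginv G g \<in> V" using V(1) by blast
    then show ?thesis by (rule rev_image_eqI) (use g in \<open>simp add: inv_inv\<close>)
  qed
  have injs: "inj_on (src G) (ginv G ` V)"
  proof (rule inj_onI, elim imageE)
    fix a b x y assume a: "a = ginv G x" "x \<in> V" and b: "b = ginv G y" "y \<in> V" and eq: "src G a = src G b"
    have "x \<in> arrows G" "y \<in> arrows G" using a(2) b(2) V(2) by blast+
    then have "rng G x = rng G y" using eq unfolding a(1) b(1) by (simp add: src_inv)
    then have "x = y" using inj_onD[OF inj(1)] a(2) b(2) by blast
    then show "a = b" using a b by simp
  qed
  show ?thesis
    unfolding normalizer_def
  proof (intro CollectI conjI ballI)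
    show "cls (\<lambda>n. f) \<in> carr (Cstar_r G c)" by (rule cls_carr[OF cf])
    fix b assume "b \<in> B"
    then obtain x where x: "P.cauchy x" "\<forall>n. x n \<in> CcS" "b = cls x" by (rule B_cases)
    have 1: "P.cauchy (\<lambda>n. conv G c f (x n))" using P.cauchy_mul[OF cf x(1)] by simp
    have 2: "P.cauchy (\<lambda>n. conv G c (conv G c f (x n)) (conv_star G c f))" using P.cauchy_mul[OF 1 cs] by simp
    have 3: "P.cauchy (\<lambda>n. conv G c (conv_star G c f) (x n))" using P.cauchy_mul[OF cs x(1)] by simp
    have 4: "P.cauchy (\<lambda>n. conv G c (conv G c (conv_star G c f) (x n)) f)" using P.cauchy_mul[OF 3 cf] by simp
    have "cls (\<lambda>n. conv G c (conv G c f (x n)) (conv_star G c f)) \<in> B"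
      by (rule cls_B[OF 2 conv_sandwich_CcS[OF f V(1) inj(2)]]) (use x(2) in blast)+
    then show "cls (\<lambda>n. f) \<otimes>\<^bsub>Cstar_r G c\<^esub> b \<otimes>\<^bsub>Cstar_r G c\<^esub> adj (Cstar_r G c) (cls (\<lambda>n. f)) \<in> B"
      using 1 by (simp add: x cls_ops cf cs)
    have "cls (\<lambda>n. conv G c (conv G c (conv_star G c f) (x n)) f) \<in> B"
      by (rule cls_B[OF 4 conv_sandwich_CcS[OF fs Vs injs, unfolded ff]]) (use x(2) in blast)+
    then show "adj (Cstar_r G c) (cls (\<lambda>n. f)) \<otimes>\<^bsub>Cstar_r G c\<^esub> b \<otimes>\<^bsub>Cstar_r G c\<^esub> cls (\<lambda>n. f) \<in> B"
      using 3 by (simp add: x cls_ops cf cs)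
  qed
qed

text \<open>Functions living on bisections are normalizers, their sums exhaust \<open>Cc G\<close>,
  and the constant classes are dense.\<close>

lemma normalizer_generates: "cstar_generated (Cstar_r G c) (normalizer (Cstar_r G c) B) = carr (Cstar_r G c)"
proof
  have "cstar_subalgebra (Cstar_r G c) (carr (Cstar_r G c))"
    unfolding cstar_subalgebra_def subalgebra_def
    using A.met.closedin_mspace by (auto simp: A.closed)
  moreover have "normalizer (Cstar_r G c) B \<subseteq> carr (Cstar_r G c)" by (auto simp: normalizer_def)
  ultimately show "cstar_generated (Cstar_r G c) (normalizer (Cstar_r G c) B) \<subseteq> carr (Cstar_r G c)"
    unfolding cstar_generated_def by blast
  show "carr (Cstar_r G c) \<subseteq> cstar_generated (Cstar_r G c) (normalizer (Cstar_r G c) B)"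
    unfolding cstar_generated_def
  proof (intro subsetI InterI)
    fix X C assume X: "X \<in> carr (Cstar_r G c)" and "C \<in> {C. cstar_subalgebra (Cstar_r G c) C \<and> normalizer (Cstar_r G c) B \<subseteq> C}"
    then have C: "cstar_subalgebra (Cstar_r G c) C" and N: "normalizer (Cstar_r G c) B \<subseteq> C" by auto
    have const: "cls (\<lambda>n. f) \<in> C" if f: "f \<in> Cc G" for f
    proof (rule Cc_induct[where P="\<lambda>f. cls (\<lambda>n. f) \<in> C" and Q=bisection, OF f bisection_cover])
      show "cls (\<lambda>n. \<lambda>g. 0) \<in> C"
        using C unfolding cstar_subalgebra_def subalgebra_def Cstar_r_def P.zer_completion by simp
      show "cls (\<lambda>n. \<lambda>g. f g + h g) \<in> C"
        if "f \<in> Cc G" "h \<in> Cc G" "cls (\<lambda>n. f) \<in> C" "cls (\<lambda>n. h) \<in> C" for f h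
      proof -
        have "cls (\<lambda>n. f) \<oplus>\<^bsub>Cstar_r G c\<^esub> cls (\<lambda>n. h) \<in> C"
          using C that unfolding cstar_subalgebra_def subalgebra_def by blast
        then show ?thesis using that P.cauchy_const by (simp add: cls_ops)
      qed
      fix f V D assume l: "f \<in> Cc G" "bisection V" "compactin (gtop G) D" "D \<subseteq> V" "\<And>g. f g \<noteq> 0 \<Longrightarrow> g \<in> D"
      have "V \<subseteq> arrows G" using openin_subset[OF bisection_open[OF l(2)]] by (simp add: topspace_gtop)
      then have "cls (\<lambda>n. f) \<in> normalizer (Cstar_r G c) B"
        using l(2) by (intro bisection_normalizer[OF l(1), where V=V]) (use l(4,5) in \<open>auto simp: bisection_def\<close>)
      then show "cls (\<lambda>n. f) \<in> C" using N by blast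
    qed
    obtain \<sigma> where \<sigma>: "P.cauchy \<sigma>" "X = cls \<sigma>" using X by (rule Cstar_r_cases)
    have closed: "closedin A.met.mtopology C" using C by (simp add: cstar_subalgebra_def)
    have in_C: "P.embed (\<sigma> n) \<in> C" for n unfolding P.embed_def by (rule const[OF cauchy_Cc[OF \<sigma>(1)]])
    then have in_A: "P.embed (\<sigma> n) \<in> carr (Cstar_r G c)" for n
      using C unfolding cstar_subalgebra_def subalgebra_def by blast
    have "limitin A.met.mtopology (\<lambda>n. P.embed (\<sigma> n)) X sequentially"
      unfolding A.met.limit_metric_sequentially
    proof (intro conjI allI impI X)
      fix e :: real assume "0 < e"
      then have half: "0 < e / 2" by simp
      obtain M where M: "\<And>n. M \<le> n \<Longrightarrow> nrm (Cstar_r G c) (sub (Cstar_r G c) (cls \<sigma>) (P.embed (\<sigma> n))) \<le> e / 2"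
        by (rule P.nrm_sub_embed_cls[OF \<sigma>(1) half, folded Cstar_r_def]) (rule that)
      have "P.embed (\<sigma> n) \<in> carr (Cstar_r G c) \<and> adist (Cstar_r G c) (P.embed (\<sigma> n)) X < e" if "M \<le> n" for n
      proof -
        have "adist (Cstar_r G c) (P.embed (\<sigma> n)) X = nrm (Cstar_r G c) (sub (Cstar_r G c) X (P.embed (\<sigma> n)))"
          using A.nrm_sub_commute[OF X in_A[of n]] by (simp add: A.adist_eq in_A X)
        then show ?thesis using M[OF that] \<open>0 < e\<close> \<sigma>(2) in_A by simp
      qed
      then show "\<exists>N. \<forall>n\<ge>N. P.embed (\<sigma> n) \<in> carr (Cstar_r G c) \<and> adist (Cstar_r G c) (P.embed (\<sigma> n)) X < e" by blast
    qed
    then show "X \<in> C"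
      by (intro conjunct2[OF closed[unfolded A.met.metric_closedin_iff_sequentially_closed], rule_format] conjI)
        (use in_C in auto)
  qed
qed

text \<open>The candidates for the approximate identity; they multiply by their values at range and
  source. The real function \<phi> is kept explicit so that its square root can be formed.\<close>

definition plateau :: "'a set \<Rightarrow> ('a \<Rightarrow> complex) set" where
  "plateau K = {f. \<exists>\<phi>. f = (\<lambda>g. complex_of_real (\<phi> g)) \<and> continuous_map (gtop G) euclideanreal \<phi> \<and> f \<in> Cc G \<and>
    (\<forall>g\<in>K. \<phi> g = 1) \<and> (\<forall>g. 0 \<le> \<phi> g \<and> \<phi> g \<le> 1) \<and> (\<forall>g. \<phi> g \<noteq> 0 \<longrightarrow> g \<in> units G)}"

lemma plateau_nonempty:
  assumes "compactin (gtop G) K" "K \<subseteq> units G" shows "plateau K \<noteq> {}"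
proof -
  obtain \<phi> :: "'a \<Rightarrow> real" where p: "continuous_map (gtop G) euclideanreal \<phi>" "(\<lambda>g. complex_of_real (\<phi> g)) \<in> Cc G"
    "\<And>g. g \<in> K \<Longrightarrow> \<phi> g = 1" "\<And>g. 0 \<le> \<phi> g \<and> \<phi> g \<le> 1" "\<And>g. \<phi> g \<noteq> 0 \<Longrightarrow> g \<in> units G"
    by (rule Cc_bump[OF assms(1) open_units assms(2)]) (rule that)
  have "(\<lambda>g. complex_of_real (\<phi> g)) \<in> plateau K" using p unfolding plateau_def by blast
  then show ?thesis by blast
qed

lemma plateau_props:
  assumes "f \<in> plateau K"
  shows "f \<in> Cc G" "f g \<noteq> 0 \<Longrightarrow> g \<in> units G" "g \<in> K \<Longrightarrow> f g = 1" "cmod (f g) \<le> 1"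
  using assms by (auto simp: plateau_def)

lemma plateau_norm: assumes f: "f \<in> plateau K" shows "reduced_norm G c f \<le> 1"
proof -
  have "fibre_finite f \<and> kernel_bounded (ker f) 1 \<and> (0 :: real) \<le> 1"
    by (rule kernel_bounded_ker_matching[OF plateau_props(4)[OF f] plateau_props(2)[OF f] inj_on_units])
  then show ?thesis using reduced_norm_le_Cc[OF plateau_props(1)[OF f]] by blast
qed

text \<open>For functions living on units convolution is the pointwise product and the involution is
  conjugation, so the pointwise square root of \<phi> is a square root in the algebra.\<close>

lemma plateau_square:
  assumes f: "f \<in> plateau K"
  obtains h where "h \<in> Cc G" "f = conv G c (conv_star G c h) h"
proof -
  obtain \<phi> where p: "f = (\<lambda>g. complex_of_real (\<phi> g))" "continuous_map (gtop G) euclideanreal \<phi>" "f \<in> Cc G"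
    "\<forall>g. 0 \<le> \<phi> g \<and> \<phi> g \<le> 1" "\<forall>g. \<phi> g \<noteq> 0 \<longrightarrow> g \<in> units G"
    using f unfolding plateau_def by blast
  define h where "h = (\<lambda>g. complex_of_real (sqrt (\<phi> g)))"
  obtain C where C: "compactin (gtop G) C" "\<And>g. f g \<noteq> 0 \<Longrightarrow> g \<in> C" using Cc_support[OF p(3)] by metis
  have h: "h \<in> Cc G"
    unfolding h_def
    by (rule CcI[OF continuous_map_complex_of_real[OF continuous_map_sqrt[OF p(2)]] C(1)]) (use C(2) p(1) in auto)
  have hu: "g \<in> units G" if "h g \<noteq> 0" for g using that p(5) by (auto simp: h_def)
  have star: "conv_star G c h = h"
  proof
    fix g
    show "conv_star G c h g = h g"
    proof (cases "g \<in> units G")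
      case True
      then have "g \<in> arrows G" "src G g = g" by (auto simp: units_iff)
      then have "ginv G g = g" "c (g, g) = 1" using inv_src[of g] cocycle_src[of g] by auto
      then show ?thesis using \<open>g \<in> arrows G\<close> by (simp add: conv_star_def h_def)
    next
      case False
      then have "h g = 0" using hu by blast
      moreover have "h (ginv G g) = 0" if "g \<in> arrows G"
      proof (rule ccontr)
        assume "h (ginv G g) \<noteq> 0"
        then have "ginv G g \<in> units G" by (rule hu)
        then have "ginv G (ginv G g) = ginv G g" using inv_src[of "ginv G g"] by (simp add: units_iff)
        then show False using False \<open>ginv G g \<in> units G\<close> that by (simp add: inv_inv)
      qed
      ultimately show ?thesis by (simp add: conv_star_def)
    qed
  qed
  have "conv G c h h = f"
  proof
    fix g
    show "conv G c h h g = f g"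
    proof (cases "g \<in> arrows G")
      case True
      have "conv G c h h g = h (rng G g) * h g" by (rule conv_units_left[OF hu True])
      also have "\<dots> = h g * h g"
        using hu[of g] unit_rng[of g] by (cases "h g = 0") auto
      also have "\<dots> = f g" using p(4) by (simp add: h_def p(1) flip: of_real_mult)
      finally show ?thesis .
    qed (use Cc_outside[OF p(3)] in \<open>simp add: conv_outside\<close>)
  qed
  then show thesis using that[OF h] star by simp
qed

lemma approximate_identity: "contains_approximate_identity (Cstar_r G c) B"
proof -
  let ?\<K> = "{K. compactin (gtop G) K \<and> K \<subseteq> units G}"
  let ?A = "Cstar_r G c"
  define T where "T = (\<lambda>K. (\<lambda>f. cls (\<lambda>n. f)) ` plateau K)"
  \<comment> \<open>The compact sets of units, directed by union, index the tails: a larger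
    \<open>K\<close> leaves fewer functions in \<open>plateau K\<close>.\<close>
  define F where "F = (INF K\<in>?\<K>. principal (T K))"
  have ev: "eventually Q F \<longleftrightarrow> (\<exists>K\<in>?\<K>. eventually Q (principal (T K)))" for Q
    unfolding F_def
  proof (rule eventually_INF_base)
    have "{} \<in> ?\<K>" by simp
    then show "?\<K> \<noteq> {}" by blast
    fix K L assume "K \<in> ?\<K>" "L \<in> ?\<K>"
    then have KL: "K \<union> L \<in> ?\<K>" by (simp add: compactin_Un)
    have "T (K \<union> L) \<subseteq> T K \<inter> T L" by (auto simp: T_def plateau_def)
    then have "principal (T (K \<union> L)) \<le> inf (principal (T K)) (principal (T L))" by simp
    then show "\<exists>x\<in>?\<K>. principal (T x) \<le> inf (principal (T K)) (principal (T L))" using KL by blast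
  qed
  have evI: "eventually Q F" if "compactin (gtop G) K" "K \<subseteq> units G" "\<And>f. f \<in> plateau K \<Longrightarrow> Q (cls (\<lambda>n. f))" for Q K
    unfolding ev using that by (intro bexI[of _ K]) (auto simp: eventually_principal T_def)
  have cf: "P.cauchy (\<lambda>n. f)" if "f \<in> Cc G" for f using that by (intro P.cauchy_const) simp
  have nrm_embed: "nrm ?A (cls (\<lambda>n. f)) = reduced_norm G c f" if "f \<in> Cc G" for f
    using P.nrm_embed[of f, folded Cstar_r_def] that by (simp add: P.embed_def)
  have props: "cls (\<lambda>n. f) \<in> B \<and> positive ?A (cls (\<lambda>n. f)) \<and> nrm ?A (cls (\<lambda>n. f)) \<le> 1" if f: "f \<in> plateau K" for f K
  proof (intro conjI)
    note p = plateau_props[OF f]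
    have "f \<in> CcS" using p units_subset by (auto simp: CcS_def)
    then show "cls (\<lambda>n. f) \<in> B" by (intro cls_B cf p)
    obtain h where h: "h \<in> Cc G" "f = conv G c (conv_star G c h) h" using plateau_square[OF f] by metis
    have ch: "P.cauchy (\<lambda>n. conv_star G c h)" by (rule cf[OF Cc_conv_star[OF h(1)]])
    have "cls (\<lambda>n. f) = adj ?A (cls (\<lambda>n. h)) \<otimes>\<^bsub>?A\<^esub> cls (\<lambda>n. h)"
      by (simp add: cls_ops cf[OF h(1)] ch h(2))
    then show "positive ?A (cls (\<lambda>n. f))" unfolding positive_def using cls_carr[OF cf[OF h(1)]] by blast
    show "nrm ?A (cls (\<lambda>n. f)) \<le> 1" using plateau_norm[OF f] by (simp add: nrm_embed p)
  qed
  have approx: "\<forall>\<^sub>F e in F. nrm ?A (sub ?A (e \<otimes>\<^bsub>?A\<^esub> X) X) < r \<and> nrm ?A (sub ?A (X \<otimes>\<^bsub>?A\<^esub> e) X) < r"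
    if X: "X \<in> carr ?A" and r: "0 < r" for X r
  proof -
    have "0 < r / 3" using r by simp
    then obtain f where f: "f \<in> Cc G" and near: "nrm ?A (sub ?A X (cls (\<lambda>n. f))) < r / 3"
      using P.embed_dense[folded Cstar_r_def, OF X, of "r/3"] by (auto simp: P.embed_def)
    obtain C where C: "compactin (gtop G) C" "\<And>g. f g \<noteq> 0 \<Longrightarrow> g \<in> C" using Cc_support[OF f] by metis
    have Ca: "C \<subseteq> arrows G" using compactin_subset_topspace[OF C(1)] by (simp add: topspace_gtop)
    \<comment> \<open>Contains range and source of every arrow where \<open>f\<close> is nonzero, so
      each member of its plateau fixes \<open>f\<close> from both sides and, being a contraction,
      moves X by at most twice the distance from X to f, which is less than r.\<close>
    let ?K = "rng G ` C \<union> src G ` C"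
    have K: "compactin (gtop G) ?K" "?K \<subseteq> units G"
      using image_compactin[OF C(1) continuous_rng] image_compactin[OF C(1) continuous_src] Ca rng_unit src_unit
      by (auto simp: compactin_Un)
    show ?thesis
    proof (rule evI[OF K])
      fix \<phi> assume phi: "\<phi> \<in> plateau ?K"
      note p = plateau_props[OF phi]
      let ?e = "cls (\<lambda>n. \<phi>)" and ?f = "cls (\<lambda>n. f)"
      have ec: "?e \<in> carr ?A" and fc: "?f \<in> carr ?A" by (rule cls_carr[OF cf[OF p(1)]], rule cls_carr[OF cf[OF f]])
      have "conv G c \<phi> f = f"
      proof
        fix g
        show "conv G c \<phi> f g = f g"
        proof (cases "g \<in> arrows G")
          case True
          have "conv G c \<phi> f g = \<phi> (rng G g) * f g" by (rule conv_units_left[OF p(2) True])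
          then show ?thesis using p(3)[of "rng G g"] C(2)[of g] by (cases "f g = 0") auto
        qed (simp add: conv_outside Cc_outside[OF f])
      qed
      then have ef: "?e \<otimes>\<^bsub>?A\<^esub> ?f = ?f" by (simp add: cls_ops cf p(1) f)
      have "conv G c f \<phi> = f"
      proof
        fix g
        show "conv G c f \<phi> g = f g"
        proof (cases "g \<in> arrows G")
          case True
          have "conv G c f \<phi> g = f g * \<phi> (src G g)" by (rule conv_units_right[OF p(2) True])
          then show ?thesis using p(3)[of "src G g"] C(2)[of g] by (cases "f g = 0") auto
        qed (simp add: conv_outside Cc_outside[OF f])
      qed
      then have fe: "?f \<otimes>\<^bsub>?A\<^esub> ?e = ?f" by (simp add: cls_ops cf p(1) f)
      have e1: "nrm ?A ?e \<le> 1" using props[OF phi] by simp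
      let ?d = "nrm ?A (sub ?A X ?f)"
      have d0: "0 \<le> ?d" by (simp add: A.nrm_nonneg A.closed X fc)
      have fX: "nrm ?A (sub ?A ?f X) = ?d" by (rule A.nrm_sub_commute[OF fc X])
      have l: "nrm ?A (?e \<otimes>\<^bsub>?A\<^esub> sub ?A X ?f) \<le> ?d"
        using A.nrm_mul[OF ec A.sub_closed[OF X fc]] mult_right_mono[OF e1 d0] by linarith
      have r: "nrm ?A (sub ?A X ?f \<otimes>\<^bsub>?A\<^esub> ?e) \<le> ?d"
        using A.nrm_mul[OF A.sub_closed[OF X fc] ec] mult_left_mono[OF e1 d0] by linarith
      have "nrm ?A (sub ?A (?e \<otimes>\<^bsub>?A\<^esub> X) X) \<le> nrm ?A (sub ?A (?e \<otimes>\<^bsub>?A\<^esub> X) ?f) + nrm ?A (sub ?A ?f X)"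
        by (intro A.nrm_sub_triangle A.closed ec X fc)
      also have "sub ?A (?e \<otimes>\<^bsub>?A\<^esub> X) ?f = ?e \<otimes>\<^bsub>?A\<^esub> sub ?A X ?f"
        using A.mul_sub_right[OF ec X fc] by (simp add: ef)
      finally have 1: "nrm ?A (sub ?A (?e \<otimes>\<^bsub>?A\<^esub> X) X) < r" using l fX near \<open>0 < r / 3\<close> by linarith
      have "nrm ?A (sub ?A (X \<otimes>\<^bsub>?A\<^esub> ?e) X) \<le> nrm ?A (sub ?A (X \<otimes>\<^bsub>?A\<^esub> ?e) ?f) + nrm ?A (sub ?A ?f X)"
        by (intro A.nrm_sub_triangle A.closed ec X fc)
      also have "sub ?A (X \<otimes>\<^bsub>?A\<^esub> ?e) ?f = sub ?A X ?f \<otimes>\<^bsub>?A\<^esub> ?e"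
        using A.mul_sub_left[OF X fc ec] by (simp add: fe)
      finally have 2: "nrm ?A (sub ?A (X \<otimes>\<^bsub>?A\<^esub> ?e) X) < r" using r fX near \<open>0 < r / 3\<close> by linarith
      show "nrm ?A (sub ?A (?e \<otimes>\<^bsub>?A\<^esub> X) X) < r \<and> nrm ?A (sub ?A (X \<otimes>\<^bsub>?A\<^esub> ?e) X) < r" using 1 2 by simp
    qed
  qed
  have inB: "\<forall>\<^sub>F e in F. e \<in> B \<and> positive ?A e \<and> nrm ?A e \<le> 1"
    by (rule evI[of "{}"]) (use props in auto)
  have inA: "\<forall>\<^sub>F e in F. e \<in> carr ?A" using inB by eventually_elim (use B_carr in blast)
  show ?thesis
    unfolding contains_approximate_identity_def
  proof (intro exI[of _ F] conjI ballI inB)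
    show "F \<noteq> bot"
    proof
      assume "F = bot"
      then have "eventually (\<lambda>_. False) F" by simp
      then obtain K where "compactin (gtop G) K" "K \<subseteq> units G" "eventually (\<lambda>_. False) (principal (T K))"
        unfolding ev by blast
      then show False using plateau_nonempty[of K] by (auto simp: eventually_principal T_def)
    qed
    fix X assume X: "X \<in> carr ?A"
    show "((\<lambda>e. nrm ?A (sub ?A (e \<otimes>\<^bsub>?A\<^esub> X) X)) \<longlongrightarrow> 0) F"
    proof (rule tendstoI)
      fix r :: real assume "0 < r"
      show "\<forall>\<^sub>F e in F. dist (nrm ?A (sub ?A (e \<otimes>\<^bsub>?A\<^esub> X) X)) 0 < r"
        using approx[OF X \<open>0 < r\<close>] inA by eventually_elim (simp add: A.nrm_nonneg A.closed X)
    qed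
    show "((\<lambda>e. nrm ?A (sub ?A (X \<otimes>\<^bsub>?A\<^esub> e) X)) \<longlongrightarrow> 0) F"
    proof (rule tendstoI)
      fix r :: real assume "0 < r"
      show "\<forall>\<^sub>F e in F. dist (nrm ?A (sub ?A (X \<otimes>\<^bsub>?A\<^esub> e) X)) 0 < r"
        using approx[OF X \<open>0 < r\<close>] inA by eventually_elim (simp add: A.nrm_nonneg A.closed X)
    qed
  qed
qed

lemma cartan_B: "cartan_subalgebra (Cstar_r G c) B"
  unfolding cartan_subalgebra_def
  using A.cstar_algebra_axioms cstar_subalgebra_B maximal_abelian_B conditional_expectation_\<Phi> \<Phi>_faithful
    normalizer_generates approximate_identity by blast

end

theorem theorem3p1:
  fixes G :: "'g groupoid" and c :: "'g \<times> 'g \<Rightarrow> complex" and S :: "'g set"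
  assumes "etale_groupoid G"
    and "second_countable (gtop G)"
    and "locally_compact_space (gtop G)"
    and "Hausdorff_space (gtop G)"
    and "continuous_cocycle2 G c"
    and "S \<in> abelian_symmetric_subgroupoids G c"
    and "\<forall>T \<in> abelian_symmetric_subgroupoids G c. S \<subseteq> T \<longrightarrow> T = S"
    and "openin (gtop G) S"
    and "closedin (gtop G) S"
    and "normal_subset G S"
    and "immediately_centralizing G S"
  shows "cartan_subalgebra (Cstar_r G c) (Cstar_r_embedded G c S)"
proof -
  interpret cartan_groupoid G c S
    using assms by (intro cartan_groupoid.intro twisted_etale_groupoid.intro
        twisted_etale_groupoid_axioms.intro cartan_groupoid_axioms.intro)
  show ?thesis by (rule cartan_B)
qed

end
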